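(* Every planar Laman graph $G$ admits an embedding $G(P)$ in the Euclidean plane that is a pointed pseudo-triangulation.
   Context: Graphs are finite and simple. A Laman graph is a graph with $n\ge 2$ vertices and exactly $2n-3$ edges such that every subset of $k\ge 2$ vertices spans at most $2k-3$ edges. An embedding $G(P)$ of $G=(V,E)$, $V=\{1,\dots,n\}$, on a set of points $P=\{p_1,\dots,p_n\}\subset\mathbb{R}^2$ maps vertex $i$ to $p_i$ (distinct points) and each edge $ij$ to the straight line segment $p_ip_j$. It is non-crossing if segments of edges without a common endpoint are disjoint and segments of two edges sharing an endpoint meet only there. A graph is planar if it has a non-crossing embedding. A vertex is pointed in a non-crossing embedding if some angle at it, between two (circularly) consecutive incident edges, is larger than $\pi$ (a vertex of degree one has a single angle $2\pi$). A pseudo-triangle is a simple polygon with exactly three convex vertices (interior angle less than $\pi$). A pseudo-triangulation is a non-crossing embedded graph $G(P)$ whose outer face is convex (the edges incident to the outer face form the boundary of the convex hull of $P$) and all of whose interior faces are pseudo-triangles. It is a pointed pseudo-triangulation if all its vertices are pointed. *)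

theory Defs
  imports "HOL-Analysis.Analysis"
begin

text \<open>The Euclidean plane is represented by the type \<^typ>\<open>complex\<close>. Edges are two-element
  sets of vertices.\<close>

definition simple_graph :: "'a set \<Rightarrow> 'a set set \<Rightarrow> bool" where
  "simple_graph V E \<longleftrightarrow> finite V \<and> (\<forall>e\<in>E. e \<subseteq> V \<and> card e = 2)"

definition laman_graph :: "'a set \<Rightarrow> 'a set set \<Rightarrow> bool" where
  "laman_graph V E \<longleftrightarrow>
     simple_graph V E \<and> card V \<ge> 2 \<and> card E = 2 * card V - 3 \<and>
     (\<forall>S\<subseteq>V. card S \<ge> 2 \<longrightarrow> card {e \<in> E. e \<subseteq> S} \<le> 2 * card S - 3)"

definition edge_segment :: "('a \<Rightarrow> complex) \<Rightarrow> 'a set \<Rightarrow> complex set" where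
  "edge_segment p e = convex hull (p ` e)"

lemma edge_segment_doubleton: "edge_segment p {i, j} = closed_segment (p i) (p j)"
  by (simp add: edge_segment_def segment_convex_hull)

text \<open>The right-hand side \<^term>\<open>p ` (e \<inter> f)\<close> is empty if \<^term>\<open>e\<close> and \<^term>\<open>f\<close> have no
  common endpoint, and otherwise consists of the image of that endpoint.\<close>

definition noncrossing_embedding :: "'a set \<Rightarrow> 'a set set \<Rightarrow> ('a \<Rightarrow> complex) \<Rightarrow> bool" where
  "noncrossing_embedding V E p \<longleftrightarrow>
     inj_on p V \<and>
     (\<forall>e\<in>E. \<forall>f\<in>E. e \<noteq> f \<longrightarrow> edge_segment p e \<inter> edge_segment p f = p ` (e \<inter> f))"

definition planar_graph :: "'a set \<Rightarrow> 'a set set \<Rightarrow> bool" where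
  "planar_graph V E \<longleftrightarrow> simple_graph V E \<and> (\<exists>p. noncrossing_embedding V E p)"

definition drawing :: "'a set \<Rightarrow> 'a set set \<Rightarrow> ('a \<Rightarrow> complex) \<Rightarrow> complex set" where
  "drawing V E p = p ` V \<union> (\<Union>e\<in>E. edge_segment p e)"

definition interior_faces :: "'a set \<Rightarrow> 'a set set \<Rightarrow> ('a \<Rightarrow> complex) \<Rightarrow> complex set set" where
  "interior_faces V E p = {F \<in> components (- drawing V E p). bounded F}"

text \<open>The drawing of a finite graph is compact, so its complement has exactly one unbounded
  component, which is then the set \<^const>\<open>outside\<close> of the drawing.\<close>

definition outer_face :: "'a set \<Rightarrow> 'a set set \<Rightarrow> ('a \<Rightarrow> complex) \<Rightarrow> complex set" where
  "outer_face V E p = outside (drawing V E p)"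

text \<open>The angle at \<^term>\<open>v\<close> swept when turning counterclockwise from the ray through
  \<^term>\<open>a\<close> to the ray through \<^term>\<open>b\<close>; it is a full turn if \<^term>\<open>a = b\<close>.\<close>

definition ccw_angle :: "complex \<Rightarrow> complex \<Rightarrow> complex \<Rightarrow> real" where
  "ccw_angle v a b = (if a = b then 2 * pi else Arg2pi ((b - v) / (a - v)))"

definition neighbours :: "'a set set \<Rightarrow> 'a \<Rightarrow> 'a set" where
  "neighbours E v = {w. {v, w} \<in> E}"

text \<open>The edge \<^term>\<open>{v, j}\<close> is the next one counterclockwise after \<^term>\<open>{v, i}\<close> around
  \<^term>\<open>v\<close>. For \<^term>\<open>i = j\<close> the angle is a full turn, so this holds only if
  \<^term>\<open>v\<close> has degree one.\<close>

definition consecutive_at :: "'a set set \<Rightarrow> ('a \<Rightarrow> complex) \<Rightarrow> 'a \<Rightarrow> 'a \<Rightarrow> 'a \<Rightarrow> bool" where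
  "consecutive_at E p v i j \<longleftrightarrow>
     i \<in> neighbours E v \<and> j \<in> neighbours E v \<and>
     (\<forall>k \<in> neighbours E v. ccw_angle (p v) (p i) (p j) \<le> ccw_angle (p v) (p i) (p k))"

definition pointed_vertex :: "'a set set \<Rightarrow> ('a \<Rightarrow> complex) \<Rightarrow> 'a \<Rightarrow> bool" where
  "pointed_vertex E p v \<longleftrightarrow>
     (\<exists>i j. consecutive_at E p v i j \<and> ccw_angle (p v) (p i) (p j) > pi)"

text \<open>A polygon with \<^term>\<open>m\<close> vertices \<^term>\<open>q 0\<close>, ..., \<^term>\<open>q (m - 1)\<close> in cyclic
  order; it is simple if the cycle is drawn without crossings.\<close>

definition cycle_edges :: "nat \<Rightarrow> nat set set" where
  "cycle_edges m = {{i, Suc i mod m} | i. i < m}"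

definition simple_polygon :: "nat \<Rightarrow> (nat \<Rightarrow> complex) \<Rightarrow> bool" where
  "simple_polygon m q \<longleftrightarrow> m \<ge> 3 \<and> noncrossing_embedding {..<m} (cycle_edges m) q"

definition polygon_interior :: "nat \<Rightarrow> (nat \<Rightarrow> complex) \<Rightarrow> complex set" where
  "polygon_interior m q = inside (drawing {..<m} (cycle_edges m) q)"

text \<open>No orientation of the polygon is assumed. The two edges at \<^term>\<open>q i\<close> form two angles,
  \<open>\<alpha>\<close> and \<open>2 * pi - \<alpha>\<close>; the first one is the interior angle iff its bisector starts out into
  the interior of the polygon.\<close>

definition interior_angle :: "nat \<Rightarrow> (nat \<Rightarrow> complex) \<Rightarrow> nat \<Rightarrow> real" where
  "interior_angle m q i =
     (let v = q i; a = q (Suc i mod m); b = q ((i + m - 1) mod m); \<alpha> = ccw_angle v a b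
      in if \<forall>\<^sub>F t in at_right 0. v + of_real t * (a - v) * cis (\<alpha> / 2) \<in> polygon_interior m q
         then \<alpha> else 2 * pi - \<alpha>)"

text \<open>Pseudo-triangles are given by their open interiors, so that they can be compared with
  faces, which are open. (With closures, an edge sticking into a face would go unnoticed.)
  Vertices with interior angle \<^term>\<open>pi\<close> are allowed; they are not convex, so they do not
  affect the count.\<close>

definition pseudo_triangle :: "complex set \<Rightarrow> bool" where
  "pseudo_triangle F \<longleftrightarrow>
     (\<exists>m q. simple_polygon m q \<and> F = polygon_interior m q \<and>
            card {i. i < m \<and> interior_angle m q i < pi} = 3)"

text \<open>An edge is incident to the outer face if its segment lies on the boundary of that face.\<close>

definition convex_outer_face :: "'a set \<Rightarrow> 'a set set \<Rightarrow> ('a \<Rightarrow> complex) \<Rightarrow> bool" where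
  "convex_outer_face V E p \<longleftrightarrow>
     (\<Union>e \<in> {e \<in> E. edge_segment p e \<subseteq> frontier (outer_face V E p)}. edge_segment p e)
       = frontier (convex hull (p ` V))"

definition pseudo_triangulation :: "'a set \<Rightarrow> 'a set set \<Rightarrow> ('a \<Rightarrow> complex) \<Rightarrow> bool" where
  "pseudo_triangulation V E p \<longleftrightarrow>
     simple_graph V E \<and> noncrossing_embedding V E p \<and> convex_outer_face V E p \<and>
     (\<forall>F \<in> interior_faces V E p. pseudo_triangle F)"

definition pointed_pseudo_triangulation :: "'a set \<Rightarrow> 'a set set \<Rightarrow> ('a \<Rightarrow> complex) \<Rightarrow> bool" where
  "pointed_pseudo_triangulation V E p \<longleftrightarrow>
     pseudo_triangulation V E p \<and> (\<forall>v\<in>V. pointed_vertex E p v)"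

end

theory Submission imports Defs begin

text \<open>The rotation system of a non-crossing embedding is planar in a purely combinatorial sense, and
  only this rotation system is kept. Counting edges and faces, a planar rotation system of a Laman
  graph has a facial triangle one of whose edges can be contracted so that a Laman graph results,
  with an inherited planar rotation system. By induction the smaller graph is drawn without crossings
  so that all edges at each vertex lie in an open half plane; splitting the contracted vertex into two
  sufficiently close points along a suitable direction preserves this property. Finally, a
  non-crossing drawing with \<open>2n - 3\<close> edges and a half plane at each vertex is automatically a
  pseudo-triangulation: at least one angle at each vertex is larger than \<open>pi\<close>, each bounded face has
  at least three convex corners, and Euler's formula forces equality. The same count shows that no
  edge can be added without destroying weak pointedness, whereas a missing edge of the convex hull
  could be added.\<close>

section \<open>Cyclic orders and rotation systems\<close>

text \<open>Planarity is stated by a criterion that passes to subgraphs by definition. For a drawing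
  it only needs the Jordan curve theorem for single cycles; combinatorially it yields Euler's
  inequality by deleting non-tree edges; and it survives contraction, because a bad subgraph of the
  contraction lifts to a bad subgraph of the original. The obstacle to contraction is sparsity: an
  edge of a facial triangle is unusable if a tight set of at least 3 vertices contains the edge but
  not the apex. If all edges were blocked in this way, take for each a largest blocker, and among
  these a smallest one. Maximality makes its complement connected, so everything outside attaches
  within one face, and one of its own facial triangles is a face of the whole graph. Two blockers of
  this triangle then share two vertices, and submodularity forbids the third edge of the triangle.
  In the splitting step the reflex angle at the contracted vertex can fall into three places of the
  merged rotation, and each dictates another direction. All counts are of arcs, that is, twice the
  edges.\<close>

definition cyc :: "real \<Rightarrow> real \<Rightarrow> real \<Rightarrow> bool" where
  "cyc x y z \<longleftrightarrow> x < y \<and> y < z \<or> y < z \<and> z < x \<or> z < x \<and> x < y"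

lemma cyc_rotate: "cyc x y z \<longleftrightarrow> cyc y z x"
  by (auto simp: cyc_def)

lemma cyc_total: "x \<noteq> y \<Longrightarrow> y \<noteq> z \<Longrightarrow> x \<noteq> z \<Longrightarrow> cyc x y z \<or> cyc x z y"
  by (auto simp: cyc_def)

text \<open>The clause for \<open>j = i\<close> makes a lone neighbour its own successor. Without it
  every \<open>i\<close> would be its own successor, since \<open>cyc\<close> fails whenever two
  arguments agree.\<close>

definition succ_of :: "('a \<Rightarrow> real) \<Rightarrow> 'a set \<Rightarrow> 'a \<Rightarrow> 'a \<Rightarrow> bool" where
  "succ_of k N i j \<longleftrightarrow> j \<in> N \<and> (j = i \<longrightarrow> N = {i}) \<and> (\<forall>l\<in>N. \<not> cyc (k i) (k l) (k j))"

definition nxt :: "('a \<Rightarrow> real) \<Rightarrow> 'a set \<Rightarrow> 'a \<Rightarrow> 'a" where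
  "nxt k N i = (SOME j. succ_of k N i j)"

lemma succ_of_ex:
  assumes "finite N" "i \<in> N"
  shows "\<exists>j. succ_of k N i j"
proof (cases "N = {i}")
  case True
  then show ?thesis by (auto simp: succ_of_def cyc_def)
next
  case False
  define S where "S = {j \<in> N. k j > k i}"
  show ?thesis
  \<comment> \<open>If no key exceeds that of \<open>i\<close>, the order wraps around and the
    smallest remaining key follows; otherwise the smallest larger key does.\<close>
  proof (cases "S = {}")
    case True
    have ne: "N - {i} \<noteq> {}" using False assms by auto
    have fin: "finite (N - {i})" using assms by auto
    define j where "j = arg_min_on k (N - {i})"
    have j: "j \<in> N - {i}" "\<forall>l\<in>N - {i}. k j \<le> k l"
      using arg_min_if_finite(1)[OF fin ne] arg_min_least[OF fin ne] by (auto simp: j_def)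
    have "\<not> cyc (k i) (k l) (k j)" if "l \<in> N" for l
    proof (cases "l = i")
      case False
      then have "k j \<le> k l" "k l \<le> k i" using that j True by (auto simp: S_def not_less)
      then show ?thesis by (auto simp: cyc_def)
    qed (auto simp: cyc_def)
    then show ?thesis using j by (auto simp: succ_of_def)
  next
    case ne: False
    have fin: "finite S" using assms by (auto simp: S_def)
    define j where "j = arg_min_on k S"
    have j: "j \<in> S" "\<forall>l\<in>S. k j \<le> k l"
      using arg_min_if_finite(1)[OF fin ne] arg_min_least[OF fin ne] by (auto simp: j_def)
    have "\<not> cyc (k i) (k l) (k j)" if "l \<in> N" for l
    proof (cases "k i < k l")
      case True
      then have "k j \<le> k l" "k i < k j" using that j by (auto simp: S_def)
      then show ?thesis by (auto simp: cyc_def)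
    next
      case False
      moreover have "k i < k j" using j by (auto simp: S_def)
      ultimately show ?thesis by (auto simp: cyc_def)
    qed
    then show ?thesis using j by (auto simp: succ_of_def S_def)
  qed
qed

lemma succ_of_unique:
  assumes "inj_on k N" "i \<in> N" "succ_of k N i j" "succ_of k N i j'"
  shows "j = j'"
proof (rule ccontr)
  assume ne: "j \<noteq> j'"
  then have "j \<noteq> i" "j' \<noteq> i" using assms by (auto simp: succ_of_def)
  then have "k j \<noteq> k j'" "k i \<noteq> k j" "k i \<noteq> k j'"
    using assms ne by (auto simp: succ_of_def inj_on_def)
  then have "cyc (k i) (k j) (k j') \<or> cyc (k i) (k j') (k j)" using cyc_total by blast
  then show False using assms(3,4) unfolding succ_of_def by blast
qed

lemma nxt_succ: "finite N \<Longrightarrow> i \<in> N \<Longrightarrow> succ_of k N i (nxt k N i)"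
  unfolding nxt_def using succ_of_ex by (metis someI_ex)

lemma nxt_in: "finite N \<Longrightarrow> i \<in> N \<Longrightarrow> nxt k N i \<in> N"
  using nxt_succ by (metis succ_of_def)

lemma nxt_eqI:
  assumes "finite N" "inj_on k N" "i \<in> N" "succ_of k N i j"
  shows "nxt k N i = j"
  using succ_of_unique[OF assms(2,3) _ assms(4)] nxt_succ[OF assms(1,3)] by blast

lemma nxt_not_cyc: "finite N \<Longrightarrow> i \<in> N \<Longrightarrow> l \<in> N \<Longrightarrow> \<not> cyc (k i) (k l) (k (nxt k N i))"
  using nxt_succ by (metis succ_of_def)

lemma nxt_self: "finite N \<Longrightarrow> i \<in> N \<Longrightarrow> nxt k N i = i \<Longrightarrow> N = {i}"
  using nxt_succ by (metis succ_of_def)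

lemma nxt_singleton: "nxt k {i} i = i"
  using nxt_in[of "{i}" i k] by auto

text \<open>Two distinct predecessors of one element form a cyclic triple with it, and in either
  orientation one of them separates the other from the successor.\<close>

lemma nxt_inj:
  assumes "finite N" "inj_on k N"
  shows "inj_on (nxt k N) N"
proof (rule inj_onI, rule ccontr)
  fix i i' assume i: "i \<in> N" "i' \<in> N" and eq: "nxt k N i = nxt k N i'" and ne: "i \<noteq> i'"
  let ?j = "nxt k N i"
  have j: "?j \<in> N" "?j \<noteq> i" "?j \<noteq> i'"
    using nxt_in nxt_self assms i eq ne by (metis, metis singletonD, metis singletonD)
  then have "k ?j \<noteq> k i" "k ?j \<noteq> k i'" "k i \<noteq> k i'"
    using assms(2) i ne by (auto simp: inj_on_def)
  then have "cyc (k i) (k i') (k ?j) \<or> cyc (k i') (k i) (k ?j)"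
    by (auto simp: cyc_def)
  then show False using nxt_not_cyc assms i eq by metis
qed

lemma nxt_subset:
  assumes "finite N" "inj_on k N" "N' \<subseteq> N" "i \<in> N'" "nxt k N i \<in> N'"
  shows "nxt k N' i = nxt k N i"
proof -
  have "succ_of k N i (nxt k N i)" using nxt_succ[OF assms(1)] assms(3,4) by blast
  then have "succ_of k N' i (nxt k N i)" using assms(3-5) by (auto simp: succ_of_def)
  then show ?thesis
    using nxt_eqI[OF finite_subset[OF assms(3,1)] inj_on_subset[OF assms(2,3)] assms(4)] by blast
qed

text \<open>Only the predecessor of \<open>y\<close> notices the deletion. This is the local move
  behind the merging of two faces when an edge disappears.\<close>

lemma nxt_delete:
  assumes "finite N" "inj_on k N" "z \<in> N" "y \<in> N" "z \<noteq> y"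
  shows "nxt k (N - {y}) z = (if nxt k N z = y then nxt k N y else nxt k N z)"
proof (cases "nxt k N z = y")
  case False
  then show ?thesis using nxt_subset[OF assms(1,2), of "N - {y}" z] nxt_in[OF assms(1,3)] assms
    by auto
next
  case True
  let ?j = "nxt k N y"
  have s1: "succ_of k N z y" and s2: "succ_of k N y ?j"
    using nxt_succ assms True by metis+
  have jy: "?j \<noteq> y" using s2 assms(3,5) by (auto simp: succ_of_def)
  have "succ_of k (N - {y}) z ?j"
  proof -
    have "?j = z \<longrightarrow> N - {y} = {z}"
    proof
      assume jz: "?j = z"
      { fix l assume l: "l \<in> N" "l \<noteq> z" "l \<noteq> y"
        then have "k l \<noteq> k z" "k l \<noteq> k y" "k y \<noteq> k z" using assms by (auto simp: inj_on_def)
        then have "cyc (k z) (k l) (k y) \<or> cyc (k y) (k l) (k z)" by (auto simp: cyc_def)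
        then have False using s1 s2 l jz by (auto simp: succ_of_def) }
      then show "N - {y} = {z}" using assms by auto
    qed
    moreover have "\<not> cyc (k z) (k l) (k ?j)" if l: "l \<in> N - {y}" for l
    proof
      assume c: "cyc (k z) (k l) (k ?j)"
      have d: "k l \<noteq> k y" "k z \<noteq> k y" "k ?j \<noteq> k y"
        using l assms jy nxt_in[OF assms(1,4), of k] by (auto simp: inj_on_def)
      have "\<not> cyc (k z) (k l) (k y)" "\<not> cyc (k y) (k l) (k ?j)" "\<not> cyc (k z) (k ?j) (k y)"
        using s1 s2 l by (auto simp: succ_of_def)
      then show False using c d unfolding cyc_def by (smt (verit))
    qed
    ultimately show ?thesis using jy nxt_in[OF assms(1,4), of k] by (auto simp: succ_of_def)
  qed
  then show ?thesis using nxt_eqI[of "N - {y}" k z ?j] assms True by (auto simp: inj_on_diff)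
qed

text \<open>Keys matter only through the cyclic order they induce, so a rotation may be cut open
  anywhere and its keys renormalised.\<close>

lemma nxt_cong_cyc:
  assumes "finite N" "inj_on k N" "inj_on k' N" "i \<in> N"
    and "\<And>x y z. x \<in> N \<Longrightarrow> y \<in> N \<Longrightarrow> z \<in> N \<Longrightarrow> cyc (k x) (k y) (k z) \<longleftrightarrow> cyc (k' x) (k' y) (k' z)"
  shows "nxt k N i = nxt k' N i"
proof -
  have "succ_of k' N i (nxt k' N i)" by (rule nxt_succ[OF assms(1,4)])
  then have "succ_of k N i (nxt k' N i)" using assms(4,5) by (auto simp: succ_of_def)
  then show ?thesis by (rule nxt_eqI[OF assms(1,2,4)])
qed

lemma nxt_image:
  assumes "finite N" "inj_on k (g ` N)" "inj_on g N" "i \<in> N"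
  shows "nxt k (g ` N) (g i) = g (nxt (k \<circ> g) N i)"
proof -
  have "succ_of (k \<circ> g) N i (nxt (k \<circ> g) N i)" by (rule nxt_succ[OF assms(1,4)])
  then have "succ_of k (g ` N) (g i) (g (nxt (k \<circ> g) N i))"
    using assms(3,4) by (auto simp: succ_of_def inj_on_def)
  then show ?thesis using nxt_eqI[OF finite_imageI[OF assms(1)] assms(2) imageI[OF assms(4)]] by blast
qed

text \<open>An injective self-map of a finite set permutes it, so an orbit closes up at its starting
  point; the least period enumerates it without repetition.\<close>

lemma finite_inj_orbit:
  fixes f :: "'a \<Rightarrow> 'a"
  assumes "finite A" "\<And>x. x \<in> A \<Longrightarrow> f x \<in> A" "inj_on f A" "d \<in> A"
  obtains m where "m > 0" "(f ^^ m) d = d" "inj_on (\<lambda>i. (f ^^ i) d) {..<m}"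
    "{(x, f x) | x. x \<in> A}\<^sup>* `` {d} = (\<lambda>i. (f ^^ i) d) ` {..<m}"
proof -
  have inA: "(f ^^ i) d \<in> A" for i using assms(2,4) by (induction i) auto
  have cancel: "(f ^^ i) d = (f ^^ j) d \<Longrightarrow> i \<le> j \<Longrightarrow> (f ^^ (j - i)) d = d" for i j
  proof (induction i arbitrary: j)
    case 0 then show ?case by simp
  next
    case (Suc i)
    then obtain j' where j: "j = Suc j'" by (cases j) auto
    then have "(f ^^ i) d = (f ^^ j') d"
      using Suc.prems assms(3) inA by (auto dest: inj_onD)
    then show ?case using Suc j by auto
  qed
  have "\<not> inj_on (\<lambda>i. (f ^^ i) d) UNIV"
    using finite_imageD[of "\<lambda>i. (f ^^ i) d" UNIV] assms(1) inA
    by (metis finite_subset image_subsetI infinite_UNIV_nat)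
  then obtain i j where "(f ^^ i) d = (f ^^ j) d" "i < j"
    unfolding inj_on_def by (metis linorder_neqE_nat)
  then have ex: "\<exists>m. m > 0 \<and> (f ^^ m) d = d" using cancel[of i j] by (intro exI[of _ "j - i"]) auto
  define m where "m = (LEAST m. m > 0 \<and> (f ^^ m) d = d)"
  have m: "m > 0" "(f ^^ m) d = d" using LeastI_ex[OF ex] by (auto simp: m_def)
  have min: "\<not> (n > 0 \<and> (f ^^ n) d = d)" if "n < m" for n
    using not_less_Least that by (auto simp: m_def)
  have inj: "inj_on (\<lambda>i. (f ^^ i) d) {..<m}"
  proof (rule inj_onI, rule ccontr)
    fix i j assume ij: "i \<in> {..<m}" "j \<in> {..<m}" "(f ^^ i) d = (f ^^ j) d" "i \<noteq> j"
    show False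
    proof (cases "i < j")
      case True
      then have "j - i < m" "j - i > 0" using ij by auto
      then show False using min cancel[of i j] ij True by (metis less_imp_le)
    next
      case False
      then have "i - j < m" "i - j > 0" using ij by auto
      then show False using min cancel[of j i] ij False by (metis not_less)
    qed
  qed
  have "(f ^^ i) d \<in> {(x, f x) | x. x \<in> A}\<^sup>* `` {d}" for i
  proof (induction i)
    case (Suc i)
    then have "((f ^^ i) d, (f ^^ Suc i) d) \<in> {(x, f x) | x. x \<in> A}" using inA by auto
    then show ?case using Suc by (meson Image_singleton_iff rtrancl.rtrancl_into_rtrancl)
  qed auto
  moreover have "e \<in> (\<lambda>i. (f ^^ i) d) ` {..<m}" if "(d, e) \<in> {(x, f x) | x. x \<in> A}\<^sup>*" for e
    using that
  proof induction
    case base then show ?case using m by (auto intro!: image_eqI[of _ _ 0])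
  next
    case (step y z)
    then obtain i where i: "i < m" "y = (f ^^ i) d" by auto
    show ?case
    proof (cases "Suc i = m")
      case True
      then have "z = d" using step i m by auto
      then show ?thesis using m by (auto intro!: image_eqI[of _ _ 0])
    next
      case False
      then show ?thesis using step i by (auto intro!: image_eqI[of _ _ "Suc i"])
    qed
  qed
  ultimately show ?thesis using that m inj by (metis (no_types, lifting) Image_singleton_iff image_subsetI subsetI subset_antisym)
qed

section \<open>Rotation systems, their faces, and combinatorial planarity\<close>

definition rot_graph :: "('a \<Rightarrow> 'a \<Rightarrow> real) \<Rightarrow> ('a \<times> 'a) set \<Rightarrow> bool" where
  "rot_graph \<kappa> A \<longleftrightarrow> finite A \<and> sym A \<and> irrefl A \<and> (\<forall>v. inj_on (\<kappa> v) (A `` {v}))"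

text \<open>The face of a dart lies to its right, so it is followed by turning to the
  counterclockwise successor of the reversed dart.\<close>

definition face_step :: "('a \<Rightarrow> 'a \<Rightarrow> real) \<Rightarrow> ('a \<times> 'a) set \<Rightarrow> 'a \<times> 'a \<Rightarrow> 'a \<times> 'a" where
  "face_step \<kappa> A d = (snd d, nxt (\<kappa> (snd d)) (A `` {snd d}) (fst d))"

definition orb :: "('a \<Rightarrow> 'a \<Rightarrow> real) \<Rightarrow> ('a \<times> 'a) set \<Rightarrow> (('a \<times> 'a) \<times> ('a \<times> 'a)) set" where
  "orb \<kappa> A = {(d, face_step \<kappa> A d) | d. d \<in> A}\<^sup>*"

definition faces :: "('a \<Rightarrow> 'a \<Rightarrow> real) \<Rightarrow> ('a \<times> 'a) set \<Rightarrow> ('a \<times> 'a) set set" where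
  "faces \<kappa> A = (\<lambda>d. orb \<kappa> A `` {d}) ` A"

definition del :: "'a \<Rightarrow> 'a \<Rightarrow> ('a \<times> 'a) set \<Rightarrow> ('a \<times> 'a) set" where
  "del x y A = A - {(x, y), (y, x)}"

text \<open>Combinatorial planarity: in every subgraph, an edge with the same face on both sides is
  a bridge.\<close>

definition planar_rot :: "('a \<Rightarrow> 'a \<Rightarrow> real) \<Rightarrow> ('a \<times> 'a) set \<Rightarrow> bool" where
  "planar_rot \<kappa> A \<longleftrightarrow> (\<forall>H x y. H \<subseteq> A \<longrightarrow> sym H \<longrightarrow> (x, y) \<in> H \<longrightarrow>
     ((x, y), (y, x)) \<in> orb \<kappa> H \<longrightarrow> (x, y) \<notin> (del x y H)\<^sup>*)"

lemma orb_into: "(d, e) \<in> orb \<kappa> B \<Longrightarrow> e \<in> B \<Longrightarrow> (d, face_step \<kappa> B e) \<in> orb \<kappa> B"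
  unfolding orb_def by (rule rtrancl.rtrancl_into_rtrancl) blast+

lemma orb_refl: "(d, d) \<in> orb \<kappa> A"
  by (simp add: orb_def)

lemma orb_trans: "(d, e) \<in> orb \<kappa> A \<Longrightarrow> (e, f) \<in> orb \<kappa> A \<Longrightarrow> (d, f) \<in> orb \<kappa> A"
  by (simp add: orb_def)

lemma orb_step: "d \<in> A \<Longrightarrow> (d, face_step \<kappa> A d) \<in> orb \<kappa> A"
  using orb_into orb_refl by metis

lemma rot_graph_subset: "rot_graph \<kappa> A \<Longrightarrow> H \<subseteq> A \<Longrightarrow> sym H \<Longrightarrow> rot_graph \<kappa> H"
  unfolding rot_graph_def irrefl_def by (meson Image_mono finite_subset inj_on_subset subset_eq)

lemma planar_rot_subset: "planar_rot \<kappa> A \<Longrightarrow> H \<subseteq> A \<Longrightarrow> planar_rot \<kappa> H"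
  unfolding planar_rot_def by (meson order_trans)

lemma sym_del: "sym A \<Longrightarrow> sym (del x y A)"
  by (auto simp: sym_def del_def)

lemma rot_graph_del: "rot_graph \<kappa> A \<Longrightarrow> rot_graph \<kappa> (del x y A)"
  by (rule rot_graph_subset) (auto simp: del_def sym_def rot_graph_def)

context
  fixes \<kappa> :: "'a \<Rightarrow> 'a \<Rightarrow> real" and A :: "('a \<times> 'a) set"
  assumes rg: "rot_graph \<kappa> A"
begin

lemma rg_fin: "finite A" and rg_sym: "sym A" and rg_irr: "(x, x) \<notin> A"
  and rg_inj: "inj_on (\<kappa> v) (A `` {v})" and rg_swap: "(x, y) \<in> A \<Longrightarrow> (y, x) \<in> A"
  and rg_finN: "finite (A `` {v})"
  using rg by (auto simp: rot_graph_def irrefl_def sym_def finite_Image)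

lemma face_step_in: "d \<in> A \<Longrightarrow> face_step \<kappa> A d \<in> A"
  using nxt_in[OF rg_finN, of "fst d" "snd d" "\<kappa> (snd d)"] rg_swap[of "fst d" "snd d"]
  by (auto simp: face_step_def)

lemma face_step_inj: "inj_on (face_step \<kappa> A) A"
proof (rule inj_onI)
  fix d e assume de: "d \<in> A" "e \<in> A" "face_step \<kappa> A d = face_step \<kappa> A e"
  obtain x y where d: "d = (x, y)" by force
  obtain x' where e: "e = (x', y)" using de d by (cases e) (auto simp: face_step_def)
  have "nxt (\<kappa> y) (A `` {y}) x = nxt (\<kappa> y) (A `` {y}) x'" using de d e by (auto simp: face_step_def)
  moreover have "x \<in> A `` {y}" "x' \<in> A `` {y}" using de d e rg_swap by auto
  ultimately show "d = e" using nxt_inj[OF rg_finN rg_inj, of y] d e by (auto dest: inj_onD)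
qed

lemma orb_in: "(d, e) \<in> orb \<kappa> A \<Longrightarrow> d \<in> A \<Longrightarrow> e \<in> A"
  unfolding orb_def by (induction rule: rtrancl_induct) (auto simp: face_step_in)

lemma orb_enum:
  assumes "d \<in> A"
  obtains m where "m > 0" "(face_step \<kappa> A ^^ m) d = d"
    "inj_on (\<lambda>i. (face_step \<kappa> A ^^ i) d) {..<m}"
    "orb \<kappa> A `` {d} = (\<lambda>i. (face_step \<kappa> A ^^ i) d) ` {..<m}"
  using finite_inj_orbit[OF rg_fin face_step_in face_step_inj assms] unfolding orb_def by blast

lemma orb_funpow: "d \<in> A \<Longrightarrow> (d, (face_step \<kappa> A ^^ i) d) \<in> orb \<kappa> A"
proof (induction i)
  case (Suc i)
  then have "(d, (face_step \<kappa> A ^^ i) d) \<in> orb \<kappa> A" by blast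
  from orb_into[OF this orb_in[OF this Suc.prems]] show ?case by simp
qed (simp add: orb_refl)

text \<open>Walking on around the orbit undoes a single step. Hence reachability along a face is an
  equivalence and faces partition the darts.\<close>

lemma orb_step_back: "d \<in> A \<Longrightarrow> (face_step \<kappa> A d, d) \<in> orb \<kappa> A"
proof -
  assume d: "d \<in> A"
  obtain m where m: "m > 0" "(face_step \<kappa> A ^^ m) d = d" by (rule orb_enum[OF d])
  then obtain m' where "m = Suc m'" by (cases m) auto
  then have "(face_step \<kappa> A ^^ m') (face_step \<kappa> A d) = d"
    using m by (simp only: funpow_Suc_right comp_apply)
  then show ?thesis using orb_funpow[OF face_step_in[OF d], of m'] by simp
qed

lemma orb_sym: "(d, e) \<in> orb \<kappa> A \<Longrightarrow> d \<in> A \<Longrightarrow> (e, d) \<in> orb \<kappa> A"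
proof -
  assume "(d, e) \<in> orb \<kappa> A" "d \<in> A"
  then have "e \<in> A \<and> (e, d) \<in> orb \<kappa> A"
    unfolding orb_def
  proof (induction rule: rtrancl_induct)
    case (step y z)
    then show ?case using orb_step_back[of y] face_step_in[of y] unfolding orb_def by auto
  qed auto
  then show ?thesis by blast
qed

lemma orb_class_eq: "(d, e) \<in> orb \<kappa> A \<Longrightarrow> d \<in> A \<Longrightarrow> orb \<kappa> A `` {d} = orb \<kappa> A `` {e}"
  using orb_sym orb_trans by blast

lemma finite_faces: "finite (faces \<kappa> A)"
  by (simp add: faces_def rg_fin)

lemma faces_cover: "\<Union> (faces \<kappa> A) = A"
  unfolding faces_def using orb_in orb_refl by blast

lemma faces_disjoint: "F \<in> faces \<kappa> A \<Longrightarrow> G \<in> faces \<kappa> A \<Longrightarrow> F \<noteq> G \<Longrightarrow> F \<inter> G = {}"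
proof (rule ccontr)
  assume FG: "F \<in> faces \<kappa> A" "G \<in> faces \<kappa> A" "F \<noteq> G" "F \<inter> G \<noteq> {}"
  obtain d e where de: "d \<in> A" "e \<in> A" "F = orb \<kappa> A `` {d}" "G = orb \<kappa> A `` {e}"
    using FG(1,2) unfolding faces_def by blast
  then obtain f where "(d, f) \<in> orb \<kappa> A" "(e, f) \<in> orb \<kappa> A" using FG(4) by blast
  then show False using FG(3) de orb_class_eq by metis
qed

lemma sum_card_faces: "(\<Sum>F\<in>faces \<kappa> A. card F) = card A"
  using card_Union_disjoint[of "faces \<kappa> A"] faces_cover faces_disjoint rg_fin
  by (metis Union_upper disjnt_def finite_subset pairwiseI)

text \<open>Only darts that used to step into the deleted edge change. Such a dart turns on to the
  next edge at the same vertex, which is where the opposite dart of the deleted edge led.\<close>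

lemma face_step_del:
  assumes xy: "(x, y) \<in> A" and sep: "((x, y), (y, x)) \<notin> orb \<kappa> A"
    and d: "d \<in> A" "d \<noteq> (x, y)" "d \<noteq> (y, x)"
  shows "face_step \<kappa> (del x y A) d =
    (if face_step \<kappa> A d = (x, y) then face_step \<kappa> A (y, x)
     else if face_step \<kappa> A d = (y, x) then face_step \<kappa> A (x, y) else face_step \<kappa> A d)"
proof -
  obtain z w where zw: "d = (z, w)" by force
  have ne: "x \<noteq> y" using xy rg_irr by auto
  have N: "del x y A `` {w} = (if w = x then A `` {w} - {y} else if w = y then A `` {w} - {x} else A `` {w})"
    using ne by (auto simp: del_def)
  have z: "z \<in> A `` {w}" using d zw rg_swap by auto
  have xy': "y \<in> A `` {x}" "x \<in> A `` {y}" using xy rg_swap by auto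
  show ?thesis
    using nxt_delete[OF rg_finN rg_inj z, of y] nxt_delete[OF rg_finN rg_inj z, of x] xy' d zw ne N
    by (auto simp: face_step_def)
qed

lemma face_step_ne: "(x, y) \<in> A \<Longrightarrow> face_step \<kappa> A (x, y) \<noteq> (x, y)"
  using rg_irr by (auto simp: face_step_def)

end

section \<open>Merging two faces by deleting the edge between them\<close>

lemma orb_del_across:
  assumes rg: "rot_graph \<kappa> A" and xy: "(x, y) \<in> A" and sep: "((x, y), (y, x)) \<notin> orb \<kappa> A"
  shows "(face_step \<kappa> A (x, y), face_step \<kappa> A (y, x)) \<in> orb \<kappa> (del x y A)"
proof -
  let ?B = "del x y A" and ?f = "face_step \<kappa> A" and ?d = "(x, y)"
  obtain m where m: "m > 0" "(?f ^^ m) ?d = ?d" "inj_on (\<lambda>i. (?f ^^ i) ?d) {..<m}"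
    by (rule orb_enum[OF rg xy])
  have inB: "(?f ^^ i) ?d \<in> ?B" if "0 < i" "i < m" for i
  proof -
    have "(?f ^^ i) ?d \<noteq> ?d"
      using inj_onD[OF m(3), of i 0] that by auto
    moreover have "(?f ^^ i) ?d \<noteq> (y, x)" using orb_funpow[OF rg xy, of i] sep by metis
    moreover have "(?f ^^ i) ?d \<in> A" using orb_in[OF rg orb_funpow[OF rg xy, of i] xy] .
    ultimately show ?thesis by (auto simp: del_def)
  qed
  have m1: "m \<noteq> 1" using m(2) face_step_ne[OF rg xy] by auto
  have run: "0 < i \<Longrightarrow> i < m \<Longrightarrow> (?f ?d, (?f ^^ i) ?d) \<in> orb \<kappa> ?B" for i
  proof (induction i)
    case (Suc i)
    show ?case
    proof (cases "i = 0")
      case False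
      let ?e = "(?f ^^ i) ?d"
      have e: "?e \<in> ?B" "?f ?e \<in> ?B" using inB[of i] inB[of "Suc i"] Suc.prems False by auto
      then have "face_step \<kappa> ?B ?e = ?f ?e"
        using face_step_del[OF rg xy sep, of ?e] by (auto simp: del_def)
      then have "(?e, ?f ?e) \<in> orb \<kappa> ?B" using orb_step[OF e(1), of \<kappa>] by simp
      moreover have "(?f ?d, ?e) \<in> orb \<kappa> ?B" using Suc False by simp
      ultimately show ?thesis using orb_trans by fastforce
    qed (simp add: orb_refl)
  qed simp
  \<comment> \<open>\<open>?t\<close> is the dart that steps into \<open>(x, y)\<close>; the
    deletion redirects it into the face on the other side.\<close>
  let ?t = "(?f ^^ (m - 1)) ?d"
  have "?f ?t = ?d" using m m1 by (cases m) auto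
  moreover have t: "?t \<in> ?B" using inB[of "m - 1"] m m1 by simp
  ultimately have "face_step \<kappa> ?B ?t = ?f (y, x)"
    using face_step_del[OF rg xy sep, of ?t] by (auto simp: del_def)
  then have "(?t, ?f (y, x)) \<in> orb \<kappa> ?B"
    using orb_step[OF t, of \<kappa>] by simp
  moreover have "(?f ?d, ?t) \<in> orb \<kappa> ?B" using run[of "m - 1"] m m1 by simp
  ultimately show ?thesis using orb_trans by metis
qed

text \<open>The two deleted darts have no place in the new graph and are represented by their
  successors. With this substitution every old face is carried into a single new face.\<close>

lemma orb_del:
  assumes rg: "rot_graph \<kappa> A" and xy: "(x, y) \<in> A" and sep: "((x, y), (y, x)) \<notin> orb \<kappa> A"
    and d: "d \<in> A" and de: "(d, e) \<in> orb \<kappa> A"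
  shows "(if d \<in> del x y A then d else face_step \<kappa> A d, if e \<in> del x y A then e else face_step \<kappa> A e)
    \<in> orb \<kappa> (del x y A)"
proof -
  let ?B = "del x y A" and ?f = "face_step \<kappa> A"
  let ?g = "\<lambda>e. if e \<in> ?B then e else ?f e"
  have yx: "(y, x) \<in> A" using xy rg_swap[OF rg] by blast
  have sep': "((y, x), (x, y)) \<notin> orb \<kappa> A" using sep orb_sym[OF rg _ yx] by blast
  have BB: "del y x A = ?B" by (auto simp: del_def)
  have notB: "e = (x, y) \<or> e = (y, x)" if "e \<in> A" "e \<notin> ?B" for e using that by (auto simp: del_def)
  have "?f (x, y) \<noteq> (y, x)" "?f (y, x) \<noteq> (x, y)"
    using orb_step[OF xy, of \<kappa>] orb_step[OF yx, of \<kappa>] sep sep' by force+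
  then have f1: "?f (x, y) \<in> ?B" "?f (y, x) \<in> ?B"
    using face_step_in[OF rg xy] face_step_in[OF rg yx] face_step_ne[OF rg xy] face_step_ne[OF rg yx]
    unfolding del_def by blast+
  have across: "(?f (x, y), ?f (y, x)) \<in> orb \<kappa> ?B" "(?f (y, x), ?f (x, y)) \<in> orb \<kappa> ?B"
    using orb_del_across[OF rg xy sep] orb_del_across[OF rg yx sep'] BB by auto
  have "e \<in> A \<and> (?g d, ?g e) \<in> orb \<kappa> ?B"
    using de unfolding orb_def[of \<kappa> A]
  proof (induction rule: rtrancl_induct)
    case base
    then show ?case using d orb_refl by blast
  next
    case (step e e')
    then have e: "e \<in> A" and e': "e' = ?f e" and IH: "(?g d, ?g e) \<in> orb \<kappa> ?B"
      by blast+
    have e'A: "e' \<in> A" using face_step_in[OF rg e] e' by simp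
    show ?case
    proof (cases "e \<in> ?B")
      case False
      then have "e = (x, y) \<or> e = (y, x)" by (rule notB[OF e])
      then have "e' \<in> ?B" unfolding e' using f1 by (elim disjE) simp_all
      then show ?thesis using IH False e' e'A by simp
    next
      case True
      then have ne: "e \<noteq> (x, y)" "e \<noteq> (y, x)" unfolding del_def by blast+
      have st: "(?g d, face_step \<kappa> ?B e) \<in> orb \<kappa> ?B"
        using orb_into[OF IH] True by simp
      consider "e' \<in> ?B" | "e' = (x, y)" | "e' = (y, x)" using notB[OF e'A] by blast
      then have "(?g d, ?g e') \<in> orb \<kappa> ?B"
      proof cases
        case 1
        then have "e' \<noteq> (x, y)" "e' \<noteq> (y, x)" unfolding del_def by blast+
        then have "face_step \<kappa> ?B e = e'"
          using face_step_del[OF rg xy sep e ne] e' by simp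
        then show ?thesis using st 1 by simp
      next
        case 2
        have "face_step \<kappa> ?B e = ?f (y, x)"
          using face_step_del[OF rg xy sep e ne] e' 2 by simp
        moreover have "?g e' = ?f (x, y)" using 2 by (simp add: del_def)
        ultimately show ?thesis using orb_trans[OF st] across by simp
      next
        case 3
        then have "e' \<noteq> (x, y)" using sep orb_refl by blast
        then have "face_step \<kappa> ?B e = ?f (x, y)"
          using face_step_del[OF rg xy sep e ne] e' 3 by simp
        moreover have "?g e' = ?f (y, x)" using 3 by (simp add: del_def)
        ultimately show ?thesis using orb_trans[OF st] across by simp
      qed
      then show ?thesis using e'A by blast
    qed
  qed
  then show ?thesis by blast
qed

text \<open>The map on faces induced by \<open>orb_del\<close> is onto, and the two faces beside the
  deleted edge have the same image. It therefore stays onto when one of them is left out.\<close>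

lemma card_faces_del:
  assumes rg: "rot_graph \<kappa> A" and xy: "(x, y) \<in> A" and sep: "((x, y), (y, x)) \<notin> orb \<kappa> A"
  shows "card (faces \<kappa> A) \<ge> card (faces \<kappa> (del x y A)) + 1"
proof -
  let ?B = "del x y A" and ?f = "face_step \<kappa> A"
  let ?g = "\<lambda>e. if e \<in> ?B then e else ?f e"
  let ?c = "\<lambda>d. orb \<kappa> A `` {d}" and ?c' = "\<lambda>d. orb \<kappa> ?B `` {d}"
  have yx: "(y, x) \<in> A" using xy rg_swap[OF rg] by blast
  have rgB: "rot_graph \<kappa> ?B" by (rule rot_graph_del[OF rg])
  have sep': "((y, x), (x, y)) \<notin> orb \<kappa> A" using sep orb_sym[OF rg _ yx] by blast
  have "?f (x, y) \<noteq> (y, x)" "?f (y, x) \<noteq> (x, y)"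
    using orb_step[OF xy, of \<kappa>] orb_step[OF yx, of \<kappa>] sep sep' by force+
  then have f1: "?f (x, y) \<in> ?B" "?f (y, x) \<in> ?B"
    using face_step_in[OF rg xy] face_step_in[OF rg yx] face_step_ne[OF rg xy] face_step_ne[OF rg yx]
    unfolding del_def by blast+
  have notB: "e = (x, y) \<or> e = (y, x)" if "e \<in> A" "e \<notin> ?B" for e using that by (auto simp: del_def)
  have gB: "?g d \<in> ?B" if "d \<in> A" for d using notB[OF that] f1 by metis
  define h where "h F = ?c' (?g (SOME d. d \<in> F))" for F
  have hc: "h (?c d) = ?c' (?g d)" if d: "d \<in> A" for d
  proof -
    have "(d, SOME e. e \<in> ?c d) \<in> orb \<kappa> A"
      using orb_refl[of d \<kappa> A] someI_ex[of "\<lambda>e. e \<in> ?c d"] by blast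
    from orb_del[OF rg xy sep d this] show ?thesis
      unfolding h_def using orb_class_eq[OF rgB _ gB[OF d]] by metis
  qed
  have "(x, y) \<notin> ?B" "(y, x) \<notin> ?B" by (auto simp: del_def)
  then have same: "h (?c (x, y)) = h (?c (y, x))"
    using hc[OF xy] hc[OF yx] orb_class_eq[OF rgB orb_del_across[OF rg xy sep] f1(1)] by simp
  have ne: "?c (x, y) \<noteq> ?c (y, x)" using sep orb_refl[of "(y, x)" \<kappa> A] by blast
  have "faces \<kappa> ?B \<subseteq> h ` (faces \<kappa> A - {?c (x, y)})"
  proof
    fix F assume "F \<in> faces \<kappa> ?B"
    then obtain d where d: "d \<in> ?B" "F = ?c' d" by (auto simp: faces_def)
    then have dA: "d \<in> A" by (auto simp: del_def)
    have F: "F = h (?c d)" using hc[OF dA] d by simp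
    have m: "?c d \<in> faces \<kappa> A" "?c (y, x) \<in> faces \<kappa> A" using dA yx unfolding faces_def by blast+
    show "F \<in> h ` (faces \<kappa> A - {?c (x, y)})"
      using F m same ne by (cases "?c d = ?c (x, y)") (metis DiffI image_eqI singletonD)+
  qed
  then have "card (faces \<kappa> ?B) \<le> card (faces \<kappa> A - {?c (x, y)})"
    using surj_card_le[of "faces \<kappa> A - {?c (x, y)}"] finite_faces[OF rg] by blast
  moreover have m: "?c (x, y) \<in> faces \<kappa> A" using xy unfolding faces_def by blast
  moreover have "card (faces \<kappa> A) > 0" using m finite_faces[OF rg] card_gt_0_iff by blast
  ultimately show ?thesis using card_Diff_singleton[OF m] by linarith
qed

section \<open>Counting faces\<close>

definition conn_on :: "'a set \<Rightarrow> ('a \<times> 'a) set \<Rightarrow> bool" where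
  "conn_on V A \<longleftrightarrow> (\<forall>x\<in>V. \<forall>y\<in>V. (x, y) \<in> A\<^sup>*)"

lemma rtrancl_exit:
  assumes "(x, y) \<in> R\<^sup>*" "x \<in> S" "y \<notin> S"
  obtains s t where "(s, t) \<in> R" "s \<in> S" "t \<notin> S"
  using assms by (induction rule: rtrancl_induct) blast+

text \<open>A shortest walk repeats no vertex, since the part between two visits could be cut
  out.\<close>

lemma simple_walk_ex:
  assumes "(x, y) \<in> R\<^sup>*"
  obtains q k where "q 0 = x" "q k = y" "inj_on q {..k}" "\<And>i. i < k \<Longrightarrow> (q i, q (Suc i)) \<in> R"
proof -
  have ex: "\<exists>k. (x, y) \<in> R ^^ k" using assms by (simp add: rtrancl_power)
  define k where "k = (LEAST k. (x, y) \<in> R ^^ k)"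
  have "(x, y) \<in> R ^^ k" unfolding k_def by (rule LeastI_ex[OF ex])
  then obtain q where q: "q 0 = x" "q k = y" "\<And>i. i < k \<Longrightarrow> (q i, q (Suc i)) \<in> R"
    unfolding relpow_fun_conv by blast
  have no: False if ij: "i < j" "j \<le> k" "q i = q j" for i j
  proof -
    have "(x, q i) \<in> R ^^ i" unfolding relpow_fun_conv
      using q ij by (intro exI[of _ q]) auto
    moreover have "(q j, y) \<in> R ^^ (k - j)" unfolding relpow_fun_conv
      using q ij by (intro exI[of _ "\<lambda>l. q (j + l)"]) auto
    ultimately have "(x, y) \<in> R ^^ (i + (k - j))"
      using ij unfolding relpow_add by auto
    then have "k \<le> i + (k - j)" unfolding k_def by (rule Least_le)
    then show False using ij by simp
  qed
  have "inj_on q {..k}"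
  proof (rule inj_onI, rule ccontr)
    fix i j assume "i \<in> {..k}" "j \<in> {..k}" "q i = q j" "i \<noteq> j"
    then show False using no[of i j] no[of j i] by (cases "i < j") auto
  qed
  then show ?thesis using q by (intro that) auto
qed

text \<open>The tree grows by one vertex at a time, along an arc that leaves the set reached so far.
  Arcs come in opposite pairs, so each new vertex costs two.\<close>

lemma spanning_tree_ex:
  assumes "finite V" "V \<noteq> {}" "sym A" "A \<subseteq> V \<times> V" "conn_on V A"
  obtains T where "T \<subseteq> A" "sym T" "conn_on V T" "card T + 2 = 2 * card V"
proof -
  obtain r where r: "r \<in> V" using assms by blast
  have "\<exists>S T. S \<subseteq> V \<and> r \<in> S \<and> card S = Suc k \<and> T \<subseteq> A \<inter> S \<times> S \<and> sym T \<and> conn_on S T \<and>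
      card T + 2 = 2 * card S" if "Suc k \<le> card V" for k
    using that
  proof (induction k)
    case 0
    then show ?case using r
      by (intro exI[of _ "{r}"] exI[of _ "{}"]) (auto simp: conn_on_def sym_def)
  next
    case (Suc k)
    then obtain S T where S: "S \<subseteq> V" "r \<in> S" "card S = Suc k" and
      T: "T \<subseteq> A \<inter> S \<times> S" "sym T" "conn_on S T" "card T + 2 = 2 * card S" by auto
    have finS: "finite S" using S assms(1) finite_subset by blast
    have finT: "finite T" using T(1) finS by (meson finite_Int finite_SigmaI finite_subset)
    have "S \<noteq> V" using Suc.prems S by auto
    then obtain y where y: "y \<in> V" "y \<notin> S" using S by blast
    have "(r, y) \<in> A\<^sup>*" using assms(5) r y by (auto simp: conn_on_def)
    then obtain s t where st: "(s, t) \<in> A" "s \<in> S" "t \<notin> S" using rtrancl_exit S y by metis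
    let ?T = "T \<union> {(s, t), (t, s)}"
    have ne: "s \<noteq> t" "(s, t) \<notin> T" "(t, s) \<notin> T" using st T(1) by auto
    have "card ?T = card T + 2" using ne finT by (simp add: card_insert_if)
    moreover have "?T \<subseteq> A \<inter> insert t S \<times> insert t S" using T st assms(3) by (auto simp: sym_def)
    moreover have "sym ?T" using T(2) by (auto simp: sym_def)
    moreover have "conn_on (insert t S) ?T"
    proof -
      have TT: "T\<^sup>* \<subseteq> ?T\<^sup>*" by (rule rtrancl_mono) auto
      have 1: "(x, s) \<in> ?T\<^sup>*" "(s, x) \<in> ?T\<^sup>*" if "x \<in> insert t S" for x
      proof -
        show "(x, s) \<in> ?T\<^sup>*"
        proof (cases "x = t")
          case False
          then have "(x, s) \<in> T\<^sup>*" using that st T(3) by (auto simp: conn_on_def)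
          then show ?thesis using TT by blast
        qed (auto intro: r_into_rtrancl)
        show "(s, x) \<in> ?T\<^sup>*"
        proof (cases "x = t")
          case False
          then have "(s, x) \<in> T\<^sup>*" using that st T(3) by (auto simp: conn_on_def)
          then show ?thesis using TT by blast
        qed (auto intro: r_into_rtrancl)
      qed
      show ?thesis unfolding conn_on_def using 1 rtrancl_trans by metis
    qed
    moreover have "card (insert t S) = Suc (Suc k)" "insert t S \<subseteq> V" "r \<in> insert t S"
      using S st finS assms(4) by auto
    ultimately show ?case using S T by (intro exI[of _ "insert t S"] exI[of _ ?T]) auto
  qed
  moreover have "Suc (card V - 1) = card V" using assms by (simp add: card_gt_0_iff)
  ultimately obtain S T where ST: "S \<subseteq> V" "card S = card V" "T \<subseteq> A \<inter> S \<times> S" "sym T" "conn_on S T"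
      "card T + 2 = 2 * card S" by (metis order_refl)
  then have "S = V" using assms(1) card_subset_eq by blast
  then show ?thesis using that ST by blast
qed

lemma card_del: "finite A \<Longrightarrow> (x, y) \<in> A \<Longrightarrow> (y, x) \<in> A \<Longrightarrow> x \<noteq> y \<Longrightarrow> card (del x y A) + 2 = card A"
proof -
  assume a: "finite A" "(x, y) \<in> A" "(y, x) \<in> A" "x \<noteq> y"
  have "card (del x y A) = card A - card {(x, y), (y, x)}"
    unfolding del_def by (rule card_Diff_subset) (use a in auto)
  moreover have "card {(x, y), (y, x)} = 2" using a by simp
  moreover have "card {(x, y), (y, x)} \<le> card A" using a by (intro card_mono) auto
  ultimately show ?thesis by simp
qed

lemma faces_nonempty: "finite A \<Longrightarrow> A \<noteq> {} \<Longrightarrow> card (faces \<kappa> A) \<ge> 1"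
  by (simp add: faces_def card_gt_0_iff Suc_le_eq)

text \<open>This is Euler's \<open>F \<ge> E - V + 2\<close> with every edge counted twice. A
  spanning tree has at least one face. Putting back a non-tree edge adds a face: the tree bypasses
  the edge, so by planarity its two sides belong to different faces.\<close>

theorem card_faces_ge:
  assumes rg: "rot_graph \<kappa> A" and pl: "planar_rot \<kappa> A"
    and V: "finite V" "card V \<ge> 2" "A \<subseteq> V \<times> V" "conn_on V A"
  shows "2 * card (faces \<kappa> A) + 2 * card V \<ge> card A + 4"
proof -
  have ne: "V \<noteq> {}" using V by auto
  obtain T where T: "T \<subseteq> A" "sym T" "conn_on V T" "card T + 2 = 2 * card V"
    using spanning_tree_ex[OF V(1) ne rg_sym[OF rg] V(3,4)] by metis
  have "2 * card (faces \<kappa> B) + 2 * card V \<ge> card B + 4"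
    if "T \<subseteq> B" "B \<subseteq> A" "sym B" "card (B - T) = c" for B c
    using that
  proof (induction c arbitrary: B rule: less_induct)
    case (less c)
    have rgB: "rot_graph \<kappa> B" using rot_graph_subset[OF rg] less by blast
    have finB: "finite B" by (rule rg_fin[OF rgB])
    show ?case
    proof (cases "B = T")
      case True
      have "T \<noteq> {}" using T(4) V(2) by auto
      then show ?thesis using True T(4) faces_nonempty[OF finB, of \<kappa>] by simp
    next
      case False
      then obtain x y where xy: "(x, y) \<in> B" "(x, y) \<notin> T" using less.prems by auto
      then have yx: "(y, x) \<in> B" "(y, x) \<notin> T" using less.prems T(2) by (auto simp: sym_def)
      have TB: "T \<subseteq> del x y B" using xy yx less.prems by (auto simp: del_def)
      have "(x, y) \<in> T\<^sup>*" using xy less.prems V(3) T(3) by (auto simp: conn_on_def)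
      then have "(x, y) \<in> (del x y B)\<^sup>*" using TB rtrancl_mono by blast
      then have sep: "((x, y), (y, x)) \<notin> orb \<kappa> B"
        using pl less.prems xy unfolding planar_rot_def by blast
      have xny: "x \<noteq> y" using xy rg_irr[OF rgB] by auto
      have "card (del x y B - T) < card (B - T)"
        using finB xy by (intro psubset_card_mono) (auto simp: del_def)
      moreover have "del x y B \<subseteq> A" using less.prems by (auto simp: del_def)
      ultimately have "2 * card (faces \<kappa> (del x y B)) + 2 * card V \<ge> card (del x y B) + 4"
        using less.IH[of "card (del x y B - T)" "del x y B"] TB less.prems sym_del[OF less.prems(3)] by simp
      then show ?thesis using card_faces_del[OF rgB xy(1) sep] card_del[OF finB xy(1) yx(1) xny] by linarith
    qed
  qed
  then show ?thesis using T(1) rg_sym[OF rg] by blast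
qed

section \<open>Attachments of a connected piece lie in one face\<close>

lemma nxt_pair: "a \<noteq> b \<Longrightarrow> inj_on k {a, b} \<Longrightarrow> nxt k {a, b} a = b"
  using nxt_in[of "{a, b}" a k] nxt_self[of "{a, b}" a k] by auto

text \<open>The dart \<open>(x, y)\<close> names the corner of \<open>H\<close> into which the arc
  \<open>(y, r)\<close> points. Suppose the two corners belong to different faces of
  \<open>H\<close>, and add a path outside \<open>X\<close> joining them. Then both sides of the
  path belong to one face, although the path closes a cycle through the connected piece; this
  contradicts planarity.\<close>

lemma attach_same_face:
  assumes rg: "rot_graph \<kappa> A" and pl: "planar_rot \<kappa> A"
    and H: "H = A \<inter> X \<times> X" and conn: "conn_on X H"
    and y: "y \<in> X" "(y, r) \<in> A" "r \<notin> X" "(x, y) \<in> H" "nxt (\<kappa> y) (insert r (H `` {y})) x = r"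
    and y': "y' \<in> X" "(y', r') \<in> A" "r' \<notin> X" "(x', y') \<in> H" "nxt (\<kappa> y') (insert r' (H `` {y'})) x' = r'"
    and rr: "(r, r') \<in> (A \<inter> (- X) \<times> (- X))\<^sup>*"
  shows "((x, y), (x', y')) \<in> orb \<kappa> H"
proof (rule ccontr)
  assume no: "((x, y), (x', y')) \<notin> orb \<kappa> H"
  have symA: "sym A" by (rule rg_sym[OF rg])
  have HA: "H \<subseteq> A" using H by auto
  have symH: "sym H" using symA H by (auto simp: sym_def)
  have rgH: "rot_graph \<kappa> H" by (rule rot_graph_subset[OF rg HA symH])
  note finN = rg_finN[OF rg] and injN = rg_inj[OF rg]
  obtain q k where q: "q 0 = r" "q k = r'" "inj_on q {..k}"
    "\<And>i. i < k \<Longrightarrow> (q i, q (Suc i)) \<in> A \<inter> (- X) \<times> (- X)"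
    using simple_walk_ex[OF rr] by metis
  have qX: "q i \<notin> X" if "i \<le> k" for i
    using that q(2,4) y'(3) by (cases "i = k") auto
  have xx: "x \<noteq> x'" if "y = y'" using no that orb_refl by metis
  \<comment> \<open>The two arcs differ, because otherwise injectivity of the successor map would
    make the corners equal.\<close>
  have yr: "(y, r) \<noteq> (y', r')"
  proof
    assume e: "(y, r) = (y', r')"
    have sub: "insert r (H `` {y}) \<subseteq> A `` {y}" using HA y by auto
    have "x \<in> insert r (H `` {y})" "x' \<in> insert r (H `` {y})"
      using y y' e symH by (auto simp: sym_def)
    then show False
      using xx e y(5) y'(5) inj_onD[OF nxt_inj[OF finite_subset[OF sub finN] inj_on_subset[OF injN sub]]]
      by auto
  qed
  \<comment> \<open>The whole walk from \<open>y\<close> to \<open>y'\<close>: index 0 is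
    \<open>y\<close>, indices 1 to \<open>Suc k\<close> are the outside path, and
    \<open>k + 2\<close> is \<open>y'\<close>. The ends \<open>y\<close> and \<open>y'\<close> may
    coincide.\<close>
  define s where "s j = (if j = 0 then y else if j = k + 2 then y' else q (j - 1))" for j
  have s0: "s 0 = y" "s (Suc 0) = r" "s (Suc k) = r'" "s (k + 2) = y'"
    using q by (auto simp: s_def)
  have sA: "(s j, s (Suc j)) \<in> A" if "j \<le> Suc k" for j
  proof -
    have "j = 0 \<or> j = Suc k \<or> 0 < j \<and> j \<le> k" using that by linarith
    then consider "j = 0" | "j = Suc k" | "0 < j" "j \<le> k" by blast
    then show ?thesis
    proof cases
      case 3
      then show ?thesis using q(4)[of "j - 1"] by (auto simp: s_def)
    next
      case 2
      then show ?thesis using s0 y' symA by (auto simp: sym_def)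
    qed (use s0 y in auto)
  qed
  have sX: "s j \<notin> X" if "0 < j" "j \<le> Suc k" for j using that qX by (auto simp: s_def)
  have sinj: "i = j" if "s i = s j" "0 < i" "i \<le> Suc k" "0 < j" "j \<le> Suc k" for i j
    using that q(3) by (auto simp: s_def dest!: inj_onD)
  define P where "P = {(s j, s (Suc j)) | j. j \<le> Suc k} \<union> {(s (Suc j), s j) | j. j \<le> Suc k}"
  define H2 where "H2 = H \<union> P"
  have P0: "(s j, s (Suc j)) \<in> P" "(s (Suc j), s j) \<in> P" if "j \<le> Suc k" for j
    using that unfolding P_def by blast+
  have symP: "sym P" unfolding P_def sym_def by blast
  have PA: "P \<subseteq> A" using sA symA by (auto simp: P_def sym_def)
  have symH2: "sym H2" using symH symP by (auto simp: H2_def sym_def)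
  have H2A: "H2 \<subseteq> A" using HA PA by (auto simp: H2_def)
  have rg2: "rot_graph \<kappa> H2" by (rule rot_graph_subset[OF rg H2A symH2])
  have Nmid: "H2 `` {s j} = {s (j - 1), s (Suc j)}" if "0 < j" "j \<le> Suc k" for j
  proof
    show "{s (j - 1), s (Suc j)} \<subseteq> H2 `` {s j}"
    proof -
      have "(s (Suc (j - 1)), s (j - 1)) \<in> P" "(s j, s (Suc j)) \<in> P"
        using that by (intro P0; simp)+
      then show ?thesis using that by (auto simp: H2_def)
    qed
    show "H2 `` {s j} \<subseteq> {s (j - 1), s (Suc j)}"
    proof
      fix z assume "z \<in> H2 `` {s j}"
      then have "(s j, z) \<in> P" using sX[OF that] H by (auto simp: H2_def)
      then consider i where "i \<le> Suc k" "s j = s i" "z = s (Suc i)" |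
        i where "i \<le> Suc k" "s j = s (Suc i)" "z = s i" unfolding P_def by blast
      then show "z \<in> {s (j - 1), s (Suc j)}"
      proof cases
        case 1
        have "i \<noteq> 0" using 1 sX[OF that] y s0 by metis
        then show ?thesis using sinj[of j i] 1 that by auto
      next
        case 2
        have "i \<noteq> Suc k" using 2 sX[OF that] y' s0 by auto
        then show ?thesis using sinj[of j "Suc i"] 2 that by auto
      qed
    qed
  qed
  have sne: "s (j - 1) \<noteq> s (Suc j)" if "0 < j" "j \<le> Suc k" for j
  proof
    assume e: "s (j - 1) = s (Suc j)"
    have "j = 1 \<and> j = Suc k \<or> j = 1 \<and> j < Suc k \<or> j > 1 \<and> j = Suc k \<or> 1 < j \<and> j < Suc k"
      using that by linarith
    then consider "j = 1" "j = Suc k" | "j = 1" "j < Suc k" | "j > 1" "j = Suc k" | "1 < j" "j < Suc k"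
      by blast
    then show False
    proof cases
      case 1
      then show False using e s0 yr by auto
    next
      case 2
      then show False using e s0 y sX[of "Suc (Suc 0)"] by auto
    next
      case 3
      then show False using e s0 y' sX[of "j - 1"] by auto
    next
      case 4
      then have "j - 1 = Suc j" using e by (intro sinj) auto
      then show False by simp
    qed
  qed
  \<comment> \<open>Inner vertices of the walk have degree two in \<open>H2\<close>, so face steps
    run straight along it in both directions.\<close>
  have fwd: "face_step \<kappa> H2 (s j, s (Suc j)) = (s (Suc j), s (j + 2))" if "j \<le> k" for j
  proof -
    have "nxt (\<kappa> (s (Suc j))) (H2 `` {s (Suc j)}) (s j) = s (j + 2)"
      using nxt_pair[OF sne[of "Suc j"]] rg_inj[OF rg2, of "s (Suc j)"] Nmid[of "Suc j"] that by auto
    then show ?thesis by (simp add: face_step_def)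
  qed
  have bwd: "face_step \<kappa> H2 (s (j + 2), s (Suc j)) = (s (Suc j), s j)" if "j \<le> k" for j
  proof -
    have "nxt (\<kappa> (s (Suc j))) (H2 `` {s (Suc j)}) (s (j + 2)) = s j"
      using nxt_pair[OF sne[of "Suc j", symmetric]] rg_inj[OF rg2, of "s (Suc j)"] Nmid[of "Suc j"] that
      by (auto simp: insert_commute)
    then show ?thesis by (simp add: face_step_def)
  qed
  have P1: "(s j, s (Suc j)) \<in> H2" "(s (Suc j), s j) \<in> H2" if "j \<le> Suc k" for j
    using P0[OF that] by (auto simp: H2_def)
  have run1: "((s 0, s 1), (s j, s (Suc j))) \<in> orb \<kappa> H2" if "j \<le> Suc k" for j
    using that
  proof (induction j)
    case (Suc j)
    then show ?case using orb_into[of _ _ \<kappa> H2] fwd[of j] P1[of j] by force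
  qed (simp add: orb_refl)
  have run2: "((s (k + 2), s (Suc k)), (s (Suc k + 1 - j), s (Suc k - j))) \<in> orb \<kappa> H2" if "j \<le> Suc k" for j
    using that
  proof (induction j)
    case (Suc j)
    define i where "i = k - j"
    have i: "Suc k + 1 - j = i + 2" "Suc k - j = Suc i" "Suc k + 1 - Suc j = Suc i" "Suc k - Suc j = i" "i \<le> k"
      using Suc.prems by (auto simp: i_def)
    have "(s (i + 2), s (Suc i)) \<in> H2" using P1(2)[of "Suc i"] i by simp
    then show ?case using Suc.IH Suc.prems orb_into[of _ "(s (i + 2), s (Suc i))" \<kappa> H2] bwd[OF i(5)] unfolding i
      by simp
  qed (simp add: orb_refl)
  have HX: "H2 `` {z} = H `` {z} \<union> (if z = y then {r} else {}) \<union> (if z = y' then {r'} else {})" if "z \<in> X" for z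
  proof
    show "H2 `` {z} \<subseteq> H `` {z} \<union> (if z = y then {r} else {}) \<union> (if z = y' then {r'} else {})"
    proof
      fix w assume "w \<in> H2 `` {z}"
      then consider "(z, w) \<in> H" | j where "j \<le> Suc k" "z = s j" "w = s (Suc j)" |
        j where "j \<le> Suc k" "z = s (Suc j)" "w = s j"
        unfolding H2_def P_def by blast
      then show "w \<in> H `` {z} \<union> (if z = y then {r} else {}) \<union> (if z = y' then {r'} else {})"
      proof cases
        case 2
        then have "j = 0" using sX[of j] that by auto
        then show ?thesis using 2 s0 by simp
      next
        case 3
        then have "j = Suc k" using sX[of "Suc j"] that by fastforce
        then show ?thesis using 3 s0 by simp
      qed simp
    qed
    show "H `` {z} \<union> (if z = y then {r} else {}) \<union> (if z = y' then {r'} else {}) \<subseteq> H2 `` {z}"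
      using P1(1)[of 0] P1(2)[of "Suc k"] s0 by (auto simp: H2_def)
  qed
  note fin2 = rg_finN[OF rg2] and inj2 = rg_inj[OF rg2]
  have toX: "w \<in> X" if "(z, w) \<in> H" for z w using that H by auto
  \<comment> \<open>Away from the two attaching corners, adding the path does not alter the face
    steps of \<open>H\<close>.\<close>
  have keep: "face_step \<kappa> H2 e = face_step \<kappa> H e" if e: "e \<in> H" "e \<noteq> (x, y)" "e \<noteq> (x', y')" for e
  proof -
    obtain z w where zw: "e = (z, w)" by force
    have w: "w \<in> X" using toX e zw by auto
    have z: "z \<in> H `` {w}" using e zw symH by (auto simp: sym_def)
    let ?j = "nxt (\<kappa> w) (H2 `` {w}) z"
    have jin: "?j \<in> H2 `` {w}" by (rule nxt_in[OF fin2]) (use z in \<open>auto simp: H2_def\<close>)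
    have "?j \<in> H `` {w}"
    proof (rule ccontr)
      assume nj: "?j \<notin> H `` {w}"
      then consider "w = y" "?j = r" | "w = y'" "?j = r'" using jin HX[OF w] by (auto split: if_splits)
      then show False
      proof cases
        case 1
        have sub: "insert r (H `` {y}) \<subseteq> H2 `` {y}" using HX[OF y(1)] by auto
        have eq: "nxt (\<kappa> y) (insert r (H `` {y})) z = r"
          using nxt_subset[OF fin2 inj2 sub, of z] z 1 by auto
        have "x \<in> insert r (H `` {y})" "z \<in> insert r (H `` {y})" using y(4) z 1 symH by (auto simp: sym_def)
        then have "z = x"
          using inj_onD[OF nxt_inj[OF finite_subset[OF sub fin2] inj_on_subset[OF inj2 sub]]] eq y(5) by auto
        then show False using e zw 1 by simp
      next
        case 2
        have sub: "insert r' (H `` {y'}) \<subseteq> H2 `` {y'}" using HX[OF y'(1)] by auto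
        have eq: "nxt (\<kappa> y') (insert r' (H `` {y'})) z = r'"
          using nxt_subset[OF fin2 inj2 sub, of z] z 2 by auto
        have "x' \<in> insert r' (H `` {y'})" "z \<in> insert r' (H `` {y'})" using y'(4) z 2 symH by (auto simp: sym_def)
        then have "z = x'"
          using inj_onD[OF nxt_inj[OF finite_subset[OF sub fin2] inj_on_subset[OF inj2 sub]]] eq y'(5) by auto
        then show False using e zw 2 by simp
      qed
    qed
    then have "nxt (\<kappa> w) (H `` {w}) z = ?j"
      using nxt_subset[OF fin2 inj2, of "H `` {w}" w z] z by (auto simp: H2_def)
    then show ?thesis by (simp add: face_step_def zw)
  qed
  have xN: "x' \<in> H `` {y'}" using y' symH by (auto simp: sym_def)
  have r'N: "r' \<in> H2 `` {y'}" "r' \<notin> H `` {y'}" using HX[OF y'(1)] y'(3) H by auto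
  have xr: "x' \<noteq> r'" using xN r'N by auto
  have notr: "nxt (\<kappa> y') N x' \<noteq> r" if N: "N \<subseteq> H2 `` {y'}" "insert r (H `` {y'}) \<subseteq> N" "y = y'" for N
  proof
    assume e: "nxt (\<kappa> y') N x' = r"
    have fN: "finite N" "inj_on (\<kappa> y') N" using N fin2 inj2 by (auto intro: finite_subset inj_on_subset)
    have "nxt (\<kappa> y') (insert r (H `` {y'})) x' = r"
      using nxt_subset[OF fN N(2), of x'] e xN by auto
    moreover have "x' \<in> insert r (H `` {y'})" "x \<in> insert r (H `` {y'})"
      using xN y(4) N(3) symH by (auto simp: sym_def)
    ultimately have "x' = x"
      using inj_onD[OF nxt_inj[OF finite_subset[OF N(2) fN(1)] inj_on_subset[OF fN(2) N(2)]]] y(5) N(3) by auto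
    then show False using xx N by auto
  qed
  have xN2: "x' \<in> H2 `` {y'}" using xN by (auto simp: H2_def)
  \<comment> \<open>At \<open>y'\<close> the path enters directly after \<open>x'\<close>. The work
    is in the case \<open>y = y'\<close>, where \<open>r\<close> enters at the same vertex but in
    another corner.\<close>
  have b: "nxt (\<kappa> y') (H2 `` {y'}) x' = r'"
  proof -
    let ?j = "nxt (\<kappa> y') (H2 `` {y'}) x'"
    have jin: "?j \<in> H2 `` {y'}" by (rule nxt_in[OF fin2 xN2])
    have "?j \<in> insert r' (H `` {y'})"
    proof (rule ccontr)
      assume "?j \<notin> insert r' (H `` {y'})"
      then have "y = y'" "?j = r" using jin HX[OF y'(1)] by (auto split: if_splits)
      then show False using notr[of "H2 `` {y'}"] HX[OF y'(1)] by auto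
    qed
    moreover have "insert r' (H `` {y'}) \<subseteq> H2 `` {y'}" using HX[OF y'(1)] by auto
    ultimately show ?thesis
      using nxt_subset[OF fin2 inj2, of "insert r' (H `` {y'})" y' x'] xN y'(5) by simp
  qed
  have c: "nxt (\<kappa> y') (H2 `` {y'}) r' = nxt (\<kappa> y') (H `` {y'}) x'"
  proof -
    let ?j = "nxt (\<kappa> y') (H2 `` {y'}) r'" and ?N = "H2 `` {y'} - {r'}"
    have dj: "nxt (\<kappa> y') ?N x' = ?j" using nxt_delete[OF fin2 inj2 xN2 r'N(1) xr] b by auto
    have fN: "finite ?N" "inj_on (\<kappa> y') ?N" using fin2 inj2 by (auto intro: inj_on_diff)
    have xN3: "x' \<in> ?N" using xN2 xr by auto
    have jin: "?j \<in> ?N" using nxt_in[OF fN(1) xN3, of "\<kappa> y'"] dj by simp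
    have "?j \<in> H `` {y'}"
    proof (rule ccontr)
      assume "?j \<notin> H `` {y'}"
      then have *: "y = y'" "?j = r" "r \<noteq> r'" using jin HX[OF y'(1)] by (auto split: if_splits)
      then show False using notr[of ?N] HX[OF y'(1)] dj r'N by auto
    qed
    moreover have "H `` {y'} \<subseteq> ?N" using HX[OF y'(1)] r'N by auto
    ultimately show ?thesis using nxt_subset[OF fN, of "H `` {y'}" x'] xN dj by simp
  qed
  let ?c = "(x', y')"
  obtain m where m: "m > 0" "(face_step \<kappa> H ^^ m) ?c = ?c"
    "inj_on (\<lambda>i. (face_step \<kappa> H ^^ i) ?c) {..<m}"
    "orb \<kappa> H `` {?c} = (\<lambda>i. (face_step \<kappa> H ^^ i) ?c) ` {..<m}" by (rule orb_enum[OF rgH y'(4)])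
  \<comment> \<open>By assumption the face of \<open>(x', y')\<close> does not pass through
    \<open>(x, y)\<close>, so it can be followed in \<open>H2\<close> unchanged until it returns to
    \<open>(x', y')\<close>.\<close>
  have around: "(face_step \<kappa> H ?c, (face_step \<kappa> H ^^ Suc i) ?c) \<in> orb \<kappa> H2" if "Suc i \<le> m" for i
    using that
  proof (induction i)
    case (Suc i)
    let ?e = "(face_step \<kappa> H ^^ Suc i) ?c"
    have eo: "(?c, ?e) \<in> orb \<kappa> H" by (rule orb_funpow[OF rgH y'(4)])
    have eH: "?e \<in> H" by (rule orb_in[OF rgH eo y'(4)])
    have "?e \<noteq> ?c" using inj_onD[OF m(3), of "Suc i" 0] Suc.prems by auto
    moreover have "?e \<noteq> (x, y)" using no orb_sym[OF rgH eo y'(4)] by metis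
    ultimately have "face_step \<kappa> H2 ?e = face_step \<kappa> H ?e" using keep eH by blast
    moreover have "?e \<in> H2" using eH by (simp add: H2_def)
    ultimately show ?case using Suc.IH Suc.prems orb_into[of _ ?e \<kappa> H2] by auto
  qed (simp add: orb_refl)
  have 1: "(face_step \<kappa> H ?c, ?c) \<in> orb \<kappa> H2" using around[of "m - 1"] m by simp
  have 2: "face_step \<kappa> H2 (r', y') = face_step \<kappa> H ?c" using c by (simp add: face_step_def)
  have 3: "face_step \<kappa> H2 ?c = (y', r')" using b by (simp add: face_step_def)
  have mem: "(r', y') \<in> H2" "?c \<in> H2" using P1(1)[of "Suc k"] s0 y'(4) by (auto simp: H2_def)
  have 4: "((y, r), (r', y')) \<in> orb \<kappa> H2" using run1[of "Suc k"] s0 by simp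
  have 5: "((y', r'), (r, y)) \<in> orb \<kappa> H2" using run2[of "Suc k"] s0 by simp
  have "((y, r), face_step \<kappa> H ?c) \<in> orb \<kappa> H2" using orb_into[OF 4 mem(1)] 2 by simp
  from orb_trans[OF this 1] have "((y, r), (y', r')) \<in> orb \<kappa> H2" using orb_into[of _ ?c \<kappa> H2] mem(2) 3 by force
  \<comment> \<open>Out along the path, once around the face at \<open>y'\<close>, and back along
    the path: both darts of the first path edge lie on one orbit.\<close>
  from orb_trans[OF this 5] have bad: "((y, r), (r, y)) \<in> orb \<kappa> H2" .
  have yrH2: "(y, r) \<in> H2" using P1(1)[of 0] s0 by simp
  have nb: "(y, r) \<notin> (del y r H2)\<^sup>*"
    using pl H2A symH2 yrH2 bad unfolding planar_rot_def by blast
  \<comment> \<open>The first path edge is no bridge: the rest of the path and a connection inside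
    \<open>X\<close> bypass it.\<close>
  have "(s 1, s (Suc j)) \<in> (del y r H2)\<^sup>*" if "j \<le> Suc k" for j
    using that
  proof (induction j)
    case (Suc j)
    have "(s (Suc j), s (Suc (Suc j))) \<in> del y r H2"
    proof -
      have "s (Suc j) \<noteq> y" using sX[of "Suc j"] Suc.prems y by auto
      moreover have "(s (Suc j), s (Suc (Suc j))) \<noteq> (r, y)"
      proof
        assume e: "(s (Suc j), s (Suc (Suc j))) = (r, y)"
        then have "\<not> Suc (Suc j) \<le> Suc k" using sX[of "Suc (Suc j)"] y by auto
        then have "j = k" using Suc.prems by simp
        then show False using e s0 yr by auto
      qed
      ultimately show ?thesis using P1(1)[of "Suc j"] Suc.prems by (auto simp: del_def)
    qed
    then show ?case using Suc by (auto intro: rtrancl.rtrancl_into_rtrancl)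
  qed simp
  from this[of "Suc k"] have ry': "(r, y') \<in> (del y r H2)\<^sup>*" using s0 by simp
  have "H \<subseteq> del y r H2" using y(3) H by (auto simp: del_def H2_def)
  then have "(y', y) \<in> (del y r H2)\<^sup>*"
    using conn y(1) y'(1) rtrancl_mono unfolding conn_on_def by blast
  with ry' have "(r, y) \<in> (del y r H2)\<^sup>*" by (rule rtrancl_trans)
  then have "(y, r) \<in> (del y r H2)\<^sup>*"
    using sym_rtrancl[OF sym_del[OF symH2]] by (meson symD)
  then show False using nb by blast
qed

section \<open>Laman graphs\<close>

text \<open>Every edge is represented by two opposite arcs, so the bounds \<open>2k - 3\<close> are doubled; the
  additive form avoids truncated subtraction.\<close>

definition laman_arcs :: "'a set \<Rightarrow> ('a \<times> 'a) set \<Rightarrow> bool" where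
  "laman_arcs V A \<longleftrightarrow> finite V \<and> A \<subseteq> V \<times> V \<and> sym A \<and> irrefl A \<and> card V \<ge> 2 \<and>
     card A + 6 = 4 * card V \<and>
     (\<forall>S\<subseteq>V. card S \<ge> 2 \<longrightarrow> card (A \<inter> S \<times> S) + 6 \<le> 4 * card S)"

definition tight :: "('a \<times> 'a) set \<Rightarrow> 'a set \<Rightarrow> bool" where
  "tight A X \<longleftrightarrow> card X \<ge> 2 \<and> card (A \<inter> X \<times> X) + 6 = 4 * card X"

lemma laman_D:
  assumes "laman_arcs V A"
  shows "finite V" "A \<subseteq> V \<times> V" "sym A" "irrefl A" "card V \<ge> 2" "card A + 6 = 4 * card V"
  using assms by (simp_all add: laman_arcs_def)

lemma sym_induced: "sym A \<Longrightarrow> sym (A \<inter> X \<times> X)"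
  by (auto simp: sym_def)

lemma irrefl_subset: "irrefl A \<Longrightarrow> B \<subseteq> A \<Longrightarrow> irrefl B"
  by (auto simp: irrefl_def)

lemma laman_finite_arcs: "laman_arcs V A \<Longrightarrow> finite A"
  unfolding laman_arcs_def by (meson finite_SigmaI finite_subset)

lemma laman_sparse: "laman_arcs V A \<Longrightarrow> S \<subseteq> V \<Longrightarrow> card S \<ge> 2 \<Longrightarrow> card (A \<inter> S \<times> S) + 6 \<le> 4 * card S"
  by (simp add: laman_arcs_def)

text \<open>Parity sharpens a strict bound: an arc count below the sparsity bound is below it by at
  least two.\<close>

lemma even_card_arcs:
  assumes "finite A" "sym A" "irrefl A"
  shows "even (card A)"
  using assms
proof (induction "card A" arbitrary: A rule: less_induct)
  case less
  show ?case
  proof (cases "A = {}")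
    case False
    then obtain x y where xy: "(x, y) \<in> A" by auto
    then have yx: "(y, x) \<in> A" "x \<noteq> y" using less.prems by (auto simp: sym_def irrefl_def)
    have c: "card (del x y A) + 2 = card A" by (rule card_del[OF less.prems(1) xy yx])
    have "irrefl (del x y A)" using less.prems by (auto simp: irrefl_def del_def)
    then have "even (card (del x y A))"
      using less.hyps[of "del x y A"] c less.prems sym_del[OF less.prems(2)] finite_Diff[OF less.prems(1)] by (simp add: del_def)
    then show ?thesis using c by (metis even_add even_numeral)
  qed simp
qed

lemma even_card_induced:
  assumes "laman_arcs V A"
  shows "even (card (A \<inter> S \<times> S))"
  using even_card_arcs[OF _ sym_induced[OF laman_D(3)[OF assms]]
      irrefl_subset[OF laman_D(4)[OF assms] Int_lower1]] laman_finite_arcs[OF assms] by simp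

lemma laman_tight_induced:
  assumes "laman_arcs V A" "X \<subseteq> V" "tight A X"
  shows "laman_arcs X (A \<inter> X \<times> X)"
proof -
  have "card (A \<inter> X \<times> X \<inter> S \<times> S) + 6 \<le> 4 * card S" if "S \<subseteq> X" "card S \<ge> 2" for S
  proof -
    have "A \<inter> X \<times> X \<inter> S \<times> S = A \<inter> S \<times> S" using that by auto
    then show ?thesis using laman_sparse[OF assms(1), of S] that assms(2) by auto
  qed
  then show ?thesis unfolding laman_arcs_def
    using finite_subset[OF assms(2) laman_D(1)[OF assms(1)]] sym_induced[OF laman_D(3)[OF assms(1)]]
      irrefl_subset[OF laman_D(4)[OF assms(1)] Int_lower1] assms(3)
    by (simp add: tight_def)
qed

lemma card_induced_Un:
  assumes "finite A"
  shows "card (A \<inter> X \<times> X) + card (A \<inter> Y \<times> Y)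
    \<le> card (A \<inter> (X \<union> Y) \<times> (X \<union> Y)) + card (A \<inter> (X \<inter> Y) \<times> (X \<inter> Y))"
    and "x \<in> X - Y \<Longrightarrow> z \<in> Y - X \<Longrightarrow> (x, z) \<in> A \<Longrightarrow> card (A \<inter> X \<times> X) + card (A \<inter> Y \<times> Y)
    < card (A \<inter> (X \<union> Y) \<times> (X \<union> Y)) + card (A \<inter> (X \<inter> Y) \<times> (X \<inter> Y))"
proof -
  let ?P = "A \<inter> X \<times> X" and ?Q = "A \<inter> Y \<times> Y" and ?U = "A \<inter> (X \<union> Y) \<times> (X \<union> Y)"
  have fin: "finite ?P" "finite ?Q" "finite ?U" using assms by auto
  have "?P \<inter> ?Q = A \<inter> (X \<inter> Y) \<times> (X \<inter> Y)" by auto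
  then have eq: "card ?P + card ?Q = card (?P \<union> ?Q) + card (A \<inter> (X \<inter> Y) \<times> (X \<inter> Y))"
    using card_Un_Int[OF fin(1,2)] by simp
  have "card (?P \<union> ?Q) \<le> card ?U" by (rule card_mono[OF fin(3)]) auto
  then show "card ?P + card ?Q \<le> card ?U + card (A \<inter> (X \<inter> Y) \<times> (X \<inter> Y))" using eq by simp
  assume xz: "x \<in> X - Y" "z \<in> Y - X" "(x, z) \<in> A"
  have "card (?P \<union> ?Q) < card ?U"
    by (rule psubset_card_mono[OF fin(3)]) (use xz in auto)
  then show "card ?P + card ?Q < card ?U + card (A \<inter> (X \<inter> Y) \<times> (X \<inter> Y))" using eq by simp
qed

text \<open>Submodularity: the arcs inside \<open>X\<close> and inside \<open>Y\<close> are
  accounted for by the union and the intersection. Sparsity of these two leaves no slack, so the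
  union is tight and no arc joins the two differences.\<close>

lemma tight_Un_Int:
  assumes L: "laman_arcs V A" and X: "X \<subseteq> V" "tight A X" and Y: "Y \<subseteq> V" "tight A Y"
    and c: "card (X \<inter> Y) \<ge> 2"
  shows "tight A (X \<union> Y)" and "\<And>x z. x \<in> X - Y \<Longrightarrow> z \<in> Y - X \<Longrightarrow> (x, z) \<notin> A"
proof -
  have fin: "finite X" "finite Y" using finite_subset[OF X(1)] finite_subset[OF Y(1)] laman_D(1)[OF L] by simp_all
  note finA = laman_finite_arcs[OF L]
  have cu: "card X + card Y = card (X \<union> Y) + card (X \<inter> Y)" by (rule card_Un_Int[OF fin])
  have c2: "card (X \<union> Y) \<ge> 2" using X(2) fin card_mono[of "X \<union> Y" X] by (auto simp: tight_def)
  have u: "card (A \<inter> (X \<union> Y) \<times> (X \<union> Y)) + 6 \<le> 4 * card (X \<union> Y)"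
    using laman_sparse[OF L _ c2] X Y by auto
  have i: "card (A \<inter> (X \<inter> Y) \<times> (X \<inter> Y)) + 6 \<le> 4 * card (X \<inter> Y)"
    using laman_sparse[OF L _ c] X Y by auto
  show "tight A (X \<union> Y)"
    using card_induced_Un(1)[OF finA, of X Y] cu u i X(2) Y(2) c2 unfolding tight_def by linarith
  show "(x, z) \<notin> A" if "x \<in> X - Y" "z \<in> Y - X" for x z
    using card_induced_Un(2)[OF finA that] cu u i X(2) Y(2) unfolding tight_def by linarith
qed

text \<open>Used with \<open>W = V\<close> for connectedness, and with \<open>W\<close> lacking one
  vertex for the absence of cut vertices. In the second use the missing vertex belongs to both
  parts.\<close>

lemma induced_reach_partition:
  assumes sym: "sym A" and "A \<subseteq> V \<times> V" "x \<in> W" "W \<subseteq> V"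
  defines "B \<equiv> A \<inter> W \<times> W"
  defines "S \<equiv> {z \<in> W. (x, z) \<in> B\<^sup>*}"
  shows "x \<in> S" "A \<subseteq> (V - (W - S)) \<times> (V - (W - S)) \<union> (V - S) \<times> (V - S)"
proof -
  show "x \<in> S" using assms by (auto simp: S_def)
  have no: "\<not> (a \<in> S \<and> b \<in> W - S)" if "(a, b) \<in> A" for a b
  proof
    assume ab: "a \<in> S \<and> b \<in> W - S"
    then have "(a, b) \<in> B" using that by (auto simp: B_def S_def)
    then have "(x, b) \<in> B\<^sup>*" using ab by (auto simp: S_def intro: rtrancl.rtrancl_into_rtrancl)
    then show False using ab by (auto simp: S_def)
  qed
  show "A \<subseteq> (V - (W - S)) \<times> (V - (W - S)) \<union> (V - S) \<times> (V - S)"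
  proof
    fix e assume e: "e \<in> A"
    obtain a b where ab: "e = (a, b)" by force
    have "(a, b) \<in> A" "(b, a) \<in> A" using e ab sym by (auto simp: sym_def)
    then show "e \<in> (V - (W - S)) \<times> (V - (W - S)) \<union> (V - S) \<times> (V - S)"
      using no[of a b] no[of b a] ab assms(2) by (auto simp: S_def)
  qed
qed

text \<open>Two separated parts would have at most \<open>4 * card V - 8\<close> arcs together. The
  bound with 4 in place of 6 also covers parts with a single vertex.\<close>

lemma laman_conn:
  assumes L: "laman_arcs V A"
  shows "conn_on V A"
proof -
  have fin: "finite V" and AV: "A \<subseteq> V \<times> V" and sA: "sym A" and irr: "irrefl A" and
    cA: "card A + 6 = 4 * card V" using laman_D[OF L] by simp_all
  note finA = laman_finite_arcs[OF L]
  have bound: "card (A \<inter> T \<times> T) + 4 \<le> 4 * card T" if "T \<subseteq> V" "T \<noteq> {}" for T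
  proof (cases "card T \<ge> 2")
    case True
    then show ?thesis using laman_sparse[OF L that(1)] by simp
  next
    case False
    then have "card T = 1" using that finite_subset[OF that(1) fin] card_gt_0_iff[of T] by simp
    then obtain t where "T = {t}" by (rule card_1_singletonE)
    then have "A \<inter> T \<times> T = {}" using irr by (auto simp: irrefl_def)
    then show ?thesis using \<open>card T = 1\<close> by simp
  qed
  show ?thesis unfolding conn_on_def
  proof (intro ballI, rule ccontr)
    fix x y assume xy: "x \<in> V" "y \<in> V" "(x, y) \<notin> A\<^sup>*"
    define S where "S = {z \<in> V. (x, z) \<in> (A \<inter> V \<times> V)\<^sup>*}"
    have AA: "A \<inter> V \<times> V = A" using AV by auto
    have xS: "x \<in> S" and part: "A \<subseteq> (V - (V - S)) \<times> (V - (V - S)) \<union> (V - S) \<times> (V - S)"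
      using induced_reach_partition[OF sA AV xy(1) order_refl] by (auto simp: S_def)
    have SV: "S \<subseteq> V" by (auto simp: S_def)
    have yS: "y \<in> V - S" using xy AA by (auto simp: S_def)
    have "A = A \<inter> S \<times> S \<union> A \<inter> (V - S) \<times> (V - S)" using part SV by auto
    then have "card A \<le> card (A \<inter> S \<times> S) + card (A \<inter> (V - S) \<times> (V - S))" using card_Un_le[of "A \<inter> S \<times> S" "A \<inter> (V - S) \<times> (V - S)"] by simp
    moreover have "card (A \<inter> S \<times> S) + 4 \<le> 4 * card S" using bound[of S] SV xS by auto
    moreover have "card (A \<inter> (V - S) \<times> (V - S)) + 4 \<le> 4 * card (V - S)" using bound[of "V - S"] yS by auto
    moreover have "card S + card (V - S) = card V"
      using card_Diff_subset[of S V] card_mono[OF fin SV] finite_subset[OF SV fin] SV by simp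
    ultimately show False using cA by linarith
  qed
qed

text \<open>The parts on the two sides of a cut vertex share it, so they have
  \<open>card V + 1\<close> vertices in sum and at most \<open>4 * card V - 8\<close> arcs, two too
  few.\<close>

lemma laman_conn_del:
  assumes L: "laman_arcs V A" and n: "card V \<ge> 3" and v: "v \<in> V"
  shows "conn_on (V - {v}) (A \<inter> (V - {v}) \<times> (V - {v}))"
proof -
  have fin: "finite V" and AV: "A \<subseteq> V \<times> V" and sA: "sym A" and irr: "irrefl A" and
    cA: "card A + 6 = 4 * card V" using laman_D[OF L] by simp_all
  let ?W = "V - {v}"
  show ?thesis unfolding conn_on_def
  proof (intro ballI, rule ccontr)
    fix x y assume xy: "x \<in> ?W" "y \<in> ?W" "(x, y) \<notin> (A \<inter> ?W \<times> ?W)\<^sup>*"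
    define S where "S = {z \<in> ?W. (x, z) \<in> (A \<inter> ?W \<times> ?W)\<^sup>*}"
    have xS: "x \<in> S" and part: "A \<subseteq> (V - (?W - S)) \<times> (V - (?W - S)) \<union> (V - S) \<times> (V - S)"
      using induced_reach_partition[OF sA AV xy(1)] by (auto simp: S_def)
    let ?P = "V - (?W - S)" and ?Q = "V - S"
    have SV: "S \<subseteq> ?W" by (auto simp: S_def)
    have yS: "y \<in> ?W - S" using xy by (auto simp: S_def)
    have P: "?P = insert v S" using SV v by auto
    have finS: "finite S" using SV fin finite_subset by blast
    have "v \<notin> S" using SV by auto
    then have cP: "card ?P = Suc (card S)" unfolding P using finS by simp
    have cQ: "card ?Q + card S = card V"
    proof -
      have "S \<subseteq> V" using SV by auto
      then show ?thesis using card_Diff_subset[OF finS, of V] card_mono[OF fin, of S] by simp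
    qed
    have S1: "card S \<ge> 1" using xS finS card_gt_0_iff[of S] by auto
    have "{v, y} \<subseteq> ?Q" using yS v SV by auto
    then have Q2: "card ?Q \<ge> 2" using card_mono[of ?Q "{v, y}"] fin yS by auto
    have "A = A \<inter> ?P \<times> ?P \<union> A \<inter> ?Q \<times> ?Q" using part by auto
    then have "card A \<le> card (A \<inter> ?P \<times> ?P) + card (A \<inter> ?Q \<times> ?Q)" using card_Un_le[of "A \<inter> ?P \<times> ?P" "A \<inter> ?Q \<times> ?Q"] by simp
    moreover have "card (A \<inter> ?P \<times> ?P) + 6 \<le> 4 * card ?P" using laman_sparse[OF L, of ?P] cP S1 by auto
    moreover have "card (A \<inter> ?Q \<times> ?Q) + 6 \<le> 4 * card ?Q" using laman_sparse[OF L, of ?Q] Q2 by auto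
    ultimately show False using cA cP cQ by linarith
  qed
qed

text \<open>Sparsity of the graph without \<open>v\<close> leaves at least four arcs, that is two
  edges, to \<open>v\<close>.\<close>

lemma laman_degree:
  assumes L: "laman_arcs V A" and n: "card V \<ge> 3" and v: "v \<in> V"
  shows "card (A `` {v}) \<ge> 2"
proof -
  have fin: "finite V" and AV: "A \<subseteq> V \<times> V" and sA: "sym A" and
    cA: "card A + 6 = 4 * card V" using laman_D[OF L] by simp_all
  let ?W = "V - {v}" and ?N = "A `` {v}"
  have finN: "finite ?N" using laman_finite_arcs[OF L] by (rule finite_Image)
  have cW: "card ?W + 1 = card V" using fin v n by simp
  have "A \<subseteq> A \<inter> ?W \<times> ?W \<union> ({v} \<times> ?N \<union> ?N \<times> {v})" using AV sA by (auto simp: sym_def)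
  moreover have "finite (A \<inter> ?W \<times> ?W \<union> ({v} \<times> ?N \<union> ?N \<times> {v}))"
    using finN laman_finite_arcs[OF L] by auto
  ultimately have "card A \<le> card (A \<inter> ?W \<times> ?W \<union> ({v} \<times> ?N \<union> ?N \<times> {v}))"
    by (intro card_mono)
  also have "\<dots> \<le> card (A \<inter> ?W \<times> ?W) + card ({v} \<times> ?N \<union> ?N \<times> {v})" by (rule card_Un_le)
  also have "card ({v} \<times> ?N \<union> ?N \<times> {v}) \<le> card ({v} \<times> ?N) + card (?N \<times> {v})" by (rule card_Un_le)
  finally have "card A \<le> card (A \<inter> ?W \<times> ?W) + 2 * card ?N" by (simp add: card_cartesian_product)
  moreover have "card (A \<inter> ?W \<times> ?W) + 6 \<le> 4 * card ?W" using laman_sparse[OF L, of ?W] cW n by auto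
  ultimately show ?thesis using cA cW by linarith
qed

section \<open>Contractible edges of facial triangles\<close>

text \<open>The face itself is the orbit of \<open>(v, u)\<close>; the arcs listed here are the
  reversed ones. The vertex \<open>a\<close> is the apex over the edge between \<open>u\<close> and
  \<open>v\<close>.\<close>

definition facial_triangle :: "('a \<Rightarrow> 'a \<Rightarrow> real) \<Rightarrow> ('a \<times> 'a) set \<Rightarrow> 'a \<Rightarrow> 'a \<Rightarrow> 'a \<Rightarrow> bool" where
  "facial_triangle \<kappa> A u v a \<longleftrightarrow> (u, v) \<in> A \<and> (v, a) \<in> A \<and> (a, u) \<in> A \<and>
     nxt (\<kappa> u) (A `` {u}) v = a \<and> nxt (\<kappa> v) (A `` {v}) a = u \<and> nxt (\<kappa> a) (A `` {a}) u = v"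

lemma facial_triangle_rotate: "facial_triangle \<kappa> A u v a \<Longrightarrow> facial_triangle \<kappa> A v a u"
  by (simp add: facial_triangle_def)

lemma face_triangle:
  assumes rg: "rot_graph \<kappa> A" and F: "F \<in> faces \<kappa> A" "card F = 3"
  obtains u v a where "facial_triangle \<kappa> A u v a" "(v, u) \<in> F"
    "F = {(v, u), (u, a), (a, v)}"
proof -
  obtain d where d: "d \<in> A" "F = orb \<kappa> A `` {d}" using F by (auto simp: faces_def)
  let ?f = "face_step \<kappa> A"
  obtain m where m: "m > 0" "(?f ^^ m) d = d" "inj_on (\<lambda>i. (?f ^^ i) d) {..<m}"
    "orb \<kappa> A `` {d} = (\<lambda>i. (?f ^^ i) d) ` {..<m}" by (rule orb_enum[OF rg d(1)])
  have m3: "m = 3" using F(2) d(2) m(4) card_image[OF m(3)] by simp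
  obtain v u where vu: "d = (v, u)" by force
  define a where "a = nxt (\<kappa> u) (A `` {u}) v"
  have f1: "?f d = (u, a)" by (simp add: vu face_step_def a_def)
  define w where "w = nxt (\<kappa> a) (A `` {a}) u"
  have f2: "?f (u, a) = (a, w)" by (simp add: face_step_def w_def)
  have f3: "?f (a, w) = d" using m(2) m3 f1 f2 by (simp add: numeral_3_eq_3)
  then have wv: "w = v" by (simp add: vu face_step_def)
  have e: "(u, a) \<in> A" "(a, v) \<in> A" using face_step_in[OF rg d(1)] f1 face_step_in[OF rg, of "(u, a)"] f2 wv by auto
  have "facial_triangle \<kappa> A u v a" unfolding facial_triangle_def
    using e d(1) rg_swap[OF rg] vu f3 wv a_def w_def by (auto simp: face_step_def)
  moreover have "{..<3::nat} = {0, 1, 2}" by auto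
  then have "F = {(v, u), (u, a), (a, v)}"
    using d(2) m(4) m3 f1 f2 wv vu by (simp add: numeral_2_eq_2)
  ultimately show ?thesis using that by auto
qed

text \<open>An orbit of length one would be a loop, and an orbit of length two turns back at a
  vertex, which then has degree one.\<close>

lemma face_card_ge_3:
  assumes rg: "rot_graph \<kappa> A" and deg: "\<And>v. A `` {v} \<noteq> {} \<Longrightarrow> card (A `` {v}) \<ge> 2"
    and F: "F \<in> faces \<kappa> A"
  shows "card F \<ge> 3"
proof -
  obtain d where d: "d \<in> A" "F = orb \<kappa> A `` {d}" using F by (auto simp: faces_def)
  let ?f = "face_step \<kappa> A"
  obtain m where m: "m > 0" "(?f ^^ m) d = d" "inj_on (\<lambda>i. (?f ^^ i) d) {..<m}"
    "orb \<kappa> A `` {d} = (\<lambda>i. (?f ^^ i) d) ` {..<m}" by (rule orb_enum[OF rg d(1)])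
  obtain x y where xy: "d = (x, y)" by force
  have "m \<noteq> 1" using m(2) face_step_ne[OF rg] d(1) xy by auto
  moreover have "m \<noteq> 2"
  proof
    assume "m = 2"
    then have "?f (?f d) = d" using m(2) by (simp add: numeral_2_eq_2)
    then have "nxt (\<kappa> y) (A `` {y}) x = x" by (auto simp: face_step_def xy)
    moreover have "x \<in> A `` {y}" using d xy rg_swap[OF rg] by auto
    ultimately have "A `` {y} = {x}" using nxt_self[OF rg_finN[OF rg]] by auto
    then show False using deg[of y] by auto
  qed
  ultimately have "m \<ge> 3" using m(1) by linarith
  then show ?thesis using d(2) m(4) card_image[OF m(3)] by simp
qed

text \<open>With one extra unit for each triangle every face counts at least 4, while the face sizes
  add up to the number of arcs. Euler's inequality and the arc count of a Laman graph force at least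
  two extra units.\<close>

lemma two_triangles:
  assumes L: "laman_arcs V A" and rg: "rot_graph \<kappa> A" and pl: "planar_rot \<kappa> A" and n: "card V \<ge> 3"
  shows "card {F \<in> faces \<kappa> A. card F = 3} \<ge> 2"
proof -
  have V: "finite V" "card V \<ge> 2" "A \<subseteq> V \<times> V" and cA: "card A + 6 = 4 * card V" using laman_D[OF L] by simp_all
  have ge: "2 * card (faces \<kappa> A) + 2 * card V \<ge> card A + 4"
    by (rule card_faces_ge[OF rg pl V laman_conn[OF L]])
  have finF: "finite (faces \<kappa> A)" by (rule finite_faces[OF rg])
  let ?T = "{F \<in> faces \<kappa> A. card F = 3}"
  have deg: "card (A `` {v}) \<ge> 2" if "A `` {v} \<noteq> {}" for v
    using laman_degree[OF L n, of v] that V by auto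
  have "4 * card (faces \<kappa> A) = (\<Sum>F\<in>faces \<kappa> A. 4)" by simp
  also have "\<dots> \<le> (\<Sum>F\<in>faces \<kappa> A. card F + (if card F = 3 then 1 else 0))"
  proof (rule sum_mono)
    fix F assume "F \<in> faces \<kappa> A"
    then have "card F \<ge> 3" using face_card_ge_3[OF rg deg] by blast
    then show "4 \<le> card F + (if card F = 3 then 1 else 0)" by auto
  qed
  also have "\<dots> = card A + card ?T"
    using sum_card_faces[OF rg] finF by (simp add: sum.distrib sum.If_cases Int_def)
  finally show ?thesis using ge cA by linarith
qed

text \<open>The contraction removes one vertex, which lowers the bound by two edges. A set
  containing \<open>u\<close> and \<open>v\<close> but not the apex \<open>w\<close> loses only the
  contracted edge, which is too little if the set is tight. The pair \<open>{u, v}\<close> alone is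
  tight but harmless, hence at least 3 vertices.\<close>

definition blocker :: "'a set \<Rightarrow> ('a \<times> 'a) set \<Rightarrow> 'a \<Rightarrow> 'a \<Rightarrow> 'a \<Rightarrow> 'a set \<Rightarrow> bool" where
  "blocker V A u v w X \<longleftrightarrow> X \<subseteq> V \<and> tight A X \<and> card X \<ge> 3 \<and> u \<in> X \<and> v \<in> X \<and> w \<notin> X"

text \<open>\<open>R\<close> is a union of components of the complement of \<open>X\<close>. The
  graph is covered by the parts induced on \<open>X \<union> R\<close> and on \<open>V - R\<close>,
  which overlap exactly in the arcs inside \<open>X\<close>. As the whole graph and \<open>X\<close>
  are tight, sparsity of the two parts leaves no slack.\<close>

lemma tight_add_component:
  assumes L: "laman_arcs V A" and X: "X \<subseteq> V" "tight A X" and R: "R \<subseteq> V - X"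
    and no: "\<And>r s. r \<in> R \<Longrightarrow> s \<in> V - X - R \<Longrightarrow> (r, s) \<notin> A"
  shows "tight A (X \<union> R)"
proof -
  have fin: "finite V" and AV: "A \<subseteq> V \<times> V" and sA: "sym A" and cA: "card A + 6 = 4 * card V"
    using laman_D[OF L] by simp_all
  note finA = laman_finite_arcs[OF L]
  let ?O = "V - X - R" and ?P = "X \<union> R" and ?Q = "V - R"
  have finX: "finite X" "finite R" using X R fin by (auto intro: finite_subset)
  have "A = A \<inter> ?P \<times> ?P \<union> A \<inter> ?Q \<times> ?Q"
  proof -
    have "(a, b) \<in> ?P \<times> ?P \<union> ?Q \<times> ?Q" if ab: "(a, b) \<in> A" for a b
      using no[of a b] no[of b a] ab AV sA by (auto simp: sym_def)
    then show ?thesis by auto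
  qed
  moreover have "A \<inter> ?P \<times> ?P \<inter> (A \<inter> ?Q \<times> ?Q) = A \<inter> X \<times> X" using R X by auto
  ultimately have c: "card (A \<inter> ?P \<times> ?P) + card (A \<inter> ?Q \<times> ?Q) = card A + card (A \<inter> X \<times> X)"
    using card_Un_Int[of "A \<inter> ?P \<times> ?P" "A \<inter> ?Q \<times> ?Q"] finA by simp
  have cP: "card ?P = card X + card R" using card_Un_disjoint[OF finX] R by auto
  have cQ: "card ?Q + card R = card V" 
  proof -
    have "R \<subseteq> V" using R by auto
    then show ?thesis using card_Diff_subset[OF finX(2), of V] card_mono[OF fin, of R] by simp
  qed
  have X2: "card X \<ge> 2" using X by (simp add: tight_def)
  have "card ?Q \<ge> card X" using R X fin by (intro card_mono) auto
  then have "card (A \<inter> ?Q \<times> ?Q) + 6 \<le> 4 * card ?Q" using laman_sparse[OF L, of ?Q] X2 by auto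
  moreover have "card (A \<inter> ?P \<times> ?P) + 6 \<le> 4 * card ?P" using laman_sparse[OF L, of ?P] X2 cP X R by auto
  ultimately show ?thesis using c cP cQ cA X(2) unfolding tight_def by linarith
qed

text \<open>A component of the complement that misses \<open>w\<close> could be added to
  \<open>X\<close>, against maximality.\<close>

lemma outside_tight_connected:
  assumes L: "laman_arcs V A" and X: "X \<subseteq> V" "tight A X" and w: "w \<in> V - X"
    and max: "\<And>Y. X \<subseteq> Y \<Longrightarrow> Y \<subseteq> V \<Longrightarrow> tight A Y \<Longrightarrow> w \<notin> Y \<Longrightarrow> Y = X"
    and r: "r \<in> V - X" and r': "r' \<in> V - X"
  shows "(r, r') \<in> (A \<inter> (- X) \<times> (- X))\<^sup>*"
proof -
  let ?B = "A \<inter> (- X) \<times> (- X)"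
  have sA: "sym A" using laman_D[OF L] by simp_all
  then have sB: "sym (?B\<^sup>*)" by (intro sym_rtrancl) (auto simp: sym_def)
  have to: "(r, w) \<in> ?B\<^sup>*" if r: "r \<in> V - X" for r
  proof (rule ccontr)
    assume nr: "(r, w) \<notin> ?B\<^sup>*"
    define R where "R = {z \<in> V - X. (r, z) \<in> ?B\<^sup>*}"
    have "tight A (X \<union> R)"
    proof (rule tight_add_component[OF L X])
      show "R \<subseteq> V - X" by (auto simp: R_def)
      fix a b assume ab: "a \<in> R" "b \<in> V - X - R"
      show "(a, b) \<notin> A"
      proof
        assume "(a, b) \<in> A"
        then have "(a, b) \<in> ?B" using ab by (auto simp: R_def)
        then have "(r, b) \<in> ?B\<^sup>*" using ab by (auto simp: R_def intro: rtrancl.rtrancl_into_rtrancl)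
        then show False using ab by (auto simp: R_def)
      qed
    qed
    moreover have "r \<in> R" "w \<notin> R" "R \<subseteq> V" using r nr by (auto simp: R_def)
    ultimately show False using max[of "X \<union> R"] X w r by auto
  qed
  have "(w, r') \<in> ?B\<^sup>*" using to[OF r'] sB by (meson symD)
  then show ?thesis using to[OF r] by (meson rtrancl_trans)
qed

theorem contractible_triangle_ex:
  assumes L: "laman_arcs V A" and rg: "rot_graph \<kappa> A" and pl: "planar_rot \<kappa> A" and n: "card V \<ge> 3"
  obtains u v a where "facial_triangle \<kappa> A u v a" "\<And>X. \<not> blocker V A u v a X"
proof (rule ccontr)
  assume "\<not> thesis"
  then have all: "\<exists>X. blocker V A u v a X" if "facial_triangle \<kappa> A u v a" for u v a
    using that \<open>\<And>u v a. facial_triangle \<kappa> A u v a \<Longrightarrow> (\<And>X. \<not> blocker V A u v a X) \<Longrightarrow> thesis\<close> by blast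
  have fin: "finite V" and AV: "A \<subseteq> V \<times> V" using laman_D[OF L] by simp_all
  \<comment> \<open>For each facial triangle a largest blocker is singled out, and \<open>X\<close>
    will be the smallest of these over all triangles. Largeness makes the outside of
    \<open>X\<close> connected; smallness excludes another such blocker properly inside
    \<open>X\<close>.\<close>
  define P where "P = (\<lambda>(u, v, w, X). facial_triangle \<kappa> A u v w \<and> blocker V A u v w X \<and>
    (\<forall>Y. blocker V A u v w Y \<longrightarrow> card Y \<le> card X))"
  have Pex: "\<exists>X. P (u, v, w, X)" if f: "facial_triangle \<kappa> A u v w" for u v w
  proof -
    obtain X0 where X0: "blocker V A u v w X0" using all[OF f] by blast
    have "\<forall>Y. blocker V A u v w Y \<longrightarrow> card Y < Suc (card V)"
      using card_mono[OF fin] by (auto simp: blocker_def le_imp_less_Suc)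
    then obtain X where "blocker V A u v w X" "\<forall>Y. blocker V A u v w Y \<longrightarrow> card Y \<le> card X"
      using ex_has_greatest_nat[of "blocker V A u v w" X0 card "Suc (card V)"] X0 less_imp_le by blast
    then show ?thesis using f unfolding P_def by auto
  qed
  have "card {F \<in> faces \<kappa> A. card F = 3} \<noteq> 0" using two_triangles[OF L rg pl n] by linarith
  then have "{F \<in> faces \<kappa> A. card F = 3} \<noteq> {}" by (metis card.empty)
  then obtain u0 v0 w0 where "facial_triangle \<kappa> A u0 v0 w0" using face_triangle[OF rg] by blast
  then obtain p0 where "P p0" using Pex by blast
  then obtain p where p: "P p" "\<And>p'. P p' \<Longrightarrow> card (snd (snd (snd p))) \<le> card (snd (snd (snd p')))"
    using ex_has_least_nat[of P p0 "\<lambda>p. card (snd (snd (snd p)))"] by blast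
  obtain u v w X where puv: "p = (u, v, w, X)" by (cases p)
  have X: "X \<subseteq> V" "tight A X" "card X \<ge> 3" "u \<in> X" "v \<in> X" "w \<notin> X"
    and Xmax: "\<And>Y. blocker V A u v w Y \<Longrightarrow> card Y \<le> card X"
    and fuv: "facial_triangle \<kappa> A u v w"
    using p(1) unfolding puv P_def blocker_def by auto
  have Xmin: "card X \<le> card Y" if "P (x, y, z, Y)" for x y z Y
    using p(2)[OF that] by (simp add: puv)
  have finX: "finite X" using finite_subset[OF X(1) fin] .
  have w: "w \<in> V - X" using fuv AV X by (auto simp: facial_triangle_def)
  have tmax: "Y = X" if Y: "X \<subseteq> Y" "Y \<subseteq> V" "tight A Y" "w \<notin> Y" for Y
  proof -
    have finY: "finite Y" by (rule finite_subset[OF Y(2) fin])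
    have "card X \<le> card Y" by (rule card_mono[OF finY Y(1)])
    then have "blocker V A u v w Y" using Y X by (auto simp: blocker_def)
    then have "card Y \<le> card X" by (rule Xmax)
    then show ?thesis using card_seteq[OF finY Y(1)] by simp
  qed
  define H where "H = A \<inter> X \<times> X"
  have HA: "H \<subseteq> A" by (auto simp: H_def)
  have LH: "laman_arcs X H" unfolding H_def by (rule laman_tight_induced[OF L X(1,2)])
  have rgH: "rot_graph \<kappa> H" by (rule rot_graph_subset[OF rg HA laman_D(3)[OF LH]])
  have plH: "planar_rot \<kappa> H" by (rule planar_rot_subset[OF pl HA])
  have connH: "conn_on X H" by (rule laman_conn[OF LH])
  \<comment> \<open>A triangular face of \<open>H\<close> without such corners is still a face of
    \<open>A\<close>. All these corners lie in one face, so at least one of the two or more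
    triangles of \<open>H\<close> is free of them.\<close>
  define att where "att = {(z', z) \<in> H. \<exists>r. r \<notin> X \<and> (z, r) \<in> A \<and> nxt (\<kappa> z) (insert r (H `` {z})) z' = r}"
  have att_same: "(d, e) \<in> orb \<kappa> H" if de: "d \<in> att" "e \<in> att" for d e
  proof -
    obtain x y r where 1: "d = (x, y)" "(x, y) \<in> H" "r \<notin> X" "(y, r) \<in> A" "nxt (\<kappa> y) (insert r (H `` {y})) x = r"
      using de(1) by (auto simp: att_def)
    obtain x' y' r' where 2: "e = (x', y')" "(x', y') \<in> H" "r' \<notin> X" "(y', r') \<in> A"
      "nxt (\<kappa> y') (insert r' (H `` {y'})) x' = r'"
      using de(2) by (auto simp: att_def)
    have yX: "y \<in> X" "y' \<in> X" using 1(2) 2(2) by (auto simp: H_def)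
    have rV: "r \<in> V - X" "r' \<in> V - X" using 1 2 AV by auto
    have "(r, r') \<in> (A \<inter> (- X) \<times> (- X))\<^sup>*"
      by (rule outside_tight_connected[OF L X(1,2) w tmax rV])
    from attach_same_face[OF rg pl H_def connH yX(1) 1(4,3,2,5) yX(2) 2(4,3,2,5) this]
    show ?thesis using 1(1) 2(1) by simp
  qed
  obtain F where F: "F \<in> faces \<kappa> H" "card F = 3" "F \<inter> att = {}"
  proof -
    have "\<exists>F\<in>{F \<in> faces \<kappa> H. card F = 3}. F \<inter> att = {}"
    proof (rule ccontr)
      assume no: "\<not> ?thesis"
      let ?T = "{F \<in> faces \<kappa> H. card F = 3}"
      have eq: "F = G" if FG: "F \<in> ?T" "G \<in> ?T" for F G
      proof -
        obtain d e where d: "d \<in> F" "d \<in> att" and e: "e \<in> G" "e \<in> att" using no FG by blast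
        have m: "F \<in> faces \<kappa> H" "G \<in> faces \<kappa> H" using FG by auto
        have dH: "d \<in> H" using d(2) by (auto simp: att_def)
        obtain f where f: "f \<in> H" "F = orb \<kappa> H `` {f}" using m(1) by (auto simp: faces_def)
        have "(f, d) \<in> orb \<kappa> H" using d f by blast
        then have "e \<in> F" using orb_trans[OF _ att_same[OF d(2) e(2)]] f by blast
        then show ?thesis using faces_disjoint[OF rgH m] e by blast
      qed
      have "card ?T \<noteq> 0" using two_triangles[OF LH rgH plH X(3)] by linarith
      then have "?T \<noteq> {}" by (metis card.empty)
      then obtain G where "G \<in> ?T" by blast
      then have "?T = {G}" using eq by blast
      then show False using two_triangles[OF LH rgH plH X(3)] by simp
    qed
    then show ?thesis using that by blast
  qed
  obtain x y z where tri: "facial_triangle \<kappa> H x y z" and Feq: "F = {(y, x), (x, z), (z, y)}"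
    using face_triangle[OF rgH F(1,2)] by metis
  have lift: "nxt (\<kappa> b) (A `` {b}) c = nxt (\<kappa> b) (H `` {b}) c" if cb: "(c, b) \<in> F" "(c, b) \<in> H" for b c
  proof -
    let ?r = "nxt (\<kappa> b) (A `` {b}) c"
    have cN: "c \<in> H `` {b}" using cb rg_swap[OF rgH] by auto
    then have cA: "c \<in> A `` {b}" using HA by auto
    have r: "?r \<in> A `` {b}" by (rule nxt_in[OF rg_finN[OF rg] cA])
    have sub: "H `` {b} \<subseteq> A `` {b}" "insert ?r (H `` {b}) \<subseteq> A `` {b}" using HA r by auto
    have "?r \<in> X"
    proof (rule ccontr)
      assume nX: "?r \<notin> X"
      have "nxt (\<kappa> b) (insert ?r (H `` {b})) c = ?r"
        by (rule nxt_subset[OF rg_finN[OF rg] rg_inj[OF rg] sub(2)]) (use cN in auto)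
      then have "(c, b) \<in> att" using cb nX r by (auto simp: att_def)
      then show False using F(3) cb by blast
    qed
    then have "?r \<in> H `` {b}" using r cb by (auto simp: H_def)
    then show ?thesis using nxt_subset[OF rg_finN[OF rg] rg_inj[OF rg] sub(1) cN] by simp
  qed
  have triA: "facial_triangle \<kappa> A x y z"
    using tri lift[of y x] lift[of x z] lift[of z y] HA rg_swap[OF rgH]
    unfolding facial_triangle_def Feq by auto
  have xyzX: "x \<in> X" "y \<in> X" "z \<in> X" using tri by (auto simp: facial_triangle_def H_def)
  have ne: "x \<noteq> y" "y \<noteq> z" "x \<noteq> z" using triA rg_irr[OF rg] by (auto simp: facial_triangle_def)
  \<comment> \<open>A blocker that misses \<open>w\<close> would, united with \<open>X\<close>, stay
    inside \<open>X\<close> by maximality of \<open>X\<close>. It lacks the apex \<open>d\<close>,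
    so it would be smaller than \<open>X\<close>.\<close>
  have in_w: "w \<in> W" if "P (b, c, d, W)" "b \<in> X" "c \<in> X" "d \<in> X" "b \<noteq> c" for b c d W
  proof (rule ccontr)
    assume nw: "w \<notin> W"
    have W: "W \<subseteq> V" "tight A W" "b \<in> W" "c \<in> W" "d \<notin> W" using that(1) by (auto simp: P_def blocker_def)
    have finW: "finite W" by (rule finite_subset[OF W(1) fin])
    have "{b, c} \<subseteq> W \<inter> X" using W(3,4) that(2,3) by simp
    then have "card {b, c} \<le> card (W \<inter> X)" using finX by (intro card_mono) simp_all
    then have "card (W \<inter> X) \<ge> 2" using that(5) by simp
    then have "tight A (W \<union> X)" by (rule tight_Un_Int(1)[OF L W(1,2) X(1,2)])
    then have "W \<union> X = X" using W(1) X(1,6) nw by (intro tmax) simp_all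
    then have "W \<subset> X" using W(5) that(4) by blast
    then have "card W < card X" by (rule psubset_card_mono[OF finX])
    then show False using Xmin[OF that(1)] by simp
  qed
  obtain W1 where W1: "P (x, y, z, W1)" using Pex[OF triA] by blast
  obtain W2 where W2: "P (y, z, x, W2)" using Pex[OF facial_triangle_rotate[OF triA]] by blast
  have w1: "W1 \<subseteq> V" "tight A W1" "x \<in> W1" "y \<in> W1" "z \<notin> W1" using W1 by (auto simp: P_def blocker_def)
  have w2: "W2 \<subseteq> V" "tight A W2" "y \<in> W2" "z \<in> W2" "x \<notin> W2" using W2 by (auto simp: P_def blocker_def)
  have "w \<in> W1" "w \<in> W2" using in_w[OF W1] in_w[OF W2] xyzX ne by auto
  then have "{y, w} \<subseteq> W1 \<inter> W2" "y \<noteq> w" using w1 w2 X(6) xyzX by auto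
  moreover have "finite (W1 \<inter> W2)" using finite_subset[OF w1(1) fin] by simp
  ultimately have "card (W1 \<inter> W2) \<ge> 2" using card_mono[of "W1 \<inter> W2" "{y, w}"] by simp
  \<comment> \<open>\<open>W1\<close> and \<open>W2\<close> share \<open>y\<close> and
    \<open>w\<close>, while \<open>x\<close> and \<open>z\<close> lie in their two
    differences.\<close>
  then have "(x, z) \<notin> A" using tight_Un_Int(2)[OF L w1(1,2) w2(1,2)] w1 w2 by blast
  then show False using triA rg_swap[OF rg] by (auto simp: facial_triangle_def)
qed

section \<open>Contracting an edge of a facial triangle\<close>

text \<open>Cuts the rotation open at \<open>i\<close>. The differences to \<open>k i\<close> are
  divided by more than twice their largest size, which puts them between -1/2 and 1/2; adding 1 to
  the negative ones moves them behind the others and keeps the cyclic order.\<close>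

lemma cyc_cut:
  assumes "finite N" "inj_on k N" "i \<in> N"
  obtains l where "l i = 0" "\<And>x. x \<in> N \<Longrightarrow> 0 \<le> l x \<and> l x < (1::real)" "inj_on l N"
    "\<And>x y z. x \<in> N \<Longrightarrow> y \<in> N \<Longrightarrow> z \<in> N \<Longrightarrow> cyc (k x) (k y) (k z) \<longleftrightarrow> cyc (l x) (l y) (l z)"
proof -
  define S where "S = (\<Sum>x\<in>N. \<bar>k x\<bar>)"
  define R where "R = 1 + 4 * S"
  have ab: "\<bar>k x\<bar> \<le> S" if "x \<in> N" for x
    using member_le_sum[of x N "\<lambda>x. \<bar>k x\<bar>"] that assms(1) by (auto simp: S_def)
  have R: "R > 0" "2 * \<bar>k x - k i\<bar> < R" if "x \<in> N" for x
  proof -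
    have "p \<le> q + r \<Longrightarrow> q \<le> S \<Longrightarrow> r \<le> S \<Longrightarrow> 2 * p < R" for p q r unfolding R_def by linarith
    then show "2 * \<bar>k x - k i\<bar> < R" using ab[OF that] ab[OF assms(3)] abs_triangle_ineq4 by blast
    have "0 \<le> p \<Longrightarrow> p \<le> S \<Longrightarrow> R > 0" for p unfolding R_def by linarith
    then show "R > 0" using ab[OF that] abs_ge_zero by blast
  qed
  define p where "p x = (k x - k i) / R" for x
  have p: "\<bar>p x\<bar> < 1 / 2" if "x \<in> N" for x
    using R[OF that] by (simp add: p_def abs_div_pos[symmetric] field_simps)
  have plt: "p x < p y \<longleftrightarrow> k x < k y" for x y
    using R(1)[OF assms(3)] by (simp add: p_def divide_less_cancel)
  define l where "l x = (if p x \<ge> 0 then p x else p x + 1)" for x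
  have "cyc (k x) (k y) (k z) \<longleftrightarrow> cyc (l x) (l y) (l z)" if "x \<in> N" "y \<in> N" "z \<in> N" for x y z
  proof -
    have "cyc (k x) (k y) (k z) \<longleftrightarrow> cyc (p x) (p y) (p z)" by (simp add: cyc_def plt)
    also have "\<dots> \<longleftrightarrow> cyc (l x) (l y) (l z)"
      using p[OF that(1)] p[OF that(2)] p[OF that(3)] unfolding cyc_def l_def by (auto split: if_splits)
    finally show ?thesis .
  qed
  moreover have "l i = 0" by (simp add: l_def p_def)
  moreover have "0 \<le> l x \<and> l x < 1" if "x \<in> N" for x using p[OF that] by (auto simp: l_def)
  moreover have "inj_on l N"
  proof (rule inj_onI)
    fix x y assume xy: "x \<in> N" "y \<in> N" "l x = l y"
    then have "p x = p y" using p[OF xy(1)] p[OF xy(2)] by (auto simp: l_def split: if_splits)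
    then have "k x = k y" using plt[of x y] plt[of y x] by linarith
    then show "x = y" using assms(2) xy by (auto dest: inj_onD)
  qed
  ultimately show ?thesis using that by blast
qed

text \<open>The edge \<open>u v\<close> of the facial triangle \<open>u v a\<close> is contracted to \<open>u\<close>. The keys \<open>ku\<close> and \<open>kv\<close> are the
  rotations at \<open>u\<close> and \<open>v\<close> restarted at \<open>a\<close> and \<open>u\<close>, which allows concatenating them.\<close>

locale contraction =
  fixes A :: "('a \<times> 'a) set" and \<kappa> :: "'a \<Rightarrow> 'a \<Rightarrow> real" and u v a :: 'a and B C :: "'a set"
    and ku kv :: "'a \<Rightarrow> real"
  assumes rg: "rot_graph \<kappa> A"
    and Nu: "A `` {u} = insert v (insert a B)" and Nv: "A `` {v} = insert u (insert a C)"
    and nB: "a \<notin> B" "v \<notin> B" and nC: "a \<notin> C" "u \<notin> C" and BC: "B \<inter> C = {}"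
    and cycu: "\<And>x y z. x \<in> A `` {u} \<Longrightarrow> y \<in> A `` {u} \<Longrightarrow> z \<in> A `` {u} \<Longrightarrow>
      cyc (\<kappa> u x) (\<kappa> u y) (\<kappa> u z) \<longleftrightarrow> cyc (ku x) (ku y) (ku z)"
    and cycv: "\<And>x y z. x \<in> A `` {v} \<Longrightarrow> y \<in> A `` {v} \<Longrightarrow> z \<in> A `` {v} \<Longrightarrow>
      cyc (\<kappa> v x) (\<kappa> v y) (\<kappa> v z) \<longleftrightarrow> cyc (kv x) (kv y) (kv z)"
    and kua: "ku a = 0" and ku: "\<And>b. b \<in> B \<Longrightarrow> 0 < ku b \<and> ku b < ku v" "0 < ku v" "ku v < 1"
    and kvu: "kv u = 0" and kv: "\<And>c. c \<in> C \<Longrightarrow> 0 < kv c \<and> kv c < kv a" "0 < kv a" "kv a < 1"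
    and inju: "inj_on ku (A `` {u})" and injv: "inj_on kv (A `` {v})"
    and nxa: "nxt (\<kappa> a) (A `` {a}) u = v"
begin

definition A' :: "('a \<times> 'a) set" where
  "A' = {(x, y). x \<noteq> v \<and> y \<noteq> v \<and> ((x, y) \<in> A \<or> x = u \<and> y \<in> C \<or> y = u \<and> x \<in> C)}"

text \<open>At \<open>u\<close> the neighbours \<open>a\<close> and \<open>B\<close> keep keys below
  1 while \<open>C\<close> receives keys above 1, so the merged rotation reads \<open>a\<close>,
  \<open>B\<close>, \<open>C\<close>. At a vertex of \<open>C\<close> the new arc to
  \<open>u\<close> takes the place of the old one to \<open>v\<close>.\<close>

definition \<kappa>' :: "'a \<Rightarrow> 'a \<Rightarrow> real" where
  "\<kappa>' z x = (if z = u then (if x \<in> C then 1 + kv x else ku x)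
     else if x = u \<and> z \<in> C then \<kappa> z v else \<kappa> z x)"

text \<open>Undoes the contraction on arcs; disjointness of \<open>B\<close> and \<open>C\<close>
  makes this unambiguous. The arcs between \<open>u\<close> and \<open>a\<close> stand for two
  merged edges and are sent to themselves.\<close>

definition lift :: "'a \<times> 'a \<Rightarrow> 'a \<times> 'a" where
  "lift = (\<lambda>(x, y). (if x = u \<and> y \<in> C then v else x, if y = u \<and> x \<in> C then v else y))"

lemma sw: "(x, y) \<in> A \<Longrightarrow> (y, x) \<in> A" using rg_swap[OF rg] .
lemma irr: "(x, x) \<notin> A" using rg_irr[OF rg] .
lemma arcs_u: "(u, x) \<in> A \<longleftrightarrow> x = v \<or> x = a \<or> x \<in> B" using Nu by auto
lemma arcs_v: "(v, x) \<in> A \<longleftrightarrow> x = u \<or> x = a \<or> x \<in> C" using Nv by auto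
lemma arcs_u': "(x, u) \<in> A \<longleftrightarrow> x = v \<or> x = a \<or> x \<in> B" using arcs_u sw by blast
lemma arcs_v': "(x, v) \<in> A \<longleftrightarrow> x = u \<or> x = a \<or> x \<in> C" using arcs_v sw by blast

lemma dist: "u \<noteq> v" "u \<noteq> a" "v \<noteq> a" "u \<notin> B" "v \<notin> C"
  using irr[of u] irr[of v] arcs_u[of v] arcs_u[of a] arcs_v[of a] arcs_u[of u] arcs_v[of v] by auto

lemma A'_sym: "sym A'" using sw by (auto simp: A'_def sym_def)

lemma A'_irrefl: "(x, x) \<notin> A'" using irr nC by (auto simp: A'_def)

lemma N'u: "A' `` {u} = insert a (B \<union> C)"
  using dist nB by (auto simp: A'_def arcs_u arcs_u')

lemma A'_v: "(v, x) \<notin> A'" "(x, v) \<notin> A'" by (auto simp: A'_def)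

lemma lift_in: "d \<in> A' \<Longrightarrow> lift d \<in> A"
proof -
  assume d: "d \<in> A'"
  obtain x y where xy: "d = (x, y)" by force
  then have "x \<noteq> v" "y \<noteq> v" "(x, y) \<in> A \<or> x = u \<and> y \<in> C \<or> y = u \<and> x \<in> C"
    using d by (auto simp: A'_def)
  then show ?thesis using nC arcs_v[of y] arcs_v'[of x] by (cases "x = u"; cases "y = u") (auto simp: xy lift_def)
qed

lemma lift_swap: "lift (y, x) = prod.swap (lift (x, y))"
  by (auto simp: lift_def)

lemma drop_lift: "d \<in> A' \<Longrightarrow> map_prod (\<lambda>x. if x = v then u else x) (\<lambda>x. if x = v then u else x) (lift d) = d"
  by (cases d) (simp add: lift_def A'_def)

lemma lift_inj: "inj_on lift A'"
  by (rule inj_on_inverseI) (rule drop_lift)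

lemma lift_not_v: "d \<in> A' \<Longrightarrow> lift d \<notin> {(u, v), (v, u), (v, a), (a, v)}"
proof -
  assume d: "d \<in> A'"
  obtain x y where xy: "d = (x, y)" by force
  have "x \<noteq> v" "y \<noteq> v" using d xy by (auto simp: A'_def)
  then show ?thesis using dist nC by (cases "x = u"; cases "y = u") (auto simp: xy lift_def)
qed

lemma finA: "finite A" by (rule rg_fin[OF rg])

lemma finA': "finite A'"
proof -
  have "lift ` A' \<subseteq> A" by (rule image_subsetI) (rule lift_in)
  then show ?thesis by (rule finite_imageD[OF finite_subset[OF _ finA] lift_inj])
qed

text \<open>Two edges are lost: the contracted one and one of the two that become parallel.\<close>

lemma lift_image: "lift ` A' = A - {(u, v), (v, u), (v, a), (a, v)}"
proof
  show "lift ` A' \<subseteq> A - {(u, v), (v, u), (v, a), (a, v)}"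
    by (rule image_subsetI) (rule DiffI[OF lift_in lift_not_v])
  show "A - {(u, v), (v, u), (v, a), (a, v)} \<subseteq> lift ` A'"
  proof
    fix e assume e: "e \<in> A - {(u, v), (v, u), (v, a), (a, v)}"
    obtain x y where xy: "e = (x, y)" by force
    show "e \<in> lift ` A'"
    proof (cases "x = v \<or> y = v")
      case True
      then show ?thesis
      proof
        assume "x = v"
        then have "y \<in> C" using e xy arcs_v by auto
        then have "lift (u, y) = e" "(u, y) \<in> A'" using \<open>x = v\<close> xy dist nC by (auto simp: lift_def A'_def)
        then show ?thesis by (metis image_eqI)
      next
        assume "y = v"
        then have "x \<in> C" using e xy arcs_v' by auto
        then have "lift (x, u) = e" "(x, u) \<in> A'" using \<open>y = v\<close> xy dist nC by (auto simp: lift_def A'_def)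
        then show ?thesis by (metis image_eqI)
      qed
    next
      case False
      then have "\<not> (x = u \<and> y \<in> C)" "\<not> (y = u \<and> x \<in> C)"
        using e xy arcs_u arcs_u' BC nC by auto
      then have "lift e = e" "e \<in> A'" using e xy False by (auto simp: lift_def A'_def)
      then show ?thesis by (metis image_eqI)
    qed
  qed
qed

lemma \<kappa>'_C: "z \<in> C \<Longrightarrow> \<kappa>' z = \<kappa> z \<circ> (\<lambda>x. if x = u then v else x)"
  using nC by (auto simp: \<kappa>'_def)

lemma \<kappa>'_other: "z \<noteq> u \<Longrightarrow> z \<notin> C \<Longrightarrow> \<kappa>' z = \<kappa> z"
  by (auto simp: \<kappa>'_def)

lemma \<kappa>'_u: "x \<notin> C \<Longrightarrow> \<kappa>' u x = ku x" "x \<in> C \<Longrightarrow> \<kappa>' u x = 1 + kv x"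
  by (auto simp: \<kappa>'_def)

lemma N'_C: "z \<in> C \<Longrightarrow> A `` {z} = (\<lambda>x. if x = u then v else x) ` (A' `` {z})"
proof -
  assume z: "z \<in> C"
  then have zu: "(z, u) \<notin> A" "(z, v) \<in> A" "z \<noteq> v" "(z, u) \<in> A'"
    using arcs_u' arcs_v' BC nC dist by (auto simp: A'_def)
  show ?thesis
  proof
    show "A `` {z} \<subseteq> (\<lambda>x. if x = u then v else x) ` (A' `` {z})"
    proof
      fix x assume x: "x \<in> A `` {z}"
      show "x \<in> (\<lambda>x. if x = u then v else x) ` (A' `` {z})"
      proof (cases "x = v")
        case True
        then show ?thesis using zu by (intro image_eqI[of _ _ u]) auto
      next
        case False
        then show ?thesis using x zu by (intro image_eqI[of _ _ x]) (auto simp: A'_def)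
      qed
    qed
    show "(\<lambda>x. if x = u then v else x) ` (A' `` {z}) \<subseteq> A `` {z}"
      using z zu by (auto simp: A'_def arcs_v' nC)
  qed
qed

lemma N'_other: "z \<noteq> u \<Longrightarrow> z \<notin> C \<Longrightarrow> z \<noteq> v \<Longrightarrow> A' `` {z} = A `` {z} - {v}"
  using nC by (auto simp: A'_def)

lemma \<kappa>'_u_bounds: "x \<in> A' `` {u} \<Longrightarrow> x \<notin> C \<Longrightarrow> 0 \<le> \<kappa>' u x \<and> \<kappa>' u x < ku v"
  "x \<in> C \<Longrightarrow> 1 < \<kappa>' u x"
proof -
  assume "x \<in> A' `` {u}" "x \<notin> C"
  then have "x = a \<or> x \<in> B" using N'u by auto
  then show "0 \<le> \<kappa>' u x \<and> \<kappa>' u x < ku v"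
    using ku(1)[of x] ku(2) kua \<open>x \<notin> C\<close> by (auto simp: \<kappa>'_def)
qed (use kv(1)[of x] in \<open>simp add: \<kappa>'_def\<close>)

lemma rg': "rot_graph \<kappa>' A'"
proof -
  have "inj_on (\<kappa>' z) (A' `` {z})" for z
  proof -
    consider "z = u" | "z \<in> C" | "z = v" | "z \<noteq> u" "z \<notin> C" "z \<noteq> v" by blast
    then show ?thesis
    proof cases
      case 1
      show ?thesis
      proof (rule inj_onI)
        fix x y assume xy: "x \<in> A' `` {z}" "y \<in> A' `` {z}" "\<kappa>' z x = \<kappa>' z y"
        consider "x \<in> C" "y \<in> C" | "x \<notin> C" "y \<notin> C" | "x \<in> C" "y \<notin> C" | "x \<notin> C" "y \<in> C" by blast
        then show "x = y"
        proof cases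
          case c: 1
          then show ?thesis using xy 1 injv Nv by (auto simp: \<kappa>'_u dest: inj_onD)
        next
          case c: 2
          then have "x \<in> A `` {u}" "y \<in> A `` {u}" using xy 1 N'u Nu by auto
          then show ?thesis using xy c 1 inju by (auto simp: \<kappa>'_u dest: inj_onD)
        next
          case c: 3
          then show ?thesis using xy 1 \<kappa>'_u_bounds(1)[of y] \<kappa>'_u_bounds(2)[of x] ku(3) by auto
        next
          case c: 4
          then show ?thesis using xy 1 \<kappa>'_u_bounds(1)[of x] \<kappa>'_u_bounds(2)[of y] ku(3) by auto
        qed
      qed
    next
      case 2
      have "inj_on (\<lambda>x. if x = u then v else x) (A' `` {z})"
        using A'_v by (auto simp: inj_on_def)
      then show ?thesis
        unfolding \<kappa>'_C[OF 2] using rg_inj[OF rg, of z] N'_C[OF 2] by (auto intro: comp_inj_on)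
    next
      case 3
      then show ?thesis using A'_v by (auto simp: inj_on_def)
    next
      case 4
      then show ?thesis using rg_inj[OF rg, of z] N'_other[OF 4] \<kappa>'_other[of z]
        by (metis inj_on_diff)
    qed
  qed
  then show ?thesis using finA' A'_sym A'_irrefl by (auto simp: rot_graph_def irrefl_def)
qed

section \<open>Faces of subgraphs of the contraction, lifted back to the original graph\<close>

definition liftset :: "('a \<times> 'a) set \<Rightarrow> ('a \<times> 'a) set" where
  "liftset H = insert (u, v) (insert (v, u) (lift ` H))"

context
  fixes H' :: "('a \<times> 'a) set"
  assumes H': "H' \<subseteq> A'" and symH': "sym H'"
begin

lemma H'_v: "(v, x) \<notin> H'" "(x, v) \<notin> H'" using H' A'_v by auto

lemma H'_uu: "(u, u) \<notin> H'" using H' A'_irrefl by auto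

lemma lift_image_u: "(u, y) \<in> lift ` H' \<longleftrightarrow> (u, y) \<in> H' \<and> y \<notin> C"
proof
  assume "(u, y) \<in> lift ` H'"
  then obtain p q where pq: "(p, q) \<in> H'" "lift (p, q) = (u, y)" by auto
  then show "(u, y) \<in> H' \<and> y \<notin> C"
    using dist(1) nC(2) H'_uu by (auto simp: lift_def split: if_splits)
next
  assume "(u, y) \<in> H' \<and> y \<notin> C"
  moreover from this have "lift (u, y) = (u, y)" using nC(2) by (simp add: lift_def)
  ultimately show "(u, y) \<in> lift ` H'" by (metis image_eqI)
qed

lemma lift_image_v: "(v, y) \<in> lift ` H' \<longleftrightarrow> (u, y) \<in> H' \<and> y \<in> C"
proof
  assume "(v, y) \<in> lift ` H'"
  then obtain p q where pq: "(p, q) \<in> H'" "lift (p, q) = (v, y)" by auto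
  then show "(u, y) \<in> H' \<and> y \<in> C"
    using dist(1) nC(2) H'_uu H'_v by (auto simp: lift_def split: if_splits)
next
  assume "(u, y) \<in> H' \<and> y \<in> C"
  moreover from this have "lift (u, y) = (v, y)" using nC(2) by (simp add: lift_def)
  ultimately show "(v, y) \<in> lift ` H'" by (metis image_eqI)
qed

lemma liftset_u: "liftset H' `` {u} = insert v (H' `` {u} - C)"
  using lift_image_u dist(1) by (auto simp: liftset_def)

lemma liftset_v: "liftset H' `` {v} = insert u (H' `` {u} \<inter> C)"
  using lift_image_v dist(1) by (auto simp: liftset_def)

lemma liftset_C:
  assumes z: "z \<in> C"
  shows "liftset H' `` {z} = (\<lambda>x. if x = u then v else x) ` (H' `` {z})"
proof -
  have zz: "z \<noteq> u" "z \<noteq> v" using z nC dist by auto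
  have l: "lift (z, y) = (z, if y = u then v else y)" for y using z zz nC by (simp add: lift_def)
  show ?thesis
  proof
    show "liftset H' `` {z} \<subseteq> (\<lambda>x. if x = u then v else x) ` (H' `` {z})"
    proof
      fix y assume "y \<in> liftset H' `` {z}"
      then have "(z, y) \<in> lift ` H'" using zz by (auto simp: liftset_def)
      then obtain p q where pq: "(p, q) \<in> H'" "lift (p, q) = (z, y)" by auto
      then have "p = z" using zz by (auto simp: lift_def split: if_splits)
      then have "q \<in> H' `` {z}" "y = (if q = u then v else q)" using pq l[of q] by auto
      then show "y \<in> (\<lambda>x. if x = u then v else x) ` (H' `` {z})"
        using image_eqI[of y "\<lambda>x. if x = u then v else x" q "H' `` {z}"] by blast
    qed
    show "(\<lambda>x. if x = u then v else x) ` (H' `` {z}) \<subseteq> liftset H' `` {z}"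
    proof
      fix y assume "y \<in> (\<lambda>x. if x = u then v else x) ` (H' `` {z})"
      then obtain q where q: "q \<in> H' `` {z}" "y = (if q = u then v else q)" by (auto simp del: if_split)
      then have "lift (z, q) \<in> lift ` H'" by auto
      then have "(z, y) \<in> lift ` H'" unfolding l q(2) .
      then show "y \<in> liftset H' `` {z}" by (auto simp: liftset_def)
    qed
  qed
qed

lemma liftset_other:
  assumes z: "z \<notin> C" "z \<noteq> u" "z \<noteq> v"
  shows "liftset H' `` {z} = H' `` {z}"
proof -
  have l: "lift (z, y) = (z, y)" for y using z by (simp add: lift_def)
  show ?thesis
  proof
    show "liftset H' `` {z} \<subseteq> H' `` {z}"
    proof
      fix y assume "y \<in> liftset H' `` {z}"
      then have "(z, y) \<in> lift ` H'" using z by (auto simp: liftset_def)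
      then obtain p q where pq: "(p, q) \<in> H'" "lift (p, q) = (z, y)" by auto
      then have "p = z" using z by (auto simp: lift_def split: if_splits)
      then show "y \<in> H' `` {z}" using pq l[of q] by auto
    qed
    show "H' `` {z} \<subseteq> liftset H' `` {z}"
    proof
      fix y assume "y \<in> H' `` {z}"
      then have "lift (z, y) \<in> lift ` H'" by auto
      then show "y \<in> liftset H' `` {z}" using l by (auto simp: liftset_def)
    qed
  qed
qed

lemma liftset_sub: "liftset H' \<subseteq> A"
proof -
  have "lift ` H' \<subseteq> A" by (rule image_subsetI) (use H' lift_in in blast)
  then show ?thesis using arcs_u arcs_v by (auto simp: liftset_def)
qed

lemma liftset_sym: "sym (liftset H')"
proof (rule symI)
  fix x y assume "(x, y) \<in> liftset H'"
  then consider "(x, y) = (u, v)" | "(x, y) = (v, u)" | p q where "(p, q) \<in> H'" "(x, y) = lift (p, q)"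
    by (auto simp: liftset_def)
  then show "(y, x) \<in> liftset H'"
  proof cases
    case 3
    then have "(y, x) = lift (q, p)" using lift_swap[of q p] 3(2) by (metis swap_simp)
    moreover have "(q, p) \<in> H'" using 3(1) symH' by (auto dest: symD)
    ultimately show ?thesis by (auto simp: liftset_def)
  qed (auto simp: liftset_def)
qed

lemma rgL: "rot_graph \<kappa> (liftset H')" by (rule rot_graph_subset[OF rg liftset_sub liftset_sym])

lemma rgH': "rot_graph \<kappa>' H'" by (rule rot_graph_subset[OF rg' H' symH'])

lemma uv_L: "(u, v) \<in> liftset H'" "(v, u) \<in> liftset H'" by (auto simp: liftset_def)

text \<open>\<open>S0\<close> stays with \<open>u\<close> when the contraction is undone, and
  \<open>T0\<close> returns to \<open>v\<close>.\<close>

definition "S0 = H' `` {u} - C"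
definition "T0 = H' `` {u} \<inter> C"

lemma N0: "H' `` {u} = S0 \<union> T0" "S0 \<inter> T0 = {}" "finite S0" "finite T0"
  using rg_finN[OF rgH', of u] by (auto simp: S0_def T0_def)

lemma S0_key: "x \<in> S0 \<Longrightarrow> \<kappa>' u x = ku x \<and> 0 \<le> ku x \<and> ku x < ku v \<and> ku x < 1"
  using \<kappa>'_u_bounds(1)[of x] H' \<kappa>'_u(1)[of x] ku(3) by (auto simp: S0_def)

lemma T0_key: "x \<in> T0 \<Longrightarrow> \<kappa>' u x = 1 + kv x \<and> 0 < kv x"
  using kv(1)[of x] \<kappa>'_u(2)[of x] by (auto simp: T0_def)

lemma nxt_u: "x \<in> insert v S0 \<Longrightarrow> nxt (\<kappa> u) (liftset H' `` {u}) x = nxt ku (insert v S0) x"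
  and inj_u: "inj_on ku (insert v S0)"
proof -
  have sub: "insert v S0 \<subseteq> A `` {u}" using liftset_u liftset_sub by (auto simp: S0_def)
  show i: "inj_on ku (insert v S0)" by (rule inj_on_subset[OF inju sub])
  assume x: "x \<in> insert v S0"
  have fin: "finite (insert v S0)" using N0(3,4) by simp
  have ce: "cyc (\<kappa> u x) (\<kappa> u y) (\<kappa> u z) \<longleftrightarrow> cyc (ku x) (ku y) (ku z)"
    if "x \<in> insert v S0" "y \<in> insert v S0" "z \<in> insert v S0" for x y z
    by (rule cycu) (use that sub in blast)+
  have "nxt (\<kappa> u) (insert v S0) x = nxt ku (insert v S0) x"
    by (rule nxt_cong_cyc[OF fin inj_on_subset[OF rg_inj[OF rg] sub] i x ce])
  then show "nxt (\<kappa> u) (liftset H' `` {u}) x = nxt ku (insert v S0) x"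
    unfolding liftset_u S0_def .
qed

lemma nxt_v: "x \<in> insert u T0 \<Longrightarrow> nxt (\<kappa> v) (liftset H' `` {v}) x = nxt kv (insert u T0) x"
  and inj_v: "inj_on kv (insert u T0)"
proof -
  have sub: "insert u T0 \<subseteq> A `` {v}" using liftset_v liftset_sub by (auto simp: T0_def)
  show i: "inj_on kv (insert u T0)" by (rule inj_on_subset[OF injv sub])
  assume x: "x \<in> insert u T0"
  have fin: "finite (insert u T0)" using N0(3,4) by simp
  have ce: "cyc (\<kappa> v x) (\<kappa> v y) (\<kappa> v z) \<longleftrightarrow> cyc (kv x) (kv y) (kv z)"
    if "x \<in> insert u T0" "y \<in> insert u T0" "z \<in> insert u T0" for x y z
    by (rule cycv) (use that sub in blast)+
  have "nxt (\<kappa> v) (insert u T0) x = nxt kv (insert u T0) x"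
    by (rule nxt_cong_cyc[OF fin inj_on_subset[OF rg_inj[OF rg] sub] i x ce])
  then show "nxt (\<kappa> v) (liftset H' `` {v}) x = nxt kv (insert u T0) x"
    unfolding liftset_v T0_def .
qed

lemma not_in0: "v \<notin> S0" "u \<notin> T0" "u \<notin> S0"
  using H'_v H'_uu by (auto simp: S0_def T0_def)

text \<open>\<open>S0\<close> is a contiguous block of the merged order, so a successor that does
  not lead across to \<open>v\<close> is not affected by \<open>T0\<close>.\<close>

lemma nxt_stay_S:
  assumes x: "x \<in> S0" and j: "nxt ku (insert v S0) x \<noteq> v"
  shows "nxt (\<kappa>' u) (H' `` {u}) x = nxt ku (insert v S0) x"
proof (rule nxt_eqI[OF rg_finN[OF rgH'] rg_inj[OF rgH']])
  show xN: "x \<in> H' `` {u}" using x N0 by auto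
  let ?j = "nxt ku (insert v S0) x"
  have sc: "succ_of ku (insert v S0) x ?j" using nxt_succ[of "insert v S0"] N0 x by auto
  then have jS: "?j \<in> S0" using j by (auto simp: succ_of_def)
  have jx: "?j \<noteq> x" using sc not_in0 x by (auto simp: succ_of_def)
  have nc: "\<not> cyc (ku x) (ku l) (ku ?j)" if "l \<in> insert v S0" for l using sc that by (auto simp: succ_of_def)
  have "\<not> cyc (\<kappa>' u x) (\<kappa>' u l) (\<kappa>' u ?j)" if "l \<in> H' `` {u}" for l
  proof (cases "l \<in> S0")
    case True
    then show ?thesis using nc[of l] S0_key[OF x] S0_key[OF jS] S0_key[OF True] by simp
  next
    case False
    then have l: "l \<in> T0" using that N0 by auto
    have "\<not> ku ?j < ku x" using nc[of v] S0_key[OF x] by (auto simp: cyc_def)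
    then show ?thesis using S0_key[OF x] S0_key[OF jS] T0_key[OF l] by (auto simp: cyc_def)
  qed
  then show "succ_of (\<kappa>' u) (H' `` {u}) x ?j" using jS jx N0 by (auto simp: succ_of_def)
qed

lemma nxt_stay_T:
  assumes x: "x \<in> T0" and j: "nxt kv (insert u T0) x \<noteq> u"
  shows "nxt (\<kappa>' u) (H' `` {u}) x = nxt kv (insert u T0) x"
proof (rule nxt_eqI[OF rg_finN[OF rgH'] rg_inj[OF rgH']])
  show xN: "x \<in> H' `` {u}" using x N0 by auto
  let ?j = "nxt kv (insert u T0) x"
  have sc: "succ_of kv (insert u T0) x ?j" using nxt_succ[of "insert u T0"] N0 x by auto
  then have jT: "?j \<in> T0" using j by (auto simp: succ_of_def)
  have jx: "?j \<noteq> x" using sc not_in0 x by (auto simp: succ_of_def)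
  have nc: "\<not> cyc (kv x) (kv l) (kv ?j)" if "l \<in> insert u T0" for l using sc that by (auto simp: succ_of_def)
  have "\<not> cyc (\<kappa>' u x) (\<kappa>' u l) (\<kappa>' u ?j)" if "l \<in> H' `` {u}" for l
  proof (cases "l \<in> T0")
    case True
    then show ?thesis using nc[of l] T0_key[OF x] T0_key[OF jT] T0_key[OF True] by (simp add: cyc_def)
  next
    case False
    then have l: "l \<in> S0" using that N0 by auto
    have "\<not> kv ?j < kv x" using nc[of u] T0_key[OF x] T0_key[OF jT] kvu by (auto simp: cyc_def)
    then show ?thesis using T0_key[OF x] T0_key[OF jT] S0_key[OF l] by (auto simp: cyc_def)
  qed
  then show "succ_of (\<kappa>' u) (H' `` {u}) x ?j" using jT jx N0 by (auto simp: succ_of_def)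
qed

lemma first_S: "s = nxt ku (insert v S0) v \<Longrightarrow> S0 \<noteq> {} \<Longrightarrow> s \<in> S0 \<and> (\<forall>l\<in>S0. ku s \<le> ku l)"
proof -
  assume s: "s = nxt ku (insert v S0) v" and ne: "S0 \<noteq> {}"
  have sc: "succ_of ku (insert v S0) v s" using nxt_succ[of "insert v S0" v ku] N0 s by auto
  then have sS: "s \<in> S0" using ne not_in0 by (auto simp: succ_of_def)
  have "\<not> cyc (ku v) (ku l) (ku s)" if "l \<in> S0" for l using sc that by (auto simp: succ_of_def)
  then have "ku s \<le> ku l" if "l \<in> S0" for l using that S0_key[OF sS] by (force simp: cyc_def)
  then show ?thesis using sS by blast
qed

lemma first_T: "t = nxt kv (insert u T0) u \<Longrightarrow> T0 \<noteq> {} \<Longrightarrow> t \<in> T0 \<and> (\<forall>l\<in>T0. kv t \<le> kv l)"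
proof -
  assume t: "t = nxt kv (insert u T0) u" and ne: "T0 \<noteq> {}"
  have sc: "succ_of kv (insert u T0) u t" using nxt_succ[of "insert u T0" u kv] N0 t by auto
  then have tT: "t \<in> T0" using ne not_in0 by (auto simp: succ_of_def)
  have "\<not> cyc (kv u) (kv l) (kv t)" if "l \<in> T0" for l using sc that by (auto simp: succ_of_def)
  then have "kv t \<le> kv l" if "l \<in> T0" for l using that T0_key[OF that] kvu by (force simp: cyc_def)
  then show ?thesis using tT by blast
qed

lemma last_S: "x \<in> S0 \<Longrightarrow> nxt ku (insert v S0) x = v \<Longrightarrow> l \<in> S0 \<Longrightarrow> ku l \<le> ku x"
proof -
  assume x: "x \<in> S0" "nxt ku (insert v S0) x = v" and l: "l \<in> S0"
  have "\<not> cyc (ku x) (ku l) (ku v)" using nxt_not_cyc[of "insert v S0" x l ku] x l N0 by auto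
  then show ?thesis using S0_key[OF l] by (force simp: cyc_def)
qed

lemma last_T: "x \<in> T0 \<Longrightarrow> nxt kv (insert u T0) x = u \<Longrightarrow> l \<in> T0 \<Longrightarrow> kv l \<le> kv x"
proof -
  assume x: "x \<in> T0" "nxt kv (insert u T0) x = u" and l: "l \<in> T0"
  have "\<not> cyc (kv x) (kv l) (kv u)" using nxt_not_cyc[of "insert u T0" x l kv] x l N0 by auto
  then show ?thesis using T0_key[OF x(1)] kvu by (force simp: cyc_def)
qed

lemma nxt_max:
  assumes "finite N" "inj_on k N" "x \<in> N" "j \<in> N" "\<And>l. l \<in> N \<Longrightarrow> k l \<le> k x" "\<And>l. l \<in> N \<Longrightarrow> k j \<le> k l"
  shows "nxt k N x = j"
proof (rule nxt_eqI[OF assms(1-3)])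
  have "N = {x}" if "j = x"
  proof -
    have "k l = k x" if "l \<in> N" for l using assms(5)[OF that] assms(6)[OF that] \<open>j = x\<close> by simp
    then show ?thesis using assms(2,3) by (auto dest: inj_onD)
  qed
  moreover have "\<not> cyc (k x) (k l) (k j)" if "l \<in> N" for l
    using assms(5)[OF that] assms(6)[OF that] by (auto simp: cyc_def)
  ultimately show "succ_of k N x j" using assms(4) by (auto simp: succ_of_def)
qed

text \<open>Behind the last element of \<open>S0\<close> the rotation at \<open>u\<close> shows the
  contracted edge; in the merged order the first element of \<open>T0\<close> comes there.\<close>

lemma cross_S_T:
  assumes x: "x \<in> S0" "nxt ku (insert v S0) x = v" and T: "T0 \<noteq> {}"
  shows "nxt (\<kappa>' u) (H' `` {u}) x = nxt kv (insert u T0) u"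
proof (rule nxt_eqI[OF rg_finN[OF rgH'] rg_inj[OF rgH']])
  let ?t = "nxt kv (insert u T0) u"
  show "x \<in> H' `` {u}" using x N0 by auto
  have t: "?t \<in> T0" "\<And>l. l \<in> T0 \<Longrightarrow> kv ?t \<le> kv l" using first_T[OF refl T] by auto
  have "\<not> cyc (\<kappa>' u x) (\<kappa>' u l) (\<kappa>' u ?t)" if "l \<in> H' `` {u}" for l
  proof (cases "l \<in> S0")
    case True
    then show ?thesis using last_S[OF x True] S0_key[OF x(1)] S0_key[OF True] T0_key[OF t(1)]
      by (auto simp: cyc_def)
  next
    case False
    then have l: "l \<in> T0" using that N0 by auto
    then show ?thesis using t(2)[OF l] S0_key[OF x(1)] T0_key[OF l] T0_key[OF t(1)] by (auto simp: cyc_def)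
  qed
  moreover have "?t \<noteq> x" using t x N0 by auto
  ultimately show "succ_of (\<kappa>' u) (H' `` {u}) x ?t" using t N0 by (auto simp: succ_of_def)
qed

lemma cross_T_S:
  assumes x: "x \<in> T0" "nxt kv (insert u T0) x = u" and S: "S0 \<noteq> {}"
  shows "nxt (\<kappa>' u) (H' `` {u}) x = nxt ku (insert v S0) v"
proof (rule nxt_max[OF rg_finN[OF rgH'] rg_inj[OF rgH']])
  let ?s = "nxt ku (insert v S0) v"
  have s: "?s \<in> S0" "\<And>l. l \<in> S0 \<Longrightarrow> ku ?s \<le> ku l" using first_S[OF refl S] by auto
  show "x \<in> H' `` {u}" "?s \<in> H' `` {u}" using x s N0 by auto
  show "\<kappa>' u l \<le> \<kappa>' u x" "\<kappa>' u ?s \<le> \<kappa>' u l" if "l \<in> H' `` {u}" for l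
  proof -
    have "\<kappa>' u l \<le> \<kappa>' u x \<and> \<kappa>' u ?s \<le> \<kappa>' u l"
    proof (cases "l \<in> S0")
      case True
      then show ?thesis using s(2)[OF True] S0_key[OF True] T0_key[OF x(1)] S0_key[OF s(1)] by linarith
    next
      case False
      then have l: "l \<in> T0" using that N0(1) by blast
      then show ?thesis using last_T[OF x l] T0_key[OF l] T0_key[OF x(1)] S0_key[OF s(1)] by linarith
    qed
    then show "\<kappa>' u l \<le> \<kappa>' u x" "\<kappa>' u ?s \<le> \<kappa>' u l" by auto
  qed
qed

text \<open>With \<open>T0\<close> empty, \<open>v\<close> is a dead end of the lifted graph: the
  merged rotation passes over it and starts again at the first element of \<open>S0\<close>.\<close>

lemma wrap_S:
  assumes x: "x \<in> S0" "nxt ku (insert v S0) x = v" and T: "T0 = {}"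
  shows "nxt (\<kappa>' u) (H' `` {u}) x = nxt ku (insert v S0) v"
proof (rule nxt_max[OF rg_finN[OF rgH'] rg_inj[OF rgH']])
  let ?s = "nxt ku (insert v S0) v"
  have s: "?s \<in> S0" "\<And>l. l \<in> S0 \<Longrightarrow> ku ?s \<le> ku l" using first_S[OF refl] x by auto
  show "x \<in> H' `` {u}" "?s \<in> H' `` {u}" using x s N0 by auto
  show "\<kappa>' u l \<le> \<kappa>' u x" "\<kappa>' u ?s \<le> \<kappa>' u l" if "l \<in> H' `` {u}" for l
    using that N0 T last_S[OF x, of l] s(2)[of l] S0_key[of l] S0_key[OF x(1)] S0_key[OF s(1)] by auto
qed

lemma wrap_T:
  assumes x: "x \<in> T0" "nxt kv (insert u T0) x = u" and S: "S0 = {}"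
  shows "nxt (\<kappa>' u) (H' `` {u}) x = nxt kv (insert u T0) u"
proof (rule nxt_max[OF rg_finN[OF rgH'] rg_inj[OF rgH']])
  let ?t = "nxt kv (insert u T0) u"
  have t: "?t \<in> T0" "\<And>l. l \<in> T0 \<Longrightarrow> kv ?t \<le> kv l" using first_T[OF refl] x by auto
  show "x \<in> H' `` {u}" "?t \<in> H' `` {u}" using x t N0 by auto
  show "\<kappa>' u l \<le> \<kappa>' u x" "\<kappa>' u ?t \<le> \<kappa>' u l" if "l \<in> H' `` {u}" for l
    using that N0 S last_T[OF x, of l] t(2)[of l] T0_key[of l] T0_key[OF x(1)] T0_key[OF t(1)] by auto
qed

text \<open>One face step at the merged vertex becomes up to three steps in the lifted graph. The
  contracted edge is traversed once when the step changes between the blocks \<open>S0\<close> and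
  \<open>T0\<close>, and forth and back when the block to be visited is empty.\<close>

lemma orb_lift_step:
  assumes d: "d \<in> H'"
  shows "(lift d, lift (face_step \<kappa>' H' d)) \<in> orb \<kappa> (liftset H')"
proof -
  let ?L = "liftset H'"
  obtain x y where xy: "d = (x, y)" by force
  have dL: "lift d \<in> ?L" using d by (auto simp: liftset_def)
  have x: "x \<in> H' `` {y}" using d xy symH' by (auto dest: symD)
  have yv: "y \<noteq> v" "x \<noteq> v" using H'_v d xy by auto
  let ?j = "nxt (\<kappa>' y) (H' `` {y}) x"
  have j: "?j \<in> H' `` {y}" by (rule nxt_in[OF rg_finN[OF rgH'] x])
  have fd: "face_step \<kappa>' H' d = (y, ?j)" by (simp add: xy face_step_def)
  have one: "face_step \<kappa> ?L (lift d) = e \<Longrightarrow> (lift d, e) \<in> orb \<kappa> ?L" for e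
    using orb_step[OF dL, of \<kappa>] by simp
  show ?thesis
  proof (cases "y = u")
    case False
    show ?thesis
    proof (cases "y \<in> C")
      case True
      let ?g = "\<lambda>x. if x = u then v else x"
      have inj: "inj_on ?g (H' `` {y})" using H'_v by (auto simp: inj_on_def)
      have "inj_on (\<kappa> y) (?g ` (H' `` {y}))" using rg_inj[OF rgL, of y] liftset_C[OF True] by simp
      then have "nxt (\<kappa> y) (?L `` {y}) (?g x) = ?g ?j"
        using nxt_image[OF rg_finN[OF rgH'] _ inj x, of "\<kappa> y"] liftset_C[OF True] \<kappa>'_C[OF True] by simp
      moreover have "lift d = (?g x, y)" "lift (y, ?j) = (y, ?g ?j)" using True False by (auto simp: xy lift_def)
      ultimately show ?thesis unfolding fd by (intro one) (simp add: face_step_def)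
    next
      case nC: False
      have "lift d = d" "lift (y, ?j) = (y, ?j)" using nC False by (auto simp: xy lift_def)
      then show ?thesis unfolding fd using liftset_other[OF nC False yv(1)] \<kappa>'_other[OF False nC]
        by (intro one) (simp add: face_step_def xy)
    qed
  next
    case yu: True
    have uC: "u \<notin> C" by (rule nC(2))
    let ?s = "nxt ku (insert v S0) v" and ?t = "nxt kv (insert u T0) u"
    have luv: "face_step \<kappa> ?L (u, v) = (v, ?t)" using nxt_v[of u] by (simp add: face_step_def)
    have lvu: "face_step \<kappa> ?L (v, u) = (u, ?s)" using nxt_u[of v] by (simp add: face_step_def)
    have o1: "((u, v), (v, ?t)) \<in> orb \<kappa> ?L" using orb_step[OF uv_L(1), of \<kappa>] luv by simp
    have o2: "((v, u), (u, ?s)) \<in> orb \<kappa> ?L" using orb_step[OF uv_L(2), of \<kappa>] lvu by simp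
    have sv: "?s = v" if "S0 = {}" using that by (simp add: nxt_singleton)
    have tu: "?t = u" if "T0 = {}" using that by (simp add: nxt_singleton)
    have lS: "lift (u, l) = (u, l)" if "l \<in> S0" for l using that uC by (auto simp: lift_def S0_def)
    have lT: "lift (u, l) = (v, l)" if "l \<in> T0" for l using that uC by (auto simp: lift_def T0_def)
    show ?thesis
    proof (cases "x \<in> C")
      case True
      then have xT: "x \<in> T0" using x yu by (auto simp: T0_def)
      have ld: "lift d = (x, v)" using True yu uC by (auto simp: xy lift_def)
      let ?k = "nxt kv (insert u T0) x"
      have fl: "face_step \<kappa> ?L (lift d) = (v, ?k)" using nxt_v[of x] xT by (simp add: ld face_step_def)
      show ?thesis
      proof (cases "?k = u")
        case False
        have "?k \<in> T0" using nxt_in[of "insert u T0" x kv] N0 xT False by auto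
        then have "lift (face_step \<kappa>' H' d) = (v, ?k)"
          unfolding fd yu nxt_stay_T[OF xT False] by (rule lT)
        then show ?thesis using one[OF fl] by simp
      next
        case True
        have o3: "(lift d, (v, u)) \<in> orb \<kappa> ?L" using one[OF fl] True by simp
        show ?thesis
        proof (cases "S0 = {}")
          case False
          then have "lift (face_step \<kappa>' H' d) = (u, ?s)"
            unfolding fd yu cross_T_S[OF xT True False] using first_S[OF refl False] by (intro lS) blast
          then show ?thesis using orb_trans[OF o3 o2] by simp
        next
          case Se: True
          have "T0 \<noteq> {}" using xT by auto
          then have "lift (face_step \<kappa>' H' d) = (v, ?t)"
            unfolding fd yu wrap_T[OF xT True Se] using first_T[OF refl] by (intro lT) blast
          then show ?thesis using orb_trans[OF orb_trans[OF o3 o2]] o1 sv[OF Se] by simp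
        qed
      qed
    next
      case False
      then have xS: "x \<in> S0" using x yu by (auto simp: S0_def)
      have ld: "lift d = (x, u)" using False yu uC yv by (auto simp: xy lift_def)
      let ?k = "nxt ku (insert v S0) x"
      have fl: "face_step \<kappa> ?L (lift d) = (u, ?k)" using nxt_u[of x] xS by (simp add: ld face_step_def)
      show ?thesis
      proof (cases "?k = v")
        case False
        have "?k \<in> S0" using nxt_in[of "insert v S0" x ku] N0 xS False by auto
        then have "lift (face_step \<kappa>' H' d) = (u, ?k)"
          unfolding fd yu nxt_stay_S[OF xS False] by (rule lS)
        then show ?thesis using one[OF fl] by simp
      next
        case True
        have o3: "(lift d, (u, v)) \<in> orb \<kappa> ?L" using one[OF fl] True by simp
        show ?thesis
        proof (cases "T0 = {}")
          case False
          then have "lift (face_step \<kappa>' H' d) = (v, ?t)"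
            unfolding fd yu cross_S_T[OF xS True False] using first_T[OF refl False] by (intro lT) blast
          then show ?thesis using orb_trans[OF o3 o1] by simp
        next
          case Te: True
          have "S0 \<noteq> {}" using xS by auto
          then have "lift (face_step \<kappa>' H' d) = (u, ?s)"
            unfolding fd yu wrap_S[OF xS True Te] using first_S[OF refl] by (intro lS) blast
          then show ?thesis using orb_trans[OF orb_trans[OF o3 o1]] o2 tu[OF Te] by simp
        qed
      qed
    qed
  qed
qed

lemma orb_lift:
  assumes "(d, e) \<in> orb \<kappa>' H'" "d \<in> H'"
  shows "(lift d, lift e) \<in> orb \<kappa> (liftset H')"
proof -
  have "e \<in> H' \<and> (lift d, lift e) \<in> orb \<kappa> (liftset H')"
    using assms(1) unfolding orb_def[of \<kappa>' H']
  proof (induction rule: rtrancl_induct)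
    case base
    then show ?case using assms(2) orb_refl by blast
  next
    case (step y z)
    then have y: "y \<in> H'" "z = face_step \<kappa>' H' y" "(lift d, lift y) \<in> orb \<kappa> (liftset H')" by blast+
    then show ?case using orb_trans[OF y(3) orb_lift_step[OF y(1)]] face_step_in[OF rgH' y(1)] by simp
  qed
  then show ?thesis by blast
qed

text \<open>A connection that avoids an edge survives the splitting of \<open>u\<close>, because the
  contracted edge joins the two halves and is not the edge avoided.\<close>

lemma bridge_lift:
  assumes xy: "(x, y) \<in> H'" and con: "(x, y) \<in> (del x y H')\<^sup>*"
  shows "\<exists>p q. lift (x, y) = (p, q) \<and> (p, q) \<in> (del p q (liftset H'))\<^sup>*"
proof -
  obtain p q where pq: "lift (x, y) = (p, q)" by force
  let ?D = "del p q (liftset H')"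
  have nuv: "(p, q) \<noteq> (u, v)" "(p, q) \<noteq> (v, u)" using lift_not_v[of "(x, y)"] xy H' pq by auto
  have uv: "(u, v) \<in> ?D" "(v, u) \<in> ?D" using nuv by (auto simp: del_def liftset_def)
  have l1: "(s, fst (lift (s, t))) \<in> ?D\<^sup>*" "(fst (lift (s, t)), s) \<in> ?D\<^sup>*"
    "(snd (lift (s, t)), t) \<in> ?D\<^sup>*" "(t, snd (lift (s, t))) \<in> ?D\<^sup>*" for s t
    using uv by (auto simp: lift_def intro: r_into_rtrancl)
  have arc: "(s, t) \<in> ?D\<^sup>*" if st: "(s, t) \<in> del x y H'" for s t
  proof -
    have stH: "(s, t) \<in> H'" "(s, t) \<noteq> (x, y)" "(s, t) \<noteq> (y, x)" using st by (auto simp: del_def)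
    have yx: "(y, x) \<in> H'" using xy symH' by (auto dest: symD)
    have l2: "lift (y, x) = (q, p)" using lift_swap[of y x] pq by simp
    have "lift (s, t) \<noteq> lift (x, y)" using inj_onD[OF lift_inj, of "(s, t)" "(x, y)"] stH xy H' by auto
    moreover have "lift (s, t) \<noteq> lift (y, x)" using inj_onD[OF lift_inj, of "(s, t)" "(y, x)"] stH yx H' by auto
    ultimately have "lift (s, t) \<in> ?D" using stH pq l2 by (auto simp: del_def liftset_def)
    then have "(fst (lift (s, t)), snd (lift (s, t))) \<in> ?D\<^sup>*" by auto
    then show ?thesis using l1(1,3)[of s t] by (meson rtrancl_trans)
  qed
  have "(x, y) \<in> ?D\<^sup>*" using con
  proof (induction rule: rtrancl_induct)
    case (step y z)
    show ?case by (rule rtrancl_trans[OF step.IH arc[OF step.hyps(2)]])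
  qed simp
  moreover have "(p, x) \<in> ?D\<^sup>*" "(y, q) \<in> ?D\<^sup>*" using l1(2)[of x y] l1(4)[of y x] pq by simp_all
  ultimately have "(p, q) \<in> ?D\<^sup>*" by (meson rtrancl_trans)
  then show ?thesis using pq by blast
qed

end

text \<open>A violation in \<open>H'\<close> becomes one in \<open>liftset H'\<close>: the edge
  still has one face on both sides by \<open>orb_lift\<close>, and it is still no bridge by
  \<open>bridge_lift\<close>.\<close>

theorem planar_contraction:
  assumes pl: "planar_rot \<kappa> A"
  shows "planar_rot \<kappa>' A'"
  unfolding planar_rot_def
proof (intro allI impI notI)
  fix H' x y
  assume H': "H' \<subseteq> A'" "sym H'" "(x, y) \<in> H'" "((x, y), (y, x)) \<in> orb \<kappa>' H'" "(x, y) \<in> (del x y H')\<^sup>*"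
  obtain p q where pq: "lift (x, y) = (p, q)" "(p, q) \<in> (del p q (liftset H'))\<^sup>*"
    using bridge_lift[OF H'(1-3,5)] by blast
  have "lift (y, x) = (q, p)" using lift_swap[of y x] pq by simp
  then have "((p, q), (q, p)) \<in> orb \<kappa> (liftset H')" using orb_lift[OF H'(1,2,4,3)] pq by simp
  moreover have "(p, q) \<in> liftset H'" using H'(3) pq(1) by (metis image_eqI insertCI liftset_def)
  ultimately show False
    using pl liftset_sub[OF H'(1,2)] liftset_sym[OF H'(1,2)] pq(2) unfolding planar_rot_def by blast
qed

text \<open>A set \<open>S\<close> containing \<open>u\<close> is compared with
  \<open>insert v S\<close>, whose bound is larger by 4 arcs. If \<open>a\<close> is in
  \<open>S\<close>, four arcs disappear. If not, only two do, and the other two come from the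
  absence of blockers together with parity.\<close>

theorem laman_contraction:
  assumes L: "laman_arcs V A" and nb: "\<And>X. \<not> blocker V A u v a X" and n: "card V \<ge> 3"
  shows "laman_arcs (V - {v}) A'"
proof -
  have fin: "finite V" and AV: "A \<subseteq> V \<times> V" and cA: "card A + 6 = 4 * card V" using laman_D[OF L] by simp_all
  have uvV: "u \<in> V" "v \<in> V" "a \<in> V" using AV arcs_u[of v] arcs_u[of a] by auto
  have A'V: "A' \<subseteq> (V - {v}) \<times> (V - {v})"
  proof
    fix d assume d: "d \<in> A'"
    obtain x y where xy: "d = (x, y)" by force
    have "lift d \<in> V \<times> V" using lift_in[OF d] AV by auto
    then show "d \<in> (V - {v}) \<times> (V - {v})"
      using d uvV arcs_v AV unfolding xy by (auto simp: lift_def A'_def split: if_splits)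
  qed
  have c4: "card {(u, v), (v, u), (v, a), (a, v)} = 4" using dist by auto
  have sub4: "{(u, v), (v, u), (v, a), (a, v)} \<subseteq> A" using arcs_u arcs_v arcs_u' arcs_v' by auto
  have cA': "card A' + 4 = card A"
  proof -
    have "card A' = card (lift ` A')" by (rule card_image[OF lift_inj, symmetric])
    also have "\<dots> = card A - 4" unfolding lift_image using card_Diff_subset[OF _ sub4] c4 by simp
    finally show ?thesis using card_mono[OF finA sub4] c4 by linarith
  qed
  have cV: "card (V - {v}) + 1 = card V" using fin uvV(2) n by simp
  have sparse: "card (A' \<inter> S \<times> S) + 6 \<le> 4 * card S" if S: "S \<subseteq> V - {v}" "card S \<ge> 2" for S
  proof (cases "u \<in> S")
    case False
    have "A' \<inter> S \<times> S \<subseteq> A \<inter> S \<times> S" using False by (auto simp: A'_def)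
    then have "card (A' \<inter> S \<times> S) \<le> card (A \<inter> S \<times> S)" using finA by (intro card_mono) auto
    moreover have "S \<subseteq> V" using S by auto
    ultimately show ?thesis using laman_sparse[OF L, of S] S by linarith
  next
    case True
    let ?S = "insert v S"
    have finS: "finite S" using S fin finite_subset by blast
    have cS: "card ?S = card S + 1" using finS S(1) by (simp add: subset_Diff_insert)
    have SV: "?S \<subseteq> V" using S uvV by auto
    let ?E = "if a \<in> S then {(u, v), (v, u), (v, a), (a, v)} else {(u, v), (v, u)}"
    have E: "?E \<subseteq> A \<inter> ?S \<times> ?S" using sub4 True by auto
    have "lift ` (A' \<inter> S \<times> S) \<subseteq> A \<inter> ?S \<times> ?S - ?E"
    proof (rule image_subsetI)
      fix d assume d: "d \<in> A' \<inter> S \<times> S"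
      obtain x y where xy: "d = (x, y)" by force
      have dA: "d \<in> A'" using d by blast
      have "lift d \<in> A" "lift d \<notin> ?E" using lift_in[OF dA] lift_not_v[OF dA] by simp_all
      moreover have "lift d \<in> ?S \<times> ?S" using d True unfolding xy lift_def by simp
      ultimately show "lift d \<in> A \<inter> ?S \<times> ?S - ?E" by blast
    qed
    then have "card (lift ` (A' \<inter> S \<times> S)) \<le> card (A \<inter> ?S \<times> ?S - ?E)" using finA by (intro card_mono) auto
    moreover have "card (lift ` (A' \<inter> S \<times> S)) = card (A' \<inter> S \<times> S)"
      using lift_inj by (intro card_image) (auto intro: inj_on_subset)
    moreover have "card (A \<inter> ?S \<times> ?S - ?E) = card (A \<inter> ?S \<times> ?S) - card ?E"
      using card_Diff_subset[OF _ E] by simp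
    moreover have "card ?E \<le> card (A \<inter> ?S \<times> ?S)" using E finA by (intro card_mono) auto
    ultimately have le: "card (A' \<inter> S \<times> S) + card ?E \<le> card (A \<inter> ?S \<times> ?S)" by linarith
    have sp: "card (A \<inter> ?S \<times> ?S) + 6 \<le> 4 * card ?S" using laman_sparse[OF L SV] cS S by simp
    show ?thesis
    proof (cases "a \<in> S")
      case True
      then show ?thesis using le sp cS c4 by simp
    next
      case aS: False
      have "card {(u, v), (v, u)} = 2" using dist by simp
      then have le2: "card (A' \<inter> S \<times> S) + 2 \<le> card (A \<inter> ?S \<times> ?S)" using le aS by simp
      have "\<not> tight A ?S"
      proof
        assume "tight A ?S"
        then have "blocker V A u v a ?S" using SV cS S True aS dist by (auto simp: blocker_def)
        then show False using nb by blast
      qed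
      then have "card (A \<inter> ?S \<times> ?S) + 6 \<noteq> 4 * card ?S" using cS S by (auto simp: tight_def)
      moreover have "even (card (A \<inter> ?S \<times> ?S))" by (rule even_card_induced[OF L])
      ultimately have "card (A \<inter> ?S \<times> ?S) + 8 \<le> 4 * card ?S" using sp by (auto elim!: evenE) presburger
      then show ?thesis using le2 cS by simp
    qed
  qed
  have "irrefl A'" using A'_irrefl by (auto simp: irrefl_def)
  then show ?thesis unfolding laman_arcs_def
    using fin A'V A'_sym cV n cA' cA sparse by auto
qed

end

lemma contraction_ex:
  assumes L: "laman_arcs V A" and rg: "rot_graph \<kappa> A" and tri: "facial_triangle \<kappa> A u v a"
    and nb: "\<And>X. \<not> blocker V A u v a X"
  obtains B C ku kv where "contraction A \<kappa> u v a B C ku kv"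
proof -
  have arcs: "(u, v) \<in> A" "(v, a) \<in> A" "(a, u) \<in> A" "(v, u) \<in> A" "(a, v) \<in> A" "(u, a) \<in> A"
    using tri rg_swap[OF rg] by (auto simp: facial_triangle_def)
  have ne: "u \<noteq> v" "v \<noteq> a" "a \<noteq> u" using arcs rg_irr[OF rg] by metis+
  have nx: "nxt (\<kappa> u) (A `` {u}) v = a" "nxt (\<kappa> v) (A `` {v}) a = u" "nxt (\<kappa> a) (A `` {a}) u = v"
    using tri by (auto simp: facial_triangle_def)
  define B where "B = A `` {u} - {v, a}"
  define C where "C = A `` {v} - {u, a}"
  have Nu: "A `` {u} = insert v (insert a B)" and Nv: "A `` {v} = insert u (insert a C)"
    using arcs by (auto simp: B_def C_def)
  \<comment> \<open>A common neighbour other than \<open>a\<close> would form a tight triangle with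
    \<open>u\<close> and \<open>v\<close>, which is a blocker.\<close>
  have BC: "B \<inter> C = {}"
  proof (rule ccontr)
    assume "B \<inter> C \<noteq> {}"
    then obtain b where b: "(u, b) \<in> A" "(v, b) \<in> A" "b \<noteq> a" "b \<noteq> u" "b \<noteq> v" by (auto simp: B_def C_def)
    let ?X = "{u, v, b}"
    have V: "finite V" "?X \<subseteq> V" using laman_D[OF L] b arcs by auto
    have "{(u, v), (v, u), (u, b), (b, u), (v, b), (b, v)} \<subseteq> A \<inter> ?X \<times> ?X"
      using arcs b rg_swap[OF rg] by auto
    moreover have "card {(u, v), (v, u), (u, b), (b, u), (v, b), (b, v)} = 6" using ne b by auto
    moreover have "finite (A \<inter> ?X \<times> ?X)" by auto
    ultimately have "card (A \<inter> ?X \<times> ?X) \<ge> 6" using card_mono by metis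
    moreover have c3: "card ?X = 3" using ne b by auto
    ultimately have "tight A ?X" using laman_sparse[OF L V(2)] by (simp add: tight_def)
    then have "blocker V A u v a ?X" using V c3 b ne by (auto simp: blocker_def)
    then show False using nb by blast
  qed
  note finN = rg_finN[OF rg] and injN = rg_inj[OF rg]
  obtain ku where ku: "ku a = 0" "\<And>x. x \<in> A `` {u} \<Longrightarrow> 0 \<le> ku x \<and> ku x < (1::real)" "inj_on ku (A `` {u})"
    "\<And>x y z. x \<in> A `` {u} \<Longrightarrow> y \<in> A `` {u} \<Longrightarrow> z \<in> A `` {u} \<Longrightarrow>
       cyc (\<kappa> u x) (\<kappa> u y) (\<kappa> u z) \<longleftrightarrow> cyc (ku x) (ku y) (ku z)"
    using cyc_cut[OF finN injN, of a u] arcs by auto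
  obtain kv where kv: "kv u = 0" "\<And>x. x \<in> A `` {v} \<Longrightarrow> 0 \<le> kv x \<and> kv x < (1::real)" "inj_on kv (A `` {v})"
    "\<And>x y z. x \<in> A `` {v} \<Longrightarrow> y \<in> A `` {v} \<Longrightarrow> z \<in> A `` {v} \<Longrightarrow>
       cyc (\<kappa> v x) (\<kappa> v y) (\<kappa> v z) \<longleftrightarrow> cyc (kv x) (kv y) (kv z)"
    using cyc_cut[OF finN injN, of u v] arcs by auto
  have kupos: "0 < ku x" if "x \<in> A `` {u}" "x \<noteq> a" for x
    using ku(1) ku(2)[OF that(1)] inj_onD[OF ku(3), of x a] that arcs by force
  have kvpos: "0 < kv x" if "x \<in> A `` {v}" "x \<noteq> u" for x
    using kv(1) kv(2)[OF that(1)] inj_onD[OF kv(3), of x u] that arcs by force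
  have kuB: "0 < ku b \<and> ku b < ku v" if b: "b \<in> B" for b
  proof -
    have bN: "b \<in> A `` {u}" "b \<noteq> a" "b \<noteq> v" using b by (auto simp: B_def)
    have "\<not> cyc (\<kappa> u v) (\<kappa> u b) (\<kappa> u a)" using nxt_not_cyc[OF finN, of v u b "\<kappa> u"] nx(1) arcs bN by auto
    then have "\<not> cyc (ku v) (ku b) 0" using ku(4)[of v b a] ku(1) bN arcs by auto
    moreover have "ku b \<noteq> ku v" using inj_onD[OF ku(3), of b v] bN arcs by auto
    ultimately show ?thesis using kupos[OF bN(1,2)] kupos[of v] arcs ne by (auto simp: cyc_def)
  qed
  have kvC: "0 < kv c \<and> kv c < kv a" if c: "c \<in> C" for c
  proof -
    have cN: "c \<in> A `` {v}" "c \<noteq> u" "c \<noteq> a" using c by (auto simp: C_def)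
    have "\<not> cyc (\<kappa> v a) (\<kappa> v c) (\<kappa> v u)" using nxt_not_cyc[OF finN, of a v c "\<kappa> v"] nx(2) arcs cN by auto
    then have "\<not> cyc (kv a) (kv c) 0" using kv(4)[of a c u] kv(1) cN arcs by auto
    moreover have "kv c \<noteq> kv a" using inj_onD[OF kv(3), of c a] cN arcs by auto
    ultimately show ?thesis using kvpos[OF cN(1,2)] kvpos[of a] arcs ne by (auto simp: cyc_def)
  qed
  have "contraction A \<kappa> u v a B C ku kv"
  proof (rule contraction.intro[OF rg Nu Nv _ _ _ _ BC ku(4) kv(4) ku(1) kuB _ _ kv(1) kvC _ _ ku(3) kv(3) nx(3)])
    show "a \<notin> B" "v \<notin> B" "a \<notin> C" "u \<notin> C" by (simp_all add: B_def C_def)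
    show "0 < ku v" "ku v < 1" using kupos[of v] ku(2)[of v] arcs ne by auto
    show "0 < kv a" "kv a < 1" using kvpos[of a] kv(2)[of a] arcs ne by auto
  qed
  then show ?thesis by (rule that)
qed

section \<open>Splitting a pointed vertex\<close>

definition crs :: "complex \<Rightarrow> complex \<Rightarrow> real" where
  "crs z w = Re z * Im w - Im z * Re w"

lemma crs_simps: "crs (x + y) z = crs x z + crs y z" "crs z (x + y) = crs z x + crs z y"
  "crs (- x) y = - crs x y" "crs x (- y) = - crs x y" "crs x x = 0"
  "crs (r *\<^sub>R x) y = r * crs x y" "crs x (r *\<^sub>R y) = r * crs x y"
  "crs (x - y) z = crs x z - crs y z" "crs z (x - y) = crs z x - crs z y"
  by (auto simp: crs_def algebra_simps)

lemma crs_swap: "crs x y = - crs y x"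
  by (simp add: crs_def)

text \<open>Within an open half plane, positive cross product is transitive. The identity used is
  the linear relation between three plane vectors, paired with \<open>g\<close>.\<close>

lemma crs_trans:
  assumes "g \<bullet> x > 0" "g \<bullet> y > 0" "g \<bullet> z > 0" "crs x y > 0" "crs y z > 0"
  shows "crs x z > 0"
proof -
  have "(g \<bullet> y) * crs x z = (g \<bullet> z) * crs x y + (g \<bullet> x) * crs y z"
    by (simp add: crs_def inner_complex_def algebra_simps)
  also have "\<dots> > 0" using assms by (simp add: add_pos_pos)
  finally show ?thesis using assms(2) by (simp add: zero_less_mult_iff)
qed

lemma crs_rot: "crs (- (\<i> * g)) x = g \<bullet> x" "(\<i> * d) \<bullet> x = crs d x" "(- (\<i> * d)) \<bullet> x = - crs d x"
  by (auto simp: crs_def inner_complex_def)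

text \<open>Three distinct directions in counterclockwise order have at most one angle of a half
  turn or more between successive ones. So the order is recognised by two positive cross products,
  an open condition.\<close>

definition ccw3 :: "complex \<Rightarrow> complex \<Rightarrow> complex \<Rightarrow> bool" where
  "ccw3 x y z \<longleftrightarrow> crs x y > 0 \<and> crs y z > 0 \<or> crs y z > 0 \<and> crs z x > 0 \<or> crs z x > 0 \<and> crs x y > 0"

lemma ccw3_rotate: "ccw3 x y z \<longleftrightarrow> ccw3 y z x"
  by (auto simp: ccw3_def)

text \<open>Tilting the normal slightly towards \<open>d\<close> takes \<open>d\<close> off the
  border of the half plane; the finitely many strict inequalities on \<open>D\<close>
  survive.\<close>

lemma open_halfplane_insert:
  fixes g :: "'b::euclidean_space"
  assumes fin: "finite D" and D: "\<And>x. x \<in> D \<Longrightarrow> g \<bullet> x > 0" and d: "g \<bullet> d \<ge> 0" "d \<noteq> 0"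
  obtains g' where "g' \<bullet> d > 0" "\<And>x. x \<in> D \<Longrightarrow> g' \<bullet> x > 0"
proof -
  have "\<forall>\<^sub>F h in at_right (0::real). \<forall>x\<in>D. (g + h *\<^sub>R d) \<bullet> x > 0"
  proof (rule eventually_ball_finite[OF fin], intro ballI)
    fix x assume x: "x \<in> D"
    have "((\<lambda>h. (g + h *\<^sub>R d) \<bullet> x) \<longlongrightarrow> (g + 0 *\<^sub>R d) \<bullet> x) (at_right 0)"
      by (intro tendsto_intros)
    then show "\<forall>\<^sub>F h in at_right 0. (g + h *\<^sub>R d) \<bullet> x > 0"
      using D[OF x] by (intro order_tendstoD(1)) auto
  qed
  moreover have "\<forall>\<^sub>F h in at_right (0::real). h > 0" by (simp add: eventually_at_right_less)
  ultimately have "\<forall>\<^sub>F h in at_right (0::real). h > 0 \<and> (\<forall>x\<in>D. (g + h *\<^sub>R d) \<bullet> x > 0)"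
    by (rule eventually_conj[rotated])
  then obtain h where h: "h > 0" "\<forall>x\<in>D. (g + h *\<^sub>R d) \<bullet> x > 0"
    using eventually_happens'[OF trivial_limit_at_right_real] by blast
  have "(g + h *\<^sub>R d) \<bullet> d > 0" using d h(1) by (simp add: inner_add_left add_nonneg_pos)
  then show ?thesis using h(2) by (intro that[of "g + h *\<^sub>R d"]) auto
qed

context contraction
begin

lemma finB: "finite B" "finite C"
  using rg_finN[OF rg, of u] rg_finN[OF rg, of v] Nu Nv by auto

lemma key_max_B: "B \<noteq> {} \<Longrightarrow> \<exists>m\<in>B. \<forall>b\<in>B. b \<noteq> m \<longrightarrow> ku b < ku m"
proof -
  assume ne: "B \<noteq> {}"
  have "Max (ku ` B) \<in> ku ` B" using finB ne by (intro Max_in) auto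
  then obtain m where m: "m \<in> B" "ku m = Max (ku ` B)" by auto
  have "ku b < ku m" if "b \<in> B" "b \<noteq> m" for b
  proof -
    have "ku b \<le> ku m" using m(2) that finB by simp
    moreover have "ku b \<noteq> ku m" using inj_onD[OF inju, of b m] that m(1) Nu by auto
    ultimately show ?thesis by simp
  qed
  then show ?thesis using m(1) by blast
qed

lemma key_min_C: "C \<noteq> {} \<Longrightarrow> \<exists>m\<in>C. \<forall>c\<in>C. c \<noteq> m \<longrightarrow> kv m < kv c"
proof -
  assume ne: "C \<noteq> {}"
  have "Min (kv ` C) \<in> kv ` C" using finB ne by (intro Min_in) auto
  then obtain m where m: "m \<in> C" "kv m = Min (kv ` C)" by auto
  have "kv m < kv c" if "c \<in> C" "c \<noteq> m" for c
  proof -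
    have "kv m \<le> kv c" using m(2) that finB by simp
    moreover have "kv m \<noteq> kv c" using inj_onD[OF injv, of c m] that m(1) Nv by auto
    ultimately show ?thesis by simp
  qed
  then show ?thesis using m(1) by blast
qed

text \<open>The merged neighbours have the cyclic order \<open>a\<close>, \<open>B\<close>,
  \<open>C\<close> inside an open half plane. Its reflex angle falls between \<open>B\<close> and
  \<open>C\<close>, or before or inside \<open>B\<close>, or inside or after \<open>C\<close>; these
  are the three cases. The direction \<open>d\<close> from \<open>u\<close> to \<open>v\<close> must
  leave \<open>a\<close>, \<open>B\<close>, \<open>d\<close> at \<open>u\<close> and
  \<open>- d\<close>, \<open>C\<close>, \<open>a\<close> at \<open>v\<close> in this order and in
  open half planes. The condition on products keeps the two fans apart, and
  \<open>crs d (e a) > 0\<close> orders \<open>u\<close> and \<open>v\<close> as seen from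
  \<open>a\<close>.\<close>

lemma split_direction:
  fixes e :: "'a \<Rightarrow> complex"
  assumes g: "\<And>x. x \<in> A' `` {u} \<Longrightarrow> g \<bullet> e x > 0"
    and nz: "\<And>x y. x \<in> A' `` {u} \<Longrightarrow> y \<in> A' `` {u} \<Longrightarrow> x \<noteq> y \<Longrightarrow> crs (e x) (e y) \<noteq> 0"
    and ord: "\<And>x y z. x \<in> A' `` {u} \<Longrightarrow> y \<in> A' `` {u} \<Longrightarrow> z \<in> A' `` {u} \<Longrightarrow>
      cyc (\<kappa>' u x) (\<kappa>' u y) (\<kappa>' u z) \<Longrightarrow> ccw3 (e x) (e y) (e z)"
  obtains d gu gv where
    "gu \<bullet> d > 0" "\<And>x. x \<in> insert a B \<Longrightarrow> gu \<bullet> e x > 0"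
    "gv \<bullet> (- d) > 0" "\<And>x. x \<in> insert a C \<Longrightarrow> gv \<bullet> e x > 0"
    "\<And>x y. x \<in> insert a B \<Longrightarrow> y \<in> insert a B \<Longrightarrow> ku x < ku y \<Longrightarrow> ccw3 (e x) (e y) d"
    "\<And>x y. x \<in> insert a C \<Longrightarrow> y \<in> insert a C \<Longrightarrow> kv x < kv y \<Longrightarrow> ccw3 (- d) (e x) (e y)"
    "\<And>b c. b \<in> insert a B \<Longrightarrow> c \<in> insert a C \<Longrightarrow> \<not> (b = a \<and> c = a) \<Longrightarrow>
       crs d (e c) * crs (e b) (e c) < 0 \<or> crs (e b) d * crs (e b) (e c) > 0"
    "crs d (e a) > 0" "\<And>x. x \<in> insert a B \<union> C \<Longrightarrow> crs d (e x) \<noteq> 0"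
proof -
  have aN: "a \<in> A' `` {u}" and BN: "\<And>b. b \<in> B \<Longrightarrow> b \<in> A' `` {u}" and CN: "\<And>c. c \<in> C \<Longrightarrow> c \<in> A' `` {u}"
    using N'u by auto
  have ga: "g \<bullet> e a > 0" and gB: "\<And>b. b \<in> B \<Longrightarrow> g \<bullet> e b > 0" and gC: "\<And>c. c \<in> C \<Longrightarrow> g \<bullet> e c > 0"
    using g aN BN CN by auto
  have keya: "\<kappa>' u a = 0" using \<kappa>'_u(1)[of a] nC kua by simp
  have keyB: "\<kappa>' u b = ku b" "0 < ku b" "ku b < 1" if "b \<in> B" for b
    using \<kappa>'_u(1)[of b] that BC ku(1)[OF that] ku(3) by auto
  have keyC: "\<kappa>' u c = 1 + kv c" "0 < kv c" if "c \<in> C" for c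
    using \<kappa>'_u(2)[OF that] kv(1)[OF that] by auto
  have pos: "0 < \<kappa>' u x" if "x \<in> B \<union> C" for x using that keyB[of x] keyC[of x] by auto
  have T: "ccw3 (e a) (e x) (e y)" if "x \<in> B \<union> C" "y \<in> B \<union> C" "\<kappa>' u x < \<kappa>' u y" for x y
    using ord[OF aN, of x y] that BN CN pos[of x] keya by (auto simp: cyc_def)
  have T1: "crs (e x) (e y) > 0" "crs (e y) (e a) > 0"
    if "x \<in> B \<union> C" "y \<in> B \<union> C" "\<kappa>' u x < \<kappa>' u y" "crs (e x) (e a) > 0" for x y
    using T[OF that(1-3)] that(4) crs_swap[of "e a" "e x"] by (auto simp: ccw3_def)
  have T2: "crs (e a) (e x) > 0" "crs (e x) (e y) > 0"
    if "x \<in> B \<union> C" "y \<in> B \<union> C" "\<kappa>' u x < \<kappa>' u y" "crs (e a) (e y) > 0" for x y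
    using T[OF that(1-3)] that(4) crs_swap[of "e a" "e y"] by (auto simp: ccw3_def)
  have neg: "\<not> crs (e x) (e a) > 0 \<Longrightarrow> crs (e a) (e x) > 0" "\<not> crs (e a) (e x) > 0 \<Longrightarrow> crs (e x) (e a) > 0"
    if "x \<in> B \<union> C" for x
    using nz[of x a] nz[OF aN, of x] that aN BN CN nB nC crs_swap[of "e a" "e x"] by fastforce+
  have BltC: "\<kappa>' u b < \<kappa>' u c" if "b \<in> B" "c \<in> C" for b c
    using keyB[OF that(1)] keyC[OF that(2)] by simp
  have finD: "finite (e ` insert a B)" "finite (e ` insert a C)" using finB by auto
  consider (1) "\<forall>b\<in>B. crs (e a) (e b) > 0" "\<forall>c\<in>C. crs (e c) (e a) > 0"
    | (2) "\<exists>b\<in>B. crs (e b) (e a) > 0" | (3) "\<exists>c\<in>C. crs (e a) (e c) > 0"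
    using neg by (metis UnI1 UnI2)
  then show ?thesis
  proof cases
    case 1
    \<comment> \<open>Reflex angle between \<open>B\<close> and \<open>C\<close>: \<open>d\<close>
      runs along the border of the half plane, clockwise from all neighbours. Both fans, with
      \<open>d\<close> and \<open>- d\<close> added, lie in the closed half plane, which is tilted
      one way for \<open>u\<close> and the other way for \<open>v\<close>.\<close>
    define d where "d = - (\<i> * g)"
    have dx: "crs d x = g \<bullet> x" for x by (simp add: d_def crs_rot)
    have gd: "g \<bullet> d = 0" by (simp add: d_def inner_complex_def)
    have d0: "d \<noteq> 0" using dx[of "e a"] ga by (auto simp: crs_def)
    obtain gu where gu: "gu \<bullet> d > 0" "\<And>x. x \<in> e ` insert a B \<Longrightarrow> gu \<bullet> x > 0"
      using open_halfplane_insert[OF finD(1), of g d] ga gB gd d0 by auto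
    obtain gv where gv: "gv \<bullet> (- d) > 0" "\<And>x. x \<in> e ` insert a C \<Longrightarrow> gv \<bullet> x > 0"
      using open_halfplane_insert[OF finD(2), of g "- d"] ga gC gd d0 by auto
    have oB: "crs (e x) (e y) > 0" if "x \<in> insert a B" "y \<in> insert a B" "ku x < ku y" for x y
    proof -
      have "y \<in> B" using that kua keyB(2)[of x] by auto
      then show ?thesis using that 1 T2(2)[of x y] keyB(1)[of x] keyB(1)[of y] by auto
    qed
    have oC: "crs (e x) (e y) > 0" if "x \<in> insert a C" "y \<in> insert a C" "kv x < kv y" for x y
    proof -
      have "x \<in> C" using that kv(1)[of y] by auto
      then show ?thesis using that 1 T1(1)[of x y] keyC(1)[of x] keyC(1)[of y] by auto
    qed
    show ?thesis
    proof (rule that[of gu d gv])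
      show "ccw3 (e x) (e y) d" if "x \<in> insert a B" "y \<in> insert a B" "ku x < ku y" for x y
        using oB[OF that] dx[of "e x"] that ga gB by (auto simp: ccw3_def)
      show "ccw3 (- d) (e x) (e y)" if "x \<in> insert a C" "y \<in> insert a C" "kv x < kv y" for x y
        using oC[OF that] dx[of "e y"] that ga gC crs_swap[of "e y" d] by (auto simp: ccw3_def crs_simps)
      show "crs d (e c) * crs (e b) (e c) < 0 \<or> crs (e b) d * crs (e b) (e c) > 0"
        if bc: "b \<in> insert a B" "c \<in> insert a C" "\<not> (b = a \<and> c = a)" for b c
      proof -
        have "crs (e c) (e b) > 0"
          using bc 1 crs_trans[OF gC[of c] ga gB[of b]] by auto
        then have "crs (e b) (e c) < 0" using crs_swap[of "e b" "e c"] by simp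
        moreover have "crs d (e c) > 0" using dx bc ga gC by auto
        ultimately show ?thesis by (simp add: mult_pos_neg)
      qed
    qed (use gu gv dx ga gB gC in \<open>auto simp: less_le\<close>)
  next
    case 2
    then obtain b0 where b0: "b0 \<in> B" "crs (e b0) (e a) > 0" by blast
    obtain b1 where b1: "b1 \<in> B" "\<And>b. b \<in> B \<Longrightarrow> b \<noteq> b1 \<Longrightarrow> ku b < ku b1" using key_max_B b0 by blast
    have b1a: "crs (e b1) (e a) > 0"
      using b0 T1(2)[of b0 b1] b1(1) b1(2)[OF b0(1)] keyB(1)[of b0] keyB(1)[of b1] by (cases "b0 = b1") auto
    have b1C: "crs (e b1) (e c) > 0" "crs (e c) (e a) > 0" if "c \<in> C" for c
      using T1[of b1 c] BltC[OF b1(1) that] b1a b1(1) that by auto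
    obtain m where m: "m \<in> insert a C" "\<And>c. c \<in> insert a C \<Longrightarrow> crs (e m) (e c) \<ge> 0" "C \<noteq> {} \<Longrightarrow> m \<in> C"
    proof (cases "C = {}")
      case True
      then show ?thesis using that[of a] by (auto simp: crs_simps)
    next
      case False
      then obtain m where m: "m \<in> C" "\<forall>c\<in>C. c \<noteq> m \<longrightarrow> kv m < kv c" using key_min_C by blast
      have "crs (e m) (e c) \<ge> 0" if c: "c \<in> insert a C" for c
      proof -
        consider "c = a" | "c = m" | "c \<in> C" "c \<noteq> m" using c by blast
        then show ?thesis
        proof cases
          case 3
          then have "crs (e m) (e c) > 0"
            using T1(1)[of m c] m b1C(2)[OF m(1)] keyC(1)[of m] keyC(1)[of c] by auto
          then show ?thesis by simp
        qed (use b1C(2)[OF m(1)] in \<open>auto simp: crs_simps\<close>)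
      qed
      then show ?thesis using that m(1) by blast
    qed
    \<comment> \<open>Counterclockwise, the half plane shows a final part of \<open>B\<close>, then
      \<open>C\<close>, \<open>a\<close> and the rest of \<open>B\<close>. The vector
      \<open>d\<close> is put between the last element of \<open>B\<close> and the first of
      \<open>C\<close> (or \<open>a\<close> if \<open>C\<close> is empty). So \<open>u\<close> keeps
      \<open>g\<close>, and the fan of \<open>v\<close> lies to the left of
      \<open>d\<close>.\<close>
    define d where "d = e b1 + e m"
    have gd: "g \<bullet> d > 0" using gB[OF b1(1)] ga gC m(1) by (auto simp: d_def inner_add_right add_pos_pos)
    have dC: "crs d (e c) > 0" if "c \<in> insert a C" for c
      using m(2)[OF that] b1C(1)[of c] b1a that by (auto simp: d_def crs_simps add_pos_nonneg)
    have Bm: "crs (e b) d > 0" "crs (e b) (e c) > 0" if "b \<in> B" "crs (e b) (e a) > 0" "c \<in> insert a C" for b c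
    proof -
      have *: "crs (e b) (e c) > 0" if "c \<in> insert a C" for c
        using T1(1)[of b c] BltC[of b c] \<open>b \<in> B\<close> \<open>crs (e b) (e a) > 0\<close> that by auto
      then show "crs (e b) (e c) > 0" using that by blast
      have "crs (e b) (e b1) \<ge> 0"
        using T1(1)[of b b1] b1 that keyB(1)[of b] keyB(1)[of b1] by (cases "b = b1") (auto simp: crs_simps less_imp_le)
      then show "crs (e b) d > 0" using *[OF m(1)] by (simp add: d_def crs_simps)
    qed
    have Bp: "crs d (e b) > 0" if "b \<in> B" "\<not> crs (e b) (e a) > 0" for b
      using crs_trans[OF gd ga gB[OF that(1)] dC] neg(1)[of b] that by auto
    have d0: "d \<noteq> 0" using gd by auto
    obtain gv where gv: "gv \<bullet> (- d) > 0" "\<And>x. x \<in> e ` insert a C \<Longrightarrow> gv \<bullet> x > 0"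
      using open_halfplane_insert[OF finD(2), of "\<i> * d" "- d"] dC d0 by (auto simp: crs_rot crs_simps)
    have oC: "crs (e x) (e y) > 0" if "x \<in> insert a C" "y \<in> insert a C" "kv x < kv y" for x y
    proof -
      have "x \<in> C" using that kv(1)[of y] by auto
      then show ?thesis using that T1(1)[of x y] b1C(2) keyC(1)[of x] keyC(1)[of y] by auto
    qed
    show ?thesis
    proof (rule that[of g d gv])
      show "ccw3 (e x) (e y) d" if xy: "x \<in> insert a B" "y \<in> insert a B" "ku x < ku y" for x y
      proof -
        have yB: "y \<in> B" using xy kua keyB(2)[of x] by auto
        have xd: "crs d (e x) > 0" if "\<not> (x \<in> B \<and> crs (e x) (e a) > 0)" using Bp[of x] dC[of a] that xy by auto
        have xB: "crs (e y) (e a) > 0 \<and> crs (e x) (e y) > 0" if "x \<in> B" "crs (e x) (e a) > 0"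
          using T1[of x y] that yB xy(3) keyB(1)[of x] keyB(1)[of y] by auto
        have yp: "crs (e x) (e y) > 0" if "\<not> crs (e y) (e a) > 0"
          using neg(1)[of y] T2(2)[of x y] that yB xy keyB(1)[of x] keyB(1)[of y] by auto
        show ?thesis
          using xd xB yp Bm(1)[OF yB _ insertI1] unfolding ccw3_def by blast
      qed
      show "ccw3 (- d) (e x) (e y)" if "x \<in> insert a C" "y \<in> insert a C" "kv x < kv y" for x y
        using oC[OF that] dC[OF that(2)] crs_swap[of "e y" d] by (auto simp: ccw3_def crs_simps)
      show "crs d (e c) * crs (e b) (e c) < 0 \<or> crs (e b) d * crs (e b) (e c) > 0"
        if bc: "b \<in> insert a B" "c \<in> insert a C" "\<not> (b = a \<and> c = a)" for b c
      proof (cases "b \<in> B \<and> crs (e b) (e a) > 0")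
        case True
        then show ?thesis using Bm[of b c] bc by simp
      next
        case False
        then have "b = a \<or> crs (e a) (e b) > 0" using neg(1)[of b] bc by auto
        then have "crs (e c) (e b) > 0"
          using bc b1C(2)[of c] crs_trans[OF gC[of c] ga gB[of b]] by auto
        then have "crs (e b) (e c) < 0" using crs_swap[of "e b" "e c"] by simp
        then show ?thesis using dC[OF bc(2)] by (simp add: mult_pos_neg)
      qed
      show "crs d (e x) \<noteq> 0" if "x \<in> insert a B \<union> C" for x
        using that Bm(1)[of x a] Bp[of x] dC[of x] crs_swap[of "e x" d] by fastforce
    qed (use gd gv ga gB dC in auto)
  next
    case 3
    then obtain c0 where c0: "c0 \<in> C" "crs (e a) (e c0) > 0" by blast
    obtain c1 where c1: "c1 \<in> C" "\<And>c. c \<in> C \<Longrightarrow> c \<noteq> c1 \<Longrightarrow> kv c1 < kv c" using key_min_C c0 by blast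
    have c1a: "crs (e a) (e c1) > 0"
      using c0 T2(1)[of c1 c0] c1(1) c1(2)[OF c0(1)] keyC(1)[of c0] keyC(1)[of c1] by (cases "c0 = c1") auto
    have c1B: "crs (e a) (e b) > 0" "crs (e b) (e c1) > 0" if "b \<in> B" for b
      using T2[of b c1] BltC[OF that c1(1)] c1a c1(1) that by auto
    obtain m where m: "m \<in> insert a B" "\<And>b. b \<in> insert a B \<Longrightarrow> crs (e b) (e m) \<ge> 0"
    proof (cases "B = {}")
      case True
      then show ?thesis using that[of a] by (auto simp: crs_simps)
    next
      case False
      then obtain m where m: "m \<in> B" "\<forall>b\<in>B. b \<noteq> m \<longrightarrow> ku b < ku m" using key_max_B by blast
      have "crs (e b) (e m) \<ge> 0" if b: "b \<in> insert a B" for b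
      proof -
        consider "b = a" | "b = m" | "b \<in> B" "b \<noteq> m" using b by blast
        then show ?thesis
        proof cases
          case 3
          then have "crs (e b) (e m) > 0"
            using T2(2)[of b m] m c1B(1)[OF m(1)] keyB(1)[of m] keyB(1)[of b] by auto
          then show ?thesis by simp
        qed (use c1B(1)[OF m(1)] in \<open>auto simp: crs_simps\<close>)
      qed
      then show ?thesis using that m(1) by blast
    qed
    \<comment> \<open>The mirror case: counterclockwise, a final part of \<open>C\<close>, then
      \<open>a\<close>, \<open>B\<close> and the rest of \<open>C\<close>. Here \<open>- d\<close>
      is the vector \<open>f\<close> between the last element of \<open>B\<close> (or
      \<open>a\<close>) and the first of \<open>C\<close>. So \<open>v\<close> keeps
      \<open>g\<close>, and the fan of \<open>u\<close> lies to the right of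
      \<open>f\<close>.\<close>
    define f where "f = e m + e c1"
    have gf: "g \<bullet> f > 0" using gC[OF c1(1)] ga gB m(1) by (auto simp: f_def inner_add_right add_pos_pos)
    have Bf: "crs (e b) f > 0" if "b \<in> insert a B" for b
      using m(2)[OF that] c1B(2)[of b] c1a that by (auto simp: f_def crs_simps add_nonneg_pos)
    have Cp: "crs f (e c) > 0" "crs (e b) (e c) > 0" if "c \<in> C" "crs (e a) (e c) > 0" "b \<in> insert a B" for b c
    proof -
      have *: "crs (e b) (e c) > 0" if "b \<in> insert a B" for b
        using T2(2)[of b c] BltC[of b c] \<open>c \<in> C\<close> \<open>crs (e a) (e c) > 0\<close> that by auto
      then show "crs (e b) (e c) > 0" using that by blast
      have "crs (e c1) (e c) \<ge> 0"
        using T2(2)[of c1 c] c1 that keyC(1)[of c] keyC(1)[of c1] by (cases "c = c1") (auto simp: crs_simps less_imp_le)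
      then show "crs f (e c) > 0" using *[OF m(1)] by (simp add: f_def crs_simps)
    qed
    have Cm: "crs (e c) f > 0" "crs (e c) (e a) > 0" if "c \<in> C" "\<not> crs (e a) (e c) > 0" for c
      using crs_trans[OF gC[OF that(1)] ga gf _ Bf] neg(2)[of c] that by auto
    have f0: "f \<noteq> 0" using gf by auto
    obtain gu where gu: "gu \<bullet> (- f) > 0" "\<And>x. x \<in> e ` insert a B \<Longrightarrow> gu \<bullet> x > 0"
    proof -
      have "(\<i> * (- f)) \<bullet> x > 0" if "x \<in> e ` insert a B" for x
        using Bf that crs_swap[of f x] unfolding crs_rot by (auto simp: crs_simps)
      moreover have "(\<i> * (- f)) \<bullet> (- f) \<ge> 0" unfolding crs_rot by (simp add: crs_simps)
      ultimately show ?thesis using open_halfplane_insert[OF finD(1), of "\<i> * (- f)" "- f"] f0 that by auto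
    qed
    show ?thesis
    proof (rule that[of gu "- f" g])
      show "ccw3 (e x) (e y) (- f)" if xy: "x \<in> insert a B" "y \<in> insert a B" "ku x < ku y" for x y
      proof -
        have yB: "y \<in> B" using xy kua keyB(2)[of x] by auto
        have "crs (e x) (e y) > 0"
          using T2(2)[of x y] c1B(1) yB xy keyB(1)[of x] keyB(1)[of y] by auto
        then show ?thesis using Bf[OF xy(1)] crs_swap[of f "e x"] by (auto simp: ccw3_def crs_simps)
      qed
      show "ccw3 (- (- f)) (e x) (e y)" if xy: "x \<in> insert a C" "y \<in> insert a C" "kv x < kv y" for x y
      proof -
        have xC: "x \<in> C" using xy kv(1)[of y] by auto
        have yf: "crs (e y) f > 0" if "\<not> (y \<in> C \<and> crs (e a) (e y) > 0)" using Cm(1)[of y] Bf[of a] that xy by auto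
        have yC: "crs (e a) (e x) > 0 \<and> crs (e x) (e y) > 0" if "y \<in> C" "crs (e a) (e y) > 0"
          using T2[of x y] that xC xy(3) keyC(1)[of x] keyC(1)[of y] by auto
        have xm: "crs (e x) (e y) > 0" if "\<not> crs (e a) (e x) > 0"
          using Cm(2)[of x] T1(1)[of x y] that xC xy keyC(1)[of x] keyC(1)[of y] by auto
        show ?thesis
          using yf yC xm Cp(1)[OF xC _ insertI1] unfolding ccw3_def minus_minus by blast
      qed
      show "crs (- f) (e c) * crs (e b) (e c) < 0 \<or> crs (e b) (- f) * crs (e b) (e c) > 0"
        if bc: "b \<in> insert a B" "c \<in> insert a C" "\<not> (b = a \<and> c = a)" for b c
      proof (cases "c \<in> C \<and> crs (e a) (e c) > 0")
        case True
        then show ?thesis using Cp[of c b] bc by (simp add: crs_simps)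
      next
        case False
        then have "c = a \<or> crs (e c) (e a) > 0" using Cm(2)[of c] bc by auto
        then have "crs (e c) (e b) > 0"
          using bc c1B(1)[of b] crs_trans[OF gC[of c] ga gB[of b]] by auto
        then have "crs (e b) (e c) < 0" using crs_swap[of "e b" "e c"] by simp
        then show ?thesis using Bf[OF bc(1)] by (simp add: crs_simps mult_pos_neg)
      qed
      show "crs (- f) (e x) \<noteq> 0" if "x \<in> insert a B \<union> C" for x
        using that Bf[of x] Cp(1)[of x a] Cm(1)[of x] crs_swap[of "e x" f] by (fastforce simp: crs_simps)
      show "crs (- f) (e a) > 0" using Bf[of a] crs_swap[of "e a" f] by (simp add: crs_simps)
    qed (use gf gu ga gC in auto)
  qed
qed

end

text \<open>All geometric conditions are strict, hence stable under small motions of a vertex. That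
  edges with a common end meet nowhere else is encoded by the nonzero cross products.\<close>

definition good_drawing :: "'a set \<Rightarrow> ('a \<times> 'a) set \<Rightarrow> ('a \<Rightarrow> 'a \<Rightarrow> real) \<Rightarrow> ('a \<Rightarrow> complex) \<Rightarrow> bool" where
  "good_drawing V A \<kappa> p \<longleftrightarrow> inj_on p V \<and>
     (\<forall>x\<in>V. \<exists>g. \<forall>y\<in>A `` {x}. g \<bullet> (p y - p x) > 0) \<and>
     (\<forall>x y z. (x, y) \<in> A \<longrightarrow> (x, z) \<in> A \<longrightarrow> y \<noteq> z \<longrightarrow> crs (p y - p x) (p z - p x) \<noteq> 0) \<and>
     (\<forall>x i j k. (x, i) \<in> A \<longrightarrow> (x, j) \<in> A \<longrightarrow> (x, k) \<in> A \<longrightarrow> cyc (\<kappa> x i) (\<kappa> x j) (\<kappa> x k) \<longrightarrow>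
        ccw3 (p i - p x) (p j - p x) (p k - p x)) \<and>
     (\<forall>x y z w. (x, y) \<in> A \<longrightarrow> (z, w) \<in> A \<longrightarrow> {x, y} \<inter> {z, w} = {} \<longrightarrow>
        closed_segment (p x) (p y) \<inter> closed_segment (p z) (p w) = {})"

lemma tendsto_crs: "(f \<longlongrightarrow> x) F \<Longrightarrow> (h \<longlongrightarrow> y) F \<Longrightarrow> ((\<lambda>t. crs (f t) (h t)) \<longlongrightarrow> crs x y) F"
  unfolding crs_def by (intro tendsto_intros)

lemma eventually_crs_pos:
  "(f \<longlongrightarrow> x) F \<Longrightarrow> (h \<longlongrightarrow> y) F \<Longrightarrow> crs x y > 0 \<Longrightarrow> \<forall>\<^sub>F t in F. crs (f t) (h t) > 0"
  by (rule order_tendstoD(1)[OF tendsto_crs])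

lemma eventually_crs_nonzero:
  assumes "(f \<longlongrightarrow> x) F" "(h \<longlongrightarrow> y) F" "crs x y \<noteq> 0"
  shows "\<forall>\<^sub>F t in F. crs (f t) (h t) \<noteq> 0"
  using tendsto_imp_eventually_ne[OF tendsto_crs[OF assms(1,2)] assms(3)] .

lemma eventually_ccw3:
  assumes "(f \<longlongrightarrow> x) F" "(h \<longlongrightarrow> y) F" "(k \<longlongrightarrow> z) F" "ccw3 x y z"
  shows "\<forall>\<^sub>F t in F. ccw3 (f t) (h t) (k t)"
proof -
  consider "crs x y > 0 \<and> crs y z > 0" | "crs y z > 0 \<and> crs z x > 0" | "crs z x > 0 \<and> crs x y > 0"
    using assms(4) unfolding ccw3_def by blast
  then show ?thesis
  proof cases
    case 1
    then have "\<forall>\<^sub>F t in F. crs (f t) (h t) > 0" "\<forall>\<^sub>F t in F. crs (h t) (k t) > 0"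
      using eventually_crs_pos assms by blast+
    then show ?thesis by eventually_elim (simp add: ccw3_def)
  next
    case 2
    then have "\<forall>\<^sub>F t in F. crs (h t) (k t) > 0" "\<forall>\<^sub>F t in F. crs (k t) (f t) > 0"
      using eventually_crs_pos assms by blast+
    then show ?thesis by eventually_elim (simp add: ccw3_def)
  next
    case 3
    then have "\<forall>\<^sub>F t in F. crs (k t) (f t) > 0" "\<forall>\<^sub>F t in F. crs (f t) (h t) > 0"
      using eventually_crs_pos assms by blast+
    then show ?thesis by eventually_elim (simp add: ccw3_def)
  qed
qed

lemma ccw3_scale: "r > 0 \<Longrightarrow> ccw3 (r *\<^sub>R x) y z \<longleftrightarrow> ccw3 x y z"
  by (simp add: ccw3_def crs_simps zero_less_mult_iff)

text \<open>Moving one end of a segment moves each of its points by at most as much, and a compact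
  and a disjoint closed set have positive distance.\<close>

lemma eventually_segment_disjoint:
  fixes f :: "real \<Rightarrow> complex"
  assumes f: "(f \<longlongrightarrow> x) F" and S: "closed S" and dis: "closed_segment x y \<inter> S = {}"
  shows "\<forall>\<^sub>F t in F. closed_segment (f t) y \<inter> S = {}"
proof (cases "S = {}")
  case False
  have "setdist (closed_segment x y) S > 0"
    using setdist_gt_0_compact_closed[OF compact_segment S] dis False by blast
  then have "\<forall>\<^sub>F t in F. dist (f t) x < setdist (closed_segment x y) S"
    using f by (simp add: tendsto_iff)
  then show ?thesis
  proof eventually_elim
    fix t assume t: "dist (f t) x < setdist (closed_segment x y) S"
    show "closed_segment (f t) y \<inter> S = {}"
    proof (rule ccontr)
      assume "closed_segment (f t) y \<inter> S \<noteq> {}"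
      then obtain z where z: "z \<in> closed_segment (f t) y" "z \<in> S" by blast
      then obtain s where s: "0 \<le> s" "s \<le> 1" "z = (1 - s) *\<^sub>R f t + s *\<^sub>R y" by (auto simp: in_segment)
      let ?w = "(1 - s) *\<^sub>R x + s *\<^sub>R y"
      have "?w \<in> closed_segment x y" using s by (auto simp: in_segment)
      then have "setdist (closed_segment x y) S \<le> dist ?w z" using z(2) by (rule setdist_le_dist)
      also have "dist ?w z = norm ((1 - s) *\<^sub>R (x - f t))" by (simp add: s(3) dist_norm algebra_simps)
      also have "\<dots> \<le> dist (f t) x"
        using s by (simp add: dist_norm norm_minus_commute mult_left_le_one_le)
      finally show False using t by simp
    qed
  qed
qed simp

text \<open>The assumptions on \<open>d\<close>, \<open>gu\<close> and \<open>gv\<close> are the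
  conclusions of \<open>split_direction\<close> for the directions \<open>p x - p u\<close>.\<close>

locale splitting = contraction A \<kappa> u v a B C ku kv
  for A :: "('a \<times> 'a) set" and \<kappa> u v a B C ku kv +
  fixes V :: "'a set" and p :: "'a \<Rightarrow> complex" and d gu gv :: complex
  assumes finV: "finite V" and AV: "A \<subseteq> V \<times> V"
    and good: "good_drawing (V - {v}) A' \<kappa>' p"
    and d_gu: "gu \<bullet> d > 0" "\<And>x. x \<in> insert a B \<Longrightarrow> gu \<bullet> (p x - p u) > 0"
    and d_gv: "gv \<bullet> (- d) > 0" "\<And>x. x \<in> insert a C \<Longrightarrow> gv \<bullet> (p x - p u) > 0"
    and d_ordu: "\<And>x y. x \<in> insert a B \<Longrightarrow> y \<in> insert a B \<Longrightarrow> ku x < ku y \<Longrightarrow> ccw3 (p x - p u) (p y - p u) d"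
    and d_ordv: "\<And>x y. x \<in> insert a C \<Longrightarrow> y \<in> insert a C \<Longrightarrow> kv x < kv y \<Longrightarrow> ccw3 (- d) (p x - p u) (p y - p u)"
    and d_X: "\<And>b c. b \<in> insert a B \<Longrightarrow> c \<in> insert a C \<Longrightarrow> \<not> (b = a \<and> c = a) \<Longrightarrow>
       crs d (p c - p u) * crs (p b - p u) (p c - p u) < 0 \<or>
       crs (p b - p u) d * crs (p b - p u) (p c - p u) > 0"
    and d_a: "crs d (p a - p u) > 0" and d_nz: "\<And>x. x \<in> insert a B \<union> C \<Longrightarrow> crs d (p x - p u) \<noteq> 0"
begin

text \<open>The vertex \<open>v\<close> leaves the position of \<open>u\<close> along
  \<open>d\<close>. Each requirement on a drawing is shown for all small positive \<open>t\<close>,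
  and there are finitely many.\<close>

definition q :: "real \<Rightarrow> 'a \<Rightarrow> complex" where
  "q t = p(v := p u + t *\<^sub>R d)"

lemma q_simps: "q t v = p u + t *\<^sub>R d" "x \<noteq> v \<Longrightarrow> q t x = p x"
  by (auto simp: q_def)

lemma q_lim: "((\<lambda>t. q t v) \<longlongrightarrow> p u) (at_right 0)"
proof -
  have "((\<lambda>t. p u + t *\<^sub>R d) \<longlongrightarrow> p u + 0 *\<^sub>R d) (at_right 0)" by (intro tendsto_intros)
  then show ?thesis by (simp add: q_simps)
qed

lemma lim_to: "((\<lambda>t. c - q t v) \<longlongrightarrow> c - p u) (at_right 0)"
  by (intro tendsto_intros q_lim)

lemma lim_from: "((\<lambda>t. q t v - c) \<longlongrightarrow> p u - c) (at_right 0)"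
  by (intro tendsto_intros q_lim)

lemma t_pos: "\<forall>\<^sub>F t in at_right (0::real). t > 0"
  by (simp add: eventually_at_right_less)

lemma uV: "u \<in> V - {v}" "v \<in> V" "a \<in> V - {v}"
  using AV arcs_u[of v] arcs_u[of a] dist by auto

lemma A'I: "(x, y) \<in> A \<Longrightarrow> x \<noteq> v \<Longrightarrow> y \<noteq> v \<Longrightarrow> (x, y) \<in> A'"
  by (simp add: A'_def)

lemma A'_uC: "c \<in> insert a C \<Longrightarrow> (u, c) \<in> A'" "c \<in> insert a C \<Longrightarrow> (c, u) \<in> A'"
  using N'u A'_sym by (auto dest: symD)

lemma A'_uB: "b \<in> insert a B \<Longrightarrow> (u, b) \<in> A'"
  using N'u by auto

lemma good_inj: "inj_on p (V - {v})" using good by (simp add: good_drawing_def)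
lemma good_pointed: "x \<in> V \<Longrightarrow> x \<noteq> v \<Longrightarrow> \<exists>g. \<forall>y\<in>A' `` {x}. g \<bullet> (p y - p x) > 0"
  using good by (simp add: good_drawing_def)
lemma good_crs: "(x, y) \<in> A' \<Longrightarrow> (x, z) \<in> A' \<Longrightarrow> y \<noteq> z \<Longrightarrow> crs (p y - p x) (p z - p x) \<noteq> 0"
  using good by (simp add: good_drawing_def)
lemma good_ccw3: "(x, i) \<in> A' \<Longrightarrow> (x, j) \<in> A' \<Longrightarrow> (x, k) \<in> A' \<Longrightarrow> cyc (\<kappa>' x i) (\<kappa>' x j) (\<kappa>' x k) \<Longrightarrow>
    ccw3 (p i - p x) (p j - p x) (p k - p x)"
  using good unfolding good_drawing_def by blast
lemma good_disjoint: "(x, y) \<in> A' \<Longrightarrow> (z, w) \<in> A' \<Longrightarrow> {x, y} \<inter> {z, w} = {} \<Longrightarrow>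
        closed_segment (p x) (p y) \<inter> closed_segment (p z) (p w) = {}"
  using good unfolding good_drawing_def by blast

lemma ev_inj: "\<forall>\<^sub>F t in at_right 0. inj_on (q t) V"
proof -
  have "\<forall>\<^sub>F t in at_right 0. \<forall>x\<in>V - {v}. q t v \<noteq> p x"
  proof (rule eventually_ball_finite, use finV in simp, intro ballI)
    fix x assume x: "x \<in> V - {v}"
    show "\<forall>\<^sub>F t in at_right 0. q t v \<noteq> p x"
    proof (cases "x = u")
      case True
      have "d \<noteq> 0" using d_gu(1) by auto
      then show ?thesis using t_pos by (auto simp: q_simps True elim: eventually_mono)
    next
      case False
      then have "p u \<noteq> p x" using inj_onD[OF good_inj, of u x] uV x by auto
      then show ?thesis using tendsto_imp_eventually_ne[OF q_lim] by blast
    qed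
  qed
  then show ?thesis
  proof eventually_elim
    case (elim t)
    show ?case
    proof (rule inj_onI)
      fix x y assume xy: "x \<in> V" "y \<in> V" "q t x = q t y"
      then show "x = y"
        using elim[rule_format, of x] elim[rule_format, of y] inj_onD[OF good_inj, of x y]
        by (cases "x = v"; cases "y = v") (auto simp: q_simps)
    qed
  qed
qed

lemma nbr_cases:
  assumes "(x, y) \<in> A" "x \<noteq> u" "x \<noteq> v"
  obtains "y \<noteq> v" "(x, y) \<in> A'" | "y = v" "x \<in> insert a C" "(x, u) \<in> A'"
proof (cases "y = v")
  case True
  then have "x \<in> insert a C" using assms arcs_v' by auto
  then show ?thesis using that(2)[OF True] A'_uC by blast
next
  case False
  then show ?thesis using that(1)[OF False] A'I[OF assms(1,3)] by blast
qed

lemma ev_pointed: "\<forall>\<^sub>F t in at_right 0. \<forall>x\<in>V. \<exists>g. \<forall>y\<in>A `` {x}. g \<bullet> (q t y - q t x) > 0"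
proof (rule eventually_ball_finite[OF finV], intro ballI)
  fix x assume x: "x \<in> V"
  have finN: "finite (A `` {x})" by (rule rg_finN[OF rg])
  consider "x = u" | "x = v" | "x \<noteq> u" "x \<noteq> v" by blast
  then show "\<forall>\<^sub>F t in at_right 0. \<exists>g. \<forall>y\<in>A `` {x}. g \<bullet> (q t y - q t x) > 0"
  proof cases
    case 1
    show ?thesis using t_pos
    proof eventually_elim
      case (elim t)
      have "gu \<bullet> (q t y - q t x) > 0" if "y \<in> A `` {x}" for y
        using that d_gu elim dist 1 Nu by (cases "y = v") (auto simp: q_simps)
      then show ?case by blast
    qed
  next
    case 2
    have "\<forall>\<^sub>F t in at_right 0. \<forall>y\<in>A `` {x}. gv \<bullet> (q t y - q t x) > 0"
    proof (rule eventually_ball_finite[OF finN], intro ballI)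
      fix y assume y: "y \<in> A `` {x}"
      show "\<forall>\<^sub>F t in at_right 0. gv \<bullet> (q t y - q t x) > 0"
      proof (cases "y = u")
        case True
        show ?thesis using t_pos
          by eventually_elim (use d_gv(1) dist in \<open>simp add: 2 True q_simps mult_pos_neg\<close>)
      next
        case False
        then have yC: "y \<in> insert a C" "y \<noteq> v" using y 2 Nv dist by auto
        have "((\<lambda>t. gv \<bullet> (p y - q t v)) \<longlongrightarrow> gv \<bullet> (p y - p u)) (at_right 0)"
          by (intro tendsto_intros q_lim)
        then show ?thesis using order_tendstoD(1)[OF _ d_gv(2)[OF yC(1)]] by (simp add: 2 q_simps(2)[OF yC(2)])
      qed
    qed
    then show ?thesis by eventually_elim blast
  next
    case 3
    obtain g where g: "\<And>y. (x, y) \<in> A' \<Longrightarrow> g \<bullet> (p y - p x) > 0" using good_pointed[OF x 3(2)] by auto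
    have "\<forall>\<^sub>F t in at_right 0. \<forall>y\<in>A `` {x}. g \<bullet> (q t y - q t x) > 0"
    proof (rule eventually_ball_finite[OF finN], intro ballI)
      fix y assume y: "y \<in> A `` {x}"
      then have xy: "(x, y) \<in> A" by simp
      show "\<forall>\<^sub>F t in at_right 0. g \<bullet> (q t y - q t x) > 0"
      proof (rule nbr_cases[OF xy 3])
        assume "y \<noteq> v" "(x, y) \<in> A'"
        then show ?thesis using g 3 by (simp add: q_simps)
      next
        assume c: "y = v" "x \<in> insert a C" "(x, u) \<in> A'"
        have "((\<lambda>t. g \<bullet> (q t v - p x)) \<longlongrightarrow> g \<bullet> (p u - p x)) (at_right 0)"
          by (intro tendsto_intros q_lim)
        then show ?thesis using order_tendstoD(1)[OF _ g[OF c(3)]] by (simp add: c(1) q_simps(2)[OF 3(2)])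
      qed
    qed
    then show ?thesis by eventually_elim blast
  qed
qed

text \<open>Seen from \<open>a\<close>, the vertices \<open>u\<close> and \<open>v\<close> have the
  same direction in the limit, so their order cannot come from continuity; it is decided by the term
  linear in \<open>t\<close>.\<close>

lemma crs_at_a: "t > 0 \<Longrightarrow> crs (p u - p a) (q t v - p a) > 0"
proof -
  assume t: "t > 0"
  have "crs (p u - p a) (q t v - p a) = t * crs d (p a - p u)"
    by (simp add: q_simps crs_def algebra_simps)
  then show ?thesis using t d_a by simp
qed

lemma ev_crs:
  assumes x: "(x, y) \<in> A" "(x, z) \<in> A" "y \<noteq> z"
  shows "\<forall>\<^sub>F t in at_right 0. crs (q t y - q t x) (q t z - q t x) \<noteq> 0"
proof -
  consider "x = u" | "x = v" | "x \<noteq> u" "x \<noteq> v" by blast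
  then show ?thesis
  proof cases
    case 1
    show ?thesis using t_pos
    proof eventually_elim
      case (elim t)
      have yB: "y \<in> insert v (insert a B)" "z \<in> insert v (insert a B)" using x 1 Nu by auto
      have qu: "q t x = p u" using 1 dist by (simp add: q_simps)
      consider "y = v" "z \<noteq> v" | "y \<noteq> v" "z = v" | "y \<noteq> v" "z \<noteq> v" using x by auto
      then show ?case
      proof cases
        case 1
        then have "crs d (p z - p u) \<noteq> 0" using d_nz[of z] yB by auto
        then show ?thesis using elim 1 by (simp add: qu q_simps crs_simps)
      next
        case 2
        then have "crs d (p y - p u) \<noteq> 0" using d_nz[of y] yB by auto
        then show ?thesis using elim 2 crs_swap[of "p y - p u" d] by (simp add: qu q_simps crs_simps(7))
      next
        case 3
        then show ?thesis using good_crs[of u y z] A'_uB yB x by (auto simp: qu q_simps)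
      qed
    qed
  next
    case 2
    have key: "\<forall>\<^sub>F t in at_right 0. crs (q t u - q t v) (q t z - q t v) \<noteq> 0" if z: "z \<in> insert a C" for z
      using t_pos
    proof eventually_elim
      case (elim t)
      have zv: "z \<noteq> v" using z dist by auto
      have "crs (q t u - q t v) (q t z - q t v) = - t * crs d (p z - p u)"
        using zv dist by (simp add: q_simps crs_def algebra_simps)
      then show ?case using elim d_nz[of z] z by auto
    qed
    have yC: "y \<in> insert u (insert a C)" "z \<in> insert u (insert a C)" using x 2 Nv by auto
    consider "y = u" "z \<noteq> u" | "y \<noteq> u" "z = u" | "y \<noteq> u" "z \<noteq> u" using x by auto
    then show ?thesis
    proof cases
      case 1
      then show ?thesis using key[of z] yC 2 by auto
    next
      case c: 2
      then have "\<forall>\<^sub>F t in at_right 0. crs (q t u - q t v) (q t y - q t v) \<noteq> 0" using key[of y] yC by auto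
      then show ?thesis unfolding \<open>x = v\<close> c(2)
        by eventually_elim (metis crs_swap neg_equal_0_iff_equal)
    next
      case 3
      then have yz: "y \<in> insert a C" "z \<in> insert a C" "y \<noteq> v" "z \<noteq> v" using yC dist by auto
      have "crs (p y - p u) (p z - p u) \<noteq> 0" using good_crs[of u y z] A'_uC yz x by auto
      then have "\<forall>\<^sub>F t in at_right 0. crs (p y - q t v) (p z - q t v) \<noteq> 0"
        by (rule eventually_crs_nonzero[OF lim_to lim_to])
      then show ?thesis using yz by (simp add: 2 q_simps(2))
    qed
  next
    case 3
    have qx: "q t x = p x" for t using 3 by (simp add: q_simps)
    have key: "\<forall>\<^sub>F t in at_right 0. crs (q t v - p x) (p z - p x) \<noteq> 0"
      if z: "(x, v) \<in> A" "(x, z) \<in> A" "z \<noteq> v" for z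
    proof (cases "z = u")
      case True
      then have "x = a" using z arcs_u' arcs_v' BC 3 by auto
      show ?thesis using t_pos
      proof eventually_elim
        case (elim t)
        then show ?case using crs_at_a[OF elim] crs_swap[of "q t v - p x" "p z - p x"] True \<open>x = a\<close> by simp
      qed
    next
      case False
      have "(x, u) \<in> A'" using nbr_cases[OF z(1) 3] by auto
      moreover have "(x, z) \<in> A'" using A'I z 3 by auto
      ultimately have "crs (p u - p x) (p z - p x) \<noteq> 0" using good_crs False by auto
      then show ?thesis by (rule eventually_crs_nonzero[OF lim_from tendsto_const])
    qed
    consider "y = v" "z \<noteq> v" | "y \<noteq> v" "z = v" | "y \<noteq> v" "z \<noteq> v" using x by auto
    then show ?thesis
    proof cases
      case 1
      then show ?thesis using key[of z] x by (simp add: qx q_simps(2))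
    next
      case 2
      then have "\<forall>\<^sub>F t in at_right 0. crs (q t v - p x) (p y - p x) \<noteq> 0" using key[of y] x by auto
      then show ?thesis unfolding qx 2(2) q_simps(2)[OF 2(1)]
        by eventually_elim (metis crs_swap neg_equal_0_iff_equal)
    next
      case c: 3
      then have "crs (p y - p x) (p z - p x) \<noteq> 0" using good_crs[of x y z] A'I x 3 by auto
      then show ?thesis using c by (simp add: qx q_simps(2))
    qed
  qed
qed

lemma cyc_ne: "cyc r s t \<Longrightarrow> r \<noteq> s \<and> s \<noteq> t \<and> r \<noteq> t"
  by (auto simp: cyc_def)

text \<open>Only \<open>u\<close>, \<open>a\<close> and the vertices of \<open>C\<close> are
  adjacent to \<open>v\<close>. A vertex of \<open>C\<close> had \<open>u\<close> in its place. At
  \<open>a\<close> the edge to \<open>v\<close> follows directly after the one to \<open>u\<close>,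
  so only a comparison with \<open>u\<close> itself needs \<open>crs_at_a\<close>.\<close>

lemma ev_rot_v:
  assumes x: "x \<noteq> v" "(x, v) \<in> A" "(x, j) \<in> A" "(x, k) \<in> A" "cyc (\<kappa> x v) (\<kappa> x j) (\<kappa> x k)"
  shows "\<forall>\<^sub>F t in at_right 0. ccw3 (q t v - p x) (p j - p x) (p k - p x)"
proof -
  have jk: "j \<noteq> v" "k \<noteq> v" "j \<noteq> k" using cyc_ne[OF x(5)] by auto
  consider "x = u" | "x \<in> C" | "x = a" using x(2) arcs_v'[of x] by auto
  then show ?thesis
  proof cases
    case 1
    have m: "v \<in> A `` {u}" "j \<in> A `` {u}" "k \<in> A `` {u}" using x(2-4) 1 by simp_all
    have c: "cyc (ku v) (ku j) (ku k)" using cycu[OF m] x(5) 1 by simp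
    have jB: "j \<in> insert a B" "k \<in> insert a B" using m(2,3) jk unfolding Nu by simp_all
    have kuv: "ku l < ku v" if "l \<in> insert a B" for l using that ku(1)[of l] ku(2) kua by auto
    have "ku j < ku v" "ku k < ku v" using kuv jB by blast+
    then have "ku j < ku k" using c by (auto simp: cyc_def)
    then have "ccw3 (p j - p u) (p k - p u) d" using d_ordu jB by blast
    then have c3: "ccw3 d (p j - p u) (p k - p u)" using ccw3_rotate[of d "p j - p u" "p k - p u"] by simp
    show ?thesis using t_pos
      by eventually_elim (use c3 in \<open>simp add: 1 q_simps ccw3_scale\<close>)
  next
    case 2
    have xu: "x \<noteq> u" using 2 nC by auto
    have nu: "(x, u) \<notin> A" using 2 arcs_u' BC nC dist by auto
    then have ju: "j \<noteq> u" "k \<noteq> u" using x by auto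
    have "cyc (\<kappa>' x u) (\<kappa>' x j) (\<kappa>' x k)" using x(5) xu 2 ju by (simp add: \<kappa>'_def)
    moreover have "(x, u) \<in> A'" "(x, j) \<in> A'" "(x, k) \<in> A'"
      using A'_uC(2)[of x] A'I[OF x(3,1) jk(1)] A'I[OF x(4,1) jk(2)] 2 by simp_all
    ultimately have "ccw3 (p u - p x) (p j - p x) (p k - p x)" using good_ccw3[of x u j k] by simp
    then show ?thesis by (rule eventually_ccw3[OF lim_from tendsto_const tendsto_const])
  next
    case 3
    have aN: "u \<in> A `` {a}" "v \<in> A `` {a}" using arcs_u' arcs_v' by auto
    have nc: "\<not> cyc (\<kappa> a u) (\<kappa> a l) (\<kappa> a v)" if "(a, l) \<in> A" for l
      using nxt_not_cyc[OF rg_finN[OF rg] aN(1), of l "\<kappa> a"] nxa that by auto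
    have ju: "j \<noteq> u"
    proof
      assume "j = u"
      then have "cyc (\<kappa> a u) (\<kappa> a k) (\<kappa> a v)" using x(5) 3 cyc_rotate by blast
      then show False using nc[of k] x 3 by blast
    qed
    have inja: "inj_on (\<kappa> a) (A `` {a})" by (rule rg_inj[OF rg])
    have \<kappa>a: "\<kappa>' a = \<kappa> a" using \<kappa>'_other[of a] dist nC by auto
    have ua: "(a, u) \<in> A'" using A'_uC by auto
    show ?thesis
    proof (cases "k = u")
      case True
      have "(a, j) \<in> A'" using A'I[of a j] x(3) 3 jk dist(3) by simp
      then have ne: "crs (p u - p a) (p j - p a) \<noteq> 0" using good_crs[OF ua, of j] ju by simp
      show ?thesis
      proof (cases "crs (p u - p a) (p j - p a) > 0")
        case pos: True
        then have "\<forall>\<^sub>F t in at_right 0. crs (q t v - p a) (p j - p a) > 0"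
          by (rule eventually_crs_pos[OF lim_from tendsto_const])
        then show ?thesis using t_pos
          by eventually_elim (use crs_at_a in \<open>simp add: 3 True ccw3_def\<close>)
      next
        case False
        then have "crs (p j - p a) (p u - p a) > 0" using ne crs_swap[of "p j - p a" "p u - p a"] by simp
        then show ?thesis using t_pos
          by (auto elim!: eventually_mono simp: 3 True ccw3_def crs_at_a)
      qed
    next
      case False
      have m: "j \<in> A `` {a}" "k \<in> A `` {a}" using x(3,4) 3 by simp_all
      have d5: "\<kappa> a j \<noteq> \<kappa> a u" "\<kappa> a k \<noteq> \<kappa> a u" "\<kappa> a u \<noteq> \<kappa> a v"
        using inj_on_eq_iff[OF inja m(1) aN(1)] inj_on_eq_iff[OF inja m(2) aN(1)] inj_on_eq_iff[OF inja aN]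
          ju False dist(1) by simp_all
      \<comment> \<open>At \<open>a\<close> nothing lies between \<open>u\<close> and
        \<open>v\<close>, so \<open>u\<close> may replace \<open>v\<close> in a cyclic triple with
        two other neighbours.\<close>
      have "cyc r y z" if "\<not> cyc r y s" "\<not> cyc r z s" "cyc s y z" "y \<noteq> r" "z \<noteq> r" "r \<noteq> s" for r s y z
        using that unfolding cyc_def by (smt (verit))
      from this[OF nc nc _ d5] have "cyc (\<kappa> a u) (\<kappa> a j) (\<kappa> a k)" using x(5) m 3 by simp
      moreover have "(a, j) \<in> A'" "(a, k) \<in> A'" using A'I m jk dist by simp_all
      ultimately have "ccw3 (p u - p a) (p j - p a) (p k - p a)"
        using good_ccw3[OF ua, of j k] \<kappa>a by simp
      then show ?thesis unfolding \<open>x = a\<close> by (rule eventually_ccw3[OF lim_from tendsto_const tendsto_const])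
    qed
  qed
qed

lemma ev_rot:
  assumes x: "(x, i) \<in> A" "(x, j) \<in> A" "(x, k) \<in> A" "cyc (\<kappa> x i) (\<kappa> x j) (\<kappa> x k)"
  shows "\<forall>\<^sub>F t in at_right 0. ccw3 (q t i - q t x) (q t j - q t x) (q t k - q t x)"
proof (cases "x = v")
  case False
  have qx: "q t x = p x" for t using False by (simp add: q_simps)
  have ne: "i \<noteq> j" "j \<noteq> k" "i \<noteq> k" using cyc_ne[OF x(4)] by auto
  consider "i = v" | "j = v" | "k = v" | "i \<noteq> v" "j \<noteq> v" "k \<noteq> v" by blast
  then show ?thesis
  proof cases
    case 1
    then show ?thesis using ev_rot_v[OF False, of j k] x ne by (simp add: qx q_simps(2))
  next
    case 2
    have "\<forall>\<^sub>F t in at_right 0. ccw3 (q t v - p x) (p k - p x) (p i - p x)"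
      using ev_rot_v[OF False, of k i] x cyc_rotate[of "\<kappa> x i"] 2 by simp
    then show ?thesis using 2 ne ccw3_rotate[of "q _ v - p x" "p k - p x" "p i - p x"]
      by (auto elim!: eventually_mono simp: qx q_simps(2) ccw3_def)
  next
    case 3
    have "\<forall>\<^sub>F t in at_right 0. ccw3 (q t v - p x) (p i - p x) (p j - p x)"
      using ev_rot_v[OF False, of i j] x cyc_rotate[of "\<kappa> x v"] 3 by simp
    then show ?thesis using 3 ne
      by (auto elim!: eventually_mono simp: qx q_simps(2) ccw3_def)
  next
    case 4
    have "cyc (\<kappa>' x i) (\<kappa>' x j) (\<kappa>' x k)"
    proof (cases "x = u")
      case True
      have m: "i \<in> A `` {u}" "j \<in> A `` {u}" "k \<in> A `` {u}" using x(1-3) True by simp_all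
      have "cyc (ku i) (ku j) (ku k)" using cycu[OF m] x(4) True by simp
      moreover have "\<kappa>' u l = ku l" if "(u, l) \<in> A" "l \<noteq> v" for l
      proof -
        have "l \<notin> C" using that arcs_u[of l] nC BC by blast
        then show ?thesis by (rule \<kappa>'_u(1))
      qed
      ultimately show ?thesis using m 4 True by simp
    next
      case xu: False
      have "\<kappa>' x l = \<kappa> x l" if "(x, l) \<in> A" for l
      proof -
        have "\<not> (l = u \<and> x \<in> C)" using that arcs_u'[of x] BC nC dist by blast
        then show ?thesis using xu unfolding \<kappa>'_def by auto
      qed
      then show ?thesis using x by simp
    qed
    then have "ccw3 (p i - p x) (p j - p x) (p k - p x)"
      using good_ccw3[OF A'I[OF x(1) False 4(1)] A'I[OF x(2) False 4(2)] A'I[OF x(3) False 4(3)]] by simp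
    then show ?thesis using 4 by (simp add: qx q_simps(2))
  qed
next
  case True
  have ne: "i \<noteq> j" "j \<noteq> k" "i \<noteq> k" using cyc_ne[OF x(4)] by auto
  have m: "i \<in> A `` {v}" "j \<in> A `` {v}" "k \<in> A `` {v}" using x(1-3) True by simp_all
  have c: "cyc (kv i) (kv j) (kv k)" using cycv[OF m] x(4) True by simp
  have iC: "i \<in> insert u (insert a C)" "j \<in> insert u (insert a C)" "k \<in> insert u (insert a C)"
    using m unfolding Nv by simp_all
  have nv: "i \<noteq> v" "j \<noteq> v" "k \<noteq> v" using iC dist by auto
  have kp: "0 < kv l" if "l \<in> insert a C" for l using kv(1)[of l] kv(2) that by auto
  have key: "\<forall>\<^sub>F t in at_right 0. ccw3 (p u - q t v) (p j - q t v) (p k - q t v)"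
    if jk: "j \<in> insert a C" "k \<in> insert a C" "cyc (kv u) (kv j) (kv k)" for j k
  proof -
    have "kv j < kv k" using jk kp[OF jk(1)] kp[OF jk(2)] kvu by (auto simp: cyc_def)
    then have "ccw3 (- d) (p j - p u) (p k - p u)" using d_ordv jk by blast
    then have "\<forall>\<^sub>F t in at_right 0. ccw3 (- d) (p j - q t v) (p k - q t v)"
      by (rule eventually_ccw3[OF tendsto_const lim_to lim_to])
    then show ?thesis using t_pos
    proof eventually_elim
      case (elim t)
      have "p u - q t v = t *\<^sub>R (- d)" by (simp add: q_simps)
      then show ?case using elim ccw3_scale by metis
    qed
  qed
  have qu: "q t u = p u" for t using dist by (simp add: q_simps)
  consider "i = u" | "j = u" | "k = u" | "i \<noteq> u" "j \<noteq> u" "k \<noteq> u" by blast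
  then show ?thesis
  proof cases
    case 1
    then show ?thesis using key[of j k] iC ne c nv by (simp add: True qu q_simps(2))
  next
    case 2
    then have "\<forall>\<^sub>F t in at_right 0. ccw3 (p u - q t v) (p k - q t v) (p i - q t v)"
      using key[of k i] iC ne c cyc_rotate[of "kv i"] by auto
    then show ?thesis using 2 nv by (auto elim!: eventually_mono simp: True qu q_simps(2) ccw3_def)
  next
    case 3
    then have "\<forall>\<^sub>F t in at_right 0. ccw3 (p u - q t v) (p i - q t v) (p j - q t v)"
      using key[of i j] iC ne c cyc_rotate[of "kv u"] by auto
    then show ?thesis using 3 nv by (auto elim!: eventually_mono simp: True qu q_simps(2) ccw3_def)
  next
    case 4
    have ia: "i \<in> insert a C" "j \<in> insert a C" "k \<in> insert a C" using iC 4 by auto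
    \<comment> \<open>In the merged rotation \<open>a\<close> comes before \<open>C\<close>, in the
      rotation at \<open>v\<close> it comes after \<open>C\<close>; cyclically this is the same
      order.\<close>
    have "(\<kappa>' u l = 1 + kv l \<and> kv l < kv a) \<or> (l = a \<and> \<kappa>' u l = 0)" if "l \<in> insert a C" for l
      using that kv(1) kua nC by (auto simp: \<kappa>'_u)
    then have "cyc (\<kappa>' u i) (\<kappa>' u j) (\<kappa>' u k)"
      using ia[THEN kp] ia ne c unfolding cyc_def by (smt (verit))
    then have "ccw3 (p i - p u) (p j - p u) (p k - p u)" using good_ccw3 A'_uC(1) ia by blast
    then have "\<forall>\<^sub>F t in at_right 0. ccw3 (p i - q t v) (p j - q t v) (p k - q t v)"
      by (rule eventually_ccw3[OF lim_to lim_to lim_to])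
    then show ?thesis using nv by (simp add: True q_simps(2))
  qed
qed

text \<open>A common point would mean that
  \<open>r *\<^sub>R b = t *\<^sub>R d + s *\<^sub>R c\<close> with nonnegative \<open>r\<close> and
  \<open>s\<close>. Cross products with \<open>c\<close> and with \<open>b\<close> then give both
  products in \<open>X\<close> the wrong sign.\<close>

lemma cone_disjoint:
  assumes t: "t > 0" and X: "crs d c * crs b c < 0 \<or> crs b d * crs b c > 0"
  shows "closed_segment w (w + b) \<inter> closed_segment (w + t *\<^sub>R d) (w + t *\<^sub>R d + c) = {}"
proof (rule ccontr)
  assume "\<not> ?thesis"
  then obtain z where z: "z \<in> closed_segment w (w + b)" "z \<in> closed_segment (w + t *\<^sub>R d) (w + t *\<^sub>R d + c)" by blast
  obtain r where r: "0 \<le> r" "z = (1 - r) *\<^sub>R w + r *\<^sub>R (w + b)" using z(1) by (auto simp: in_segment)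
  obtain s where s: "0 \<le> s" "z = (1 - s) *\<^sub>R (w + t *\<^sub>R d) + s *\<^sub>R (w + t *\<^sub>R d + c)" using z(2) by (auto simp: in_segment)
  have eq: "r *\<^sub>R b = t *\<^sub>R d + s *\<^sub>R c" using r(2) s(2) by (simp add: algebra_simps)
  have "r * crs b c = t * crs d c" using arg_cong[OF eq, of "\<lambda>x. crs x c"] by (simp add: crs_simps)
  then have 1: "t * (crs d c * crs b c) = r * (crs b c * crs b c)" by (metis mult.assoc)
  have "0 = t * crs b d + s * crs b c" using arg_cong[OF eq, of "\<lambda>x. crs b x"] by (simp add: crs_simps)
  then have "t * crs b d = - s * crs b c" by linarith
  then have 2: "t * (crs b d * crs b c) = - s * (crs b c * crs b c)" by (metis mult.assoc)
  have "t * (crs d c * crs b c) \<ge> 0" unfolding 1 using r(1) by simp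
  then have n1: "\<not> crs d c * crs b c < 0" using t mult_pos_neg[OF t, of "crs d c * crs b c"] by linarith
  have "t * (crs b d * crs b c) \<le> 0" unfolding 2 using s(1) by (simp add: mult_nonneg_nonneg)
  then have n2: "\<not> crs b d * crs b c > 0" using t mult_pos_pos[OF t, of "crs b d * crs b c"] by linarith
  show False using X n1 n2 by blast
qed

text \<open>The edge from \<open>u\<close> to \<open>a\<close> does the work: edges without
  \<open>a\<close> are disjoint from it, and another edge at \<open>a\<close> leaves in a direction
  that is not parallel.\<close>

lemma u_off_edge:
  assumes "(z, w) \<in> A'" "u \<notin> {z, w}"
  shows "p u \<notin> closed_segment (p z) (p w)"
proof
  assume on: "p u \<in> closed_segment (p z) (p w)"
  have off: False if y: "(a, y) \<in> A'" "u \<noteq> y" "p u \<in> closed_segment (p a) (p y)" for y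
  proof -
    obtain s where "p u = (1 - s) *\<^sub>R p a + s *\<^sub>R p y" using y(3) by (auto simp: in_segment)
    then have "p u - p a = s *\<^sub>R (p y - p a)" by (simp add: algebra_simps)
    then have "crs (p u - p a) (p y - p a) = 0" by (simp only: crs_simps(5,6) mult_zero_right)
    then show False using good_crs[OF A'_uC(2)[of a] y(1,2)] by simp
  qed
  show False
  proof (cases "a \<in> {z, w}")
    case True
    then show False
    proof
      assume "a = z"
      then show False using off[of w] assms on by auto
    next
      assume "a \<in> {w}"
      then show False using off[of z] assms on A'_sym by (auto simp: closed_segment_commute dest: symD)
    qed
  next
    case False
    then have "closed_segment (p u) (p a) \<inter> closed_segment (p z) (p w) = {}"
      using good_disjoint[OF A'_uC(1)[of a] assms(1)] assms(2) by auto
    then show False using on by auto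
  qed
qed

text \<open>The edge from \<open>v\<close> to \<open>y\<close> tends to the segment from
  \<open>p u\<close> to \<open>p y\<close>, a single point if \<open>y = u\<close>. An edge that
  avoids \<open>u\<close> and \<open>y\<close> is disjoint from this limit, hence from nearby
  segments. An edge at \<open>u\<close> meets the limit if \<open>y \<noteq> u\<close>, and there
  \<open>cone_disjoint\<close> is needed.\<close>

lemma ev_disjoint_v:
  assumes vy: "(v, y) \<in> A" and zw: "(z, w) \<in> A" and dis: "{v, y} \<inter> {z, w} = {}"
  shows "\<forall>\<^sub>F t in at_right 0. closed_segment (q t v) (p y) \<inter> closed_segment (p z) (p w) = {}"
proof -
  have zw': "(z, w) \<in> A'" using A'I zw dis by auto
  have cl: "closed (closed_segment (p z) (p w))" by simp
  have yC: "y = u \<or> y \<in> insert a C" using vy Nv by auto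
  have cone: "\<forall>\<^sub>F t in at_right 0. closed_segment (q t v) (p y) \<inter> closed_segment (p u) (p b) = {}"
    if b: "(u, b) \<in> A" "b \<noteq> v" "b \<noteq> y" "y \<noteq> u" for b
  proof -
    have bB: "b \<in> insert a B" using b Nu by auto
    have yC': "y \<in> insert a C" using yC b by auto
    let ?b = "p b - p u"
    have lim: "((\<lambda>t. p y - q t v) \<longlongrightarrow> p y - p u) (at_right 0)" by (intro tendsto_intros q_lim)
    have "\<not> (b = a \<and> y = a)" using b by auto
    then consider "crs d (p y - p u) * crs ?b (p y - p u) < 0" | "crs ?b d * crs ?b (p y - p u) > 0"
      using d_X[OF bB yC'] by blast
    then have "\<forall>\<^sub>F t in at_right 0. crs d (p y - q t v) * crs ?b (p y - q t v) < 0 \<or>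
        crs ?b d * crs ?b (p y - q t v) > 0"
    proof cases
      case 1
      have "((\<lambda>t. crs d (p y - q t v) * crs ?b (p y - q t v)) \<longlongrightarrow> crs d (p y - p u) * crs ?b (p y - p u)) (at_right 0)"
        by (intro tendsto_mult tendsto_crs tendsto_const lim)
      from order_tendstoD(2)[OF this 1] show ?thesis by eventually_elim blast
    next
      case 2
      have "((\<lambda>t. crs ?b d * crs ?b (p y - q t v)) \<longlongrightarrow> crs ?b d * crs ?b (p y - p u)) (at_right 0)"
        by (intro tendsto_mult tendsto_crs tendsto_const lim)
      from order_tendstoD(1)[OF this 2] show ?thesis by eventually_elim blast
    qed
    then show ?thesis using t_pos
    proof eventually_elim
      case (elim t)
      show ?case using cone_disjoint[OF elim(2,1), of "p u"] by (auto simp: q_simps)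
    qed
  qed
  consider "y = u" | "y \<noteq> u" "u \<notin> {z, w}" | "y \<noteq> u" "z = u" | "y \<noteq> u" "w = u" by blast
  then show ?thesis
  proof cases
    case 1
    then have "closed_segment (p u) (p y) \<inter> closed_segment (p z) (p w) = {}"
      using u_off_edge[OF zw'] dis by auto
    then show ?thesis by (rule eventually_segment_disjoint[OF q_lim cl])
  next
    case 2
    then have "closed_segment (p u) (p y) \<inter> closed_segment (p z) (p w) = {}"
      using good_disjoint[OF A'_uC(1)[of y] zw'] yC dis by auto
    then show ?thesis by (rule eventually_segment_disjoint[OF q_lim cl])
  next
    case 3
    then show ?thesis using cone[of w] zw dis by auto
  next
    case 4
    then have "(u, z) \<in> A" "z \<noteq> v" "z \<noteq> y" using sw[OF zw] dis by auto
    from cone[OF this 4(1)] show ?thesis using 4(2) by (simp add: closed_segment_commute[of "p z"])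
  qed
qed

lemma ev_disjoint:
  assumes xy: "(x, y) \<in> A" and zw: "(z, w) \<in> A" and dis: "{x, y} \<inter> {z, w} = {}"
  shows "\<forall>\<^sub>F t in at_right 0. closed_segment (q t x) (q t y) \<inter> closed_segment (q t z) (q t w) = {}"
proof -
  consider "x = v" | "y = v" | "z = v" | "w = v" | "v \<notin> {x, y, z, w}" by blast
  then show ?thesis
  proof cases
    case 1
    then have "y \<noteq> v" "z \<noteq> v" "w \<noteq> v" using xy dis irr by auto
    then show ?thesis using ev_disjoint_v[of y z w] 1 xy zw dis by (simp add: q_simps(2))
  next
    case 2
    then have "x \<noteq> v" "z \<noteq> v" "w \<noteq> v" using xy dis irr by auto
    then show ?thesis using ev_disjoint_v[of x z w] 2 sw[OF xy] zw dis
      by (simp add: q_simps(2) closed_segment_commute[of "p x"] insert_commute)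
  next
    case 3
    then have "x \<noteq> v" "y \<noteq> v" "w \<noteq> v" using zw dis irr by auto
    then show ?thesis using ev_disjoint_v[of w x y] 3 xy zw dis
      by (simp add: q_simps(2) Int_commute)
  next
    case 4
    then have "x \<noteq> v" "y \<noteq> v" "z \<noteq> v" using zw dis irr by auto
    then show ?thesis using ev_disjoint_v[of z x y] 4 xy sw[OF zw] dis
      by (simp add: q_simps(2) Int_commute closed_segment_commute[of "p z"] insert_commute)
  next
    case 5
    then have n: "x \<noteq> v" "y \<noteq> v" "z \<noteq> v" "w \<noteq> v" by auto
    have "closed_segment (p x) (p y) \<inter> closed_segment (p z) (p w) = {}"
      by (rule good_disjoint[OF A'I[OF xy n(1,2)] A'I[OF zw n(3,4)] dis])
    then show ?thesis using n by (simp add: q_simps(2))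
  qed
qed

lemma split_good: "\<exists>p'. good_drawing V A \<kappa> p'"
proof -
  let ?F = "at_right (0::real)"
  have e3: "\<forall>\<^sub>F t in ?F. \<forall>e\<in>A. \<forall>f\<in>A. fst e = fst f \<longrightarrow> snd e \<noteq> snd f \<longrightarrow>
      crs (q t (snd e) - q t (fst e)) (q t (snd f) - q t (fst e)) \<noteq> 0"
  proof (intro eventually_ball_finite[OF finA] ballI)
    fix e f assume "e \<in> A" "f \<in> A"
    then show "\<forall>\<^sub>F t in ?F. fst e = fst f \<longrightarrow> snd e \<noteq> snd f \<longrightarrow>
      crs (q t (snd e) - q t (fst e)) (q t (snd f) - q t (fst e)) \<noteq> 0"
      using ev_crs[of "fst e" "snd e" "snd f"] prod.collapse[of e] prod.collapse[of f]
      by (cases "fst e = fst f \<and> snd e \<noteq> snd f") (auto simp del: prod.collapse)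
  qed
  have e4: "\<forall>\<^sub>F t in ?F. \<forall>e\<in>A. \<forall>f\<in>A. \<forall>h\<in>A. fst e = fst f \<and> fst e = fst h \<and>
      cyc (\<kappa> (fst e) (snd e)) (\<kappa> (fst e) (snd f)) (\<kappa> (fst e) (snd h)) \<longrightarrow>
      ccw3 (q t (snd e) - q t (fst e)) (q t (snd f) - q t (fst e)) (q t (snd h) - q t (fst e))"
  proof (intro eventually_ball_finite[OF finA] ballI)
    fix e f h assume efh: "e \<in> A" "f \<in> A" "h \<in> A"
    obtain x i y j z k where pr: "e = (x, i)" "f = (y, j)" "h = (z, k)" by (metis prod.exhaust)
    show "\<forall>\<^sub>F t in ?F. fst e = fst f \<and> fst e = fst h \<and>
      cyc (\<kappa> (fst e) (snd e)) (\<kappa> (fst e) (snd f)) (\<kappa> (fst e) (snd h)) \<longrightarrow>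
      ccw3 (q t (snd e) - q t (fst e)) (q t (snd f) - q t (fst e)) (q t (snd h) - q t (fst e))"
    proof (cases "y = x \<and> z = x \<and> cyc (\<kappa> x i) (\<kappa> x j) (\<kappa> x k)")
      case True
      then have "(x, i) \<in> A" "(x, j) \<in> A" "(x, k) \<in> A" "cyc (\<kappa> x i) (\<kappa> x j) (\<kappa> x k)"
        using efh pr by blast+
      from ev_rot[OF this] show ?thesis by (rule eventually_mono) (auto simp: pr)
    next
      case False
      then show ?thesis by (intro always_eventually allI impI) (auto simp: pr)
    qed
  qed
  have e5: "\<forall>\<^sub>F t in ?F. \<forall>e\<in>A. \<forall>f\<in>A. {fst e, snd e} \<inter> {fst f, snd f} = {} \<longrightarrow>
      closed_segment (q t (fst e)) (q t (snd e)) \<inter> closed_segment (q t (fst f)) (q t (snd f)) = {}"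
  proof (intro eventually_ball_finite[OF finA] ballI)
    fix e f assume "e \<in> A" "f \<in> A"
    then show "\<forall>\<^sub>F t in ?F. {fst e, snd e} \<inter> {fst f, snd f} = {} \<longrightarrow>
      closed_segment (q t (fst e)) (q t (snd e)) \<inter> closed_segment (q t (fst f)) (q t (snd f)) = {}"
      using ev_disjoint[of "fst e" "snd e" "fst f" "snd f"]
      by (cases "{fst e, snd e} \<inter> {fst f, snd f} = {}") auto
  qed
  have "\<forall>\<^sub>F t in ?F. good_drawing V A \<kappa> (q t)"
    using ev_inj ev_pointed e3 e4 e5
  proof eventually_elim
    case (elim t)
    show ?case unfolding good_drawing_def
    proof (intro conjI allI impI)
      show "inj_on (q t) V" by (rule elim(1))
      show "\<forall>x\<in>V. \<exists>g. \<forall>y\<in>A `` {x}. g \<bullet> (q t y - q t x) > 0" by (rule elim(2))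
      show "crs (q t y - q t x) (q t z - q t x) \<noteq> 0" if "(x, y) \<in> A" "(x, z) \<in> A" "y \<noteq> z" for x y z
        using bspec[OF bspec[OF elim(3) that(1)] that(2)] that(3) by simp
      show "ccw3 (q t i - q t x) (q t j - q t x) (q t k - q t x)"
        if "(x, i) \<in> A" "(x, j) \<in> A" "(x, k) \<in> A" "cyc (\<kappa> x i) (\<kappa> x j) (\<kappa> x k)" for x i j k
        using bspec[OF bspec[OF bspec[OF elim(4) that(1)] that(2)] that(3)] that(4) by simp
      show "closed_segment (q t x) (q t y) \<inter> closed_segment (q t z) (q t w) = {}"
        if "(x, y) \<in> A" "(z, w) \<in> A" "{x, y} \<inter> {z, w} = {}" for x y z w
        using bspec[OF bspec[OF elim(5) that(1)] that(2)] that(3) by simp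
    qed
  qed
  then show ?thesis using eventually_happens'[OF trivial_limit_at_right_real] by blast
qed

end

lemma (in contraction) good_drawing_split:
  assumes "finite V" "A \<subseteq> V \<times> V" "good_drawing (V - {v}) A' \<kappa>' p"
  shows "\<exists>p'. good_drawing V A \<kappa> p'"
proof -
  have uV: "u \<in> V - {v}" using assms(2) arcs_u[of v] dist by auto
  obtain g where g: "\<And>x. x \<in> A' `` {u} \<Longrightarrow> g \<bullet> (p x - p u) > 0"
  proof -
    have "\<exists>g. \<forall>y\<in>A' `` {u}. g \<bullet> (p y - p u) > 0"
      using assms(3) uV unfolding good_drawing_def by simp
    then show ?thesis using that by blast
  qed
  have nz: "crs (p x - p u) (p y - p u) \<noteq> 0" if "x \<in> A' `` {u}" "y \<in> A' `` {u}" "x \<noteq> y" for x y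
    using assms(3) that unfolding good_drawing_def by blast
  have ord: "ccw3 (p x - p u) (p y - p u) (p z - p u)"
    if "x \<in> A' `` {u}" "y \<in> A' `` {u}" "z \<in> A' `` {u}" "cyc (\<kappa>' u x) (\<kappa>' u y) (\<kappa>' u z)" for x y z
    using assms(3) that unfolding good_drawing_def by blast
  show ?thesis
    apply (rule split_direction[of g "\<lambda>x. p x - p u", OF g nz ord])
           apply assumption+
    subgoal premises D for d gu gv
    proof -
      interpret splitting A \<kappa> u v a B C ku kv V p d gu gv
        by (intro splitting.intro contraction_axioms splitting_axioms.intro assms D)
      show ?thesis by (rule split_good)
    qed
    done
qed

text \<open>A contracted graph comes with a rotation system but with no straight drawing, so the
  induction runs over rotation systems. The drawing has to realise the prescribed rotation, because
  the splitting step relies on it.\<close>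

theorem good_drawing_ex:
  assumes "laman_arcs V A" "rot_graph \<kappa> A" "planar_rot \<kappa> A"
  shows "\<exists>p. good_drawing V A \<kappa> p"
  using assms
proof (induction "card V" arbitrary: V A \<kappa> rule: less_induct)
  case less
  note L = less.prems(1) and rg = less.prems(2) and pl = less.prems(3)
  have V: "finite V" "A \<subseteq> V \<times> V" "card V \<ge> 2" using laman_D[OF L] by auto
  show ?case
  proof (cases "card V = 2")
    case True
    then obtain x y where xy: "V = {x, y}" "x \<noteq> y" by (meson card_2_iff)
    define p where "p z = (if z = x then 0 else 1 :: complex)" for z
    have A: "A \<subseteq> {(x, y), (y, x)}" using V(2) xy rg_irr[OF rg] by auto
    have "good_drawing V A \<kappa> p"
      unfolding good_drawing_def
    proof (intro conjI allI impI ballI)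
      show "inj_on p V" using xy by (auto simp: p_def inj_on_def)
      show "\<exists>g. \<forall>w\<in>A `` {z}. g \<bullet> (p w - p z) > 0" if "z \<in> V" for z
        by (rule exI[of _ "if z = x then 1 else - 1"]) (use that A xy in \<open>auto simp: p_def\<close>)
      show "crs (p w - p z) (p r - p z) \<noteq> 0" if "(z, w) \<in> A" "(z, r) \<in> A" "w \<noteq> r" for z w r
        using that A xy by auto
      show "ccw3 (p i - p z) (p j - p z) (p k - p z)"
        if "(z, i) \<in> A" "(z, j) \<in> A" "(z, k) \<in> A" "cyc (\<kappa> z i) (\<kappa> z j) (\<kappa> z k)" for z i j k
        using that A xy by (auto simp: cyc_def)
      show "closed_segment (p z) (p w) \<inter> closed_segment (p r) (p s) = {}"
        if "(z, w) \<in> A" "(r, s) \<in> A" "{z, w} \<inter> {r, s} = {}" for z w r s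
        using that A xy by auto
    qed
    then show ?thesis by blast
  next
    case False
    then have n: "card V \<ge> 3" using V by simp
    obtain u v a where tri: "facial_triangle \<kappa> A u v a" and nb: "\<And>X. \<not> blocker V A u v a X"
      using contractible_triangle_ex[OF L rg pl n] by metis
    obtain B C ku kv where "contraction A \<kappa> u v a B C ku kv" using contraction_ex[OF L rg tri nb] by metis
    then interpret contraction A \<kappa> u v a B C ku kv .
    have L': "laman_arcs (V - {v}) A'" by (rule laman_contraction[OF L nb n])
    have "v \<in> V" using V arcs_u[of v] by auto
    then have "card (V - {v}) < card V" using V(1) by (intro psubset_card_mono) auto
    then obtain p where "good_drawing (V - {v}) A' \<kappa>' p"
      using less.hyps L' rg' planar_contraction[OF pl] by blast
    then show ?thesis by (rule good_drawing_split[OF V(1,2)])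
  qed
qed

section \<open>Straight-line drawings and their faces\<close>

definition ang :: "complex \<Rightarrow> complex \<Rightarrow> real" where
  "ang x y = Arg2pi (y / x)"

lemma ang_bounds: "0 \<le> ang x y" "ang x y < 2 * pi"
  using Arg2pi[of "y / x"] by (auto simp: ang_def)

lemma ang_eq:
  assumes "x \<noteq> 0" "y \<noteq> 0"
  shows "ang x y = (if Arg2pi x \<le> Arg2pi y then Arg2pi y - Arg2pi x else Arg2pi y - Arg2pi x + 2 * pi)"
  using Arg2pi_diff[OF assms(2,1)] by (auto simp: ang_def)

lemma ang_polar:
  assumes "x \<noteq> 0" "y \<noteq> 0"
  obtains r where "r > 0" "y = of_real r * x * cis (ang x y)"
proof -
  have "y / x = of_real (norm (y / x)) * cis (ang x y)"
    using Arg2pi_eq[of "y / x"] by (simp add: ang_def cis_conv_exp)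
  then have "y = of_real (norm (y / x)) * x * cis (ang x y)"
    using assms(1) by (simp add: field_simps)
  moreover have "norm (y / x) > 0" using assms by simp
  ultimately show ?thesis using that by blast
qed

lemma ang_cis:
  assumes "x \<noteq> 0" "r > 0" "0 \<le> \<theta>" "\<theta> < 2 * pi"
  shows "ang x (of_real r * x * cis \<theta>) = \<theta>"
  unfolding ang_def
  by (rule Arg2pi_unique[of r]) (use assms in \<open>auto simp: cis_conv_exp\<close>)

lemma ang_cyc:
  assumes "x \<noteq> 0" "y \<noteq> 0" "z \<noteq> 0" "ang x y < ang x z" "ang x y > 0"
  shows "cyc (Arg2pi x) (Arg2pi y) (Arg2pi z)"
  using assms(4,5) Arg2pi[of x] Arg2pi[of y] Arg2pi[of z]
  unfolding ang_eq[OF assms(1,2)] ang_eq[OF assms(1,3)] cyc_def by (auto split: if_splits)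

lemma ang_complement:
  assumes "x \<noteq> 0" "y \<noteq> 0" "ang x y \<noteq> 0"
  shows "ang y x = 2 * pi - ang x y"
  using assms(3) unfolding ang_eq[OF assms(1,2)] ang_eq[OF assms(2,1)] by (auto split: if_splits)

definition draw :: "('a \<times> 'a) set \<Rightarrow> ('a \<Rightarrow> complex) \<Rightarrow> complex set" where
  "draw A p = (\<Union>(x, y)\<in>A. closed_segment (p x) (p y))"

definition dir_key :: "('a \<Rightarrow> complex) \<Rightarrow> 'a \<Rightarrow> 'a \<Rightarrow> real" where
  "dir_key p v w = Arg2pi (p w - p v)"

locale plane_graph =
  fixes A :: "('a \<times> 'a) set" and p :: "'a \<Rightarrow> complex"
  assumes finite_arcs: "finite A" and sym_arcs: "sym A" and irrefl_arcs: "irrefl A"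
    and inj_p: "inj_on p (Field A)"
    and noncrossing: "\<And>x y z w. (x, y) \<in> A \<Longrightarrow> (z, w) \<in> A \<Longrightarrow> {x, y} \<noteq> {z, w} \<Longrightarrow>
      closed_segment (p x) (p y) \<inter> closed_segment (p z) (p w) \<subseteq> p ` ({x, y} \<inter> {z, w})"

lemma plane_graph_subset:
  assumes "plane_graph A p" "B \<subseteq> A" "sym B"
  shows "plane_graph B p"
proof -
  interpret plane_graph A p by fact
  show ?thesis
  proof
    show "finite B" by (rule finite_subset[OF assms(2) finite_arcs])
    show "sym B" by (rule assms(3))
    show "irrefl B" by (rule irrefl_subset[OF irrefl_arcs assms(2)])
    show "inj_on p (Field B)" by (rule inj_on_subset[OF inj_p mono_Field[OF assms(2)]])
    show "closed_segment (p x) (p y) \<inter> closed_segment (p z) (p w) \<subseteq> p ` ({x, y} \<inter> {z, w})"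
      if "(x, y) \<in> B" "(z, w) \<in> B" "{x, y} \<noteq> {z, w}" for x y z w
      using noncrossing[of x y z w] that assms(2) by blast
  qed
qed

context plane_graph
begin

abbreviation "D \<equiv> draw A p"
abbreviation "\<kappa> \<equiv> dir_key p"

text \<open>For \<open>h > 0\<close> the point lies to the right of the arc from \<open>x\<close> to \<open>y\<close>, where its face is.\<close>

definition pt :: "'a \<Rightarrow> 'a \<Rightarrow> real \<Rightarrow> real \<Rightarrow> complex" where
  "pt x y s h = p x + (p y - p x) * Complex s (- h)"

lemma swap: "(x, y) \<in> A \<Longrightarrow> (y, x) \<in> A" using sym_arcs by (rule symD)

lemma ne: "(x, y) \<in> A \<Longrightarrow> x \<noteq> y" using irrefl_arcs by (auto simp: irrefl_def)

lemma in_Field: "(x, y) \<in> A \<Longrightarrow> x \<in> Field A" "(x, y) \<in> A \<Longrightarrow> y \<in> Field A"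
  by (auto simp: Field_def)

lemma p_eq: "x \<in> Field A \<Longrightarrow> y \<in> Field A \<Longrightarrow> p x = p y \<longleftrightarrow> x = y"
  using inj_p by (rule inj_on_eq_iff)

lemma p_ne: "(x, y) \<in> A \<Longrightarrow> p x \<noteq> p y"
  using p_eq[of x y] in_Field[of x y] ne[of x y] by blast

lemma compact_D: "compact D"
  unfolding draw_def using finite_arcs by (intro compact_UN) auto

lemma closed_D: "closed D" by (rule compact_imp_closed[OF compact_D])

lemma open_comp: "open (- D)" using closed_D by (rule open_Compl)

lemma seg_in_D: "(x, y) \<in> A \<Longrightarrow> closed_segment (p x) (p y) \<subseteq> D"
  by (auto simp: draw_def)

lemma closed_rest: "closed (\<Union>(x, y)\<in>{(x, y)\<in>A. Q x y}. closed_segment (p x) (p y))"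
proof -
  have "finite {(x, y)\<in>A. Q x y}" by (rule finite_subset[OF _ finite_arcs]) auto
  then show ?thesis by (intro closed_UN) auto
qed

lemma vertex_off_edge:
  assumes "v \<in> Field A" "(x, y) \<in> A" "p v \<in> closed_segment (p x) (p y)"
  shows "v \<in> {x, y}"
proof (rule ccontr)
  assume nv: "v \<notin> {x, y}"
  obtain k where k: "(v, k) \<in> A" using assms(1) swap by (auto simp: Field_def)
  have "{v, k} \<noteq> {x, y}" using nv by auto
  then have "p v \<in> p ` ({v, k} \<inter> {x, y})" using noncrossing[OF k assms(2)] assms(3) by auto
  then obtain w where "p v = p w" "w \<in> {v, k} \<inter> {x, y}" by auto
  then show False using p_eq[of v w] assms(1) in_Field[OF assms(2)] nv by auto
qed

text \<open>The edges avoiding \<open>v\<close> form a closed set without \<open>p v\<close>, so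
  near \<open>p v\<close> only the edges at \<open>v\<close> remain.\<close>

lemma local_vertex:
  assumes "(v, k0) \<in> A"
  obtains \<tau> where "\<tau> > 0" "\<And>z. z \<in> D \<Longrightarrow> dist (p v) z < \<tau> \<Longrightarrow> \<exists>k. (v, k) \<in> A \<and> z \<in> closed_segment (p v) (p k)"
proof -
  let ?U = "\<Union>(x, y)\<in>{(x, y)\<in>A. v \<notin> {x, y}}. closed_segment (p x) (p y)"
  have "p v \<notin> ?U"
  proof
    assume "p v \<in> ?U"
    then obtain x y where "(x, y) \<in> A" "v \<notin> {x, y}" "p v \<in> closed_segment (p x) (p y)" by blast
    then show False using vertex_off_edge[OF in_Field(1)[OF assms]] by blast
  qed
  then have "p v \<in> - ?U" by blast
  moreover have "open (- ?U)" by (rule open_Compl[OF closed_rest])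
  ultimately obtain \<tau> where \<tau>: "\<tau> > 0" "ball (p v) \<tau> \<subseteq> - ?U" using openE by meson
  show ?thesis
  proof (rule that[OF \<tau>(1)])
    fix z assume z: "z \<in> D" "dist (p v) z < \<tau>"
    then obtain x y where xy: "(x, y) \<in> A" "z \<in> closed_segment (p x) (p y)" by (auto simp: draw_def)
    have "z \<notin> ?U" using \<tau>(2) z by auto
    then have "v \<in> {x, y}" using xy by auto
    then show "\<exists>k. (v, k) \<in> A \<and> z \<in> closed_segment (p v) (p k)"
      using xy swap[OF xy(1)] by (auto simp: closed_segment_commute)
  qed
qed

lemma pt_conv: "pt x y s h = p x + (p y - p x) * (of_real s - \<i> * of_real h)"
  by (simp add: pt_def complex_eq_iff)

lemma pt_swap: "pt y x (1 - s) (- h) = pt x y s h"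
  by (simp add: pt_conv algebra_simps)

lemma pt_off_line: "p x \<noteq> p y \<Longrightarrow> h \<noteq> 0 \<Longrightarrow> pt x y s h \<notin> closed_segment (p x) (p y)"
proof
  assume "p x \<noteq> p y" "h \<noteq> 0" "pt x y s h \<in> closed_segment (p x) (p y)"
  then obtain r where "pt x y s h = (1 - r) *\<^sub>R p x + r *\<^sub>R p y" by (auto simp: in_segment)
  then have "(p y - p x) * (of_real s - \<i> * of_real h - of_real r) = 0"
    by (simp add: pt_conv scaleR_conv_of_real algebra_simps)
  then have "of_real s - \<i> * of_real h - of_real r = (0::complex)" using \<open>p x \<noteq> p y\<close> by simp
  then have "h = 0" by (simp add: complex_eq_iff)
  then show False using \<open>h \<noteq> 0\<close> by simp
qed

text \<open>With its end points cut off, the edge has positive distance from all other edges;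
  dividing by the length of the edge converts this into the coordinates of
  \<open>pt\<close>.\<close>

lemma strip_free:
  assumes xy: "(x, y) \<in> A" and s: "0 < s1" "s2 < 1"
  obtains h where "h > 0" "\<And>s t. s1 \<le> s \<Longrightarrow> s \<le> s2 \<Longrightarrow> t \<noteq> 0 \<Longrightarrow> \<bar>t\<bar> < h \<Longrightarrow> pt x y s t \<notin> D"
proof -
  let ?O = "\<Union>(z, w)\<in>{(z, w)\<in>A. {z, w} \<noteq> {x, y}}. closed_segment (p z) (p w)"
  let ?K = "(\<lambda>s. pt x y s 0) ` {s1..s2}"
  have cl: "closed ?O" by (rule closed_rest)
  have "compact ?K" unfolding pt_conv by (intro compact_continuous_image continuous_intros) auto
  moreover have "?K \<inter> ?O = {}"
  proof (rule ccontr)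
    assume "?K \<inter> ?O \<noteq> {}"
    then obtain s where s': "s \<in> {s1..s2}" "pt x y s 0 \<in> ?O" by blast
    then obtain z w where szw: "(z, w) \<in> A" "{z, w} \<noteq> {x, y}" "pt x y s 0 \<in> closed_segment (p z) (p w)"
      by blast
    have ptx: "pt x y s 0 = (1 - s) *\<^sub>R p x + s *\<^sub>R p y"
      by (simp add: pt_conv scaleR_conv_of_real algebra_simps)
    have "pt x y s 0 \<in> closed_segment (p x) (p y)"
      unfolding in_segment ptx using s' s by (intro exI[of _ s]) auto
    then have "pt x y s 0 \<in> p ` ({x, y} \<inter> {z, w})" using noncrossing[OF xy szw(1)] szw(2,3) by blast
    then have "pt x y s 0 = p x \<or> pt x y s 0 = p y" by auto
    then have "(p y - p x) * of_real s = 0 \<or> (p y - p x) * (of_real s - 1) = 0"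
      by (auto simp: pt_conv algebra_simps)
    then have "of_real s = (0::complex) \<or> of_real s - 1 = (0::complex)" using p_ne[OF xy] by auto
    then have "s = 0 \<or> s = 1" by (auto simp: complex_eq_iff)
    then show False using s' s by auto
  qed
  ultimately have sd: "?K \<noteq> {} \<Longrightarrow> ?O \<noteq> {} \<Longrightarrow> setdist ?K ?O > 0"
    using setdist_gt_0_compact_closed[OF _ cl, of ?K] by blast
  define \<delta> where "\<delta> = (if ?K = {} \<or> ?O = {} then 1 else setdist ?K ?O)"
  have \<delta>: "\<delta> > 0" using sd by (auto simp: \<delta>_def)
  let ?n = "norm (p y - p x)"
  have n: "?n > 0" using p_ne[OF xy] by simp
  show ?thesis
  proof (rule that[of "\<delta> / ?n"])
    show "\<delta> / ?n > 0" using \<delta> n by simp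
    fix s t assume st: "s1 \<le> s" "s \<le> s2" "t \<noteq> 0" "\<bar>t\<bar> < \<delta> / ?n"
    show "pt x y s t \<notin> D"
    proof
      assume "pt x y s t \<in> D"
      then obtain z w where zw: "(z, w) \<in> A" "pt x y s t \<in> closed_segment (p z) (p w)" by (auto simp: draw_def)
      have off: "pt x y s t \<notin> closed_segment (p x) (p y)" using pt_off_line p_ne[OF xy] st by blast
      then have "{z, w} \<noteq> {x, y}" using zw by (auto simp: doubleton_eq_iff closed_segment_commute)
      then have inO: "pt x y s t \<in> ?O" using zw by auto
      have inK: "pt x y s 0 \<in> ?K" using st by auto
      have "setdist ?K ?O \<le> dist (pt x y s 0) (pt x y s t)" by (rule setdist_le_dist[OF inK inO])
      also have "\<dots> = ?n * \<bar>t\<bar>"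
      proof -
        have "pt x y s 0 - pt x y s t = (p y - p x) * (\<i> * of_real t)" by (simp add: pt_conv algebra_simps)
        then show ?thesis by (simp add: dist_norm norm_mult)
      qed
      also have "\<dots> < \<delta>" using st(4) n by (simp add: field_simps)
      finally show False using inO inK by (auto simp: \<delta>_def split: if_splits)
    qed
  qed
qed

lemma strip_connected: "connected ((\<lambda>(s, t). pt x y s t) ` ({s1..s2} \<times> {0<..<h}))"
proof (rule connected_continuous_image)
  show "continuous_on ({s1..s2} \<times> {0<..<h}) (\<lambda>(s, t). pt x y s t)"
    unfolding pt_conv case_prod_unfold by (intro continuous_intros)
  show "connected ({s1..s2} \<times> {0<..<h})" by (intro connected_Times) auto
qed

lemma strip_in_component:
  assumes xy: "(x, y) \<in> A" and s: "0 < s1" "s1 \<le> s2" "s2 < 1"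
  shows "\<exists>h K. h > 0 \<and> K \<in> components (- D) \<and>
    (\<forall>s t. s1 \<le> s \<longrightarrow> s \<le> s2 \<longrightarrow> 0 < t \<longrightarrow> t < h \<longrightarrow> pt x y s t \<in> K)"
proof -
  obtain h where h: "h > 0" "\<And>s t. s1 \<le> s \<Longrightarrow> s \<le> s2 \<Longrightarrow> t \<noteq> 0 \<Longrightarrow> \<bar>t\<bar> < h \<Longrightarrow> pt x y s t \<notin> D"
    using strip_free[OF xy s(1,3)] by metis
  let ?S = "(\<lambda>(s, t). pt x y s t) ` ({s1..s2} \<times> {0<..<h})"
  have sub: "?S \<subseteq> - D" using h(2) by force
  have "(s1, h / 2) \<in> {s1..s2} \<times> {0<..<h}" using s h(1) by auto
  then have "?S \<noteq> {}" by blast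
  then have "- D \<noteq> {}" using sub by blast
  then obtain K where K: "K \<in> components (- D)" "?S \<subseteq> K"
    using exists_component_superset[OF sub _ strip_connected] by blast
  have "pt x y s t \<in> K" if "s1 \<le> s" "s \<le> s2" "0 < t" "t < h" for s t
    by (rule subsetD[OF K(2)], rule image_eqI[of _ _ "(s, t)"]) (use that in auto)
  then show ?thesis using h(1) K(1) by blast
qed

text \<open>The component is picked at the midpoint of the arc; by \<open>fc_strip\<close> every
  other interior point of the arc has the same component on its right.\<close>

definition fc :: "'a \<Rightarrow> 'a \<Rightarrow> complex set" where
  "fc x y = (SOME K. K \<in> components (- D) \<and> (\<exists>h>0. \<forall>t. 0 < t \<longrightarrow> t < h \<longrightarrow> pt x y (1 / 2) t \<in> K))"

lemma fc_strip:
  assumes xy: "(x, y) \<in> A"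
  shows "fc x y \<in> components (- D)"
    and "0 < s1 \<Longrightarrow> s2 < 1 \<Longrightarrow>
      \<exists>h>0. \<forall>s t. s1 \<le> s \<longrightarrow> s \<le> s2 \<longrightarrow> 0 < t \<longrightarrow> t < h \<longrightarrow> pt x y s t \<in> fc x y"
proof -
  obtain h K where "h > 0" "K \<in> components (- D)"
    "\<forall>s t. 1/2 \<le> s \<longrightarrow> s \<le> 1/2 \<longrightarrow> 0 < t \<longrightarrow> t < h \<longrightarrow> pt x y s t \<in> K"
    using strip_in_component[OF xy, of "1/2" "1/2"] by auto
  then have "\<exists>K. K \<in> components (- D) \<and> (\<exists>h>0. \<forall>t. 0 < t \<longrightarrow> t < h \<longrightarrow> pt x y (1 / 2) t \<in> K)"
    by (meson order_refl)
  from someI_ex[OF this] have fc: "fc x y \<in> components (- D)"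
    "\<exists>h>0. \<forall>t. 0 < t \<longrightarrow> t < h \<longrightarrow> pt x y (1 / 2) t \<in> fc x y" unfolding fc_def by blast+
  show "fc x y \<in> components (- D)" by (rule fc(1))
  assume s: "0 < s1" "s2 < 1"
  have m: "0 < min s1 (1/2)" "min s1 (1/2) \<le> max s2 (1/2)" "max s2 (1/2) < 1" using s by auto
  obtain h K where K: "h > 0" "K \<in> components (- D)"
    "\<And>s t. min s1 (1/2) \<le> s \<Longrightarrow> s \<le> max s2 (1/2) \<Longrightarrow> 0 < t \<Longrightarrow> t < h \<Longrightarrow> pt x y s t \<in> K"
    using strip_in_component[OF xy m] by blast
  obtain h' where h': "h' > 0" "\<And>t. 0 < t \<Longrightarrow> t < h' \<Longrightarrow> pt x y (1 / 2) t \<in> fc x y" using fc(2) by blast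
  let ?t = "min h h' / 2"
  have "pt x y (1/2) ?t \<in> K" using K(1) h'(1) by (intro K(3)) auto
  moreover have "pt x y (1/2) ?t \<in> fc x y" using K(1) h'(1) by (intro h'(2)) auto
  ultimately have "K = fc x y" using components_eq[OF K(2) fc(1)] by blast
  then show "\<exists>h>0. \<forall>s t. s1 \<le> s \<longrightarrow> s \<le> s2 \<longrightarrow> 0 < t \<longrightarrow> t < h \<longrightarrow> pt x y s t \<in> fc x y"
    using K(1,3) by (intro exI[of _ h]) auto
qed

lemma fc_eqI:
  assumes xy: "(x, y) \<in> A" and S: "connected S" "S \<subseteq> - D" "z \<in> S" "z \<in> fc x y"
  shows "S \<subseteq> fc x y"
  using components_maximal[OF fc_strip(1)[OF xy] S(1,2)] S(3,4) by blast

lemma fc_props: "(x, y) \<in> A \<Longrightarrow> fc x y \<noteq> {}" "(x, y) \<in> A \<Longrightarrow> open (fc x y)"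
  "(x, y) \<in> A \<Longrightarrow> fc x y \<subseteq> - D" "(x, y) \<in> A \<Longrightarrow> connected (fc x y)"
  using fc_strip(1) in_components_nonempty open_components[OF open_comp] in_components_subset in_components_connected
  by blast+

text \<open>If two edges left \<open>v\<close> in the same direction, the nearer of their far ends
  would lie on the other edge.\<close>

lemma dir_inj: "inj_on (\<kappa> v) (A `` {v})"
proof (rule inj_onI, rule ccontr)
  fix i k assume ik: "i \<in> A `` {v}" "k \<in> A `` {v}" "\<kappa> v i = \<kappa> v k" "i \<noteq> k"
  have a: "(v, i) \<in> A" "(v, k) \<in> A" using ik by auto
  have nz: "p i - p v \<noteq> 0" "p k - p v \<noteq> 0" using p_ne[OF a(1)] p_ne[OF a(2)] by auto
  have main: False if a: "(v, i) \<in> A" "(v, k) \<in> A" "i \<noteq> k" and r: "0 < r" "r \<le> 1" "p i - p v = of_real r * (p k - p v)" for i k r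
  proof -
    have "p i = (1 - r) *\<^sub>R p v + r *\<^sub>R p k" using r(3) by (simp add: scaleR_conv_of_real algebra_simps)
    then have "p i \<in> closed_segment (p v) (p k)" unfolding in_segment
      by (intro exI[of _ r] conjI) (use r in simp_all)
    then have "i \<in> {v, k}" using vertex_off_edge[OF in_Field(2)[OF a(1)] a(2)] by blast
    then show False using a ne by auto
  qed
  obtain r where r: "0 < r" "p i - p v = of_real r * (p k - p v)"
    using ik(3) Arg2pi_eq_iff[OF nz] by (auto simp: dir_key_def)
  show False
  proof (cases "r \<le> 1")
    case True
    then show False using main[OF a ik(4) r(1) True r(2)] by blast
  next
    case False
    have "p k - p v = of_real (1 / r) * (p i - p v)" using r by (simp add: field_simps)
    then show False using main[OF a(2,1) ik(4)[symmetric], of "1 / r"] r(1) False by (auto simp: field_simps)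
  qed
qed

lemma rot: "rot_graph \<kappa> A"
  using finite_arcs sym_arcs irrefl_arcs dir_inj by (simp add: rot_graph_def)

lemma finN: "finite (A `` {v})" by (rule rg_finN[OF rot])

text \<open>The opening of the corner at \<open>v\<close> through which the face of the dart
  \<open>(i, v)\<close> passes.\<close>

definition gap :: "'a \<Rightarrow> 'a \<Rightarrow> real" where
  "gap i v = (let j = nxt (\<kappa> v) (A `` {v}) i in if j = i then 2 * pi else ang (p i - p v) (p j - p v))"

lemma nxt_arc: "(i, v) \<in> A \<Longrightarrow> (v, nxt (\<kappa> v) (A `` {v}) i) \<in> A"
  using nxt_in[OF finN, of i v "\<kappa> v"] swap[of i v] by auto

lemma ang_distinct:
  assumes "(v, i) \<in> A" "(v, k) \<in> A" "i \<noteq> k"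
  shows "0 < ang (p i - p v) (p k - p v)"
proof -
  have nz: "p i - p v \<noteq> 0" "p k - p v \<noteq> 0" using p_ne assms by (metis eq_iff_diff_eq_0)+
  have "Arg2pi (p i - p v) \<noteq> Arg2pi (p k - p v)"
    using inj_onD[OF dir_inj, of v i k] assms by (auto simp: dir_key_def)
  then show ?thesis using Arg2pi[of "p i - p v"] Arg2pi[of "p k - p v"]
    unfolding ang_eq[OF nz] by auto
qed

lemma gap_bounds: "(i, v) \<in> A \<Longrightarrow> 0 < gap i v \<and> gap i v \<le> 2 * pi"
  using ang_distinct[of v i "nxt (\<kappa> v) (A `` {v}) i"] nxt_arc[of i v] swap[of i v]
    ang_bounds(2)[of "p i - p v" "p (nxt (\<kappa> v) (A `` {v}) i) - p v"]
  by (auto simp: gap_def Let_def)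

lemma gap_le:
  assumes iv: "(i, v) \<in> A" and k: "(v, k) \<in> A" "k \<noteq> i"
  shows "gap i v \<le> ang (p i - p v) (p k - p v)"
proof (rule ccontr)
  define j where "j = nxt (\<kappa> v) (A `` {v}) i"
  assume "\<not> ?thesis"
  then have lt: "ang (p i - p v) (p k - p v) < gap i v" by simp
  have vi: "(v, i) \<in> A" by (rule swap[OF iv])
  have "j \<noteq> i"
  proof
    assume "j = i"
    then have "A `` {v} = {i}" using nxt_self[OF finN, of i v "\<kappa> v"] vi by (auto simp: j_def)
    then show False using k by auto
  qed
  then have g: "gap i v = ang (p i - p v) (p j - p v)" by (simp add: gap_def j_def)
  have nz: "p i - p v \<noteq> 0" "p k - p v \<noteq> 0" "p j - p v \<noteq> 0"
    using p_ne[OF vi] p_ne[OF k(1)] p_ne[OF nxt_arc[OF iv], folded j_def] by auto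
  have "cyc (\<kappa> v i) (\<kappa> v k) (\<kappa> v j)" unfolding dir_key_def
    by (rule ang_cyc[OF nz]) (use lt ang_distinct[OF vi k(1)] k(2) g in auto)
  then show False using nxt_not_cyc[OF finN, of i v k "\<kappa> v"] vi k by (auto simp: j_def)
qed

text \<open>A small open sector between consecutive edges is connected and free of the drawing. It
  overlaps the strip to the right of \<open>(i, v)\<close> and the strip to the right of
  \<open>(v, j)\<close>, so both arcs see the same component.\<close>

lemma sector:
  assumes iv: "(i, v) \<in> A"
  defines "j \<equiv> nxt (\<kappa> v) (A `` {v}) i"
  shows "fc i v = fc v j"
    and "\<exists>\<tau>>0. \<forall>t \<theta>. 0 < t \<longrightarrow> t < \<tau> \<longrightarrow> 0 < \<theta> \<longrightarrow> \<theta> < gap i v \<longrightarrow>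
           p v + of_real t * (p i - p v) * cis \<theta> \<in> fc i v"
proof -
  let ?\<rho> = "p i - p v" and ?\<Theta> = "gap i v"
  have vi: "(v, i) \<in> A" by (rule swap[OF iv])
  have vj: "(v, j) \<in> A" using nxt_arc[OF iv] by (simp add: j_def)
  have \<rho>: "?\<rho> \<noteq> 0" using p_ne[OF iv] by auto
  have \<Theta>: "0 < ?\<Theta>" "?\<Theta> \<le> 2 * pi" using gap_bounds[OF iv] by auto
  obtain \<tau>0 where \<tau>0: "\<tau>0 > 0" "\<And>z. z \<in> D \<Longrightarrow> dist (p v) z < \<tau>0 \<Longrightarrow> \<exists>k. (v, k) \<in> A \<and> z \<in> closed_segment (p v) (p k)"
    using local_vertex[OF vi] by metis
  define \<tau> where "\<tau> = \<tau>0 / norm ?\<rho>"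
  have \<tau>: "\<tau> > 0" using \<tau>0(1) \<rho> by (simp add: \<tau>_def)
  let ?f = "\<lambda>(t, \<theta>). p v + of_real t * ?\<rho> * cis \<theta>"
  let ?S = "?f ` ({0<..<\<tau>} \<times> {0<..<?\<Theta>})"
  have conS: "connected ?S"
  proof (rule connected_continuous_image)
    show "continuous_on ({0<..<\<tau>} \<times> {0<..<?\<Theta>}) ?f"
      unfolding case_prod_unfold by (intro continuous_intros)
    show "connected ({0<..<\<tau>} \<times> {0<..<?\<Theta>})" by (intro connected_Times) auto
  qed
  have freeS: "?S \<subseteq> - D"
  proof (rule image_subsetI, clarify)
    fix t \<theta> assume t: "t \<in> {0<..<\<tau>}" "\<theta> \<in> {0<..<?\<Theta>}" and zD: "p v + of_real t * ?\<rho> * cis \<theta> \<in> D"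
    let ?z = "p v + of_real t * ?\<rho> * cis \<theta>"
    have "dist (p v) ?z = t * norm ?\<rho>" using t by (simp add: dist_norm norm_mult)
    also have "\<dots> < \<tau>0" using t \<rho> by (simp add: \<tau>_def field_simps)
    finally obtain k where k: "(v, k) \<in> A" "?z \<in> closed_segment (p v) (p k)" using \<tau>0(2)[OF zD] by auto
    then obtain r where r: "0 \<le> r" "?z = (1 - r) *\<^sub>R p v + r *\<^sub>R p k" by (auto simp: in_segment)
    then have eq: "of_real t * ?\<rho> * cis \<theta> = of_real r * (p k - p v)" by (simp add: scaleR_conv_of_real algebra_simps)
    have "of_real t * ?\<rho> * cis \<theta> \<noteq> 0" using t \<rho> by simp
    then have r0: "r > 0" using eq r(1) by (cases "r = 0") auto
    have "p k - p v = of_real (t / r) * ?\<rho> * cis \<theta>" using eq r0 by (simp add: field_simps)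
    moreover have "\<theta> < 2 * pi" using t \<Theta> by auto
    ultimately have ak: "ang ?\<rho> (p k - p v) = \<theta>" using ang_cis[OF \<rho>, of "t / r" \<theta>] t r0 by simp
    show False
    proof (cases "k = i")
      case True
      then have "ang ?\<rho> (p k - p v) = 0" using \<rho> by (simp add: ang_def Arg2pi_eq_0)
      then show False using ak t by simp
    next
      case False
      then show False using gap_le[OF iv k(1)] ak t by simp
    qed
  qed
  have inS: "p v + of_real t * ?\<rho> * cis \<theta> \<in> ?S" if "0 < t" "t < \<tau>" "0 < \<theta>" "\<theta> < ?\<Theta>" for t \<theta>
    using that by (intro image_eqI[of _ _ "(t, \<theta>)"]) auto
  \<comment> \<open>A direction close enough to the edge that the point at distance \<open>t\<close>
    has height below \<open>h\<close> and stays in the middle part of the strip. The bound 1 keeps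
    the angle below \<open>pi / 3\<close>, where the cosine is 1/2.\<close>
  have small: "\<exists>\<phi>. 0 < \<phi> \<and> \<phi> < ?\<Theta> \<and> t * sin \<phi> < h \<and> 0 < t * sin \<phi> \<and> t / 2 \<le> t * cos \<phi> \<and> t * cos \<phi> \<le> t"
    if "t > 0" "h > 0" for t h :: real
  proof -
    define \<phi> where "\<phi> = min (?\<Theta> / 2) (min 1 (h / (2 * t)))"
    have "\<phi> \<le> ?\<Theta> / 2" by (simp add: \<phi>_def)
    then have \<phi>: "0 < \<phi>" "\<phi> < ?\<Theta>" "\<phi> \<le> 1" "\<phi> \<le> h / (2 * t)" using that \<Theta> by (simp_all add: \<phi>_def)
    have "sin \<phi> \<le> \<phi>" using \<phi>(1) by (intro sin_x_le_x) auto
    then have "t * sin \<phi> \<le> t * (h / (2 * t))" using \<phi>(4) that by (intro mult_left_mono) auto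
    also have "\<dots> < h" using that by simp
    finally have 1: "t * sin \<phi> < h" .
    have "\<phi> < pi" using \<phi>(3) pi_gt3 by linarith
    then have 2: "0 < sin \<phi>" using \<phi>(1) by (intro sin_gt_zero) auto
    have "cos (pi / 3) \<le> cos \<phi>" using \<phi> pi_gt3 by (intro cos_monotone_0_pi_le) auto
    then have "t * (1 / 2) \<le> t * cos \<phi>" using that by (intro mult_left_mono) (auto simp: cos_60)
    then show ?thesis using \<phi> 1 2 that by (intro exI[of _ \<phi>]) auto
  qed
  define t1 where "t1 = min (\<tau> / 2) (1 / 2)"
  have t1: "0 < t1" "t1 < \<tau>" "t1 \<le> 1/2" using \<tau> by (auto simp: t1_def min_def)
  obtain h where h: "h > 0" "\<And>s t. 1 - t1 \<le> s \<Longrightarrow> s \<le> 1 - t1 / 2 \<Longrightarrow> 0 < t \<Longrightarrow> t < h \<Longrightarrow> pt i v s t \<in> fc i v"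
    using fc_strip(2)[OF iv, of "1 - t1" "1 - t1 / 2"] t1 by auto
  obtain \<phi> where \<phi>: "0 < \<phi>" "\<phi> < ?\<Theta>" "t1 * sin \<phi> < h" "0 < t1 * sin \<phi>" "t1 / 2 \<le> t1 * cos \<phi>" "t1 * cos \<phi> \<le> t1"
    using small[OF t1(1) h(1)] by blast
  have "pt i v (1 - t1 * cos \<phi>) (t1 * sin \<phi>) = p v + of_real t1 * ?\<rho> * cis \<phi>"
    by (simp add: pt_conv cis.ctr complex_eq_iff algebra_simps)
  moreover have "pt i v (1 - t1 * cos \<phi>) (t1 * sin \<phi>) \<in> fc i v" using \<phi> by (intro h(2)) auto
  ultimately have Sfc: "?S \<subseteq> fc i v"
    using fc_eqI[OF iv conS freeS inS[OF t1(1,2) \<phi>(1,2)]] by simp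
  then show "\<exists>\<tau>>0. \<forall>t \<theta>. 0 < t \<longrightarrow> t < \<tau> \<longrightarrow> 0 < \<theta> \<longrightarrow> \<theta> < ?\<Theta> \<longrightarrow>
           p v + of_real t * ?\<rho> * cis \<theta> \<in> fc i v"
    using \<tau> inS by blast
  have \<sigma>: "p j - p v \<noteq> 0" using p_ne[OF vj] by auto
  obtain l where l: "l > 0" "p j - p v = of_real l * ?\<rho> * cis ?\<Theta>"
  proof (cases "j = i")
    case True
    then have "?\<Theta> = 2 * pi" by (simp add: gap_def j_def)
    then show ?thesis using that[of 1] True by (simp add: cis_2pi)
  next
    case False
    then have "?\<Theta> = ang ?\<rho> (p j - p v)" by (simp add: gap_def j_def)
    then show ?thesis using ang_polar[OF \<rho> \<sigma>] that by metis
  qed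
  define t2 where "t2 = min (\<tau> / 2) (l / 2)"
  have t2: "0 < t2" "t2 < \<tau>" "t2 / l < 1" using \<tau> l by (auto simp: t2_def min_def field_simps)
  obtain h where h: "h > 0" "\<And>s t. t2 / l / 2 \<le> s \<Longrightarrow> s \<le> t2 / l \<Longrightarrow> 0 < t \<Longrightarrow> t < h \<Longrightarrow> pt v j s t \<in> fc v j"
    using fc_strip(2)[OF vj, of "t2 / l / 2" "t2 / l"] t2 l by auto
  obtain \<phi> where \<phi>: "0 < \<phi>" "\<phi> < ?\<Theta>" "(t2 / l) * sin \<phi> < h" "0 < (t2 / l) * sin \<phi>"
      "(t2 / l) / 2 \<le> (t2 / l) * cos \<phi>" "(t2 / l) * cos \<phi> \<le> t2 / l"
    using small[of "t2 / l" h] t2 l h by auto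
  have c: "of_real l * of_real (t2 / l) = (of_real t2 :: complex)" using l by simp
  have "pt v j ((t2 / l) * cos \<phi>) ((t2 / l) * sin \<phi>)
      = p v + (of_real l * of_real (t2 / l)) * ?\<rho> * (cis ?\<Theta> * cis (- \<phi>))"
    unfolding pt_conv l(2) cis_cnj[symmetric] by (simp add: complex_eq_iff algebra_simps)
  also have "\<dots> = p v + of_real t2 * ?\<rho> * cis (?\<Theta> - \<phi>)" unfolding c cis_mult by simp
  finally have eq: "pt v j ((t2 / l) * cos \<phi>) ((t2 / l) * sin \<phi>) = p v + of_real t2 * ?\<rho> * cis (?\<Theta> - \<phi>)" .
  have "pt v j ((t2 / l) * cos \<phi>) ((t2 / l) * sin \<phi>) \<in> fc v j" using \<phi> by (intro h(2)) auto
  moreover have "p v + of_real t2 * ?\<rho> * cis (?\<Theta> - \<phi>) \<in> fc i v" using subsetD[OF Sfc inS[OF t2(1,2), of "?\<Theta> - \<phi>"]] \<phi>(1,2) by simp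
  ultimately have "fc i v \<inter> fc v j \<noteq> {}" unfolding eq by blast
  then show "fc i v = fc v j" using components_eq[OF fc_strip(1)[OF iv] fc_strip(1)[OF vj]] by blast
qed

end

section \<open>Cycles and the Jordan curve theorem\<close>

lemma ang_shift:
  assumes "x \<noteq> 0" "y \<noteq> 0" "z \<noteq> 0" "ang x y \<le> ang x z"
  shows "ang y z = ang x z - ang x y"
  using assms(4) Arg2pi[of x] Arg2pi[of y] Arg2pi[of z]
  unfolding ang_eq[OF assms(1,2)] ang_eq[OF assms(1,3)] ang_eq[OF assms(2,3)] by (auto split: if_splits)

context plane_graph
begin

text \<open>Lets a frontier point inside an edge identify the components adjacent to it, since
  nothing but the edge and its two sides is nearby.\<close>

lemma near_edge:
  assumes xy: "(x, y) \<in> A" and s0: "0 < s0" "s0 < 1"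
  shows "\<exists>r>0. ball (pt x y s0 0) r \<subseteq> fc x y \<union> fc y x \<union> D"
proof -
  have yx: "(y, x) \<in> A" by (rule swap[OF xy])
  define a b where "a = s0 / 2" and "b = (1 + s0) / 2"
  have ab: "0 < a" "b < 1" "0 < 1 - b" "1 - a < 1" using s0 by (auto simp: a_def b_def)
  obtain h where h: "h > 0" "\<And>s t. a \<le> s \<Longrightarrow> s \<le> b \<Longrightarrow> 0 < t \<Longrightarrow> t < h \<Longrightarrow> pt x y s t \<in> fc x y"
    using fc_strip(2)[OF xy ab(1,2)] by blast
  obtain h' where h': "h' > 0"
    "\<And>s t. 1 - b \<le> s \<Longrightarrow> s \<le> 1 - a \<Longrightarrow> 0 < t \<Longrightarrow> t < h' \<Longrightarrow> pt y x s t \<in> fc y x"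
    using fc_strip(2)[OF yx ab(3,4)] by blast
  let ?n = "norm (p y - p x)"
  have n: "?n > 0" "p y - p x \<noteq> 0" using p_ne[OF xy] by auto
  define \<epsilon> where "\<epsilon> = min (min (s0 / 2) ((1 - s0) / 2)) (min h h')"
  have \<epsilon>: "\<epsilon> > 0" using h(1) h'(1) s0 by (simp add: \<epsilon>_def)
  have \<epsilon>_s: "\<epsilon> \<le> s0 / 2" "\<epsilon> \<le> (1 - s0) / 2" unfolding \<epsilon>_def
    by (rule min.coboundedI1[OF min.cobounded1], rule min.coboundedI1[OF min.cobounded2])
  have \<epsilon>_h: "\<epsilon> \<le> h" "\<epsilon> \<le> h'" unfolding \<epsilon>_def
    by (rule min.coboundedI2[OF min.cobounded1], rule min.coboundedI2[OF min.cobounded2])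
  have "ball (pt x y s0 0) (?n * \<epsilon>) \<subseteq> fc x y \<union> fc y x \<union> D"
  proof
    fix z assume z: "z \<in> ball (pt x y s0 0) (?n * \<epsilon>)"
    define w where "w = (z - p x) / (p y - p x)"
    have zw: "z = p x + (p y - p x) * w" using n by (simp add: w_def)
    have "z - pt x y s0 0 = (p y - p x) * (w - of_real s0)" by (simp add: pt_conv zw algebra_simps)
    then have "?n * norm (w - of_real s0) < ?n * \<epsilon>"
      using z by (simp add: dist_norm norm_minus_commute[of _ z] norm_mult)
    then have w: "norm (w - of_real s0) < \<epsilon>" using n by simp
    have "\<bar>Re (w - of_real s0)\<bar> < \<epsilon>" "\<bar>Im (w - of_real s0)\<bar> < \<epsilon>"
      using w abs_Re_le_cmod[of "w - of_real s0"] abs_Im_le_cmod[of "w - of_real s0"] by linarith+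
    then have "\<bar>Re w - s0\<bar> < \<epsilon>" and im: "\<bar>Im w\<bar> < \<epsilon>" by simp_all
    then have re: "a \<le> Re w" "Re w \<le> b" using \<epsilon>_s by (auto simp: a_def b_def)
    have zp: "z = pt x y (Re w) (- Im w)" by (simp add: zw pt_def)
    have zq: "z = pt y x (1 - Re w) (Im w)" using pt_swap[of y x "Re w" "- Im w"] zp by simp
    consider "Im w < 0" | "Im w > 0" | "Im w = 0" by linarith
    then show "z \<in> fc x y \<union> fc y x \<union> D"
    proof cases
      case 1
      then show ?thesis using h(2)[of "Re w" "- Im w"] re im \<epsilon>_h zp by auto
    next
      case 2
      then show ?thesis using h'(2)[of "1 - Re w" "Im w"] re im \<epsilon>_h zq by auto
    next
      case 3
      then have "z = (1 - Re w) *\<^sub>R p x + Re w *\<^sub>R p y"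
        using zp by (simp add: pt_conv scaleR_conv_of_real algebra_simps)
      moreover have "0 \<le> Re w" "Re w \<le> 1" using re ab by auto
      ultimately have "z \<in> closed_segment (p x) (p y)"
        unfolding in_segment by (intro exI[of _ "Re w"] conjI) simp_all
      then show ?thesis using seg_in_D[OF xy] by auto
    qed
  qed
  then show ?thesis using n \<epsilon> by (intro exI[of _ "?n * \<epsilon>"]) simp
qed

end

locale plane_cycle = plane_graph C p for C :: "('a \<times> 'a) set" and p :: "'a \<Rightarrow> complex" +
  fixes c :: "real \<Rightarrow> complex"
  assumes simple: "simple_path c" "pathfinish c = pathstart c" and image: "draw C p = path_image c"
begin

lemma inside_outside:
  "inside D \<noteq> {}" "open (inside D)" "connected (inside D)" "outside D \<noteq> {}" "open (outside D)"
  "connected (outside D)" "bounded (inside D)" "\<not> bounded (outside D)" "inside D \<inter> outside D = {}"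
  "inside D \<union> outside D = - D" "frontier (inside D) = D" "frontier (outside D) = D"
  using Jordan_inside_outside[OF simple] unfolding image by blast+

lemma comps: "inside D \<in> components (- D)" "outside D \<in> components (- D)"
  using inside_in_components[of D] outside_in_components[of D] inside_outside by auto

lemma fc_in_out:
  assumes "(x, y) \<in> C"
  shows "fc x y = inside D \<or> fc x y = outside D"
proof -
  have "fc x y \<noteq> {}" "fc x y \<subseteq> inside D \<union> outside D" using fc_props[OF assms] inside_outside(10) by auto
  then have "fc x y \<inter> inside D \<noteq> {} \<or> fc x y \<inter> outside D \<noteq> {}" by blast
  then show ?thesis using components_eq[OF fc_strip(1)[OF assms]] comps by blast
qed

lemma mid_in_D: "(x, y) \<in> C \<Longrightarrow> pt x y (1/2) 0 \<in> D"
proof -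
  assume xy: "(x, y) \<in> C"
  have "pt x y (1/2) 0 = (1 - 1/2) *\<^sub>R p x + (1/2) *\<^sub>R p y"
    by (simp add: pt_conv scaleR_conv_of_real field_simps)
  then have "pt x y (1/2) 0 \<in> closed_segment (p x) (p y)" unfolding in_segment by (intro exI[of _ "1/2"]) simp
  then show ?thesis using seg_in_D[OF xy] by auto
qed

text \<open>A point of a Jordan curve is in the closure of both the inside and the outside, but near
  the midpoint of an edge only its two sides are available.\<close>

lemma sides: "(x, y) \<in> C \<Longrightarrow> fc x y \<noteq> fc y x"
proof
  assume xy: "(x, y) \<in> C" and eq: "fc x y = fc y x"
  obtain r where r: "r > 0" "ball (pt x y (1/2) 0) r \<subseteq> fc x y \<union> fc y x \<union> D"
    using near_edge[OF xy, of "1/2"] by auto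
  have m: "pt x y (1/2) 0 \<in> closure (inside D)" "pt x y (1/2) 0 \<in> closure (outside D)"
    using mid_in_D[OF xy] inside_outside(11,12) by (auto simp: frontier_def)
  obtain z where z: "z \<in> inside D" "dist z (pt x y (1/2) 0) < r" using m(1) r(1) closure_approachable by blast
  obtain w where w: "w \<in> outside D" "dist w (pt x y (1/2) 0) < r" using m(2) r(1) closure_approachable by blast
  have "z \<in> ball (pt x y (1/2) 0) r" "w \<in> ball (pt x y (1/2) 0) r" using z w by (auto simp: dist_commute)
  moreover have "z \<notin> D" "w \<notin> D"
    using z(1) w(1) inside_no_overlap[of D] outside_no_overlap[of D] by blast+
  ultimately have "z \<in> fc x y" "w \<in> fc x y" using r(2) eq by blast+
  then show False using fc_in_out[OF xy] z(1) w(1) inside_Int_outside[of D] by blast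
qed

end

text \<open>\<open>k\<close> is the last index, not the length, and the cycle is listed in one
  direction only.\<close>

definition cycle_arcs :: "(nat \<Rightarrow> 'a) \<Rightarrow> nat \<Rightarrow> ('a \<times> 'a) set" where
  "cycle_arcs q k = (\<lambda>i. (q i, q (if i = k then 0 else Suc i))) ` {..k}"

lemma cycle_arcs_cases:
  assumes "(x, y) \<in> cycle_arcs q k"
  obtains i where "i < k" "x = q i" "y = q (Suc i)" | "x = q k" "y = q 0"
  using assms by (auto simp: cycle_arcs_def split: if_splits) (metis le_neq_implies_less)

lemma cycle_arcs_mem: "i < k \<Longrightarrow> (q i, q (Suc i)) \<in> cycle_arcs q k" "(q k, q 0) \<in> cycle_arcs q k"
  by (auto simp: cycle_arcs_def image_iff intro: bexI[of _ i] bexI[of _ k])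

context plane_graph
begin

text \<open>Further edges can only subdivide a component; a point close to the arc shows which
  component of the smaller drawing is meant.\<close>

lemma fc_mono:
  assumes "plane_graph B p" "B \<subseteq> A" "(x, y) \<in> B"
  shows "fc x y \<subseteq> plane_graph.fc B p x y"
proof -
  interpret B: plane_graph B p by fact
  have xy: "(x, y) \<in> A" using assms by auto
  have "draw B p \<subseteq> D" using assms(2) by (auto simp: draw_def)
  then have sub: "fc x y \<subseteq> - draw B p" using fc_props(3)[OF xy] by auto
  obtain h where h: "h > 0" "\<And>s t. 1/2 \<le> s \<Longrightarrow> s \<le> 1/2 \<Longrightarrow> 0 < t \<Longrightarrow> t < h \<Longrightarrow> pt x y s t \<in> fc x y"
    using fc_strip(2)[OF xy, of "1/2" "1/2"] by auto
  obtain h' where h': "h' > 0" "\<And>s t. 1/2 \<le> s \<Longrightarrow> s \<le> 1/2 \<Longrightarrow> 0 < t \<Longrightarrow> t < h' \<Longrightarrow> pt x y s t \<in> B.fc x y"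
    using B.fc_strip(2)[OF assms(3), of "1/2" "1/2"] by auto
  let ?z = "pt x y (1/2) (min h h' / 2)"
  have "?z \<in> fc x y" using h h'(1) by (intro h(2)) auto
  moreover have "?z \<in> B.fc x y" using h' h(1) by (intro h'(2)) auto
  ultimately show ?thesis using B.fc_eqI[OF assms(3) fc_props(4)[OF xy] sub] by blast
qed

lemma polygon_arc:
  assumes "inj_on q {..Suc k}" "\<And>i. i \<le> k \<Longrightarrow> (q i, q (Suc i)) \<in> A"
  shows "\<exists>g. arc g \<and> pathstart g = p (q 0) \<and> pathfinish g = p (q (Suc k)) \<and>
    path_image g = (\<Union>i\<le>k. closed_segment (p (q i)) (p (q (Suc i))))"
  using assms
proof (induction k)
  case 0
  have "p (q 0) \<noteq> p (q (Suc 0))" using p_ne 0 by simp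
  then show ?case by (intro exI[of _ "linepath (p (q 0)) (p (q (Suc 0)))"]) auto
next
  case (Suc k)
  have "inj_on q {..Suc k}" using Suc.prems(1) by (rule inj_on_subset) auto
  then obtain g where g: "arc g" "pathstart g = p (q 0)" "pathfinish g = p (q (Suc k))"
    "path_image g = (\<Union>i\<le>k. closed_segment (p (q i)) (p (q (Suc i))))"
    using Suc.IH Suc.prems(2) by force
  let ?l = "linepath (p (q (Suc k))) (p (q (Suc (Suc k))))"
  have e: "(q (Suc k), q (Suc (Suc k))) \<in> A" using Suc.prems(2) by simp
  have inter: "path_image g \<inter> path_image ?l \<subseteq> {pathstart ?l}"
  proof
    fix z assume z: "z \<in> path_image g \<inter> path_image ?l"
    then obtain i where i: "i \<le> k" "z \<in> closed_segment (p (q i)) (p (q (Suc i)))" using g(4) by auto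
    have "q (Suc (Suc k)) \<noteq> q i" "q (Suc (Suc k)) \<noteq> q (Suc i)"
      using inj_onD[OF Suc.prems(1), of "Suc (Suc k)" i] inj_onD[OF Suc.prems(1), of "Suc (Suc k)" "Suc i"] i(1) by auto
    then have no: "q (Suc (Suc k)) \<notin> {q i, q (Suc i)}" by auto
    then have "{q i, q (Suc i)} \<noteq> {q (Suc k), q (Suc (Suc k))}" by auto
    moreover have "(q i, q (Suc i)) \<in> A" using Suc.prems(2) i(1) by simp
    ultimately have "z \<in> p ` ({q i, q (Suc i)} \<inter> {q (Suc k), q (Suc (Suc k))})"
      using noncrossing[OF _ e, of "q i" "q (Suc i)"] i(2) z by auto
    then have "z = p (q (Suc k))" using no by auto
    then show "z \<in> {pathstart ?l}" by simp
  qed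
  have "arc (g +++ ?l)" using g inter p_ne[OF e] by (intro arc_join) auto
  moreover have "path_image (g +++ ?l) = (\<Union>i\<le>Suc k. closed_segment (p (q i)) (p (q (Suc i))))"
    using g by (subst path_image_join) (auto simp: atMost_Suc)
  ultimately show ?case using g by (intro exI[of _ "g +++ ?l"]) auto
qed

text \<open>All edges but the last form an arc by \<open>polygon_arc\<close>, and the last one meets
  it only at its ends. Three vertices or more guarantee that the closing edge is a new one.\<close>

lemma cycle_plane:
  assumes inj: "inj_on q {..k}" and k: "k \<ge> 2" and sub: "cycle_arcs q k \<subseteq> A"
  shows "\<exists>c. plane_cycle (cycle_arcs q k \<union> (cycle_arcs q k)\<inverse>) p c"
proof -
  let ?S = "cycle_arcs q k" and ?C = "cycle_arcs q k \<union> (cycle_arcs q k)\<inverse>"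
  obtain k' where k': "k = Suc k'" "k' \<ge> 1" using k by (cases k) auto
  have arcs: "(q i, q (Suc i)) \<in> A" if "i \<le> k'" for i using cycle_arcs_mem(1)[of i k q] that k' sub by auto
  have last: "(q k, q 0) \<in> A" using cycle_arcs_mem(2)[of q k] sub by blast
  obtain g where g: "arc g" "pathstart g = p (q 0)" "pathfinish g = p (q k)"
    "path_image g = (\<Union>i\<le>k'. closed_segment (p (q i)) (p (q (Suc i))))"
    using polygon_arc[of q k'] inj arcs k' by auto
  let ?l = "linepath (p (q k)) (p (q 0))"
  have inter: "path_image g \<inter> path_image ?l \<subseteq> {pathstart g, pathstart ?l}"
  proof
    fix z assume z: "z \<in> path_image g \<inter> path_image ?l"
    then obtain i where i: "i \<le> k'" "z \<in> closed_segment (p (q i)) (p (q (Suc i)))" using g(4) by auto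
    have "{q i, q (Suc i)} \<noteq> {q k, q 0}"
    proof
      assume "{q i, q (Suc i)} = {q k, q 0}"
      then have "q i = q k \<or> q i = q 0 \<and> q (Suc i) = q k" by (auto simp: doubleton_eq_iff)
      then show False using inj_onD[OF inj, of i k] inj_onD[OF inj, of i 0] inj_onD[OF inj, of "Suc i" k] i(1) k' by auto
    qed
    then have "z \<in> p ` ({q i, q (Suc i)} \<inter> {q k, q 0})"
      using noncrossing[OF arcs[OF i(1)] last] i(2) z by auto
    then show "z \<in> {pathstart g, pathstart ?l}" using g by auto
  qed
  let ?c = "g +++ ?l"
  have sp: "simple_path ?c" using g inter p_ne[OF last] by (intro simple_path_join_loop) auto
  have cl: "pathfinish ?c = pathstart ?c" using g by simp
  have symC: "sym ?C" by (auto simp: sym_def)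
  have "?C \<subseteq> A" using sub swap by auto
  then have pg: "plane_graph ?C p" by (rule plane_graph_subset[OF plane_graph_axioms _ symC])
  have im: "path_image ?c = (\<Union>i\<le>k'. closed_segment (p (q i)) (p (q (Suc i)))) \<union> closed_segment (p (q k)) (p (q 0))"
    using g by (subst path_image_join) auto
  have "draw ?C p = path_image ?c"
  proof
    show "draw ?C p \<subseteq> path_image ?c"
    proof
      fix z assume "z \<in> draw ?C p"
      then obtain x y where xy: "(x, y) \<in> ?S" "z \<in> closed_segment (p x) (p y)"
        by (auto simp: draw_def closed_segment_commute)
      from xy(1) show "z \<in> path_image ?c"
      proof (cases rule: cycle_arcs_cases)
        case (1 i)
        then show ?thesis unfolding im using xy(2) k' by (intro UnI1 UN_I[of i]) auto
      next
        case 2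
        then show ?thesis unfolding im using xy(2) by auto
      qed
    qed
    show "path_image ?c \<subseteq> draw ?C p"
    proof
      fix z assume "z \<in> path_image ?c"
      then consider i where "i \<le> k'" "z \<in> closed_segment (p (q i)) (p (q (Suc i)))" | "z \<in> closed_segment (p (q k)) (p (q 0))"
        unfolding im by auto
      then show "z \<in> draw ?C p"
      proof cases
        case (1 i)
        then have "(q i, q (Suc i)) \<in> ?S" using k' by (intro cycle_arcs_mem) auto
        then show ?thesis using 1(2) by (auto simp: draw_def)
      next
        case 2
        then show ?thesis using cycle_arcs_mem(2)[of q k] by (auto simp: draw_def)
      qed
    qed
  qed
  then have "plane_cycle ?C p ?c" using pg sp cl by (intro plane_cycle.intro plane_cycle_axioms.intro)
  then show ?thesis by blast
qed

lemma face_step_fc: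
  assumes "d \<in> A"
  shows "fc (fst (face_step \<kappa> A d)) (snd (face_step \<kappa> A d)) = fc (fst d) (snd d)"
  using sector(1)[of "fst d" "snd d"] assms by (simp add: face_step_def)

lemma orb_fc:
  assumes "(d, e) \<in> orb \<kappa> A" "d \<in> A"
  shows "fc (fst e) (snd e) = fc (fst d) (snd d)"
proof -
  have "e \<in> A \<and> fc (fst e) (snd e) = fc (fst d) (snd d)"
    using assms(1) unfolding orb_def
  proof (induction rule: rtrancl_induct)
    case base
    then show ?case using assms(2) by simp
  next
    case (step y z)
    then have "y \<in> A" "z = face_step \<kappa> A y" by blast+
    then show ?case using face_step_fc[of y] face_step_in[OF rot, of y] step.IH by simp
  qed
  then show ?thesis by blast
qed

text \<open>A connection that bypasses the edge closes a cycle through it. The sides of the edge are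
  different sides of this cycle, hence different components of the larger drawing.\<close>

lemma cycle_separates:
  assumes xy: "(x, y) \<in> A" and con: "(x, y) \<in> (del x y A)\<^sup>*"
  shows "fc x y \<noteq> fc y x"
proof
  assume eq: "fc x y = fc y x"
  obtain q k where q: "q 0 = x" "q k = y" "inj_on q {..k}" "\<And>i. i < k \<Longrightarrow> (q i, q (Suc i)) \<in> del x y A"
    using simple_walk_ex[OF con] by metis
  have "k \<noteq> 0"
  proof
    assume "k = 0"
    then show False using q(1,2) ne[OF xy] by simp
  qed
  moreover have "k \<noteq> 1" using q(1,2) q(4)[of 0] by (auto simp: del_def)
  ultimately have k: "k \<ge> 2" by simp
  have sub: "cycle_arcs q k \<subseteq> A"
  proof (rule subrelI)
    fix s t assume "(s, t) \<in> cycle_arcs q k"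
    then show "(s, t) \<in> A"
      using q(4) swap[OF xy] q(1,2) by (cases rule: cycle_arcs_cases) (auto simp: del_def)
  qed
  let ?C = "cycle_arcs q k \<union> (cycle_arcs q k)\<inverse>"
  obtain c where "plane_cycle ?C p c" using cycle_plane[OF q(3) k sub] by blast
  then interpret C: plane_cycle ?C p c .
  have CA: "?C \<subseteq> A" using sub swap by auto
  have yx: "(y, x) \<in> ?C" "(x, y) \<in> ?C" using cycle_arcs_mem(2)[of q k] q(1,2) by auto
  have "fc x y \<subseteq> C.fc x y" "fc y x \<subseteq> C.fc y x"
    using fc_mono[OF C.plane_graph_axioms CA] yx by auto
  then have "C.fc x y \<inter> C.fc y x \<noteq> {}" using eq fc_props(1)[OF xy] by blast
  then have "C.fc x y = C.fc y x" using components_eq[OF C.fc_strip(1)[OF yx(2)] C.fc_strip(1)[OF yx(1)]] by blast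
  then show False using C.sides[OF yx(2)] by blast
qed

end

text \<open>Face steps stay in one component, by \<open>sector\<close>. So one orbit on both sides
  of an edge means one component on both sides, which is impossible for an edge on a cycle.\<close>

theorem (in plane_graph) planar: "planar_rot \<kappa> A"
  unfolding planar_rot_def
proof (intro allI impI notI)
  fix H x y
  assume H: "H \<subseteq> A" "sym H" "(x, y) \<in> H" "((x, y), (y, x)) \<in> orb \<kappa> H" "(x, y) \<in> (del x y H)\<^sup>*"
  interpret H: plane_graph H p by (rule plane_graph_subset[OF plane_graph_axioms H(1,2)])
  show False using H.orb_fc[OF H(4,3)] H.cycle_separates[OF H(3,5)] by simp
qed

section \<open>Faces of biconnected drawings\<close>

locale biconnected = plane_graph A p for A :: "('a \<times> 'a) set" and p :: "'a \<Rightarrow> complex" +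
  fixes V :: "'a set"
  assumes finite_V: "finite V" and card_V: "card V \<ge> 3" and Field_A: "Field A = V"
    and conn_del: "\<And>v. v \<in> V \<Longrightarrow> conn_on (V - {v}) (A \<inter> (V - {v}) \<times> (V - {v}))"
begin

lemma A_sub: "A \<subseteq> V \<times> V"
  using Field_A by (auto simp: Field_def)

lemma third: "\<exists>z\<in>V. z \<noteq> x \<and> z \<noteq> y"
proof (rule ccontr)
  assume "\<not> ?thesis"
  then have "V \<subseteq> {x, y}" by blast
  then have "card V \<le> card {x, y}" by (intro card_mono) auto
  also have "\<dots> \<le> 2" by (simp add: card_insert_if)
  finally show False using card_V by simp
qed

lemma connected: "conn_on V A"
  unfolding conn_on_def
proof (intro ballI)
  fix x y assume xy: "x \<in> V" "y \<in> V"
  obtain z where z: "z \<in> V" "z \<noteq> x" "z \<noteq> y" using third by blast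
  then have "(x, y) \<in> (A \<inter> (V - {z}) \<times> (V - {z}))\<^sup>*" using conn_del[OF z(1)] xy by (auto simp: conn_on_def)
  then show "(x, y) \<in> A\<^sup>*" using rtrancl_mono[of "A \<inter> (V - {z}) \<times> (V - {z})" A] by blast
qed

lemma degree: "A `` {v} \<noteq> {} \<Longrightarrow> card (A `` {v}) \<ge> 2"
proof (rule ccontr)
  assume nz: "A `` {v} \<noteq> {}" and lt: "\<not> card (A `` {v}) \<ge> 2"
  have "card (A `` {v}) > 0" using nz finN by (simp add: card_gt_0_iff)
  then have "card (A `` {v}) = 1" using lt by simp
  then obtain w where w: "A `` {v} = {w}" by (rule card_1_singletonE)
  have vw: "(v, w) \<in> A" using w by auto
  then have V: "v \<in> V" "w \<in> V" "v \<noteq> w" using A_sub ne by auto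
  obtain z where z: "z \<in> V" "z \<noteq> v" "z \<noteq> w" using third by blast
  have "(v, z) \<in> (A \<inter> (V - {w}) \<times> (V - {w}))\<^sup>*" using conn_del[OF V(2)] z V by (auto simp: conn_on_def)
  then obtain t where "(v, t) \<in> A \<inter> (V - {w}) \<times> (V - {w})" using z(2) by (metis converse_rtranclE)
  then show False using w by auto
qed

text \<open>Otherwise a path from \<open>i\<close> to \<open>j\<close> that avoids \<open>v\<close>
  closes to a cycle through \<open>v\<close>. The face would lie to the right of
  \<open>(i, v)\<close> and to the right of \<open>(j, v)\<close>, which are opposite sides of this
  cycle.\<close>

lemma orbit_simple:
  assumes 1: "(i, v) \<in> A" and 2: "(j, v) \<in> A" and same: "((i, v), (j, v)) \<in> orb \<kappa> A"
  shows "i = j"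
proof (rule ccontr)
  assume ij: "i \<noteq> j"
  have V: "v \<in> V" "i \<in> V - {v}" "j \<in> V - {v}" using 1 2 A_sub ne by auto
  have "(i, j) \<in> (A \<inter> (V - {v}) \<times> (V - {v}))\<^sup>*" using conn_del[OF V(1)] V by (auto simp: conn_on_def)
  then obtain q k where q: "q 0 = i" "q k = j" "inj_on q {..k}"
    "\<And>l. l < k \<Longrightarrow> (q l, q (Suc l)) \<in> A \<inter> (V - {v}) \<times> (V - {v})" using simple_walk_ex by metis
  have k: "k \<noteq> 0"
  proof
    assume "k = 0"
    then show False using q(1,2) ij by simp
  qed
  have qv: "q l \<noteq> v" if "l \<le> k" for l using that q(2) q(4)[of l] V by (cases "l = k") auto
  define r where "r l = (if l = 0 then v else q (l - 1))" for l
  have injr: "inj_on r {..Suc k}"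
  proof (rule inj_onI)
    fix a b assume ab: "a \<in> {..Suc k}" "b \<in> {..Suc k}" "r a = r b"
    have le: "a - 1 \<le> k" "b - 1 \<le> k" using ab by auto
    show "a = b"
    proof (cases "a = 0 \<or> b = 0")
      case True
      then show ?thesis using qv[OF le(1)] qv[OF le(2)] ab(3) by (auto simp: r_def split: if_splits)
    next
      case False
      then have "q (a - 1) = q (b - 1)" using ab(3) by (simp add: r_def)
      then have "a - 1 = b - 1" using inj_onD[OF q(3)] le by blast
      then show ?thesis using False by linarith
    qed
  qed
  let ?S = "cycle_arcs r (Suc k)"
  have sub: "?S \<subseteq> A"
  proof (rule subrelI)
    fix s t assume "(s, t) \<in> ?S"
    then show "(s, t) \<in> A"
    proof (cases rule: cycle_arcs_cases)
      case (1 l)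
      then show ?thesis using q(4)[of "l - 1"] q(1) swap[OF assms(1)] by (cases "l = 0") (auto simp: r_def)
    next
      case c: 2
      then show ?thesis using q(2) 2 by (auto simp: r_def)
    qed
  qed
  let ?C = "?S \<union> ?S\<inverse>"
  obtain c where "plane_cycle ?C p c" using cycle_plane[OF injr _ sub] k by auto
  then interpret C: plane_cycle ?C p c .
  have CA: "?C \<subseteq> A" using sub swap by auto
  have ivC: "(v, i) \<in> ?S" "(j, v) \<in> ?S"
    using cycle_arcs_mem(1)[of 0 "Suc k" r] cycle_arcs_mem(2)[of r "Suc k"] q(1,2) by (auto simp: r_def)
  then have C4: "(i, v) \<in> ?C" "(v, j) \<in> ?C" "(j, v) \<in> ?C" by auto
  have NC: "?C `` {v} = {i, j}"
  proof
    show "{i, j} \<subseteq> ?C `` {v}"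
      using UnI1[OF ivC(1), of "?S\<inverse>"] C4(2)
      by (simp only: insert_subset Image_singleton_iff empty_subsetI simp_thms)
    have r0: "v = r 0" by (simp add: r_def)
    have at_v: "l = 0" if "v = r l" "l \<le> Suc k" for l
      by (rule inj_onD[OF injr trans[OF that(1)[symmetric] r0]]) (use that(2) in simp_all)
    have out: "t = i" if "(v, t) \<in> ?S" for t
      using that
    proof (cases rule: cycle_arcs_cases)
      case (1 l)
      have "l = 0" by (rule at_v[OF 1(2)]) (use 1(1) in simp)
      then show ?thesis using 1(3) q(1) by (simp add: r_def)
    next
      case 2
      have "Suc k = 0" by (rule at_v[OF 2(1)]) simp
      then show ?thesis by simp
    qed
    have inn: "t = j" if "(t, v) \<in> ?S" for t
      using that
    proof (cases rule: cycle_arcs_cases)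
      case (1 l)
      have "Suc l = 0" by (rule at_v[OF 1(3)]) (use 1(1) in simp)
      then show ?thesis by simp
    next
      case 2
      then show ?thesis using q(2) by (simp add: r_def)
    qed
    show "?C `` {v} \<subseteq> {i, j}"
    proof
      fix t assume "t \<in> ?C `` {v}"
      then have "(v, t) \<in> ?S \<or> (t, v) \<in> ?S" by simp
      then show "t \<in> {i, j}" using out[of t] inn[of t] by (elim disjE) simp_all
    qed
  qed
  have "nxt (\<kappa> v) (?C `` {v}) i = j"
    unfolding NC by (rule nxt_pair[OF ij]) (use C.dir_inj[of v] NC in simp)
  then have e1: "C.fc i v = C.fc v j" using C.sector(1)[OF C4(1)] by simp
  have "fc i v \<subseteq> C.fc i v" "fc j v \<subseteq> C.fc j v" using fc_mono[OF C.plane_graph_axioms CA] C4 by auto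
  moreover have "fc j v = fc i v" using orb_fc[OF same 1] by simp
  ultimately have "C.fc i v \<inter> C.fc j v \<noteq> {}" using fc_props(1)[OF 1] by blast
  then have "C.fc i v = C.fc j v" using components_eq[OF C.fc_strip(1)[OF C4(1)] C.fc_strip(1)[OF C4(3)]] by blast
  then show False using e1 C.sides[OF C4(2)] by simp
qed

text \<open>By \<open>orbit_simple\<close> the darts of an orbit end in distinct vertices, so the
  orbit is a simple cycle.\<close>

lemma face_polygon:
  assumes d: "d \<in> A"
  obtains q k where "k \<ge> 2" "inj_on q {..k}" "orb \<kappa> A `` {d} = cycle_arcs q k"
proof -
  let ?f = "face_step \<kappa> A"
  obtain m where m: "m > 0" "(?f ^^ m) d = d" "inj_on (\<lambda>i. (?f ^^ i) d) {..<m}"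
    "orb \<kappa> A `` {d} = (\<lambda>i. (?f ^^ i) d) ` {..<m}" by (rule orb_enum[OF rot d])
  have "orb \<kappa> A `` {d} \<in> faces \<kappa> A" using d by (auto simp: faces_def)
  then have "card (orb \<kappa> A `` {d}) \<ge> 3" by (rule face_card_ge_3[OF rot, rotated]) (rule degree)
  then have m3: "m \<ge> 3" using m(4) card_image[OF m(3)] by simp
  define q where "q i = fst ((?f ^^ i) d)" for i
  have dq: "(?f ^^ i) d = (q i, q (Suc i))" for i by (simp add: q_def face_step_def prod_eq_iff)
  have qm: "q m = q 0" using m(2) by (simp add: q_def)
  have inA: "(?f ^^ i) d \<in> A" for i using orb_in[OF rot orb_funpow[OF rot d] d] .
  have step_inj: "i = j" if "q (Suc i) = q (Suc j)" "i < m" "j < m" for i j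
  proof -
    have "((?f ^^ i) d, (?f ^^ j) d) \<in> orb \<kappa> A"
      using orb_trans[OF orb_sym[OF rot orb_funpow[OF rot d] d] orb_funpow[OF rot d]] .
    then have "q i = q j" using orbit_simple[of "q i" "q (Suc i)" "q j"] inA[of i] inA[of j] dq that by simp
    then have "(?f ^^ i) d = (?f ^^ j) d" using dq that by simp
    then show ?thesis using inj_onD[OF m(3)] that by simp
  qed
  have "inj_on q {..m - 1}"
  proof (rule inj_onI)
    fix i j assume ij: "i \<in> {..m - 1}" "j \<in> {..m - 1}" "q i = q j"
    define i' where "i' = (if i = 0 then m - 1 else i - 1)"
    define j' where "j' = (if j = 0 then m - 1 else j - 1)"
    have "q (Suc i') = q i" "q (Suc j') = q j" "i' < m" "j' < m"
      using qm m3 ij by (auto simp: i'_def j'_def)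
    then have "i' = j'" using step_inj ij(3) by simp
    then show "i = j" using ij m3 by (auto simp: i'_def j'_def split: if_splits)
  qed
  moreover have "orb \<kappa> A `` {d} = cycle_arcs q (m - 1)"
  proof -
    have "{..<m} = {..m - 1}" using m3 by auto
    moreover have "(?f ^^ i) d = (q i, q (if i = m - 1 then 0 else Suc i))" if "i \<in> {..m - 1}" for i
      using dq[of i] qm m3 by auto
    ultimately show ?thesis unfolding m(4) cycle_arcs_def by (intro image_cong) auto
  qed
  ultimately show ?thesis using that[of "m - 1" q] m3 by auto
qed

lemma face_cycle:
  assumes d: "d \<in> A"
  defines "O1 \<equiv> orb \<kappa> A `` {d}"
  shows "\<exists>c. plane_cycle (O1 \<union> O1\<inverse>) p c" and "O1 \<subseteq> A"
    and "\<And>v. v \<in> Field (O1 \<union> O1\<inverse>) \<Longrightarrow> \<exists>a b. (b, v) \<in> O1 \<and> (v, a) \<in> O1 \<and> a \<noteq> b \<and>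
          nxt (\<kappa> v) (A `` {v}) b = a \<and> (O1 \<union> O1\<inverse>) `` {v} = {a, b}"
proof -
  obtain q k where qk: "k \<ge> 2" "inj_on q {..k}" "O1 = cycle_arcs q k"
    using face_polygon[OF d] unfolding O1_def by metis
  show OA: "O1 \<subseteq> A" using orb_in[OF rot _ d] by (auto simp: O1_def)
  show "\<exists>c. plane_cycle (O1 \<union> O1\<inverse>) p c" using cycle_plane[OF qk(2,1)] OA unfolding qk(3) by blast
  have fin: "(b, v) \<in> O1 \<Longrightarrow> face_step \<kappa> A (b, v) \<in> O1" for b v
    using orb_into[of d "(b, v)" \<kappa> A] OA by (auto simp: O1_def)
  have uin: "b = b'" if "(b, v) \<in> O1" "(b', v) \<in> O1" for b b' v
  proof -
    have "((b, v), (b', v)) \<in> orb \<kappa> A"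
      using that orb_trans[OF orb_sym[OF rot _ d]] by (auto simp: O1_def)
    then show ?thesis using orbit_simple[of b v b'] that OA by auto
  qed
  have uout: "a = a'" if a: "(v, a) \<in> O1" "(v, a') \<in> O1" for a a' v
  proof -
    obtain i where i: "i \<le> k" "v = q i" "a = q (if i = k then 0 else Suc i)"
      using a(1) unfolding qk(3) cycle_arcs_def by auto
    obtain j where j: "j \<le> k" "v = q j" "a' = q (if j = k then 0 else Suc j)"
      using a(2) unfolding qk(3) cycle_arcs_def by auto
    have "i = j" using inj_onD[OF qk(2), of i j] i j by auto
    then show ?thesis using i j by simp
  qed
  have pre: "\<exists>b. (b, v) \<in> O1" if va: "(v, a) \<in> O1" for v a
  proof -
    obtain i where i: "i \<le> k" "v = q i" using va unfolding qk(3) cycle_arcs_def by auto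
    show ?thesis
    proof (cases "i = 0")
      case True
      then show ?thesis using cycle_arcs_mem(2)[of q k] i unfolding qk(3) by blast
    next
      case False
      then have "(q (i - 1), q (Suc (i - 1))) \<in> O1" unfolding qk(3) using i by (intro cycle_arcs_mem(1)) simp
      then show ?thesis using False i(2) by auto
    qed
  qed
  fix v assume "v \<in> Field (O1 \<union> O1\<inverse>)"
  then obtain b where b: "(b, v) \<in> O1" using pre unfolding Field_def by blast
  let ?a = "nxt (\<kappa> v) (A `` {v}) b"
  have va: "(v, ?a) \<in> O1" using fin[OF b] by (simp add: face_step_def)
  have ab: "?a \<noteq> b"
  proof
    assume "?a = b"
    moreover have "b \<in> A `` {v}" using b OA swap by auto
    ultimately have "A `` {v} = {b}" using nxt_self[OF finN] by metis
    then show False using degree[of v] by simp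
  qed
  have "(O1 \<union> O1\<inverse>) `` {v} = {?a, b}" using uin[OF b] uout[OF va] b va by blast
  then show "\<exists>a b. (b, v) \<in> O1 \<and> (v, a) \<in> O1 \<and> a \<noteq> b \<and>
          nxt (\<kappa> v) (A `` {v}) b = a \<and> (O1 \<union> O1\<inverse>) `` {v} = {a, b}" using b va ab by blast
qed

text \<open>The face is a full side \<open>?K\<close> of its boundary cycle. Any other edge at a
  boundary vertex starts on the opposite side, because the corner of the face contains no edge. By
  connectedness of the graph no vertex, and then no edge, can lie in \<open>?K\<close>.\<close>

lemma face_side:
  assumes d: "d \<in> A"
  defines "O1 \<equiv> orb \<kappa> A `` {d}"
  shows "fc (fst d) (snd d) = plane_graph.fc (O1 \<union> O1\<inverse>) p (fst d) (snd d)"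
    and "\<And>b v a. (b, v) \<in> O1 \<Longrightarrow> (v, a) \<in> O1 \<Longrightarrow>
      plane_graph.fc (O1 \<union> O1\<inverse>) p v a = plane_graph.fc (O1 \<union> O1\<inverse>) p (fst d) (snd d)"
proof -
  let ?C = "O1 \<union> O1\<inverse>"
  obtain c where "plane_cycle ?C p c" using face_cycle(1)[OF d] unfolding O1_def by blast
  then interpret C: plane_cycle ?C p c .
  have OA: "O1 \<subseteq> A" using face_cycle(2)[OF d] unfolding O1_def .
  have corner: "\<And>v. v \<in> Field ?C \<Longrightarrow> \<exists>a b. (b, v) \<in> O1 \<and> (v, a) \<in> O1 \<and> a \<noteq> b \<and>
          nxt (\<kappa> v) (A `` {v}) b = a \<and> ?C `` {v} = {a, b}"
    using face_cycle(3)[OF d] unfolding O1_def by blast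
  have CA: "?C \<subseteq> A" using OA swap by auto
  have dO: "d \<in> O1" by (simp add: O1_def orb_refl)
  let ?K = "C.fc (fst d) (snd d)"
  have turn: "C.fc b v = C.fc v a \<and> nxt (\<kappa> v) (?C `` {v}) a = b"
    if h: "(b, v) \<in> O1" "(v, a) \<in> O1" "a \<noteq> b" "?C `` {v} = {a, b}" for a b v
  proof -
    have inj: "inj_on (\<kappa> v) {b, a}" "inj_on (\<kappa> v) {a, b}" using C.dir_inj[of v] h(4) by (auto simp: insert_commute)
    have "nxt (\<kappa> v) (?C `` {v}) b = a" unfolding h(4) using nxt_pair[OF h(3)[symmetric] inj(1)] by (simp add: insert_commute)
    moreover have "nxt (\<kappa> v) (?C `` {v}) a = b" unfolding h(4) by (rule nxt_pair[OF h(3) inj(2)])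
    ultimately show ?thesis using C.sector(1)[of b v] h(1) by simp
  qed
  have const: "C.fc (fst e) (snd e) = ?K" if "e \<in> O1" for e
  proof -
    have "(d, e) \<in> orb \<kappa> A" using that by (simp add: O1_def)
    then have "e \<in> O1 \<and> C.fc (fst e) (snd e) = ?K"
      unfolding orb_def
    proof (induction rule: rtrancl_induct)
      case base
      then show ?case using dO by simp
    next
      case (step y z)
      then have y: "y \<in> O1" "z = face_step \<kappa> A y" "y \<in> A" "C.fc (fst y) (snd y) = ?K" by blast+
      obtain b v where bv: "y = (b, v)" by force
      have zO: "z \<in> O1" using orb_into[of d y \<kappa> A] y by (auto simp: O1_def)
      have "v \<in> Field ?C" using y bv by (auto simp: Field_def)
      then obtain a' b' where ab: "(b', v) \<in> O1" "(v, a') \<in> O1" "a' \<noteq> b'" "nxt (\<kappa> v) (A `` {v}) b' = a'" "?C `` {v} = {a', b'}"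
        using corner by blast
      have "b = b'"
      proof -
        have "((b, v), (b', v)) \<in> orb \<kappa> A"
          using y(1) ab(1) orb_trans[OF orb_sym[OF rot _ d]] unfolding bv by (auto simp: O1_def)
        then show ?thesis using orbit_simple[of b v b'] y(3) ab(1) OA bv by auto
      qed
      then have "z = (v, a')" using y(2) bv ab(4) by (simp add: face_step_def)
      then show ?case using turn[OF ab(1,2,3,5)] y(4) bv \<open>b = b'\<close> zO by simp
    qed
    then show ?thesis by blast
  qed
  show "C.fc v a = ?K" if "(b, v) \<in> O1" "(v, a) \<in> O1" for b v a using const[OF that(2)] by simp
  have dC: "(fst d, snd d) \<in> ?C" using dO by simp
  have K: "connected ?K" "open ?K" "?K \<subseteq> - draw ?C p" "?K \<in> components (- draw ?C p)"
    using C.fc_props(4,2,3)[OF dC] C.fc_strip(1)[OF dC] by blast+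
  have off: "open_segment (p s) (p t) \<subseteq> - draw ?C p" if st: "(s, t) \<in> A" "(s, t) \<notin> ?C" for s t
  proof
    fix z assume z: "z \<in> open_segment (p s) (p t)"
    show "z \<in> - draw ?C p"
    proof
      assume "z \<in> draw ?C p"
      then obtain x y where xy: "(x, y) \<in> ?C" "z \<in> closed_segment (p x) (p y)" by (auto simp: draw_def)
      have "{s, t} \<noteq> {x, y}" using st(2) xy(1) by (auto simp: doubleton_eq_iff)
      moreover have "(x, y) \<in> A" using xy CA by auto
      ultimately have "z \<in> p ` ({s, t} \<inter> {x, y})"
        using noncrossing[OF st(1), of x y] xy(2) z by (auto simp: open_segment_def)
      then show False using z by (auto simp: open_segment_def)
    qed
  qed
  \<comment> \<open>The edge lies in the angle at \<open>v\<close> from \<open>a\<close>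
    counterclockwise to \<open>b\<close>. This is the complement of the corner of the face and
    belongs to the other side of the cycle.\<close>
  have away: "open_segment (p v) (p r) \<inter> ?K = {}"
    if vr: "(v, r) \<in> A" "(v, r) \<notin> ?C" "v \<in> Field ?C" for v r
  proof -
    obtain a b where ab: "(b, v) \<in> O1" "(v, a) \<in> O1" "a \<noteq> b" "nxt (\<kappa> v) (A `` {v}) b = a" "?C `` {v} = {a, b}"
      using corner[OF vr(3)] by blast
    have avC: "(a, v) \<in> ?C" "(v, a) \<in> ?C" "(v, b) \<in> ?C" using ab by auto
    have arcs: "(b, v) \<in> A" "(v, a) \<in> A" "(v, b) \<in> A" using ab OA swap by auto
    have r: "r \<noteq> a" "r \<noteq> b" using vr(2) avC by auto
    have nz: "p a - p v \<noteq> 0" "p b - p v \<noteq> 0" "p r - p v \<noteq> 0"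
      using p_ne[OF arcs(2)] p_ne[OF arcs(3)] p_ne[OF vr(1)] by auto
    let ?\<theta> = "ang (p a - p v) (p r - p v)"
    have "gap b v = ang (p b - p v) (p a - p v)" using ab(3,4) by (simp add: gap_def)
    then have "ang (p b - p v) (p a - p v) \<le> ang (p b - p v) (p r - p v)" using gap_le[OF arcs(1) vr(1) r(2)] by simp
    then have "?\<theta> = ang (p b - p v) (p r - p v) - ang (p b - p v) (p a - p v)" by (rule ang_shift[OF nz(2,1,3)])
    moreover have "ang (p a - p v) (p b - p v) = 2 * pi - ang (p b - p v) (p a - p v)"
      using ang_complement[OF nz(2,1)] ang_distinct[OF arcs(3,2) ab(3)[symmetric]] by simp
    moreover have "C.gap a v = ang (p a - p v) (p b - p v)"
      using turn[OF ab(1,2,3,5)] ab(3) by (simp add: C.gap_def)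
    ultimately have \<theta>: "?\<theta> < C.gap a v" "0 < ?\<theta>"
      using ang_bounds(2)[of "p b - p v" "p r - p v"] ang_distinct[OF arcs(2) vr(1)] r(1) by auto
    obtain \<tau> where \<tau>: "\<tau> > 0" "\<And>t. 0 < t \<Longrightarrow> t < \<tau> \<Longrightarrow> p v + of_real t * (p a - p v) * cis ?\<theta> \<in> C.fc a v"
      using C.sector(2)[OF avC(1)] \<theta> by blast
    obtain l where l: "l > 0" "p r - p v = of_real l * (p a - p v) * cis ?\<theta>" by (rule ang_polar[OF nz(1,3)])
    define s where "s = min (1/2) (\<tau> / (2 * l))"
    have s: "0 < s" "s < 1" "s * l < \<tau>" using \<tau>(1) l(1) by (auto simp: s_def min_def field_simps)
    let ?z = "(1 - s) *\<^sub>R p v + s *\<^sub>R p r"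
    have "?z = p v + of_real s * (p r - p v)" by (simp add: scaleR_conv_of_real algebra_simps)
    also have "\<dots> = p v + of_real s * (of_real l * (p a - p v) * cis ?\<theta>)" by (simp only: l(2)[symmetric])
    also have "\<dots> = p v + of_real (s * l) * (p a - p v) * cis ?\<theta>" by (simp add: mult.assoc)
    finally have "?z \<in> C.fc a v" using \<tau>(2)[of "s * l"] s l(1) by simp
    moreover have zs: "?z \<in> open_segment (p v) (p r)" using s nz by (auto simp: in_segment)
    ultimately have "open_segment (p v) (p r) \<subseteq> C.fc a v"
      using C.fc_eqI[OF avC(1) convex_connected[OF convex_open_segment] off[OF vr(1,2)] zs] by blast
    moreover have "C.fc a v \<inter> C.fc v a = {}"
      using components_nonoverlap[OF C.fc_strip(1)[OF avC(1)] C.fc_strip(1)[OF avC(2)]] C.sides[OF avC(1)] by blast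
    moreover have "C.fc v a = ?K" using const[OF ab(2)] by simp
    ultimately show ?thesis by blast
  qed
  have touch: "t \<in> Field ?C" if st: "(s, t) \<in> A" "(s, t) \<notin> ?C" "p t \<in> draw ?C p" for s t
  proof -
    obtain x y where xy: "(x, y) \<in> ?C" "p t \<in> closed_segment (p x) (p y)" using st(3) by (auto simp: draw_def)
    have "t \<in> {x, y}" using vertex_off_edge[OF in_Field(2)[OF st(1)] _ xy(2)] xy(1) CA by blast
    then show ?thesis using xy(1) by (auto simp: Field_def)
  qed
  have blocked: False if st: "(s, t) \<in> A" "(s, t) \<notin> ?C" "open_segment (p s) (p t) \<subseteq> ?K" "p t \<in> draw ?C p" for s t
  proof -
    have "(t, s) \<in> A" "(t, s) \<notin> ?C" using st swap by auto
    from away[OF this touch[OF st(1,2,4)]] have "open_segment (p s) (p t) \<inter> ?K = {}"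
      by (simp add: open_segment_commute)
    then show False using st(3) p_ne[OF st(1)] open_segment_eq_empty[of "p s" "p t"] by blast
  qed
  have openK: "open_segment (p s) (p t) \<subseteq> ?K" if st: "(s, t) \<in> A" "(s, t) \<notin> ?C" "z \<in> open_segment (p s) (p t)" "z \<in> ?K" for s t z
    using components_maximal[OF K(4) convex_connected[OF convex_open_segment] off[OF st(1,2)]] st(3,4) by blast
  have closedK: "closed_segment (p s) (p t) \<subseteq> ?K"
    if st: "(s, t) \<in> A" "(s, t) \<notin> ?C" "p s \<notin> draw ?C p" "p t \<notin> draw ?C p" "z \<in> closed_segment (p s) (p t)" "z \<in> ?K" for s t z
  proof -
    have "closed_segment (p s) (p t) \<subseteq> - draw ?C p"
      using off[OF st(1,2)] st(3,4) by (auto simp: closed_segment_eq_open)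
    then show ?thesis using components_maximal[OF K(4) _ , of "closed_segment (p s) (p t)"] st(5,6) by auto
  qed
  \<comment> \<open>On a walk from such a vertex to the boundary cycle some edge leaves
    \<open>?K\<close>. It can do so only by ending on the cycle, which \<open>blocked\<close>
    forbids.\<close>
  have noV: "p x \<notin> ?K" if x: "x \<in> V" for x
  proof
    assume xK: "p x \<in> ?K"
    have fd: "fst d \<in> V" using d A_sub by (cases d) auto
    have fdD: "p (fst d) \<in> draw ?C p" using C.seg_in_D[OF dC] by auto
    have "(x, fst d) \<in> A\<^sup>*" using connected x fd by (auto simp: conn_on_def)
    moreover have "fst d \<notin> {x. p x \<in> ?K}" using fdD K(3) by auto
    ultimately obtain s t where st: "(s, t) \<in> A" "p s \<in> ?K" "p t \<notin> ?K"
      using rtrancl_exit[of x "fst d" A "{x. p x \<in> ?K}"] xK by auto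
    have sD: "p s \<notin> draw ?C p" using st(2) K(3) by auto
    have stC: "(s, t) \<notin> ?C"
    proof
      assume "(s, t) \<in> ?C"
      then show False using C.seg_in_D sD by auto
    qed
    show False
    proof (cases "p t \<in> draw ?C p")
      case False
      then have "closed_segment (p s) (p t) \<subseteq> ?K" using closedK[OF st(1) stC sD False _ st(2)] by auto
      then show False using st(3) by auto
    next
      case True
      obtain \<epsilon> where \<epsilon>: "\<epsilon> > 0" "ball (p s) \<epsilon> \<subseteq> ?K" using openE[OF K(2) st(2)] by blast
      have "p s \<in> closure (open_segment (p s) (p t))"
        using p_ne[OF st(1)] by (simp add: closure_open_segment)
      then obtain z where z: "z \<in> open_segment (p s) (p t)" "dist z (p s) < \<epsilon>"
        using \<epsilon>(1) closure_approachable by blast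
      have "z \<in> ?K" using \<epsilon>(2) z(2) by (auto simp: dist_commute)
      then have "open_segment (p s) (p t) \<subseteq> ?K" by (rule openK[OF st(1) stC z(1)])
      then show False using blocked[OF st(1) stC _ True] by blast
    qed
  qed
  have "?K \<subseteq> - D"
  proof
    fix z assume zK: "z \<in> ?K"
    show "z \<in> - D"
    proof
      assume "z \<in> D"
      then obtain x y where xy: "(x, y) \<in> A" "z \<in> closed_segment (p x) (p y)" by (auto simp: draw_def)
      have V: "x \<in> V" "y \<in> V" using xy(1) A_sub by auto
      have xyC: "(x, y) \<notin> ?C"
      proof
        assume "(x, y) \<in> ?C"
        then show False using C.seg_in_D xy(2) zK K(3) by blast
      qed
      have "z \<in> open_segment (p x) (p y)" using xy(2) zK noV[OF V(1)] noV[OF V(2)] by (auto simp: open_segment_def)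
      then have oK: "open_segment (p x) (p y) \<subseteq> ?K" using openK[OF xy(1) xyC _ zK] by blast
      have "p x \<in> draw ?C p \<or> p y \<in> draw ?C p"
      proof (rule ccontr)
        assume "\<not> ?thesis"
        then have "closed_segment (p x) (p y) \<subseteq> ?K" using closedK[OF xy(1) xyC _ _ xy(2) zK] by blast
        then show False using noV[OF V(1)] by auto
      qed
      then show False
      proof
        assume "p y \<in> draw ?C p"
        then show False using blocked[OF xy(1) xyC oK] by blast
      next
        assume px: "p x \<in> draw ?C p"
        have "(y, x) \<in> A" "(y, x) \<notin> ?C" using xy(1) xyC swap by auto
        then show False using blocked[of y x] oK px by (simp add: open_segment_commute)
      qed
    qed
  qed
  moreover have dA: "(fst d, snd d) \<in> A" using d by simp
  moreover have sub: "fc (fst d) (snd d) \<subseteq> ?K" by (rule fc_mono[OF C.plane_graph_axioms CA dC])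
  ultimately have "?K \<subseteq> fc (fst d) (snd d)"
    using components_maximal[OF fc_strip(1)[OF dA] K(1)] fc_props(1)[OF dA] by blast
  then show "fc (fst d) (snd d) = ?K" using sub by blast
qed

end

section \<open>Counting convex corners\<close>

lemma cos_pos_cases:
  assumes "0 \<le> \<theta>" "\<theta> < 2 * pi" "\<theta> < pi / 2 \<or> 3 * pi / 2 < \<theta>"
  shows "cos \<theta> > 0"
proof (cases "\<theta> < pi / 2")
  case True
  then show ?thesis using assms(1) pi_gt_zero by (intro cos_gt_zero_pi) auto
next
  case False
  then have "cos (2 * pi - \<theta>) > 0" using assms by (intro cos_gt_zero_pi) auto
  then show ?thesis by simp
qed

text \<open>The cosine of the angle from \<open>x\<close> to \<open>- g\<close> has the sign
  opposite to that of \<open>g \<bullet> x\<close>.\<close>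

lemma ang_back:
  assumes x: "x \<noteq> 0" "g \<noteq> 0"
  shows "g \<bullet> x \<ge> 0 \<Longrightarrow> pi / 2 \<le> ang x (- g) \<and> ang x (- g) \<le> 3 * pi / 2"
    and "g \<bullet> x > 0 \<Longrightarrow> pi / 2 < ang x (- g) \<and> ang x (- g) < 3 * pi / 2"
proof -
  let ?\<theta> = "ang x (- g)"
  obtain r where r: "r > 0" "- g = of_real r * x * cis ?\<theta>" using ang_polar[of x "- g"] x by auto
  have "(of_real r * x * cis ?\<theta>) \<bullet> x = r * cos ?\<theta> * (norm x)\<^sup>2"
    unfolding cmod_power2 by (simp add: inner_complex_def power2_eq_square algebra_simps)
  then have eq: "- (g \<bullet> x) = r * cos ?\<theta> * (norm x)\<^sup>2" unfolding r(2)[symmetric] by simp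
  have pos: "cos ?\<theta> > 0 \<Longrightarrow> g \<bullet> x < 0"
  proof -
    assume "cos ?\<theta> > 0"
    then have "r * cos ?\<theta> * (norm x)\<^sup>2 > 0" using r(1) x(1) by simp
    then show ?thesis using eq by simp
  qed
  have zero: "cos ?\<theta> = 0 \<Longrightarrow> g \<bullet> x = 0" using eq by simp
  have b: "0 \<le> ?\<theta>" "?\<theta> < 2 * pi" by (rule ang_bounds)+
  have c0: "cos (3 * pi / 2) = 0" using cos_periodic_pi[of "pi / 2"] cos_pi_half by (simp add: field_simps)
  show weak: "pi / 2 \<le> ?\<theta> \<and> ?\<theta> \<le> 3 * pi / 2" if "g \<bullet> x \<ge> 0"
    using cos_pos_cases[OF b] pos that by (meson leD leI)
  show "pi / 2 < ?\<theta> \<and> ?\<theta> < 3 * pi / 2" if h: "g \<bullet> x > 0"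
  proof -
    have "cos ?\<theta> \<noteq> 0" using zero h by linarith
    then have "?\<theta> \<noteq> pi / 2" "?\<theta> \<noteq> 3 * pi / 2" using c0 cos_pi_half by metis+
    then show ?thesis using weak h by auto
  qed
qed

context plane_graph
begin

text \<open>The vector \<open>- g\<close> points away from all neighbours. The edges next to it on
  either side are at least a quarter turn away, so the corner containing it measures at least a half
  turn.\<close>

lemma wide_corner:
  assumes ne: "A `` {v} \<noteq> {}" and g: "g \<noteq> 0" "\<And>k. (v, k) \<in> A \<Longrightarrow> g \<bullet> (p k - p v) \<ge> 0"
  obtains i where "(i, v) \<in> A" "gap i v \<ge> pi" "(\<And>k. (v, k) \<in> A \<Longrightarrow> g \<bullet> (p k - p v) > 0) \<Longrightarrow> gap i v > pi"
proof -
  define i where "i = arg_min_on (\<lambda>k. ang (p k - p v) (- g)) (A `` {v})"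
  have i: "(v, i) \<in> A" "\<And>k. (v, k) \<in> A \<Longrightarrow> ang (p i - p v) (- g) \<le> ang (p k - p v) (- g)"
    using arg_min_if_finite(1)[OF finN ne] arg_min_least[OF finN ne] by (auto simp: i_def)
  have iv: "(i, v) \<in> A" by (rule swap[OF i(1)])
  define j where "j = nxt (\<kappa> v) (A `` {v}) i"
  have vj: "(v, j) \<in> A" unfolding j_def by (rule nxt_arc[OF iv])
  show ?thesis
  proof (cases "j = i")
    case True
    then have "gap i v = 2 * pi" by (simp add: gap_def j_def)
    then show ?thesis using that[OF iv] pi_gt_zero by simp
  next
    case False
    let ?x = "p i - p v" and ?y = "p j - p v"
    have nz: "?x \<noteq> 0" "?y \<noteq> 0" "- g \<noteq> 0" using p_ne[OF i(1)] p_ne[OF vj] g by auto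
    have gp: "gap i v = ang ?x ?y" using False by (simp add: gap_def j_def)
    have pos: "0 < ang ?x ?y" using ang_distinct[OF i(1) vj] False by auto
    have "ang ?x (- g) < ang ?x ?y"
    proof (rule ccontr)
      assume "\<not> ?thesis"
      then have "ang ?y (- g) = ang ?x (- g) - ang ?x ?y" by (intro ang_shift[OF nz]) simp
      then show False using i(2)[OF vj] pos by simp
    qed
    then have sh: "ang (- g) ?y = ang ?x ?y - ang ?x (- g)" by (intro ang_shift[OF nz(1,3,2)]) simp
    have "ang ?y (- g) \<noteq> 0" using ang_back(1)[OF nz(2) g(1) g(2)[OF vj]] pi_gt_zero by linarith
    then have comp: "ang (- g) ?y = 2 * pi - ang ?y (- g)" by (rule ang_complement[OF nz(2,3)])
    show ?thesis
    proof (rule that[OF iv])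
      show "gap i v \<ge> pi" unfolding gp
        using sh comp ang_back(1)[OF nz(1) g(1) g(2)[OF i(1)]] ang_back(1)[OF nz(2) g(1) g(2)[OF vj]] by linarith
      show "gap i v > pi" if s: "\<And>k. (v, k) \<in> A \<Longrightarrow> g \<bullet> (p k - p v) > 0" unfolding gp
        using sh comp ang_back(2)[OF nz(1) g(1) s[OF i(1)]] ang_back(2)[OF nz(2) g(1) s[OF vj]] by linarith
    qed
  qed
qed

end

lemma inside_subset_convex:
  fixes S T :: "complex set"
  assumes "S \<subseteq> T" "convex T"
  shows "inside S \<subseteq> T"
proof -
  have "- T \<subseteq> outside S" using outside_mono[OF assms(1)] outside_convex[OF assms(2)] by simp
  then show ?thesis using inside_Int_outside[of S] by blast
qed

lemma draw_in_hull: "draw C p \<subseteq> convex hull (p ` Field C)"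
proof
  fix z assume "z \<in> draw C p"
  then obtain x y where xy: "(x, y) \<in> C" "z \<in> closed_segment (p x) (p y)" by (auto simp: draw_def)
  have "p x \<in> convex hull (p ` Field C)" "p y \<in> convex hull (p ` Field C)"
    using xy(1) by (auto intro!: hull_inc simp: Field_def)
  then show "z \<in> convex hull (p ` Field C)" using xy(2) closed_segment_subset[OF _ _ convex_convex_hull] by blast
qed

section \<open>Components of the complement and their convex corners\<close>

context biconnected
begin

definition region :: "'a \<times> 'a \<Rightarrow> complex set" where
  "region d = fc (fst d) (snd d)"

definition boundary :: "'a \<times> 'a \<Rightarrow> ('a \<times> 'a) set" where
  "boundary d = orb \<kappa> A `` {d} \<union> (orb \<kappa> A `` {d})\<inverse>"

lemma region_comp: "d \<in> A \<Longrightarrow> region d \<in> components (- D)"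
  using fc_strip(1)[of "fst d" "snd d"] by (simp add: region_def)

lemma orb_region: "(d, e) \<in> orb \<kappa> A \<Longrightarrow> d \<in> A \<Longrightarrow> region e = region d"
  unfolding region_def by (rule orb_fc)

lemma boundary_cycle: "d \<in> A \<Longrightarrow> \<exists>c. plane_cycle (boundary d) p c"
  unfolding boundary_def by (rule face_cycle(1))

lemma boundary_sub: "d \<in> A \<Longrightarrow> boundary d \<subseteq> A" "d \<in> A \<Longrightarrow> d \<in> boundary d"
  using face_cycle(2)[of d] swap by (auto simp: boundary_def orb_refl)

lemma region_side: "d \<in> A \<Longrightarrow> region d = plane_graph.fc (boundary d) p (fst d) (snd d)"
  unfolding region_def boundary_def by (rule face_side(1))

lemma region_cases:
  assumes d: "d \<in> A"
  shows "region d = inside (draw (boundary d) p) \<or> region d = outside (draw (boundary d) p)"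
proof -
  obtain c where "plane_cycle (boundary d) p c" using boundary_cycle[OF d] by blast
  then interpret C: plane_cycle "boundary d" p c .
  have "(fst d, snd d) \<in> boundary d" using boundary_sub(2)[OF d] by simp
  from C.fc_in_out[OF this] show ?thesis using region_side[OF d] by simp
qed

lemma region_bounded:
  assumes d: "d \<in> A" "bounded (region d)"
  shows "region d = inside (draw (boundary d) p)"
proof -
  obtain c where "plane_cycle (boundary d) p c" using boundary_cycle[OF d(1)] by blast
  then interpret C: plane_cycle "boundary d" p c .
  show ?thesis using region_cases[OF d(1)] C.inside_outside(8) d(2) by metis
qed

lemma frontier_region:
  assumes d: "d \<in> A"
  shows "frontier (region d) = draw (boundary d) p"
proof -
  obtain c where "plane_cycle (boundary d) p c" using boundary_cycle[OF d] by blast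
  then interpret C: plane_cycle "boundary d" p c .
  show ?thesis using region_cases[OF d] C.inside_outside(11,12) by metis
qed

text \<open>The midpoint of the edge \<open>d\<close> lies on both boundary cycles, so
  \<open>d\<close> or its reverse belongs to the orbit of \<open>e\<close>. The reverse would put
  one component on both sides of an edge of a cycle.\<close>

lemma region_inj:
  assumes d: "d \<in> A" and e: "e \<in> A" and eq: "region d = region e"
  shows "(e, d) \<in> orb \<kappa> A"
proof -
  obtain c where "plane_cycle (boundary d) p c" using boundary_cycle[OF d] by blast
  then interpret C: plane_cycle "boundary d" p c .
  obtain x y where xy: "d = (x, y)" by force
  have xyA: "(x, y) \<in> A" "(x, y) \<in> boundary d" using d boundary_sub(2)[OF d] xy by auto
  let ?m = "pt x y (1/2) 0"
  have "?m \<in> draw (boundary d) p" using C.mid_in_D[OF xyA(2)] .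
  then have "?m \<in> draw (boundary e) p" using frontier_region[OF d] frontier_region[OF e] eq by simp
  then obtain z w where zw: "(z, w) \<in> boundary e" "?m \<in> closed_segment (p z) (p w)" by (auto simp: draw_def)
  have zwA: "(z, w) \<in> A" using zw boundary_sub(1)[OF e] by auto
  have mseg: "?m \<in> closed_segment (p x) (p y)"
    unfolding in_segment by (intro exI[of _ "1/2"]) (simp add: pt_conv scaleR_conv_of_real field_simps)
  have "?m \<noteq> p x" "?m \<noteq> p y" using p_ne[OF xyA(1)] by (auto simp: pt_conv field_simps)
  then have "?m \<notin> p ` ({x, y} \<inter> {z, w})" by auto
  then have "{x, y} = {z, w}" using noncrossing[OF xyA(1) zwA] mseg zw(2) by blast
  then have "(x, y) = (z, w) \<or> (x, y) = (w, z)" by (auto simp: doubleton_eq_iff)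
  moreover have "(w, z) \<in> boundary e" using zw(1) by (auto simp: boundary_def)
  ultimately have "(x, y) \<in> boundary e" using zw(1) by auto
  then consider "(e, (x, y)) \<in> orb \<kappa> A" | "(e, (y, x)) \<in> orb \<kappa> A" by (auto simp: boundary_def)
  then show ?thesis
  proof cases
    case 2
    then have "region (y, x) = region e" by (rule orb_region[OF _ e])
    then have same: "fc y x = fc x y" using eq xy by (simp add: region_def)
    have yxC: "(y, x) \<in> boundary d" using C.swap[OF xyA(2)] .
    have "fc x y \<subseteq> C.fc x y" "fc y x \<subseteq> C.fc y x"
      using fc_mono[OF C.plane_graph_axioms boundary_sub(1)[OF d]] xyA(2) yxC by auto
    then have "C.fc x y \<inter> C.fc y x \<noteq> {}" using same fc_props(1)[OF xyA(1)] by blast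
    then have "C.fc x y = C.fc y x"
      using components_eq[OF C.fc_strip(1)[OF xyA(2)] C.fc_strip(1)[OF yxC]] by blast
    then show ?thesis using C.sides[OF xyA(2)] by blast
  qed (simp add: xy)
qed

text \<open>A corner is identified with the dart that enters it, so there are \<open>card A\<close>
  corners in all.\<close>

definition convex_corners :: "('a \<times> 'a) set" where
  "convex_corners = {(b, v) \<in> A. gap b v < pi}"

text \<open>The convex hull of the boundary vertices contains the open face, so it has at least
  three extreme points. The face stays within this hull, whereas a corner of at least a half turn at
  an extreme point would contain the outward direction \<open>- g\<close>.\<close>

lemma bounded_face_corners:
  assumes d: "d \<in> A" and bd: "bounded (region d)"
  shows "card (orb \<kappa> A `` {d} \<inter> convex_corners) \<ge> 3"
proof -
  let ?O = "orb \<kappa> A `` {d}" and ?C = "boundary d"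
  obtain c where "plane_cycle ?C p c" using boundary_cycle[OF d] by blast
  then interpret C: plane_cycle ?C p c .
  let ?X = "p ` Field ?C"
  let ?H = "convex hull ?X"
  have finX: "finite ?X" using C.finite_arcs by (simp add: finite_Field)
  have compH: "compact ?H" using finX by (rule finite_imp_compact_convex_hull)
  have DH: "draw ?C p \<subseteq> ?H" by (rule draw_in_hull)
  have rH: "region d \<subseteq> ?H" using region_bounded[OF d bd] inside_subset_convex[OF DH convex_convex_hull] by simp
  have OA: "?O \<subseteq> A" using face_cycle(2)[OF d] .
  let ?E = "{x. x extreme_point_of ?H}"
  have EX: "?E \<subseteq> ?X" by (rule extreme_points_of_convex_hull)
  have finE: "finite ?E" using EX finX finite_subset by blast
  have HE: "?H = convex hull ?E" by (rule Krein_Milman_Minkowski[OF compH convex_convex_hull])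
  have "open (region d)" "region d \<noteq> {}"
    using fc_props(1,2)[of "fst d" "snd d"] d by (auto simp: region_def)
  then have "interior ?H \<noteq> {}" using interior_maximal[OF rH] by blast
  then have "interior (convex hull ?E) \<noteq> {}" using HE by simp
  then have "\<not> card ?E \<le> DIM(complex)" using empty_interior_convex_hull[OF finE] by blast
  then have E3: "card ?E \<ge> 3" by simp
  have corner: "\<exists>b v. (b, v) \<in> ?O \<and> p v = e \<and> gap b v < pi" if e: "e \<in> ?E" for e
  proof -
    obtain v where v: "v \<in> Field ?C" "p v = e" using EX e by auto
    obtain a b where ab: "(b, v) \<in> ?O" "(v, a) \<in> ?O" "a \<noteq> b" "nxt (\<kappa> v) (A `` {v}) b = a"
      using face_cycle(3)[OF d, of v] v(1) unfolding boundary_def by blast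
    have "convex (?H - {e})" using e extreme_point_of_stillconvex[OF convex_convex_hull] by auto
    moreover have "?X - {e} \<subseteq> ?H - {e}" using hull_subset[of ?X convex] by blast
    ultimately have "convex hull (?X - {e}) \<subseteq> ?H - {e}" by (intro hull_minimal)
    then have "e \<notin> convex hull (?X - {e})" by blast
    moreover have "closed (convex hull (?X - {e}))"
      using finX by (intro compact_imp_closed finite_imp_compact_convex_hull) auto
    \<comment> \<open>All other boundary vertices lie strictly beyond \<open>e\<close> in direction
      \<open>g\<close>; the strictness excludes corners of exactly a half turn.\<close>
    ultimately obtain g \<beta> where g: "g \<bullet> e < \<beta>" "\<And>x. x \<in> convex hull (?X - {e}) \<Longrightarrow> g \<bullet> x > \<beta>"
      using separating_hyperplane_closed_point[OF convex_convex_hull] by metis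
    have gX: "g \<bullet> (x - e) > 0" if "x \<in> ?X" "x \<noteq> e" for x
      using g(1) g(2)[OF hull_inc[of x "?X - {e}" convex]] that by (simp add: inner_diff_right)
    have gH: "g \<bullet> e \<le> g \<bullet> x" if "x \<in> ?H" for x
    proof -
      have "?X \<subseteq> {x. g \<bullet> e \<le> g \<bullet> x}" using gX by (force simp: inner_diff_right)
      then have "?H \<subseteq> {x. g \<bullet> e \<le> g \<bullet> x}" by (intro hull_minimal convex_halfspace_ge)
      then show ?thesis using that by blast
    qed
    have arcs: "(b, v) \<in> A" "(v, a) \<in> A" "(v, b) \<in> A" using ab OA swap by auto
    have fields: "a \<in> Field ?C" "b \<in> Field ?C" using ab by (auto simp: boundary_def Field_def)
    let ?x = "p b - p v" and ?y = "p a - p v"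
    have nz: "?x \<noteq> 0" "?y \<noteq> 0" using p_ne[OF arcs(3)] p_ne[OF arcs(2)] by auto
    have gxy: "g \<bullet> ?x > 0" "g \<bullet> ?y > 0" using gX[of "p b"] gX[of "p a"] fields v nz by auto
    then have g0: "g \<noteq> 0" "- g \<noteq> 0" by auto
    have gp: "gap b v = ang ?x ?y" using ab(3,4) by (simp add: gap_def)
    have "gap b v < pi"
    proof (rule ccontr)
      assume "\<not> gap b v < pi"
      then have ge: "ang ?x ?y \<ge> pi" using gp by simp
      have bk: "pi / 2 < ang ?x (- g)" "ang ?x (- g) < 3 * pi / 2" "pi / 2 < ang ?y (- g)"
        using ang_back(2)[OF nz(1) g0(1) gxy(1)] ang_back(2)[OF nz(2) g0(1) gxy(2)] by auto
      have lt: "ang ?x (- g) < gap b v"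
      proof (rule ccontr)
        assume "\<not> ?thesis"
        then have "ang ?y (- g) = ang ?x (- g) - ang ?x ?y" using gp by (intro ang_shift[OF nz g0(2)]) simp
        then show False using bk ge by linarith
      qed
      have pos: "0 < ang ?x (- g)" using bk(1) pi_gt_zero by linarith
      obtain \<tau> where \<tau>: "\<tau> > 0" "\<And>t. 0 < t \<Longrightarrow> t < \<tau> \<Longrightarrow> p v + of_real t * ?x * cis (ang ?x (- g)) \<in> fc b v"
        using sector(2)[OF arcs(1)] lt pos by blast
      obtain r where r: "r > 0" "- g = of_real r * ?x * cis (ang ?x (- g))" by (rule ang_polar[OF nz(1) g0(2)])
      let ?t = "\<tau> / 2"
      have eq: "of_real ?t * ?x * cis (ang ?x (- g)) = (?t / r) *\<^sub>R (- g)"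
      proof -
        have "of_real ?t * ?x * cis (ang ?x (- g)) = of_real (?t / r) * (of_real r * ?x * cis (ang ?x (- g)))"
          using r(1) by simp
        also have "\<dots> = of_real (?t / r) * (- g)" by (simp only: r(2)[symmetric])
        finally show ?thesis by (simp only: scaleR_conv_of_real)
      qed
      have "p v + of_real ?t * ?x * cis (ang ?x (- g)) \<in> fc b v" by (rule \<tau>(2)) (use \<tau>(1) in simp_all)
      then have "p v + (?t / r) *\<^sub>R (- g) \<in> fc b v" by (simp only: eq)
      moreover have "fc b v = region d" using orb_region[of d "(b, v)"] ab(1) d by (simp add: region_def)
      ultimately have "p v + (?t / r) *\<^sub>R (- g) \<in> ?H" using rH by auto
      then have "g \<bullet> e \<le> g \<bullet> (p v + (?t / r) *\<^sub>R (- g))" by (rule gH)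
      also have "\<dots> = g \<bullet> e - (?t / r) * (g \<bullet> g)" using v(2) by (simp add: inner_add_right inner_diff_right)
      also have "\<dots> < g \<bullet> e" using \<tau>(1) r(1) g0(1) by simp
      finally show False by simp
    qed
    then show ?thesis using ab(1) v(2) by blast
  qed
  have "?E \<subseteq> (\<lambda>(b, v). p v) ` (?O \<inter> convex_corners)"
  proof
    fix e assume "e \<in> ?E"
    then obtain b v where "(b, v) \<in> ?O" "p v = e" "gap b v < pi" using corner by blast
    then show "e \<in> (\<lambda>(b, v). p v) ` (?O \<inter> convex_corners)"
      using OA by (intro image_eqI[of _ _ "(b, v)"]) (auto simp: convex_corners_def)
  qed
  moreover have "finite (?O \<inter> convex_corners)" using OA finite_arcs finite_subset by blast
  ultimately have "card ?E \<le> card (?O \<inter> convex_corners)" by (rule surj_card_le[rotated])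
  then show ?thesis using E3 by simp
qed

text \<open>Half planes are closed here: then hull edges can be added without losing the property.\<close>

definition weakly_pointed :: bool where
  "weakly_pointed \<longleftrightarrow> (\<forall>v\<in>V. \<exists>g. g \<noteq> 0 \<and> (\<forall>k. (v, k) \<in> A \<longrightarrow> g \<bullet> (p k - p v) \<ge> 0))"

lemma V_nbr: "v \<in> V \<Longrightarrow> A `` {v} \<noteq> {}"
  using Field_A swap by (auto simp: Field_def)

text \<open>Every vertex spends at least one corner on an angle of a half turn or more, and corners
  at different vertices are different.\<close>

lemma card_convex_corners:
  assumes "weakly_pointed"
  shows "card convex_corners + card V \<le> card A"
proof -
  have "\<exists>i. (i, v) \<in> A \<and> gap i v \<ge> pi" if v: "v \<in> V" for v
  proof -
    obtain g where "g \<noteq> 0" "\<And>k. (v, k) \<in> A \<Longrightarrow> g \<bullet> (p k - p v) \<ge> 0" using assms v by (auto simp: weakly_pointed_def)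
    then show ?thesis using wide_corner[OF V_nbr[OF v]] by metis
  qed
  then obtain f where f: "\<And>v. v \<in> V \<Longrightarrow> (f v, v) \<in> A \<and> gap (f v) v \<ge> pi" by metis
  let ?W = "(\<lambda>v. (f v, v)) ` V"
  have "card ?W = card V" by (intro card_image inj_onI) auto
  moreover have "(f v, v) \<notin> convex_corners" if "v \<in> V" for v using f[OF that] by (simp add: convex_corners_def)
  then have "?W \<inter> convex_corners = {}" by blast
  moreover have "?W \<subseteq> A" using f by blast
  moreover have "convex_corners \<subseteq> A" by (auto simp: convex_corners_def)
  moreover have fin: "finite ?W" "finite convex_corners"
    using finite_V finite_subset[OF \<open>convex_corners \<subseteq> A\<close> finite_arcs] by auto
  ultimately have "card (?W \<union> convex_corners) = card V + card convex_corners" "?W \<union> convex_corners \<subseteq> A"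
    using card_Un_disjoint[OF fin] by auto
  then show ?thesis using card_mono[OF finite_arcs, of "?W \<union> convex_corners"] by simp
qed

lemma sum_face_corners: "(\<Sum>F\<in>faces \<kappa> A. card (F \<inter> convex_corners)) = card convex_corners"
proof -
  have "card (\<Union>F\<in>faces \<kappa> A. F \<inter> convex_corners) = (\<Sum>F\<in>faces \<kappa> A. card (F \<inter> convex_corners))"
  proof (rule card_UN_disjoint[OF finite_faces[OF rot]])
    show "\<forall>F\<in>faces \<kappa> A. finite (F \<inter> convex_corners)"
      using faces_cover[OF rot] finite_arcs by (metis Sup_upper finite_Int finite_subset)
    show "\<forall>F\<in>faces \<kappa> A. \<forall>G\<in>faces \<kappa> A. F \<noteq> G \<longrightarrow> F \<inter> convex_corners \<inter> (G \<inter> convex_corners) = {}"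
      using faces_disjoint[OF rot] by blast
  qed
  moreover have "(\<Union>F\<in>faces \<kappa> A. F \<inter> convex_corners) = convex_corners"
    using faces_cover[OF rot] by (auto simp: convex_corners_def)
  ultimately show ?thesis by simp
qed

definition outer_faces :: "('a \<times> 'a) set set" where
  "outer_faces = {F \<in> faces \<kappa> A. \<exists>d\<in>F. \<not> bounded (region d)}"

text \<open>An unbounded component is the outside of the drawing, and by \<open>region_inj\<close> a
  component determines its orbit.\<close>

lemma card_outer_faces: "card outer_faces \<le> 1"
proof -
  have "F = G" if FG: "F \<in> outer_faces" "G \<in> outer_faces" for F G
  proof -
    have faceD: "\<exists>d\<in>A. F = orb \<kappa> A `` {d} \<and> region d = outside D" if FO: "F \<in> outer_faces" for F
    proof -
      obtain d0 d where d: "d0 \<in> A" "F = orb \<kappa> A `` {d0}" "(d0, d) \<in> orb \<kappa> A" "\<not> bounded (region d)"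
        using FO by (auto simp: outer_faces_def faces_def)
      have "region d0 \<in> components (- D) \<and> \<not> bounded (region d0)"
        using d region_comp orb_region[OF d(3,1)] by auto
      then have "region d0 = outside D"
        using bounded_unique_outside[of D "region d0"] compact_D by (auto simp: compact_imp_bounded)
      then show ?thesis using d by blast
    qed
    obtain d where d: "d \<in> A" "F = orb \<kappa> A `` {d}" "region d = outside D" using faceD[OF FG(1)] by blast
    obtain e where e: "e \<in> A" "G = orb \<kappa> A `` {e}" "region e = outside D" using faceD[OF FG(2)] by blast
    have "(e, d) \<in> orb \<kappa> A" using region_inj[OF d(1) e(1)] d(3) e(3) by simp
    then show ?thesis using orb_class_eq[OF rot _ e(1)] d(2) e(2) by blast
  qed
  then show ?thesis by (metis card_le_Suc0_iff_eq finite_faces[OF rot] outer_faces_def finite_Collect_conjI One_nat_def finite_subset Collect_subset card.infinite le0)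
qed

lemma face_corner_bound:
  assumes "F \<in> faces \<kappa> A" "F \<notin> outer_faces"
  shows "card (F \<inter> convex_corners) \<ge> 3"
proof -
  obtain d where d: "d \<in> A" "F = orb \<kappa> A `` {d}" using assms(1) by (auto simp: faces_def)
  have "d \<in> F" using d by (simp add: orb_refl)
  then have "bounded (region d)" using assms by (auto simp: outer_faces_def)
  then show ?thesis using bounded_face_corners[OF d(1)] d(2) by simp
qed

lemma corner_sum_bound:
  "card convex_corners \<ge> 3 * card (faces \<kappa> A - outer_faces)"
proof -
  have "3 * card (faces \<kappa> A - outer_faces) = (\<Sum>F\<in>faces \<kappa> A - outer_faces. 3)" by simp
  also have "\<dots> \<le> (\<Sum>F\<in>faces \<kappa> A - outer_faces. card (F \<inter> convex_corners))"
    by (rule sum_mono) (use face_corner_bound in auto)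
  also have "\<dots> \<le> (\<Sum>F\<in>faces \<kappa> A. card (F \<inter> convex_corners))"
    by (rule sum_mono2[OF finite_faces[OF rot]]) auto
  finally show ?thesis unfolding sum_face_corners .
qed

lemma card_inner_faces: "card (faces \<kappa> A - outer_faces) + 1 \<ge> card (faces \<kappa> A)"
proof -
  have sub: "outer_faces \<subseteq> faces \<kappa> A" by (auto simp: outer_faces_def)
  have "card (faces \<kappa> A - outer_faces) = card (faces \<kappa> A) - card outer_faces"
    using finite_subset[OF sub finite_faces[OF rot]] sub by (rule card_Diff_subset)
  then show ?thesis using card_outer_faces by linarith
qed

lemma euler: "2 * card (faces \<kappa> A) + 2 * card V \<ge> card A + 4"
  using card_faces_ge[OF rot planar finite_V _ A_sub connected] card_V by simp

text \<open>Each bounded face needs three convex corners, and at most \<open>card A - card V\<close>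
  corners are convex. Since Euler's inequality bounds the number of faces from below, there cannot
  be too many arcs.\<close>

theorem arc_bound:
  assumes "weakly_pointed"
  shows "card A + 6 \<le> 4 * card V"
  using card_convex_corners[OF assms] corner_sum_bound card_inner_faces euler by linarith

text \<open>At the extremal number of arcs the inequalities behind \<open>arc_bound\<close> are
  equalities, which leaves no room for a fourth convex corner in a bounded face.\<close>

theorem bounded_faces_three_corners:
  assumes wp: "weakly_pointed" and eq: "card A + 6 = 4 * card V" and d: "d \<in> A" "bounded (region d)"
  shows "card (orb \<kappa> A `` {d} \<inter> convex_corners) = 3"
proof -
  let ?I = "faces \<kappa> A - outer_faces" and ?F = "orb \<kappa> A `` {d}"
  have F: "?F \<in> faces \<kappa> A" using d by (auto simp: faces_def)
  have "bounded (region e)" if "e \<in> ?F" for e using orb_region[of d e] that d by auto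
  then have FI: "?F \<in> ?I" using F by (auto simp: outer_faces_def)
  have finI: "finite ?I" using finite_faces[OF rot] by simp
  have "(\<Sum>G\<in>?I. card (G \<inter> convex_corners)) \<le> (\<Sum>F\<in>faces \<kappa> A. card (F \<inter> convex_corners))"
    by (rule sum_mono2[OF finite_faces[OF rot]]) auto
  then have le: "(\<Sum>G\<in>?I. card (G \<inter> convex_corners)) \<le> card convex_corners" unfolding sum_face_corners .
  have "(\<Sum>G\<in>?I. card (G \<inter> convex_corners)) = card (?F \<inter> convex_corners) + (\<Sum>G\<in>?I - {?F}. card (G \<inter> convex_corners))"
    by (rule sum.remove[OF finI FI])
  moreover have "(\<Sum>G\<in>?I - {?F}. card (G \<inter> convex_corners)) \<ge> (\<Sum>G\<in>?I - {?F}. 3)"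
    by (rule sum_mono) (use face_corner_bound in auto)
  moreover have "card (?I - {?F}) = card ?I - 1" "card ?I \<ge> 1"
    using FI finI by (auto simp: Suc_le_eq card_gt_0_iff)
  moreover have "card (?F \<inter> convex_corners) \<ge> 3" by (rule bounded_face_corners[OF d])
  ultimately show ?thesis
    using le card_convex_corners[OF wp] card_inner_faces euler eq by simp
qed

text \<open>The frontier of a bounded component cannot consist of vertices only, because the plane
  without finitely many points is connected. So it contains an interior point of some edge, and near
  that point there are only the two sides of the edge.\<close>

lemma bounded_component_region:
  assumes F: "F \<in> components (- D)" "bounded F"
  obtains d where "d \<in> A" "F = region d"
proof -
  have op: "open F" using open_components[OF open_comp F(1)] .
  have Fne: "F \<noteq> {}" "F \<subseteq> - D" using in_components_nonempty[OF F(1)] in_components_subset[OF F(1)] by auto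
  have fr: "frontier F \<subseteq> D" by (rule frontier_of_components_closed_complement[OF closed_D F(1)])
  have pD: "p ` V \<subseteq> D"
  proof
    fix z assume "z \<in> p ` V"
    then obtain v k where "(v, k) \<in> A" "z = p v" using V_nbr by blast
    then show "z \<in> D" using seg_in_D by fastforce
  qed
  have "\<not> frontier F \<subseteq> p ` V"
  proof
    assume sub: "frontier F \<subseteq> p ` V"
    have con: "Topological_Spaces.connected (- (p ` V))"
      using path_connected_complement_countable[of "p ` V"] finite_V
      by (auto intro: path_connected_imp_connected countable_finite)
    have "- (p ` V) \<inter> F \<noteq> {}" using Fne pD by blast
    moreover have "- (p ` V) - F \<noteq> {}"
    proof
      assume "- (p ` V) - F = {}"
      then have "UNIV = p ` V \<union> F" by blast
      moreover have "bounded (p ` V \<union> F)" using F(2) finite_V by (simp add: finite_imp_bounded)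
      ultimately show False using not_bounded_UNIV by metis
    qed
    ultimately have "- (p ` V) \<inter> frontier F \<noteq> {}" by (rule connected_Int_frontier[OF con])
    then show False using sub by blast
  qed
  then obtain m where m: "m \<in> frontier F" "m \<notin> p ` V" by blast
  then obtain x y where xy: "(x, y) \<in> A" "m \<in> closed_segment (p x) (p y)" using fr by (force simp: draw_def)
  obtain s where s: "0 \<le> s" "s \<le> 1" "m = (1 - s) *\<^sub>R p x + s *\<^sub>R p y" using xy(2) by (auto simp: in_segment)
  have xyV: "x \<in> V" "y \<in> V" using xy A_sub by auto
  have "s \<noteq> 0" "s \<noteq> 1" using s(3) m(2) xyV by auto
  then have s01: "0 < s" "s < 1" using s by auto
  have mp: "m = pt x y s 0" using s(3) by (simp add: pt_conv scaleR_conv_of_real algebra_simps)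
  obtain r where r: "r > 0" "ball m r \<subseteq> fc x y \<union> fc y x \<union> D"
    using near_edge[OF xy(1) s01] unfolding mp by blast
  have "m \<in> closure F" using m(1) by (simp add: frontier_def)
  then obtain z where z: "z \<in> F" "dist z m < r" using r(1) closure_approachable by blast
  then have "z \<in> fc x y \<union> fc y x" using r(2) Fne(2) by (auto simp: dist_commute)
  then consider "z \<in> fc x y" | "z \<in> fc y x" by blast
  then show ?thesis
  proof cases
    case 1
    then have "F = fc x y" using components_eq[OF F(1) fc_strip(1)[OF xy(1)]] z(1) by blast
    then show ?thesis using that[of "(x, y)"] xy(1) by (simp add: region_def)
  next
    case 2
    then have "F = fc y x" using components_eq[OF F(1) fc_strip(1)[OF swap[OF xy(1)]]] z(1) by blast
    then show ?thesis using that[of "(y, x)"] swap[OF xy(1)] by (simp add: region_def)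
  qed
qed

section \<open>The outer face\<close>

abbreviation "hull_V \<equiv> convex hull (p ` V)"

lemma compact_hull: "compact hull_V"
  using finite_V by (intro finite_imp_compact_convex_hull) auto

lemma D_hull: "D \<subseteq> hull_V"
  using draw_in_hull[of A p] Field_A by simp

lemma V_in_D: "v \<in> V \<Longrightarrow> p v \<in> D"
  using V_nbr[of v] seg_in_D by fastforce

lemma interior_hull: "interior hull_V \<noteq> {}"
proof -
  obtain v where "v \<in> V" using card_V by fastforce
  then obtain d where d: "d \<in> A" using V_nbr by blast
  obtain c where "plane_cycle (boundary d) p c" using boundary_cycle[OF d] by blast
  then interpret C: plane_cycle "boundary d" p c .
  have "draw (boundary d) p \<subseteq> hull_V" using D_hull boundary_sub(1)[OF d] by (auto simp: draw_def)
  then have "inside (draw (boundary d) p) \<subseteq> hull_V" by (rule inside_subset_convex) simp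
  then show ?thesis using C.inside_outside(1,2) interior_maximal by blast
qed

lemma supporting_line:
  assumes z: "z \<in> frontier hull_V"
  obtains g where "g \<noteq> 0" "\<And>x. x \<in> hull_V \<Longrightarrow> g \<bullet> z \<le> g \<bullet> x"
proof -
  have nz: "z \<notin> interior hull_V" using z by (simp add: frontier_def)
  obtain g \<beta> where g: "g \<noteq> 0" "g \<bullet> z \<le> \<beta>" "\<And>x. x \<in> interior hull_V \<Longrightarrow> g \<bullet> x \<ge> \<beta>"
    using separating_hyperplane_sets[of "{z}" "interior hull_V"] nz interior_hull
    by (auto simp: convex_interior)
  have "interior hull_V \<subseteq> {x. g \<bullet> z \<le> g \<bullet> x}" using g by force
  then have "closure (interior hull_V) \<subseteq> {x. g \<bullet> z \<le> g \<bullet> x}" by (intro closure_minimal closed_halfspace_ge)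
  moreover have "closure (interior hull_V) = hull_V"
    using convex_closure_interior[OF convex_convex_hull interior_hull] compact_hull
    by (simp add: compact_imp_closed)
  ultimately show ?thesis using that[of g] g(1) by blast
qed

lemma on_line_frontier:
  assumes "g \<noteq> 0" "\<And>x. x \<in> hull_V \<Longrightarrow> c \<le> g \<bullet> x" "w \<in> hull_V" "g \<bullet> w = c"
  shows "w \<in> frontier hull_V"
proof -
  have "w \<notin> interior hull_V"
  proof
    assume "w \<in> interior hull_V"
    then obtain e where e: "e > 0" "ball w e \<subseteq> hull_V" by (meson mem_interior)
    let ?w = "w - (e / (2 * norm g)) *\<^sub>R g"
    have "dist w ?w < e" using e(1) assms(1) by (simp add: dist_norm)
    then have "?w \<in> hull_V" using e(2) by (simp only: subset_iff mem_ball)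
    then have "c \<le> g \<bullet> ?w" by (rule assms(2))
    also have "\<dots> = c - (e / (2 * norm g)) * (g \<bullet> g)" using assms(4) by (simp add: inner_diff_right)
    also have "\<dots> < c" using e(1) assms(1) by simp
    finally show False by simp
  qed
  then show ?thesis using assms(3) closure_subset[of hull_V] by (auto simp: frontier_def)
qed

text \<open>\<open>g\<close> and \<open>\<i> * g\<close> are orthogonal; they serve as coordinates
  across and along a supporting line.\<close>

lemma inner_basis: "(g::complex) \<noteq> 0 \<Longrightarrow> g \<bullet> x = g \<bullet> y \<Longrightarrow> (\<i> * g) \<bullet> x = (\<i> * g) \<bullet> y \<Longrightarrow> x = y"
proof -
  assume g: "g \<noteq> 0" "g \<bullet> x = g \<bullet> y" "(\<i> * g) \<bullet> x = (\<i> * g) \<bullet> y"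
  let ?d = "x - y"
  have 1: "Re g * Re ?d + Im g * Im ?d = 0" using g(2) by (simp add: inner_complex_def algebra_simps)
  have 2: "Re g * Im ?d - Im g * Re ?d = 0" using g(3) by (simp add: inner_complex_def algebra_simps)
  have "((Re g)\<^sup>2 + (Im g)\<^sup>2) * Re ?d = Re g * (Re g * Re ?d + Im g * Im ?d) - Im g * (Re g * Im ?d - Im g * Re ?d)"
    by (simp add: power2_eq_square algebra_simps)
  then have r: "((Re g)\<^sup>2 + (Im g)\<^sup>2) * Re ?d = 0" using 1 2 by simp
  have "((Re g)\<^sup>2 + (Im g)\<^sup>2) * Im ?d = Im g * (Re g * Re ?d + Im g * Im ?d) + Re g * (Re g * Im ?d - Im g * Re ?d)"
    by (simp add: power2_eq_square algebra_simps)
  then have i: "((Re g)\<^sup>2 + (Im g)\<^sup>2) * Im ?d = 0" using 1 2 by simp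
  have "(Re g)\<^sup>2 + (Im g)\<^sup>2 \<noteq> 0" using g(1) by (simp add: complex_eq_iff sum_power2_eq_zero_iff)
  then have "Re ?d = 0" "Im ?d = 0" using r i by (metis mult_eq_0_iff)+
  then show ?thesis by (simp add: complex_eq_iff)
qed

lemma on_line_segment:
  assumes g: "g \<noteq> 0" and "g \<bullet> x = c" "g \<bullet> y = c" "g \<bullet> w = c"
    and "(\<i> * g) \<bullet> x \<le> (\<i> * g) \<bullet> w" "(\<i> * g) \<bullet> w \<le> (\<i> * g) \<bullet> y"
  shows "w \<in> closed_segment x (y::complex)"
proof (cases "(\<i> * g) \<bullet> x = (\<i> * g) \<bullet> y")
  case True
  then have "w = x" using inner_basis[OF g, of w x] assms by auto
  then show ?thesis by simp
next
  case False
  let ?h = "\<i> * g"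
  define s where "s = (?h \<bullet> w - ?h \<bullet> x) / (?h \<bullet> y - ?h \<bullet> x)"
  have pos: "?h \<bullet> y - ?h \<bullet> x > 0" using assms False by auto
  have s: "0 \<le> s" "s \<le> 1" using pos assms by (auto simp: s_def)
  have sm: "s * (?h \<bullet> y - ?h \<bullet> x) = ?h \<bullet> w - ?h \<bullet> x" using pos by (simp add: s_def)
  have "w = (1 - s) *\<^sub>R x + s *\<^sub>R y"
  proof (rule inner_basis[OF g])
    show "g \<bullet> w = g \<bullet> ((1 - s) *\<^sub>R x + s *\<^sub>R y)" using assms(2-4) by (simp add: inner_add_right algebra_simps)
    show "?h \<bullet> w = ?h \<bullet> ((1 - s) *\<^sub>R x + s *\<^sub>R y)"
      using sm by (simp add: inner_add_right algebra_simps)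
  qed
  then show ?thesis using s by (auto simp: in_segment)
qed

text \<open>A supporting line cuts out a face of the hull, and a face of a polytope is spanned by
  the generating points on it.\<close>

lemma line_face:
  assumes g: "\<And>x. x \<in> hull_V \<Longrightarrow> c \<le> g \<bullet> x" and z: "z \<in> hull_V" "g \<bullet> z = c"
  shows "z \<in> convex hull (p ` {v \<in> V. g \<bullet> p v = c})"
proof -
  have "(hull_V \<inter> {x. g \<bullet> x = c}) face_of hull_V"
    by (rule face_of_Int_supporting_hyperplane_ge[OF convex_convex_hull]) (rule g)
  then obtain S where S: "S \<subseteq> p ` V" "hull_V \<inter> {x. g \<bullet> x = c} = convex hull S"
    using face_of_convex_hull_subset[of "p ` V"] finite_V by (metis finite_imageI finite_imp_compact)
  have "S \<subseteq> p ` {v \<in> V. g \<bullet> p v = c}"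
  proof
    fix x assume x: "x \<in> S"
    then have "x \<in> convex hull S" by (rule hull_inc)
    then have "g \<bullet> x = c" using S(2) by blast
    moreover obtain v where "v \<in> V" "x = p v" using x S(1) by blast
    ultimately show "x \<in> p ` {v \<in> V. g \<bullet> p v = c}" by blast
  qed
  then show ?thesis using S(2) z hull_mono[of S "p ` {v \<in> V. g \<bullet> p v = c}" convex] by auto
qed

text \<open>If \<open>z\<close> lies strictly between neighbouring vertices on a side of the hull that are not joined, then
  adding the missing edge contradicts the bound on the number of arcs.\<close>

lemma frontier_edge:
  assumes wp: "weakly_pointed" and eq: "card A + 6 = 4 * card V"
    and z: "z \<in> frontier hull_V" "z \<notin> p ` V"
  obtains x y where "(x, y) \<in> A" "z \<in> closed_segment (p x) (p y)" "closed_segment (p x) (p y) \<subseteq> frontier hull_V"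
proof -
  obtain g where g: "g \<noteq> 0" "\<And>x. x \<in> hull_V \<Longrightarrow> g \<bullet> z \<le> g \<bullet> x" using supporting_line[OF z(1)] by metis
  define c where "c = g \<bullet> z"
  have gc: "\<And>x. x \<in> hull_V \<Longrightarrow> c \<le> g \<bullet> x" using g(2) by (simp add: c_def)
  have zH: "z \<in> hull_V" using z(1) compact_hull by (metis compact_imp_closed frontier_subset_closed subsetD)
  let ?h = "\<i> * g"
  define T where "T = {v \<in> V. g \<bullet> p v = c}"
  have finT: "finite T" using finite_V by (simp add: T_def)
  have TV: "T \<subseteq> V" by (auto simp: T_def)
  have zT: "z \<in> convex hull (p ` T)" 
    unfolding T_def using line_face[of c g z] gc zH c_def[symmetric] by blast
  have neq: "?h \<bullet> p v \<noteq> ?h \<bullet> z" if "v \<in> T" for v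
  proof
    assume "?h \<bullet> p v = ?h \<bullet> z"
    then have "p v = z" using inner_basis[OF g(1)] that by (auto simp: T_def c_def)
    then show False using z(2) that by (auto simp: T_def)
  qed
  define L where "L = {v \<in> T. ?h \<bullet> p v < ?h \<bullet> z}"
  define U where "U = {v \<in> T. ?h \<bullet> p v > ?h \<bullet> z}"
  have "L \<noteq> {}"
  proof
    assume e: "L = {}"
    have "p ` T \<subseteq> {x. ?h \<bullet> x > ?h \<bullet> z}" using e neq by (force simp: L_def)
    then have "convex hull (p ` T) \<subseteq> {x. ?h \<bullet> x > ?h \<bullet> z}" by (intro hull_minimal convex_halfspace_gt)
    then show False using zT by blast
  qed
  have "U \<noteq> {}"
  proof
    assume e: "U = {}"
    have "p ` T \<subseteq> {x. ?h \<bullet> x < ?h \<bullet> z}" using e neq by (force simp: U_def)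
    then have "convex hull (p ` T) \<subseteq> {x. ?h \<bullet> x < ?h \<bullet> z}" by (intro hull_minimal convex_halfspace_lt)
    then show False using zT by blast
  qed
  have fin: "finite L" "finite U" using finT by (auto simp: L_def U_def)
  \<comment> \<open>Minimising the negated coordinate selects the vertex of \<open>L\<close> closest
    to \<open>z\<close>.\<close>
  define x where "x = arg_min_on (\<lambda>v. - (?h \<bullet> p v)) L"
  define y where "y = arg_min_on (\<lambda>v. ?h \<bullet> p v) U"
  have x: "x \<in> L" unfolding x_def by (rule arg_min_if_finite(1)[OF fin(1) \<open>L \<noteq> {}\<close>])
  have x_max: "?h \<bullet> p v \<le> ?h \<bullet> p x" if "v \<in> L" for v
    using arg_min_least[OF fin(1) \<open>L \<noteq> {}\<close> that, of "\<lambda>v. - (?h \<bullet> p v)"]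
    unfolding x_def[symmetric] by (simp only: neg_le_iff_le)
  have y: "y \<in> U" unfolding y_def by (rule arg_min_if_finite(1)[OF fin(2) \<open>U \<noteq> {}\<close>])
  have y_min: "?h \<bullet> p y \<le> ?h \<bullet> p v" if "v \<in> U" for v
    unfolding y_def by (rule arg_min_least[OF fin(2) \<open>U \<noteq> {}\<close> that])
  have xy: "x \<in> V" "y \<in> V" "g \<bullet> p x = c" "g \<bullet> p y = c" "?h \<bullet> p x < ?h \<bullet> z" "?h \<bullet> z < ?h \<bullet> p y"
    using x y unfolding L_def U_def T_def by blast+
  have nb: "?h \<bullet> p v \<le> ?h \<bullet> p x \<or> ?h \<bullet> p y \<le> ?h \<bullet> p v" if "v \<in> T" for v
  proof (cases "?h \<bullet> p v < ?h \<bullet> z")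
    case True
    then have "v \<in> L" using that by (simp only: L_def mem_Collect_eq simp_thms)
    then show ?thesis using x_max by blast
  next
    case False
    then have "v \<in> U" using that neq[OF that] by (simp only: U_def mem_Collect_eq simp_thms linorder_neq_iff)
    then show ?thesis using y_min by blast
  qed
  have zseg: "z \<in> closed_segment (p x) (p y)"
    by (rule on_line_segment[OF g(1) xy(3,4)]) (use xy in \<open>auto simp: c_def\<close>)
  have segH: "closed_segment (p x) (p y) \<subseteq> hull_V"
    using xy by (intro closed_segment_subset hull_inc convex_convex_hull) auto
  have segc: "g \<bullet> w = c" "?h \<bullet> p x \<le> ?h \<bullet> w" "?h \<bullet> w \<le> ?h \<bullet> p y" if w: "w \<in> closed_segment (p x) (p y)" for w
  proof -
    obtain s where s: "0 \<le> s" "s \<le> 1" "w = (1 - s) *\<^sub>R p x + s *\<^sub>R p y" using w by (auto simp: in_segment)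
    show "g \<bullet> w = c" using xy by (simp add: s(3) inner_add_right algebra_simps)
    have "?h \<bullet> w = ?h \<bullet> p x + s * (?h \<bullet> p y - ?h \<bullet> p x)"
      unfolding s(3) inner_add_right inner_scaleR_right by (simp add: algebra_simps)
    moreover have "0 \<le> s * (?h \<bullet> p y - ?h \<bullet> p x)" "s * (?h \<bullet> p y - ?h \<bullet> p x) \<le> ?h \<bullet> p y - ?h \<bullet> p x"
      using s xy by (auto intro!: mult_nonneg_nonneg mult_left_le_one_le)
    ultimately show "?h \<bullet> p x \<le> ?h \<bullet> w" "?h \<bullet> w \<le> ?h \<bullet> p y" by linarith+
  qed
  have segF: "closed_segment (p x) (p y) \<subseteq> frontier hull_V"
  proof
    fix w assume w: "w \<in> closed_segment (p x) (p y)"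
    then show "w \<in> frontier hull_V" using on_line_frontier[OF g(1) gc _ segc(1)[OF w]] segH by blast
  qed
  \<comment> \<open>An edge meeting the segment in a point that is no vertex has both ends on the
    supporting line, as the hull lies on one side of it. With no vertex strictly between
    \<open>x\<close> and \<open>y\<close> it would contain both of them, so it would be the edge
    between \<open>x\<close> and \<open>y\<close>.\<close>
  have cross: "w \<in> p ` ({x, y} \<inter> {s, t})"
    if st: "(s, t) \<in> A" "{x, y} \<noteq> {s, t}" and w: "w \<in> closed_segment (p x) (p y)" "w \<in> closed_segment (p s) (p t)" for s t w
  proof (cases "w \<in> p ` V")
    case True
    then obtain v where v: "v \<in> V" "w = p v" by auto
    have "v \<in> {s, t}" using vertex_off_edge[of v s t] st(1) w(2) v Field_A by auto
    moreover have "v \<in> {x, y}"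
    proof -
      have "v \<in> T" using segc(1)[OF w(1)] v by (auto simp: T_def)
      then have "?h \<bullet> p v = ?h \<bullet> p x \<or> ?h \<bullet> p v = ?h \<bullet> p y" using nb[of v] segc(2,3)[OF w(1)] v(2) by auto
      then have "p v = p x \<or> p v = p y" using inner_basis[OF g(1)] segc(1)[OF w(1)] v(2) xy by metis
      then show ?thesis using p_eq[of v x] p_eq[of v y] v(1) xy Field_A by auto
    qed
    ultimately show ?thesis using v(2) by blast
  next
    case False
    have stV: "s \<in> V" "t \<in> V" using st(1) A_sub by auto
    obtain r where r: "0 \<le> r" "r \<le> 1" "w = (1 - r) *\<^sub>R p s + r *\<^sub>R p t" using w(2) by (auto simp: in_segment)
    have "r \<noteq> 0" "r \<noteq> 1" using False r(3) stV by auto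
    then have r01: "0 < r" "r < 1" using r by auto
    have gs: "c \<le> g \<bullet> p s" "c \<le> g \<bullet> p t" using gc stV by (auto intro: hull_inc)
    have gsum: "(1 - r) * (g \<bullet> p s - c) + r * (g \<bullet> p t - c) = 0"
      using segc(1)[OF w(1)] unfolding r(3) by (simp add: inner_add_right algebra_simps)
    have "(1 - r) * (g \<bullet> p s - c) \<ge> 0" "r * (g \<bullet> p t - c) \<ge> 0" using r01 gs by auto
    then have "(1 - r) * (g \<bullet> p s - c) = 0" "r * (g \<bullet> p t - c) = 0" using gsum by linarith+
    then have gst: "g \<bullet> p s = c" "g \<bullet> p t = c" using r01 by auto
    then have T: "s \<in> T" "t \<in> T" using stV by (auto simp: T_def)
    have hw: "?h \<bullet> w = (1 - r) * (?h \<bullet> p s) + r * (?h \<bullet> p t)" unfolding r(3) inner_add_right inner_scaleR_right ..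
    have nx: "?h \<bullet> w \<noteq> ?h \<bullet> p x" "?h \<bullet> w \<noteq> ?h \<bullet> p y"
      using inner_basis[OF g(1), of w "p x"] inner_basis[OF g(1), of w "p y"] segc(1)[OF w(1)] xy False by auto
    have main: False if ab: "(a, b) \<in> A" "{a, b} = {s, t}" "?h \<bullet> p a \<le> ?h \<bullet> p x" "?h \<bullet> p y \<le> ?h \<bullet> p b" for a b
    proof -
      have gab: "g \<bullet> p a = c" "g \<bullet> p b = c" using ab(2) gst by (auto simp: doubleton_eq_iff)
      have "p x \<in> closed_segment (p a) (p b)" "p y \<in> closed_segment (p a) (p b)"
        using on_line_segment[OF g(1) gab, of "p x"] on_line_segment[OF g(1) gab, of "p y"] xy ab by auto
      then have "x \<in> {a, b}" "y \<in> {a, b}" using vertex_off_edge[OF _ ab(1)] xy Field_A by auto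
      moreover have "x \<noteq> y" using xy by auto
      ultimately show False using st(2) ab(2) by auto
    qed
    have between: "min (?h \<bullet> p s) (?h \<bullet> p t) \<le> ?h \<bullet> w" "?h \<bullet> w \<le> max (?h \<bullet> p s) (?h \<bullet> p t)"
    proof -
      let ?m = "min (?h \<bullet> p s) (?h \<bullet> p t)" and ?M = "max (?h \<bullet> p s) (?h \<bullet> p t)"
      have "(1 - r) * ?m + r * ?m \<le> (1 - r) * (?h \<bullet> p s) + r * (?h \<bullet> p t)"
        using r01 by (intro add_mono mult_left_mono) auto
      then show "?m \<le> ?h \<bullet> w" unfolding hw by (simp add: algebra_simps)
      have "(1 - r) * (?h \<bullet> p s) + r * (?h \<bullet> p t) \<le> (1 - r) * ?M + r * ?M"
        using r01 by (intro add_mono mult_left_mono) auto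
      then show "?h \<bullet> w \<le> ?M" unfolding hw by (simp add: algebra_simps)
    qed
    have "(?h \<bullet> p s \<le> ?h \<bullet> p x \<and> ?h \<bullet> p y \<le> ?h \<bullet> p t) \<or> (?h \<bullet> p t \<le> ?h \<bullet> p x \<and> ?h \<bullet> p y \<le> ?h \<bullet> p s)"
      using nb[OF T(1)] nb[OF T(2)] between segc(2,3)[OF w(1)] nx xy(5,6) by linarith
    then show ?thesis using main[of s t] main[of t s] st(1) swap by (auto simp: insert_commute)
  qed
  have "(x, y) \<in> A"
  proof (rule ccontr)
    assume nA: "(x, y) \<notin> A"
    let ?A = "insert (x, y) (insert (y, x) A)"
    have xney: "x \<noteq> y" using xy by auto
    have yx: "(y, x) \<notin> A" using nA swap by blast
    have FA: "Field ?A = V" using Field_A xy by (auto simp: Field_def)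
    have new: "closed_segment (p x) (p y) \<inter> closed_segment (p s) (p t) \<subseteq> p ` ({x, y} \<inter> {s, t})"
      if "(s, t) \<in> A" for s t
    proof -
      have "{x, y} \<noteq> {s, t}" using that nA yx by (auto simp: doubleton_eq_iff)
      then show ?thesis using cross[OF that] by blast
    qed
    have pg: "plane_graph ?A p"
    proof
      show "finite ?A" using finite_arcs by simp
      show "sym ?A" using sym_arcs by (auto simp: sym_def)
      show "irrefl ?A" using irrefl_arcs xney by (auto simp: irrefl_def)
      show "inj_on p (Field ?A)" using inj_p FA Field_A by simp
      fix a b s t assume e: "(a, b) \<in> ?A" "(s, t) \<in> ?A" "{a, b} \<noteq> {s, t}"
      consider "(a, b) \<in> A" "(s, t) \<in> A" | "{a, b} = {x, y}" "(s, t) \<in> A" | "(a, b) \<in> A" "{s, t} = {x, y}"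
        using e by (auto simp: insert_commute)
      then show "closed_segment (p a) (p b) \<inter> closed_segment (p s) (p t) \<subseteq> p ` ({a, b} \<inter> {s, t})"
      proof cases
        case 1
        then show ?thesis using noncrossing e(3) by blast
      next
        case 2
        then have eq: "closed_segment (p a) (p b) = closed_segment (p x) (p y)"
          by (auto simp: doubleton_eq_iff closed_segment_commute)
        show ?thesis unfolding eq 2(1) by (rule new[OF 2(2)])
      next
        case 3
        then have eq: "closed_segment (p s) (p t) = closed_segment (p x) (p y)"
          by (auto simp: doubleton_eq_iff closed_segment_commute)
        show ?thesis unfolding eq 3(2) using new[OF 3(1)] by (simp only: Int_commute)
      qed
    qed
    have "biconnected ?A p V"
    proof (intro biconnected.intro biconnected_axioms.intro pg finite_V card_V FA)
      fix v assume "v \<in> V"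
      have "A \<inter> (V - {v}) \<times> (V - {v}) \<subseteq> ?A \<inter> (V - {v}) \<times> (V - {v})" by auto
      from rtrancl_mono[OF this] conn_del[OF \<open>v \<in> V\<close>]
      show "conn_on (V - {v}) (?A \<inter> (V - {v}) \<times> (V - {v}))" unfolding conn_on_def by blast
    qed
    then interpret B: biconnected ?A p V .
    \<comment> \<open>At \<open>x\<close> and \<open>y\<close> the supporting half plane does the
      job: it contains all vertices, and the added edge runs along its border.\<close>
    have "B.weakly_pointed"
      unfolding B.weakly_pointed_def
    proof
      fix v assume v: "v \<in> V"
      show "\<exists>g. g \<noteq> 0 \<and> (\<forall>k. (v, k) \<in> ?A \<longrightarrow> g \<bullet> (p k - p v) \<ge> 0)"
      proof (cases "v \<in> {x, y}")
        case True
        have "g \<bullet> p v = c" using True xy by auto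
        moreover have "k \<in> V" if "(v, k) \<in> ?A" for k using that FA by (auto simp: Field_def)
        then have "c \<le> g \<bullet> p k" if "(v, k) \<in> ?A" for k using gc that by (auto intro: hull_inc)
        ultimately show ?thesis using g(1) by (intro exI[of _ g]) (simp add: inner_diff_right)
      next
        case False
        obtain g' where g': "g' \<noteq> 0" "\<forall>k. (v, k) \<in> A \<longrightarrow> g' \<bullet> (p k - p v) \<ge> 0"
          using wp v unfolding weakly_pointed_def by blast
        then show ?thesis using False by (intro exI[of _ g']) auto
      qed
    qed
    from B.arc_bound[OF this] have "card ?A + 6 \<le> 4 * card V" .
    moreover have "card ?A = card A + 2" using finite_arcs nA yx xney by simp
    ultimately show False using eq by simp
  qed
  then show ?thesis using that zseg segF by blast
qed

text \<open>For a vertex not on a frontier edge, all other vertices and all frontier edges keep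
  away, so by \<open>frontier_edge\<close> it would be an isolated point of the frontier. A
  punctured disc is connected and would be filled or missed by the hull; neither fits a frontier
  point of a convex set with interior.\<close>

lemma frontier_covered:
  assumes wp: "weakly_pointed" and eq: "card A + 6 = 4 * card V" and z: "z \<in> frontier hull_V"
  shows "\<exists>x y. (x, y) \<in> A \<and> z \<in> closed_segment (p x) (p y) \<and> closed_segment (p x) (p y) \<subseteq> frontier hull_V"
proof (cases "z \<in> p ` V")
  case False
  then show ?thesis using frontier_edge[OF wp eq z] by metis
next
  case True
  let ?U = "\<Union>(x, y)\<in>{(x, y)\<in>A. closed_segment (p x) (p y) \<subseteq> frontier hull_V}. closed_segment (p x) (p y)"
  have "z \<in> ?U"
  proof (rule ccontr)
    assume nU: "z \<notin> ?U"
    have cl: "closed (?U \<union> (p ` V - {z}))"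
      using closed_rest[of "\<lambda>x y. closed_segment (p x) (p y) \<subseteq> frontier hull_V"] finite_V
      by (intro closed_Un[OF _ finite_imp_closed]) simp_all
    have zc: "z \<in> - (?U \<union> (p ` V - {z}))"
      using nU by (simp only: Compl_iff Un_iff Diff_iff singleton_iff simp_thms)
    obtain e where e: "e > 0" "ball z e \<subseteq> - (?U \<union> (p ` V - {z}))"
      by (rule openE[OF open_Compl[OF cl] zc])
    have iso: "frontier hull_V \<inter> (ball z e - {z}) = {}"
    proof (rule ccontr)
      assume "frontier hull_V \<inter> (ball z e - {z}) \<noteq> {}"
      then obtain w where w: "w \<in> frontier hull_V" "w \<in> ball z e" "w \<noteq> z" by blast
      then have "w \<notin> p ` V"
        using subsetD[OF e(2) w(2)] by (simp only: Compl_iff Un_iff Diff_iff singleton_iff simp_thms de_Morgan_disj)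
      then obtain x y where "(x, y) \<in> A" "w \<in> closed_segment (p x) (p y)" "closed_segment (p x) (p y) \<subseteq> frontier hull_V"
        using frontier_edge[OF wp eq w(1)] by metis
      then have "w \<in> ?U" by (intro UN_I[of "(x, y)"]) simp_all
      moreover have "w \<notin> ?U" using subsetD[OF e(2) w(2)] by (simp only: Compl_iff Un_iff simp_thms de_Morgan_disj)
      ultimately show False by contradiction
    qed
    have con: "Topological_Spaces.connected (ball z e - {z})"
      using connected_punctured_ball[of z e] by simp
    have zH: "z \<in> hull_V" using z compact_hull by (metis compact_imp_closed frontier_subset_closed subsetD)
    have "ball z e - {z} \<subseteq> hull_V \<or> (ball z e - {z}) \<inter> hull_V = {}"
      using connected_Int_frontier[OF con, of hull_V] iso by blast
    then show False
    proof
      assume "ball z e - {z} \<subseteq> hull_V"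
      then have "ball z e \<subseteq> hull_V" using zH by blast
      then have "z \<in> interior hull_V" using e(1) by (auto simp: mem_interior)
      then show False using z by (simp add: frontier_def)
    next
      assume em: "(ball z e - {z}) \<inter> hull_V = {}"
      obtain w where w: "w \<in> interior hull_V" using interior_hull by blast
      have wz: "w \<noteq> z" using w z by (auto simp: frontier_def)
      define s where "s = min 1 (e / (2 * dist z w))"
      have s: "0 < s" "s \<le> 1" "s * dist z w < e" using e(1) wz by (auto simp: s_def min_def field_simps)
      let ?q = "(1 - s) *\<^sub>R z + s *\<^sub>R w"
      have "?q \<in> hull_V" using zH w interior_subset[of hull_V] s by (intro convexD[OF convex_convex_hull]) auto
      moreover have "z - ?q = s *\<^sub>R (z - w)" by (simp add: algebra_simps)
      then have "dist z ?q = s * dist z w" using s by (simp add: dist_norm)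
      then have "?q \<in> ball z e" "?q \<noteq> z" using s wz by auto
      ultimately show False using em by blast
    qed
  qed
  then show ?thesis by auto
qed

text \<open>The frontier of the hull belongs to the drawing, so the connected unbounded outside
  cannot enter the hull.\<close>

lemma outside_D:
  assumes "weakly_pointed" "card A + 6 = 4 * card V"
  shows "outside D = - hull_V"
proof
  show "- hull_V \<subseteq> outside D" using outside_mono[OF D_hull] outside_convex[OF convex_convex_hull, of "p ` V"] by simp
  have FD: "frontier hull_V \<subseteq> D" using frontier_covered[OF assms] seg_in_D by blast
  have con: "Topological_Spaces.connected (outside D)" using connected_outside[of D] compact_D by (simp add: compact_imp_bounded)
  show "outside D \<subseteq> - hull_V"
  proof (rule ccontr)
    assume "\<not> outside D \<subseteq> - hull_V"
    then have 1: "outside D \<inter> hull_V \<noteq> {}" by blast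
    have "\<not> bounded (outside D)" using compact_D by (simp add: compact_imp_bounded unbounded_outside)
    then have 2: "outside D - hull_V \<noteq> {}" using compact_hull by (metis Diff_eq_empty_iff bounded_subset compact_imp_bounded)
    have "outside D \<inter> frontier hull_V \<noteq> {}" by (rule connected_Int_frontier[OF con 1 2])
    then show False using FD outside_no_overlap[of D] by blast
  qed
qed

end

section \<open>Pseudo-triangulations\<close>

definition arcs :: "'a set set \<Rightarrow> ('a \<times> 'a) set" where
  "arcs E = {(x, y). {x, y} \<in> E}"

lemma arcs_simple:
  assumes "simple_graph V E"
  shows "finite E" "\<forall>e\<in>E. card e = 2" "arcs E \<subseteq> V \<times> V" "sym (arcs E)" "irrefl (arcs E)"
proof -
  have V: "finite V" and E: "\<And>e. e \<in> E \<Longrightarrow> e \<subseteq> V \<and> card e = 2" using assms by (auto simp: simple_graph_def)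
  have "E \<subseteq> Pow V" using E by blast
  then show "finite E" using V by (simp add: finite_subset)
  show "\<forall>e\<in>E. card e = 2" using E by blast
  show "arcs E \<subseteq> V \<times> V" using E by (auto simp: arcs_def)
  show "sym (arcs E)" by (auto simp: arcs_def sym_def insert_commute)
  show "irrefl (arcs E)"
  proof (rule irreflI)
    fix x show "(x, x) \<notin> arcs E"
    proof
      assume "(x, x) \<in> arcs E"
      then have "card {x} = 2" using E by (simp add: arcs_def)
      then show False by simp
    qed
  qed
qed

lemma card_arcs:
  assumes "finite E" "\<forall>e\<in>E. card e = 2"
  shows "card (arcs E) = 2 * card E"
proof -
  let ?f = "\<lambda>e. {(x, y). {x, y} = e}"
  have f2: "finite (?f e) \<and> card (?f e) = 2" if e: "e \<in> E" for e
  proof -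
    obtain a b where ab: "e = {a, b}" "a \<noteq> b" using bspec[OF assms(2) e] by (auto simp: card_2_iff)
    have "?f e = {(a, b), (b, a)}" unfolding ab(1) by (auto simp: doubleton_eq_iff)
    then show ?thesis using ab(2) by simp
  qed
  have "arcs E = (\<Union>e\<in>E. ?f e)" by (auto simp: arcs_def)
  moreover have "card (\<Union>e\<in>E. ?f e) = (\<Sum>e\<in>E. card (?f e))"
    using assms(1) f2 by (intro card_UN_disjoint) auto
  ultimately show ?thesis using f2 by simp
qed

lemma laman_arcs_arcs:
  assumes "laman_graph V E"
  shows "laman_arcs V (arcs E)"
proof -
  have s: "simple_graph V E" "card V \<ge> 2" "card E = 2 * card V - 3"
    "\<And>S. S \<subseteq> V \<Longrightarrow> card S \<ge> 2 \<Longrightarrow> card {e \<in> E. e \<subseteq> S} \<le> 2 * card S - 3"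
    using assms by (auto simp: laman_graph_def)
  note E = arcs_simple[OF s(1)]
  have "card (arcs E) + 6 = 4 * card V" using card_arcs[OF E(1,2)] s(2,3) by simp
  moreover have "card (arcs E \<inter> S \<times> S) + 6 \<le> 4 * card S" if S: "S \<subseteq> V" "card S \<ge> 2" for S
  proof -
    have "arcs E \<inter> S \<times> S = arcs {e \<in> E. e \<subseteq> S}" by (auto simp: arcs_def)
    moreover have "card (arcs {e \<in> E. e \<subseteq> S}) = 2 * card {e \<in> E. e \<subseteq> S}"
      using E(1,2) by (intro card_arcs) auto
    ultimately show ?thesis using s(4)[OF S] S(2) by simp
  qed
  moreover have "finite V" using s(1) by (simp add: simple_graph_def)
  ultimately show ?thesis using E(3-5) s(2) by (simp add: laman_arcs_def)
qed

lemma plane_graph_arcs: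
  assumes "simple_graph V E" "noncrossing_embedding V E p"
  shows "plane_graph (arcs E) p"
proof
  note E = arcs_simple[OF assms(1)]
  have "finite V" using assms(1) by (simp add: simple_graph_def)
  then show "finite (arcs E)" using finite_subset[OF E(3)] by simp
  show "sym (arcs E)" "irrefl (arcs E)" by (rule E)+
  have "inj_on p V" using assms(2) unfolding noncrossing_embedding_def by (rule conjunct1)
  moreover have "Field (arcs E) \<subseteq> V" using E(3) by (auto simp: Field_def)
  ultimately show "inj_on p (Field (arcs E))" by (rule inj_on_subset)
  fix x y z w assume h: "(x, y) \<in> arcs E" "(z, w) \<in> arcs E" "{x, y} \<noteq> {z, w}"
  then have e: "{x, y} \<in> E" "{z, w} \<in> E" by (simp_all add: arcs_def)
  have "edge_segment p {x, y} \<inter> edge_segment p {z, w} = p ` ({x, y} \<inter> {z, w})"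
    by (rule assms(2)[unfolded noncrossing_embedding_def, THEN conjunct2, rule_format, OF e h(3)])
  then show "closed_segment (p x) (p y) \<inter> closed_segment (p z) (p w) \<subseteq> p ` ({x, y} \<inter> {z, w})"
    unfolding edge_segment_doubleton by (rule equalityD1)
qed

lemma noncrossing_embeddingI:
  assumes E: "\<forall>e\<in>E. card e = 2" and "inj_on p V" and pg: "plane_graph (arcs E) p"
  shows "noncrossing_embedding V E p"
  unfolding noncrossing_embedding_def
proof (intro conjI ballI impI)
  show "inj_on p V" by fact
  fix e f assume ef: "e \<in> E" "f \<in> E" "e \<noteq> f"
  obtain x y z w where xy: "e = {x, y}" "f = {z, w}"
    using bspec[OF E ef(1)] bspec[OF E ef(2)] by (auto simp: card_2_iff)
  have "edge_segment p e \<inter> edge_segment p f \<subseteq> p ` (e \<inter> f)"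
    using plane_graph.noncrossing[OF pg, of x y z w] ef unfolding xy edge_segment_doubleton
    by (simp add: arcs_def)
  moreover have "p ` (e \<inter> f) \<subseteq> edge_segment p e \<inter> edge_segment p f"
    using hull_subset[of "p ` e" convex] hull_subset[of "p ` f" convex] unfolding edge_segment_def by blast
  ultimately show "edge_segment p e \<inter> edge_segment p f = p ` (e \<inter> f)" by blast
qed

text \<open>Two edges with a common end are not parallel, so they meet only in that end. The four
  cases sort out which ends coincide.\<close>

lemma good_drawing_plane:
  assumes L: "laman_arcs V A" and G: "good_drawing V A \<kappa> p"
  shows "plane_graph A p"
proof
  note A = laman_D[OF L]
  note G' = G[unfolded good_drawing_def, THEN conjunct2, THEN conjunct2]
  note G_crs = G'[THEN conjunct1, rule_format]
    and G_disj = G'[THEN conjunct2, THEN conjunct2, rule_format]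
  show "finite A" by (rule laman_finite_arcs[OF L])
  show "sym A" "irrefl A" by (rule A)+
  have "inj_on p V" using G unfolding good_drawing_def by (rule conjunct1)
  moreover have "Field A \<subseteq> V" using A(2) by (auto simp: Field_def)
  ultimately show "inj_on p (Field A)" by (rule inj_on_subset)
  have share: "closed_segment (p a) (p b) \<inter> closed_segment (p a) (p c) \<subseteq> {p a}"
    if abc: "(a, b) \<in> A" "(a, c) \<in> A" "b \<noteq> c" for a b c
  proof
    fix u assume u: "u \<in> closed_segment (p a) (p b) \<inter> closed_segment (p a) (p c)"
    obtain s where s: "u = (1 - s) *\<^sub>R p a + s *\<^sub>R p b" using u by (auto simp: in_segment)
    obtain t where t: "u = (1 - t) *\<^sub>R p a + t *\<^sub>R p c" using u by (auto simp: in_segment)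
    have "s *\<^sub>R (p b - p a) = t *\<^sub>R (p c - p a)" using s t by (simp add: algebra_simps)
    then have "crs (s *\<^sub>R (p b - p a)) (p c - p a) = crs (t *\<^sub>R (p c - p a)) (p c - p a)" by simp
    then have "s * crs (p b - p a) (p c - p a) = 0" by (simp add: crs_def algebra_simps)
    moreover have "crs (p b - p a) (p c - p a) \<noteq> 0" by (rule G_crs[OF abc])
    ultimately have "s = 0" by simp
    then show "u \<in> {p a}" using s by simp
  qed
  fix x y z w assume h: "(x, y) \<in> A" "(z, w) \<in> A" "{x, y} \<noteq> {z, w}"
  have r: "(y, x) \<in> A" "(w, z) \<in> A" using h A(3) by (auto dest: symD)
  show "closed_segment (p x) (p y) \<inter> closed_segment (p z) (p w) \<subseteq> p ` ({x, y} \<inter> {z, w})"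
  proof (cases "{x, y} \<inter> {z, w} = {}")
    case True
    have "closed_segment (p x) (p y) \<inter> closed_segment (p z) (p w) = {}" by (rule G_disj[OF h(1,2) True])
    then show ?thesis by simp
  next
    case False
    then consider "x = z" | "x = w" | "y = z" | "y = w" by blast
    then show ?thesis
    proof cases
      case 1
      then have "y \<noteq> w" using h(3) by auto
      from share[OF h(1) _ this] show ?thesis using h(2) 1 by auto
    next
      case 2
      then have "y \<noteq> z" using h(3) by (auto simp: insert_commute)
      moreover have "(x, z) \<in> A" using r(2) 2 by simp
      ultimately have "closed_segment (p x) (p y) \<inter> closed_segment (p x) (p z) \<subseteq> {p x}" by (intro share[OF h(1)])
      then show ?thesis unfolding closed_segment_commute[of "p z" "p w"] using 2 by auto
    next
      case 3
      then have "x \<noteq> w" using h(3) by (auto simp: insert_commute)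
      moreover have "(y, w) \<in> A" using h(2) 3 by simp
      ultimately have "closed_segment (p y) (p x) \<inter> closed_segment (p y) (p w) \<subseteq> {p y}" by (intro share[OF r(1)])
      then show ?thesis unfolding closed_segment_commute[of "p x" "p y"] using 3 by auto
    next
      case 4
      then have "x \<noteq> z" using h(3) by auto
      moreover have "(y, z) \<in> A" using r(2) 4 by simp
      ultimately have "closed_segment (p y) (p x) \<inter> closed_segment (p y) (p z) \<subseteq> {p y}" by (intro share[OF r(1)])
      then show ?thesis
        unfolding closed_segment_commute[of "p x" "p y"] closed_segment_commute[of "p z" "p w"] using 4 by auto
    qed
  qed
qed

lemma ccw_angle_ang: "a \<noteq> b \<Longrightarrow> ccw_angle v a b = ang (a - v) (b - v)"
  by (simp add: ccw_angle_def ang_def)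

lemma (in plane_graph) pointed_vertexI:
  assumes E: "A = arcs E" and nbr: "A `` {v} \<noteq> {}" and g: "\<And>k. (v, k) \<in> A \<Longrightarrow> g \<bullet> (p k - p v) > 0"
  shows "pointed_vertex E p v"
proof -
  obtain k0 where "(v, k0) \<in> A" using nbr by blast
  from g[OF this] have g0: "g \<noteq> 0" by auto
  have gw: "\<And>k. (v, k) \<in> A \<Longrightarrow> 0 \<le> g \<bullet> (p k - p v)" using g by (simp add: less_imp_le)
  show ?thesis
  proof (rule wide_corner[OF nbr g0 gw])
    fix i assume i: "(i, v) \<in> A" and "(\<And>k. (v, k) \<in> A \<Longrightarrow> 0 < g \<bullet> (p k - p v)) \<Longrightarrow> pi < gap i v"
    then have wide: "pi < gap i v" using g by blast
    define j where "j = nxt (\<kappa> v) (A `` {v}) i"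
    have vi: "(v, i) \<in> A" by (rule swap[OF i])
    have vj: "(v, j) \<in> A" unfolding j_def by (rule nxt_arc[OF i])
    have nb: "neighbours E v = A `` {v}" by (auto simp: neighbours_def arcs_def E)
    have pne: "p i \<noteq> p k" if "(v, k) \<in> A" "k \<noteq> i" for k
      using p_eq[OF in_Field(2)[OF vi] in_Field(2)[OF that(1)]] that(2) by simp
    have eq: "ccw_angle (p v) (p i) (p j) = gap i v"
    proof (cases "j = i")
      case True
      then show ?thesis by (simp add: ccw_angle_def gap_def j_def)
    next
      case False
      then show ?thesis using ccw_angle_ang[OF pne[OF vj False]] by (simp add: gap_def j_def)
    qed
    have "gap i v \<le> ccw_angle (p v) (p i) (p k)" if k: "(v, k) \<in> A" for k
    proof (cases "k = i")
      case True
      then show ?thesis using gap_bounds[OF i] by (simp add: ccw_angle_def)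
    next
      case False
      then show ?thesis using ccw_angle_ang[OF pne[OF k False]] gap_le[OF i k False] by simp
    qed
    then have "consecutive_at E p v i j" unfolding consecutive_at_def nb eq using vi vj by simp
    moreover have "pi < ccw_angle (p v) (p i) (p j)" unfolding eq by (rule wide)
    ultimately show ?thesis unfolding pointed_vertex_def by (intro exI conjI)
  qed
qed

section \<open>Translation of components and corners into faces and polygons\<close>

lemma draw_converse: "draw (S \<union> S\<inverse>) p = draw S p"
proof -
  have "draw (S\<inverse>) p \<subseteq> draw S p"
  proof
    fix z assume "z \<in> draw (S\<inverse>) p"
    then obtain x y where xy: "(y, x) \<in> S" "z \<in> closed_segment (p x) (p y)" by (auto simp: draw_def)
    then have "z \<in> closed_segment (p y) (p x)" by (simp add: closed_segment_commute)
    then show "z \<in> draw S p" using xy(1) by (auto simp: draw_def)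
  qed
  moreover have "draw (S \<union> S\<inverse>) p = draw S p \<union> draw (S\<inverse>) p" unfolding draw_def by (rule UN_Un)
  ultimately show ?thesis by blast
qed

lemma draw_arcs:
  assumes "\<forall>e\<in>E. card e = 2"
  shows "draw (arcs E) p = (\<Union>e\<in>E. edge_segment p e)"
proof
  show "draw (arcs E) p \<subseteq> (\<Union>e\<in>E. edge_segment p e)"
    unfolding draw_def arcs_def by (auto simp flip: edge_segment_doubleton)
  show "(\<Union>e\<in>E. edge_segment p e) \<subseteq> draw (arcs E) p"
  proof
    fix z assume "z \<in> (\<Union>e\<in>E. edge_segment p e)"
    then obtain e where e: "e \<in> E" "z \<in> edge_segment p e" by blast
    obtain x y where "e = {x, y}" using bspec[OF assms e(1)] by (auto simp: card_2_iff)
    then show "z \<in> draw (arcs E) p" using e unfolding draw_def arcs_def by (auto simp: edge_segment_doubleton)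
  qed
qed

context biconnected
begin

lemma drawing_D:
  assumes "A = arcs E" "\<forall>e\<in>E. card e = 2"
  shows "drawing V E p = D"
proof -
  have "p ` V \<subseteq> D" using V_in_D by blast
  moreover have "(\<Union>e\<in>E. edge_segment p e) = D" using draw_arcs[OF assms(2)] assms(1) by simp
  ultimately show ?thesis unfolding drawing_def by blast
qed

lemma convex_outer_faceI:
  assumes E: "A = arcs E" "\<forall>e\<in>E. card e = 2"
    and wp: "weakly_pointed" and eq: "card A + 6 = 4 * card V"
  shows "convex_outer_face V E p"
proof -
  have "outer_face V E p = - hull_V"
    unfolding outer_face_def drawing_D[OF E] by (rule outside_D[OF wp eq])
  then have fr: "frontier (outer_face V E p) = frontier hull_V" by (simp add: frontier_complement)
  have "frontier hull_V \<subseteq> (\<Union>e\<in>{e \<in> E. edge_segment p e \<subseteq> frontier hull_V}. edge_segment p e)"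
  proof
    fix z assume "z \<in> frontier hull_V"
    then obtain x y where xy: "(x, y) \<in> A" "z \<in> closed_segment (p x) (p y)"
      "closed_segment (p x) (p y) \<subseteq> frontier hull_V" using frontier_covered[OF wp eq] by blast
    then have "{x, y} \<in> {e \<in> E. edge_segment p e \<subseteq> frontier hull_V}" "z \<in> edge_segment p {x, y}"
      by (simp_all add: E(1) arcs_def edge_segment_doubleton)
    then show "z \<in> (\<Union>e\<in>{e \<in> E. edge_segment p e \<subseteq> frontier hull_V}. edge_segment p e)" by blast
  qed
  then show ?thesis unfolding convex_outer_face_def fr by blast
qed

text \<open>The orbit has its face on the right, so a bounded face is traversed clockwise. The
  counterclockwise angle from the next to the previous vertex is then the exterior one, and
  \<open>interior_angle\<close> takes its second branch, which equals \<open>gap\<close>.\<close>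

lemma pseudo_triangle_region:
  assumes d: "d \<in> A" "bounded (region d)" and three: "card (orb \<kappa> A `` {d} \<inter> convex_corners) = 3"
  shows "pseudo_triangle (region d)"
proof -
  let ?O = "orb \<kappa> A `` {d}" and ?C = "boundary d"
  obtain q k where k: "k \<ge> 2" and injq: "inj_on q {..k}" and O: "?O = cycle_arcs q k"
    by (rule face_polygon[OF d(1)])
  obtain c where "plane_cycle ?C p c" using boundary_cycle[OF d(1)] by blast
  then interpret C: plane_cycle ?C p c .
  define m where "m = Suc k"
  define P where "P = p \<circ> q"
  define s where "s i = Suc i mod m" for i
  define r where "r i = (i + m - 1) mod m" for i
  have s: "s i = (if i = k then 0 else Suc i)" if "i < m" for i using that by (auto simp: s_def m_def)
  have r: "r i = (if i = 0 then k else i - 1)" if "i < m" for i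
  proof (cases i)
    case 0
    then show ?thesis by (simp add: r_def m_def)
  next
    case (Suc n)
    then have "i + m - 1 = n + m" by simp
    then have "r i = n mod m" unfolding r_def by (simp only: mod_add_self2)
    then show ?thesis using Suc that by simp
  qed
  have lt: "s i < m" "r i < m" for i by (auto simp: s_def r_def m_def)
  have sr: "s (r i) = i" "r (s i) = i" if "i < m" for i
  proof -
    show "s (r i) = i" using that s[OF lt(2)[of i]] r[OF that] k by (auto simp: m_def)
    show "r (s i) = i" using that r[OF lt(1)[of i]] s[OF that] k by (auto simp: m_def)
  qed
  have inj: "inj_on q {..<m}" using injq by (simp add: m_def lessThan_Suc_atMost)
  have q_eq: "q i = q j \<longleftrightarrow> i = j" if "i < m" "j < m" for i j using inj_on_eq_iff[OF inj] that by simp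
  have O': "?O = (\<lambda>i. (q i, q (s i))) ` {..<m}"
    unfolding O cycle_arcs_def by (rule image_cong) (use s in \<open>auto simp: m_def\<close>)
  have OA: "?O \<subseteq> A" using face_cycle(2)[OF d(1)] .
  have out: "(q i, q (s i)) \<in> ?O" if "i < m" for i using that unfolding O' by blast
  have arc_in: "(q (r i), q i) \<in> ?O" if "i < m" for i using out[OF lt(2)[of i]] sr(1)[OF that] by simp
  have qF: "q i \<in> Field A" if "i < m" for i using out[OF that] OA by (auto simp: Field_def)
  have seg: "edge_segment P {i, s i} = closed_segment (p (q i)) (p (q (s i)))" for i
    by (simp add: edge_segment_doubleton P_def)
  have ce: "cycle_edges m = (\<lambda>i. {i, s i}) ` {..<m}" by (auto simp: cycle_edges_def s_def)
  have U1: "(\<Union>e\<in>cycle_edges m. edge_segment P e) = (\<Union>i<m. closed_segment (p (q i)) (p (q (s i))))"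
    unfolding ce using seg by simp
  have U2: "draw ?C p = (\<Union>i<m. closed_segment (p (q i)) (p (q (s i))))"
    unfolding boundary_def draw_converse unfolding O' draw_def by simp
  have U3: "P ` {..<m} \<subseteq> (\<Union>i<m. closed_segment (p (q i)) (p (q (s i))))" by (auto simp: P_def)
  have drw: "drawing {..<m} (cycle_edges m) P = draw ?C p"
    unfolding drawing_def U1 U2 by (rule Un_absorb1[OF U3])
  have int: "polygon_interior m P = region d"
    unfolding polygon_interior_def drw using region_bounded[OF d] by simp
  have injP: "inj_on P {..<m}" unfolding P_def
    using inj inj_on_subset[OF inj_p, of "q ` {..<m}"] qF by (intro comp_inj_on) auto
  have "noncrossing_embedding {..<m} (cycle_edges m) P"
    unfolding noncrossing_embedding_def
  proof (intro conjI ballI impI injP)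
    fix e f assume ef: "e \<in> cycle_edges m" "f \<in> cycle_edges m" "e \<noteq> f"
    obtain i j where ij: "i < m" "j < m" "e = {i, s i}" "f = {j, s j}" using ef by (auto simp: ce)
    have sub: "e \<subseteq> {..<m}" "f \<subseteq> {..<m}" using ij lt by auto
    have "q ` e \<noteq> q ` f" using inj_on_image_eq_iff[OF inj sub] ef(3) by simp
    then have "{q i, q (s i)} \<noteq> {q j, q (s j)}" by (simp add: ij)
    moreover have "(q i, q (s i)) \<in> A" "(q j, q (s j)) \<in> A" using out ij OA by blast+
    ultimately have "edge_segment P e \<inter> edge_segment P f \<subseteq> p ` (q ` e \<inter> q ` f)"
      using noncrossing unfolding ij(3,4) seg by simp
    also have "q ` e \<inter> q ` f = q ` (e \<inter> f)" using inj_on_image_Int[OF inj sub] by simp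
    also have "p ` q ` (e \<inter> f) = P ` (e \<inter> f)" by (simp add: P_def image_comp)
    finally have 1: "edge_segment P e \<inter> edge_segment P f \<subseteq> P ` (e \<inter> f)" .
    have "P ` (e \<inter> f) \<subseteq> edge_segment P e \<inter> edge_segment P f"
      using hull_subset[of "P ` e" convex] hull_subset[of "P ` f" convex] unfolding edge_segment_def by blast
    with 1 show "edge_segment P e \<inter> edge_segment P f = P ` (e \<inter> f)" by blast
  qed
  then have poly: "simple_polygon m P" unfolding simple_polygon_def using k by (simp add: m_def)
  have angle: "interior_angle m P i = gap (q (r i)) (q i)" if i: "i < m" for i
  proof -
    let ?v = "q i" and ?a = "q (s i)" and ?b = "q (r i)"
    have O2: "(?v, ?a) \<in> ?O" "(?b, ?v) \<in> ?O" by (rule out[OF i], rule arc_in[OF i])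
    have vF: "?v \<in> Field (?O \<union> ?O\<inverse>)" using O2 by (auto simp: Field_def)
    obtain a b where ab: "(b, ?v) \<in> ?O" "(?v, a) \<in> ?O" "a \<noteq> b" "nxt (\<kappa> ?v) (A `` {?v}) b = a"
      "(?O \<union> ?O\<inverse>) `` {?v} = {a, b}" using face_cycle(3)[OF d(1) vF] by blast
    obtain l where l: "l < m" "?v = q l" "a = q (s l)" using ab(2) unfolding O' by blast
    have "l = i" using q_eq[OF i l(1)] l(2) by simp
    then have a: "a = ?a" using l(3) by simp
    obtain l' where l': "l' < m" "b = q l'" "?v = q (s l')" using ab(1) unfolding O' by blast
    have "i = s l'" using q_eq[OF i lt(1)[of l']] l'(3) by blast
    then have b: "b = ?b" using sr(2)[OF l'(1)] l'(2) by simp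
    have arcs: "(?v, ?a) \<in> A" "(?b, ?v) \<in> A" "(?v, ?b) \<in> A" using O2 OA swap by auto
    have Carcs: "(?a, ?v) \<in> ?C" "(?v, ?a) \<in> ?C" using O2 by (auto simp: boundary_def)
    have nz: "p ?a - p ?v \<noteq> 0" "p ?b - p ?v \<noteq> 0" using p_ne[OF arcs(1)] p_ne[OF arcs(3)] by auto
    have ne: "?a \<noteq> ?b" using ab(3) a b by simp
    let ?\<alpha> = "ang (p ?a - p ?v) (p ?b - p ?v)"
    have gp: "gap ?b ?v = ang (p ?b - p ?v) (p ?a - p ?v)" using ab(4) ne a b by (simp add: gap_def)
    then have \<alpha>: "?\<alpha> = 2 * pi - gap ?b ?v"
      using ang_complement[OF nz(2,1)] ang_distinct[OF arcs(3,1) ne[symmetric]] by simp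
    have \<alpha>0: "?\<alpha> > 0" by (rule ang_distinct[OF arcs(1,3) ne])
    have pab: "p ?a \<noteq> p ?b" using p_eq[OF qF[OF lt(1)] qF[OF lt(2)]] ne by simp
    have ccw: "ccw_angle (P i) (P (s i)) (P (r i)) = ?\<alpha>" using ccw_angle_ang[OF pab] by (simp add: P_def)
    have Cv: "?C `` {?v} = {?a, ?b}" using ab(5) a b by (simp add: boundary_def)
    have "inj_on (\<kappa> ?v) {?a, ?b}" using C.dir_inj[of ?v] unfolding Cv .
    then have "nxt (\<kappa> ?v) (?C `` {?v}) ?a = ?b" unfolding Cv by (rule nxt_pair[OF ne])
    then have "C.gap ?a ?v = ?\<alpha>" using ne by (simp add: C.gap_def)
    \<comment> \<open>The bisector of the angle \<open>?\<alpha>\<close> starts out in the component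
      on the other side of the boundary, so the test in \<open>interior_angle\<close> fails.\<close>
    then obtain \<tau> where \<tau>: "\<tau> > 0"
      "\<And>t. 0 < t \<Longrightarrow> t < \<tau> \<Longrightarrow> p ?v + of_real t * (p ?a - p ?v) * cis (?\<alpha> / 2) \<in> C.fc ?a ?v"
      using C.sector(2)[OF Carcs(1)] \<alpha>0 by auto
    have "C.fc ?v ?a = C.fc (fst d) (snd d)"
      using face_side(2)[OF d(1) O2(2,1)] unfolding boundary_def .
    then have "C.fc ?v ?a = polygon_interior m P" using region_side[OF d(1)] int by simp
    then have dis: "C.fc ?a ?v \<inter> polygon_interior m P = {}"
      using components_nonoverlap[OF C.fc_strip(1)[OF Carcs(1)] C.fc_strip(1)[OF Carcs(2)]] C.sides[OF Carcs(1)]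
      by simp
    have ev: "\<forall>\<^sub>F t in at_right 0. P i + of_real t * (P (s i) - P i) * cis (?\<alpha> / 2) \<notin> polygon_interior m P"
      unfolding eventually_at_right_field
    proof (intro exI[of _ \<tau>] conjI allI impI)
      fix t :: real assume "0 < t" "t < \<tau>"
      from \<tau>(2)[OF this] show "P i + of_real t * (P (s i) - P i) * cis (?\<alpha> / 2) \<notin> polygon_interior m P"
        using dis by (auto simp: P_def)
    qed (rule \<tau>(1))
    have "\<not> (\<forall>\<^sub>F t in at_right 0. P i + of_real t * (P (s i) - P i) * cis (?\<alpha> / 2) \<in> polygon_interior m P)"
    proof
      assume "\<forall>\<^sub>F t in at_right 0. P i + of_real t * (P (s i) - P i) * cis (?\<alpha> / 2) \<in> polygon_interior m P"
      from eventually_conj[OF this ev] have "\<forall>\<^sub>F t in at_right (0::real). False" by simp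
      then show False by simp
    qed
    then show ?thesis
      unfolding interior_angle_def Let_def s_def[symmetric] r_def[symmetric] ccw using \<alpha> by simp
  qed
  let ?I = "{i. i < m \<and> interior_angle m P i < pi}"
  \<comment> \<open>Index \<open>i\<close> corresponds to the dart that enters the corner at
    \<open>q i\<close>.\<close>
  have img: "(\<lambda>i. (q (r i), q i)) ` ?I = ?O \<inter> convex_corners"
  proof
    show "(\<lambda>i. (q (r i), q i)) ` ?I \<subseteq> ?O \<inter> convex_corners"
      using arc_in OA angle by (auto simp: convex_corners_def)
    show "?O \<inter> convex_corners \<subseteq> (\<lambda>i. (q (r i), q i)) ` ?I"
    proof
      fix e assume e: "e \<in> ?O \<inter> convex_corners"
      then obtain l where l: "l < m" "e = (q l, q (s l))" unfolding O' by blast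
      have "gap (q l) (q (s l)) < pi" using e l(2) by (simp add: convex_corners_def)
      then have "s l \<in> ?I" using angle[OF lt(1)[of l]] sr(2)[OF l(1)] lt(1)[of l] by simp
      then show "e \<in> (\<lambda>i. (q (r i), q i)) ` ?I"
        using l(2) sr(2)[OF l(1)] by (intro image_eqI[of _ _ "s l"]) simp_all
    qed
  qed
  have ij: "inj_on (\<lambda>i. (q (r i), q i)) ?I" by (rule inj_onI) (simp add: q_eq)
  have "card ?I = 3" by (rule card_image[OF ij, unfolded img three, symmetric])
  then show ?thesis unfolding pseudo_triangle_def using poly int by blast
qed

end

lemma laman_biconnected:
  assumes "laman_arcs V A" "card V \<ge> 3" "plane_graph A p"
  shows "biconnected A p V"
proof (intro biconnected.intro biconnected_axioms.intro)
  show "plane_graph A p" "card V \<ge> 3" by fact+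
  show "finite V" using laman_D[OF assms(1)] by simp
  have "A `` {v} \<noteq> {}" if "v \<in> V" for v using laman_degree[OF assms(1,2) that] by auto
  then show "Field A = V" using laman_D(2)[OF assms(1)] by (fastforce simp: Field_def)
  show "\<And>v. v \<in> V \<Longrightarrow> conn_on (V - {v}) (A \<inter> (V - {v}) \<times> (V - {v}))"
    by (rule laman_conn_del[OF assms(1,2)])
qed

text \<open>The strict half planes yield pointedness; weakened to closed ones they feed the counting
  argument, where the Laman arc count is the extremal one.\<close>

lemma good_drawing_pseudo_triangulation:
  assumes G: "laman_graph V E" and n: "card V \<ge> 3" and gd: "good_drawing V (arcs E) \<kappa> p"
  shows "pointed_pseudo_triangulation V E p"
proof -
  have simple: "simple_graph V E" using G by (simp add: laman_graph_def)
  note E = arcs_simple[OF simple]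
  have L: "laman_arcs V (arcs E)" by (rule laman_arcs_arcs[OF G])
  have pg: "plane_graph (arcs E) p" by (rule good_drawing_plane[OF L gd])
  interpret biconnected "arcs E" p V by (rule laman_biconnected[OF L n pg])
  have g: "\<exists>g. \<forall>k. (v, k) \<in> arcs E \<longrightarrow> g \<bullet> (p k - p v) > 0" if "v \<in> V" for v
    using bspec[OF gd[unfolded good_drawing_def, THEN conjunct2, THEN conjunct1] that] by (simp add: Ball_def)
  have pointed: "pointed_vertex E p v" if v: "v \<in> V" for v
    using g[OF v] pointed_vertexI[OF refl V_nbr[OF v]] by blast
  have wp: "weakly_pointed"
    unfolding weakly_pointed_def
  proof
    fix v assume v: "v \<in> V"
    obtain h where h: "\<forall>k. (v, k) \<in> arcs E \<longrightarrow> h \<bullet> (p k - p v) > 0" using g[OF v] by blast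
    obtain k where "(v, k) \<in> arcs E" using V_nbr[OF v] by blast
    then have "h \<noteq> 0" using h by auto
    then show "\<exists>g. g \<noteq> 0 \<and> (\<forall>k. (v, k) \<in> arcs E \<longrightarrow> g \<bullet> (p k - p v) \<ge> 0)"
      using h by (intro exI[of _ h]) (simp add: less_imp_le)
  qed
  have eq: "card (arcs E) + 6 = 4 * card V" by (rule laman_D(6)[OF L])
  have nc: "noncrossing_embedding V E p"
    by (rule noncrossing_embeddingI[OF E(2) gd[unfolded good_drawing_def, THEN conjunct1] pg])
  have "pseudo_triangle F" if F: "F \<in> interior_faces V E p" for F
  proof -
    have "F \<in> components (- D)" "bounded F" using F unfolding interior_faces_def drawing_D[OF refl E(2)] by auto
    then obtain d where d: "d \<in> arcs E" "F = region d" by (rule bounded_component_region)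
    have bd: "bounded (region d)" using \<open>bounded F\<close> d(2) by simp
    show ?thesis unfolding d(2)
      by (rule pseudo_triangle_region[OF d(1) bd bounded_faces_three_corners[OF wp eq d(1) bd]])
  qed
  then show ?thesis unfolding pointed_pseudo_triangulation_def pseudo_triangulation_def
    using simple nc convex_outer_faceI[OF refl E(2) wp eq] pointed by blast
qed

text \<open>Here the hull is the edge itself and is its own frontier. A convex set has empty inside,
  so there is no interior face, and each vertex has a full angle.\<close>

lemma single_edge_pseudo_triangulation:
  assumes simple: "simple_graph V E" and nc: "noncrossing_embedding V E p"
    and V2: "card V = 2" and E1: "card E = 1"
  shows "pointed_pseudo_triangulation V E p"
proof -
  have E: "E = {V}"
  proof -
    obtain e where e: "E = {e}" using E1 by (auto simp: card_1_singleton_iff)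
    then have "e \<subseteq> V" "card e = card V" "finite V" using simple V2 by (auto simp: simple_graph_def)
    then show ?thesis using e card_subset_eq by blast
  qed
  obtain a b where ab: "V = {a, b}" "a \<noteq> b" using V2 by (auto simp: card_2_iff)
  let ?S = "closed_segment (p a) (p b)"
  have S: "edge_segment p V = ?S" "convex hull (p ` V) = ?S"
    using edge_segment_doubleton[of p a b] by (simp_all add: ab(1) edge_segment_def)
  have dr: "drawing V E p = ?S" using S(1) by (auto simp: drawing_def E ab(1))
  have "interior ?S = {}" by (rule interior_closed_segment_ge2) simp
  then have fS: "frontier ?S = ?S" by (simp add: frontier_def closure_closed)
  have out: "outer_face V E p = - ?S" unfolding outer_face_def dr by (rule outside_convex) simp
  have "convex_outer_face V E p"
    unfolding convex_outer_face_def out frontier_complement S(2) fS using S(1) by (auto simp: E)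
  moreover have "interior_faces V E p = {}"
  proof (rule ccontr)
    assume "interior_faces V E p \<noteq> {}"
    then obtain F where F: "F \<in> components (- ?S)" "bounded F" by (auto simp: interior_faces_def dr)
    obtain x where x: "x \<in> - ?S" "F = connected_component_set (- ?S) x" using F(1) by (auto simp: components_def)
    then have "x \<in> inside ?S" using F(2) by (simp add: inside_def)
    then show False using inside_convex[of ?S] by simp
  qed
  moreover have "pointed_vertex E p v" if v: "v \<in> V" for v
  proof -
    obtain w where "neighbours E v = {w}"
    proof -
      have "neighbours E a = {b}" "neighbours E b = {a}"
        using ab(2) by (auto simp: neighbours_def E ab(1) doubleton_eq_iff)
      then show ?thesis using that v ab(1) by blast
    qed
    then show ?thesis unfolding pointed_vertex_def consecutive_at_def
      by (intro exI[of _ w]) (simp add: ccw_angle_def)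
  qed
  ultimately show ?thesis using simple nc
    by (simp add: pointed_pseudo_triangulation_def pseudo_triangulation_def)
qed

theorem theorem1p1:
  fixes n :: nat and E :: "nat set set"
  assumes "laman_graph {1..n} E"
    and "planar_graph {1..n} E"
  shows "\<exists>p :: nat \<Rightarrow> complex. pointed_pseudo_triangulation {1..n} E p"
proof -
  obtain p0 where simple: "simple_graph {1..n} E" and p0: "noncrossing_embedding {1..n} E p0"
    using assms(2) by (auto simp: planar_graph_def)
  have n: "card {1..n} \<ge> 2" "card E = 2 * card {1..n} - 3" using assms(1) by (auto simp: laman_graph_def)
  show ?thesis
  proof (cases "card {1..n} = 2")
    case True
    then show ?thesis using single_edge_pseudo_triangulation[OF simple p0] n(2) by auto
  next
    case False
    interpret plane_graph "arcs E" p0 by (rule plane_graph_arcs[OF simple p0])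
    obtain p where "good_drawing {1..n} (arcs E) \<kappa> p"
      using good_drawing_ex[OF laman_arcs_arcs[OF assms(1)] rot planar] by blast
    then show ?thesis using good_drawing_pseudo_triangulation[OF assms(1)] False n(1) by fastforce
  qed
qed

end
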